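(* Define $L(1)=1\otimes 1$ and $L(v_i)=\sum_{j=1}^n t_{ij}\otimes v_j$ for $i=1,\dots,n$. Then $L$ extends uniquely to a map $L\colon V\to\mathcal F_R(M(n))\widetilde\otimes V$ such that $V$, with $L$ as its left corepresentation, is a left $\mathfrak h$-comodule algebra for $\mathcal F_R(M(n))$.
   Context: Setting. Fix $n\ge 1$ and $q\in\mathbb C^\times$ not a root of unity, with a fixed choice of $\log q$ and $q^z=\exp(z\log q)$. Identify $\mathfrak h\cong\mathfrak h^*\cong\mathbb C^n$ with unit vectors $e_i$, and put $\omega(i)=e_i$. $M_{\mathfrak h^*}$ is the field of meromorphic functions on $\mathfrak h^*$ (in $\underline\lambda=(\lambda_1,\dots,\lambda_n)$), and $(T_\alpha f)(\lambda)=f(\lambda+\alpha)$. Put $h_0(z)=\frac{q^{-1}-q}{q^{-2z}-1}$, $g(z)=\frac{(q^{-2z}-q^{-2})(q^{-2z}-q^2)}{(q^{-2z}-1)^2}$, $h(z)=q-h_0(z)=q\frac{q^{-2z}-q^{-2}}{q^{-2z}-1}$. $\mathfrak h$-algebras and bialgebroids. An $\mathfrak h$-algebra is a unital associative $\mathbb C$-algebra $\mathcal A=\bigoplus_{\alpha,\beta\in\mathfrak h^*}\mathcal A_{\alpha\beta}$ (bigraded) with algebra embeddings $\mu_l,\mu_r\colon M_{\mathfrak h^*}\to\mathcal A_{00}$ such that $\mu_l(f)a=a\mu_l(T_\alpha f)$, $\mu_r(f)a=a\mu_r(T_\beta f)$ for $a\in\mathcal A_{\alpha\beta}$. Morphisms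 preserve bigrading and moment maps. $\mathcal A\widetilde\otimes\mathcal B$ has $(\mathcal A\widetilde\otimes\mathcal B)_{\alpha\beta}=\bigoplus_\gamma\mathcal A_{\alpha\gamma}\otimes_{M_{\mathfrak h^*}}\mathcal B_{\gamma\beta}$, modulo $\mu_r(f)a\otimes b=a\otimes\mu_l(f)b$, with product $(a\otimes b)(c\otimes d)=ac\otimes bd$ and moment maps $\mu_l(f)\otimes1$, $1\otimes\mu_r(f)$. $D_{\mathfrak h^*}$ is the $\mathfrak h$-algebra of difference operators $\sum_i f_iT_{\beta_i}$ on $M_{\mathfrak h^*}$, with $fT_{-\beta}\in(D_{\mathfrak h^*})_{\beta\beta}$ and both moment maps the natural embedding; $\mathcal A\cong\mathcal A\widetilde\otimes D_{\mathfrak h^*}\cong D_{\mathfrak h^*}\widetilde\otimes\mathcal A$ via $x\cong x\otimes T_{-\beta}\cong T_{-\alpha}\otimes x$ for $x\in\mathcal A_{\alpha\beta}$. An $\mathfrak h$-bialgebroid is an $\mathfrak h$-algebra with $\mathfrak h$-algebra homomorphisms $\Delta\colon\mathcal A\to\mathcal A\widetilde\otimes\mathcal A$, $\varepsilon\colon\mathcal A\to D_{\mathfrak h^*}$, coassociative and counital. The $\mathfrak h$-bialgebroid $\mathcal F_R(M(n))$. It is generated by $t_{ij}$ ($1\le i,j\le n$) and two commuting copies of $M_{\mathfrak h^*}$, written $f(\underline\lambda)=\mu_l(f)$ and $f(\underline\mu)=\mu_r(f)$, with relations $f(\underline\lambda)t_{ij}=t_{ij}f(\underline\lambda+\omega(i))$,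 $f(\underline\mu)t_{ij}=t_{ij}f(\underline\mu+\omega(j))$ and, for all $a,b,c,d$, the RLL-relations $\sum_{x,y}R^{xy}_{ac}(\underline\lambda)t_{xb}t_{yd}=\sum_{x,y}R^{bd}_{xy}(\underline\mu)t_{cy}t_{ax}$. The nonzero $R$-entries are $R^{aa}_{aa}=q$; $R^{ab}_{ab}(\underline\lambda)=1$ if $a<b$ and $g(\lambda_a-\lambda_b)$ if $a>b$; $R^{ab}_{ba}(\underline\lambda)=h_0(\lambda_a-\lambda_b)$ if $a\ne b$. Moreover $t_{ij}$ has bidegree $(\omega(i),\omega(j))$, $f(\underline\lambda),f(\underline\mu)$ have bidegree $(0,0)$, $\Delta(t_{ij})=\sum_kt_{ik}\otimes t_{kj}$, $\varepsilon(t_{ij})=\delta_{ij}T_{-\omega(i)}$, $\Delta(f(\underline\lambda))=f(\underline\lambda)\otimes1$, $\Delta(f(\underline\mu))=1\otimes f(\underline\mu)$, $\varepsilon(f(\underline\lambda))=\varepsilon(f(\underline\mu))=f$. Corepresentations. An $\mathfrak h$-space is an $M_{\mathfrak h^*}$-vector space $V=\bigoplus_{\alpha\in\mathfrak h^*} V_\alpha$ with $M_{\mathfrak h^*}V_\alpha\subseteq V_\alpha$; write $fv=\mu_V(f)v$. Morphisms are grade preserving $M_{\mathfrak h^*}$-linear maps. $\mathcal A\widetilde\otimes V=\bigoplus_{\alpha,\beta}\mathcal A_{\alpha\beta}\otimes_{M_{\mathfrak h^*}}V_\beta$ modulo $\mu_r(f)a\otimes v=a\otimes fv$, with $\mathcal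 A_{\alpha\beta}\otimes V_\beta$ in degree $\alpha$ and $f(a\otimes v)=\mu_l(f)a\otimes v$. A left corepresentation of $\mathcal A$ on $V$ is a morphism of $\mathfrak h$-spaces $\rho\colon V\to\mathcal A\widetilde\otimes V$ with $(\Delta\otimes\mathrm{Id})\rho=(\mathrm{Id}\otimes\rho)\rho$ and $(\varepsilon\otimes\mathrm{Id})\rho=\mathrm{Id}$, using $D_{\mathfrak h^*}\widetilde\otimes V\cong V$, $fT_{-\alpha}\otimes v\cong fv$ for $v\in V_\alpha$. $V$ is a left $\mathfrak h$-comodule algebra for $\mathcal A$ if there is a left corepresentation $L\colon V\to\mathcal A\widetilde\otimes V$ such that (i) $V$ is an associative algebra with $\mu_V(f)vw=v\mu_V(T_\alpha f)w$ for $v\in V_\alpha$, $w\in V$, and $V_\alpha V_\beta\subset V_{\alpha+\beta}$; (ii) $L$ is an algebra homomorphism, where $(a\otimes v)(b\otimes w)=ab\otimes vw$; if $V$ is unital, $L$ is required to be unital. The algebra $V$ of the claim. $V$ is the unital associative algebra generated by $v_1,\dots,v_n$ and a copy of $M_{\mathfrak h^*}$ (elements $f(\underline\lambda)$), with relations $v_i^2=0$ for all $i$, $v_iv_j=-h(\lambda_i-\lambda_j)v_jv_i$ for $i<j$, and $f(\underline\lambda)v_i=v_if(\underline\lambda+\omega(i))$. It is an $\mathfrak h$-space with $\mu_V(f)=f(\underline\lambda)$ acting by left multiplication and $v_{i_1}\cdots v_{i_r}\in V_{\omega(i_1)+\dots+\omega(i_r)}$. *)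

theory Defs
  imports "HOL-Complex_Analysis.Complex_Analysis" "HOL-Algebra.Free_Abelian_Groups"
    "HOL-Algebra.QuotRing" "HOL-Algebra.Algebraic_Closure_Type"
begin

section \<open>Meromorphic functions of several complex variables\<close>

text \<open>Complex differentiability: the real derivative is complex linear. Meant for open \<open>U\<close>.\<close>

definition holomorphic_Cn :: "(complex ^ 'n \<Rightarrow> complex) \<Rightarrow> (complex ^ 'n::finite) set \<Rightarrow> bool"
  where "holomorphic_Cn f U \<longleftrightarrow>
    (\<forall>z\<in>U. \<exists>D. (f has_derivative D) (at z) \<and> (\<forall>c v. D (c *s v) = c * D v))"

text \<open>\<open>f\<close> is locally a quotient of holomorphic functions whose denominator vanishes identically on no
  nonempty open set. The values of \<open>f\<close> on the zero set of \<open>b\<close> are unconstrained; they are forgotten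
  when functions agreeing on a dense open set are identified.\<close>

definition local_quotient ::
    "(complex ^ 'n \<Rightarrow> complex) \<Rightarrow> (complex ^ 'n::finite) set \<Rightarrow> (complex ^ 'n \<Rightarrow> complex) \<Rightarrow> (complex ^ 'n \<Rightarrow> complex) \<Rightarrow> bool"
  where "local_quotient f U a b \<longleftrightarrow>
    open U \<and> holomorphic_Cn a U \<and> holomorphic_Cn b U \<and>
    U \<subseteq> closure {z \<in> U. b z \<noteq> 0} \<and> (\<forall>z\<in>U. b z \<noteq> 0 \<longrightarrow> f z = a z / b z)"

definition meromorphic_Cn :: "(complex ^ 'n \<Rightarrow> complex) \<Rightarrow> bool"
  where "meromorphic_Cn f \<longleftrightarrow> (\<forall>p::complex ^ 'n::finite. \<exists>U a b. p \<in> U \<and> local_quotient f U a b)"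

definition eq_generic :: "(complex ^ 'n \<Rightarrow> complex) \<Rightarrow> (complex ^ 'n::finite \<Rightarrow> complex) \<Rightarrow> bool"
  where "eq_generic f g \<longleftrightarrow> (\<exists>W. open W \<and> closure W = UNIV \<and> (\<forall>z\<in>W. f z = g z))"

definition mero_eq :: "(complex ^ 'n \<Rightarrow> complex) \<Rightarrow> (complex ^ 'n::finite \<Rightarrow> complex) \<Rightarrow> bool"
  where "mero_eq f g \<longleftrightarrow> meromorphic_Cn f \<and> meromorphic_Cn g \<and> eq_generic f g"

lemma holomorphic_Cn_const: "holomorphic_Cn (\<lambda>_. c) U"
  unfolding holomorphic_Cn_def by (auto intro!: exI[of _ "\<lambda>_. 0"] derivative_eq_intros)

lemma holomorphic_Cn_add:
  assumes "holomorphic_Cn f U" "holomorphic_Cn g U"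
  shows "holomorphic_Cn (\<lambda>z. f z + g z) U"
  unfolding holomorphic_Cn_def
proof
  fix z assume "z \<in> U"
  with assms obtain D E where "(f has_derivative D) (at z)" "\<forall>c v. D (c *s v) = c * D v"
     "(g has_derivative E) (at z)" "\<forall>c v. E (c *s v) = c * E v"
    unfolding holomorphic_Cn_def by metis
  then show "\<exists>D. ((\<lambda>z. f z + g z) has_derivative D) (at z) \<and> (\<forall>c v. D (c *s v) = c * D v)"
    by (intro exI[of _ "\<lambda>v. D v + E v"]) (auto intro!: derivative_intros simp: algebra_simps)
qed

lemma holomorphic_Cn_mult:
  assumes "holomorphic_Cn f U" "holomorphic_Cn g U"
  shows "holomorphic_Cn (\<lambda>z. f z * g z) U"
  unfolding holomorphic_Cn_def
proof
  fix z assume "z \<in> U"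
  with assms obtain D E where "(f has_derivative D) (at z)" "\<forall>c v. D (c *s v) = c * D v"
     "(g has_derivative E) (at z)" "\<forall>c v. E (c *s v) = c * E v"
    unfolding holomorphic_Cn_def by metis
  then show "\<exists>D. ((\<lambda>z. f z * g z) has_derivative D) (at z) \<and> (\<forall>c v. D (c *s v) = c * D v)"
    by (intro exI[of _ "\<lambda>v. f z * E v + D v * g z"] conjI has_derivative_mult) (auto simp: algebra_simps)
qed

lemma holomorphic_Cn_subset: "holomorphic_Cn f U \<Longrightarrow> V \<subseteq> U \<Longrightarrow> holomorphic_Cn f V"
  unfolding holomorphic_Cn_def by blast

lemma holomorphic_Cn_continuous_on: "holomorphic_Cn f U \<Longrightarrow> continuous_on U f"
  unfolding holomorphic_Cn_def
  by (meson continuous_at_imp_continuous_on has_derivative_continuous)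

lemma holomorphic_Cn_shift:
  assumes "holomorphic_Cn f U"
  shows "holomorphic_Cn (\<lambda>z. f (z + \<alpha>)) ((\<lambda>z. z - \<alpha>) ` U)"
  unfolding holomorphic_Cn_def
proof
  fix z assume "z \<in> (\<lambda>z. z - \<alpha>) ` U"
  then have "z + \<alpha> \<in> U" by auto
  with assms obtain D where D: "(f has_derivative D) (at (z + \<alpha>))" "\<forall>c v. D (c *s v) = c * D v"
    unfolding holomorphic_Cn_def by metis
  have "((\<lambda>z. z + \<alpha>) has_derivative (\<lambda>v. v)) (at z)"
    by (auto intro!: derivative_eq_intros)
  from has_derivative_compose[OF this D(1)] D(2)
  show "\<exists>D. ((\<lambda>z. f (z + \<alpha>)) has_derivative D) (at z) \<and> (\<forall>c v. D (c *s v) = c * D v)"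
    by auto
qed

lemma open_nonzero:
  assumes "holomorphic_Cn b U" "open U"
  shows "open {z \<in> U. b z \<noteq> 0}"
proof -
  have "open (U \<inter> b -` (- {0}))"
    using holomorphic_Cn_continuous_on[OF assms(1)] assms(2) by (intro continuous_open_preimage) auto
  also have "U \<inter> b -` (- {0}) = {z \<in> U. b z \<noteq> 0}" by auto
  finally show ?thesis .
qed

lemma dense_inter:
  fixes U :: "'a::topological_space set"
  assumes "open U" "U \<subseteq> closure A" "U \<subseteq> closure B" "open A"
  shows "U \<subseteq> closure (A \<inter> B)"
proof
  fix x assume x: "x \<in> U"
  show "x \<in> closure (A \<inter> B)"
    unfolding closure_iff_nhds_not_empty
  proof safe
    fix S V assume V: "V \<subseteq> S" "x \<in> V" "open V" and e: "A \<inter> B \<inter> S = {}"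
    have "A \<inter> (V \<inter> U) \<noteq> {}"
      using assms(1,2) V x open_Int_closure_eq_empty[of "V \<inter> U" A] by auto
    then obtain y where y: "y \<in> A" "y \<in> V" "y \<in> U" by auto
    have "B \<inter> (A \<inter> V \<inter> U) \<noteq> {}"
      using open_Int_closure_eq_empty[of "A \<inter> V \<inter> U" B] y assms V by auto
    then show False using e V by auto
  qed
qed

lemma closure_shift: "closure ((\<lambda>z. z - \<alpha>) ` S) = (\<lambda>z. z - \<alpha>) ` closure S" for S :: "'a::real_normed_vector set"
  using closure_translation[of "-\<alpha>" S] by (simp add: image_def)

lemma eq_generic_refl: "eq_generic f f"
  unfolding eq_generic_def by (intro exI[of _ UNIV]) auto

lemma eq_generic_op2:
  assumes "eq_generic f f'" "eq_generic g g'" 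
  shows "\<exists>W. open W \<and> closure W = UNIV \<and> (\<forall>z\<in>W. f z = f' z \<and> g z = g' z)"
proof -
  from assms obtain W W' where "open W" "closure W = UNIV" "\<forall>z\<in>W. f z = f' z"
     "open W'" "closure W' = UNIV" "\<forall>z\<in>W'. g z = g' z" unfolding eq_generic_def by blast
  then show ?thesis using dense_inter[of UNIV W W'] by (intro exI[of _ "W \<inter> W'"]) auto
qed

lemma meromorphic_CnE:
  assumes "meromorphic_Cn f"
  obtains U a b where "open U" "p \<in> U" "holomorphic_Cn a U" "holomorphic_Cn b U"
    "U \<subseteq> closure {z \<in> U. b z \<noteq> 0}" "\<forall>z\<in>U. b z \<noteq> 0 \<longrightarrow> f z = a z / b z"
proof -
  have "\<exists>U a b. p \<in> U \<and> local_quotient f U a b"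
    using assms unfolding meromorphic_Cn_def by (rule spec)
  then obtain U a b where *: "p \<in> U" "local_quotient f U a b" by (elim exE conjE)
  show thesis
    by (rule that[of U a b]) (use * in \<open>simp_all add: local_quotient_def\<close>)
qed

lemma meromorphic_Cn_op2:
  assumes f: "meromorphic_Cn f" and g: "meromorphic_Cn g"
  shows "meromorphic_Cn (\<lambda>z. f z + g z)" "meromorphic_Cn (\<lambda>z. f z * g z)"
proof -
  have "\<exists>U a b. p \<in> U \<and> local_quotient (\<lambda>z. f z + g z) U a b"
    and "\<exists>U a b. p \<in> U \<and> local_quotient (\<lambda>z. f z * g z) U a b" for p
  proof -
    obtain U a b where
      U: "open U" "p \<in> U" "holomorphic_Cn a U" "holomorphic_Cn b U"
       "U \<subseteq> closure {z \<in> U. b z \<noteq> 0}" "\<forall>z\<in>U. b z \<noteq> 0 \<longrightarrow> f z = a z / b z"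
      by (rule meromorphic_CnE[OF f, of p])
    obtain V c d where
      V: "open V" "p \<in> V" "holomorphic_Cn c V" "holomorphic_Cn d V"
       "V \<subseteq> closure {z \<in> V. d z \<noteq> 0}" "\<forall>z\<in>V. d z \<noteq> 0 \<longrightarrow> g z = c z / d z"
      by (rule meromorphic_CnE[OF g, of p])
    define O' where "O' = U \<inter> V"
    have h: "holomorphic_Cn a O'" "holomorphic_Cn b O'" "holomorphic_Cn c O'" "holomorphic_Cn d O'"
      using U(3,4) V(3,4) unfolding O'_def by (auto elim: holomorphic_Cn_subset)
    have oO: "open O'" "p \<in> O'" using U(1,2) V(1,2) unfolding O'_def by auto
    have "O' \<subseteq> closure ({z \<in> U. b z \<noteq> 0} \<inter> {z \<in> V. d z \<noteq> 0})"
    proof (rule dense_inter[OF oO(1)])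
      show "O' \<subseteq> closure {z \<in> U. b z \<noteq> 0}" using U(5) O'_def by blast
      show "O' \<subseteq> closure {z \<in> V. d z \<noteq> 0}" using V(5) O'_def by blast
      show "open {z \<in> U. b z \<noteq> 0}" by (rule open_nonzero[OF U(4,1)])
    qed
    also have "({z \<in> U. b z \<noteq> 0} \<inter> {z \<in> V. d z \<noteq> 0}) = {z \<in> O'. b z * d z \<noteq> 0}"
      unfolding O'_def by auto
    finally have dense: "O' \<subseteq> closure {z \<in> O'. b z * d z \<noteq> 0}" .
    have val: "f z = a z / b z" "g z = c z / d z" if "z \<in> O'" "b z * d z \<noteq> 0" for z
      using that bspec[OF U(6), of z] bspec[OF V(6), of z] unfolding O'_def by auto
    have "local_quotient (\<lambda>z. f z + g z) O' (\<lambda>z. a z * d z + c z * b z) (\<lambda>z. b z * d z)"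
      unfolding local_quotient_def
      using dense oO(1) h val by (intro conjI ballI impI holomorphic_Cn_add holomorphic_Cn_mult)
        (simp_all add: add_frac_eq)
    then show "\<exists>U a b. p \<in> U \<and> local_quotient (\<lambda>z. f z + g z) U a b" using oO(2) by blast
    have "local_quotient (\<lambda>z. f z * g z) O' (\<lambda>z. a z * c z) (\<lambda>z. b z * d z)"
      unfolding local_quotient_def
      using dense oO(1) h val by (intro conjI ballI impI holomorphic_Cn_add holomorphic_Cn_mult)
        simp_all
    then show "\<exists>U a b. p \<in> U \<and> local_quotient (\<lambda>z. f z * g z) U a b" using oO(2) by blast
  qed
  then show "meromorphic_Cn (\<lambda>z. f z + g z)" "meromorphic_Cn (\<lambda>z. f z * g z)"
    unfolding meromorphic_Cn_def by blast+
qed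

lemma meromorphic_Cn_const: "meromorphic_Cn (\<lambda>_. c)"
proof -
  have "local_quotient (\<lambda>_. c) UNIV (\<lambda>_. c) (\<lambda>_. 1)"
    unfolding local_quotient_def by (simp add: holomorphic_Cn_const)
  then show ?thesis unfolding meromorphic_Cn_def by blast
qed

lemma meromorphic_Cn_uminus: "meromorphic_Cn f \<Longrightarrow> meromorphic_Cn (\<lambda>z. - f z)"
  using meromorphic_Cn_op2(2)[OF meromorphic_Cn_const[of "-1"], of f] by simp

lemma meromorphic_Cn_shift:
  assumes "meromorphic_Cn f" shows "meromorphic_Cn (\<lambda>z. f (z + \<alpha>))"
  unfolding meromorphic_Cn_def
proof
  fix p
  obtain U a b where
      U: "open U" "p + \<alpha> \<in> U" "holomorphic_Cn a U" "holomorphic_Cn b U"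
       "U \<subseteq> closure {z \<in> U. b z \<noteq> 0}" "\<forall>z\<in>U. b z \<noteq> 0 \<longrightarrow> f z = a z / b z"
    by (rule meromorphic_CnE[OF assms, of "p + \<alpha>"])
  define V where "V = (\<lambda>z. z - \<alpha>) ` U"
  have mem: "z \<in> V \<longleftrightarrow> z + \<alpha> \<in> U" for z unfolding V_def by force
  have "V \<subseteq> (\<lambda>z. z - \<alpha>) ` closure {z \<in> U. b z \<noteq> 0}" unfolding V_def using U(5) by (rule image_mono)
  also have "\<dots> = closure ((\<lambda>z. z - \<alpha>) ` {z \<in> U. b z \<noteq> 0})" by (simp add: closure_shift)
  also have "(\<lambda>z. z - \<alpha>) ` {z \<in> U. b z \<noteq> 0} = {z \<in> V. b (z + \<alpha>) \<noteq> 0}" unfolding V_def by force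
  finally have dense: "V \<subseteq> closure {z \<in> V. b (z + \<alpha>) \<noteq> 0}" .
  have oV: "open V" unfolding V_def using open_translation[of U "-\<alpha>"] U(1) by (simp add: image_def)
  have pV: "p \<in> V" using U(2) mem by blast
  have hol: "holomorphic_Cn (\<lambda>z. a (z + \<alpha>)) V" "holomorphic_Cn (\<lambda>z. b (z + \<alpha>)) V"
    unfolding V_def by (rule holomorphic_Cn_shift[OF U(3)], rule holomorphic_Cn_shift[OF U(4)])
  have val: "f (z + \<alpha>) = a (z + \<alpha>) / b (z + \<alpha>)" if "z \<in> V" "b (z + \<alpha>) \<noteq> 0" for z
    using bspec[OF U(6), of "z + \<alpha>"] that mem by blast
  have "local_quotient (\<lambda>z. f (z + \<alpha>)) V (\<lambda>z. a (z + \<alpha>)) (\<lambda>z. b (z + \<alpha>))"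
    unfolding local_quotient_def by (intro conjI oV hol dense ballI impI val)
  with pV show "\<exists>U a b. p \<in> U \<and> local_quotient (\<lambda>z. f (z + \<alpha>)) U a b" by blast
qed

lemma holomorphic_Cn_identity:
  assumes a: "holomorphic_Cn a (ball p r)" and q: "q \<in> ball p r"
    and N: "open N" "q \<in> N" "\<forall>z\<in>N. a z = 0" and z: "z \<in> ball p r"
  shows "a z = 0"
proof -
  define l where "l t = q + t *s (z - q)" for t :: complex
  define S where "S = l -` ball p r"
  have l_der: "(l has_derivative (\<lambda>t. t *s (z - q))) (at t)" for t
  proof -
    have "bounded_linear (\<lambda>t. t *s (z - q))"
      unfolding linear_conv_bounded_linear[symmetric]
      by (rule linearI) (auto simp: vec_eq_iff algebra_simps scaleR_diff_right)
    from bounded_linear_imp_has_derivative[OF this] show ?thesis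
      unfolding l_def using has_derivative_add[OF has_derivative_const] by fastforce
  qed
  have cl: "continuous_on UNIV l"
    by (intro continuous_at_imp_continuous_on ballI has_derivative_continuous[OF l_der])
  have oS: "open S" unfolding S_def by (rule open_vimage) (auto simp: cl)
  have l_comb: "l (u *\<^sub>R x + v *\<^sub>R y) = u *\<^sub>R l x + v *\<^sub>R l y" if "u + v = 1" for u v x y
  proof -
    have v: "v = 1 - u" using that by simp
    show ?thesis unfolding vec_eq_iff l_def v
      by (simp add: scaleR_conv_of_real[where 'a = complex] algebra_simps)
  qed
  have "convex S" unfolding convex_def S_def using convexD[OF convex_ball[of p r]] l_comb by simp
  then have cS: "connected S" by (rule convex_connected)
  have hol: "(a \<circ> l) holomorphic_on S"
  proof -
    have "\<exists>f'. ((a \<circ> l) has_field_derivative f') (at t)" if "t \<in> S" for t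
    proof -
      have "l t \<in> ball p r" using that by (simp add: S_def)
      then obtain D where D: "(a has_derivative D) (at (l t))" "\<forall>c v. D (c *s v) = c * D v"
        using bspec[OF a[unfolded holomorphic_Cn_def], of "l t"] by metis
      have "((a \<circ> l) has_derivative (\<lambda>s. D (s *s (z - q)))) (at t)"
        using has_derivative_compose[OF l_der D(1)] unfolding o_def .
      moreover have "(\<lambda>s. D (s *s (z - q))) = (\<lambda>s. D (z - q) * s)"
        using D(2) by (metis mult.commute)
      ultimately have "((a \<circ> l) has_derivative (\<lambda>s. D (z - q) * s)) (at t)"
        by simp
      then show ?thesis unfolding has_field_derivative_def by blast
    qed
    then show ?thesis using oS by (simp add: holomorphic_on_open)
  qed
  have oN: "open (l -` N \<inter> S)" by (intro open_Int open_vimage oS N(1) cl)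
  have "0 \<in> l -` N \<inter> S" "1 \<in> S" using N q z by (auto simp: l_def S_def)
  then have "(a \<circ> l) 1 = 0"
    using analytic_continuation_open[OF oN oS _ cS _ hol holomorphic_on_const[of 0], of 1] N(3) by fastforce
  then show ?thesis by (simp add: l_def)
qed

lemma zero_of_dense:
  assumes "open U" "holomorphic_Cn a U" "U \<subseteq> closure W" "\<forall>z\<in>W \<inter> U. a z = 0" "z \<in> U"
  shows "a z = 0"
proof (rule ccontr)
  assume "a z \<noteq> 0"
  then have "W \<inter> {z \<in> U. a z \<noteq> 0} \<noteq> {}"
    using open_Int_closure_eq_empty[OF open_nonzero[OF assms(2,1)], of W] assms(3,5) by auto
  then show False using assms(4) by auto
qed

lemma meromorphic_Cn_zero_or_nonzero:
  assumes "meromorphic_Cn f"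
  shows "eq_generic f (\<lambda>_. 0) \<or> (\<exists>W. open W \<and> closure W = UNIV \<and> (\<forall>z\<in>W. f z \<noteq> 0))"
proof -
  define Z where "Z = {p. \<exists>N W. open N \<and> p \<in> N \<and> open W \<and> N \<subseteq> closure W \<and> (\<forall>z\<in>W \<inter> N. f z = 0)}"
  have oZ: "open Z"
  proof (subst open_subopen, rule ballI)
    fix p assume "p \<in> Z"
    then obtain N W where N: "open N" "p \<in> N" "open W" "N \<subseteq> closure W" "\<forall>z\<in>W \<inter> N. f z = 0"
      unfolding Z_def by blast
    have "N \<subseteq> Z" unfolding Z_def using N(1,3,4,5) by blast
    with N(1,2) show "\<exists>T. open T \<and> p \<in> T \<and> T \<subseteq> Z" by blast
  qed
  have "closure Z \<subseteq> Z"
  proof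
    fix p assume p: "p \<in> closure Z"
    obtain U a b where
      U: "open U" "p \<in> U" "holomorphic_Cn a U" "holomorphic_Cn b U"
       "U \<subseteq> closure {z \<in> U. b z \<noteq> 0}" "\<forall>z\<in>U. b z \<noteq> 0 \<longrightarrow> f z = a z / b z"
      by (rule meromorphic_CnE[OF assms, of p])
    from U obtain r where r: "r > 0" "ball p r \<subseteq> U" by (meson openE)
    have "Z \<inter> ball p r \<noteq> {}"
      using open_Int_closure_eq_empty[OF open_ball, of p r Z] p centre_in_ball[of p r] r(1) by blast
    then obtain q N W where q: "q \<in> ball p r" "open N" "q \<in> N" "open W" "N \<subseteq> closure W" "\<forall>z\<in>W \<inter> N. f z = 0"
      unfolding Z_def by blast
    have nz: "open {z \<in> U. b z \<noteq> 0}" by (rule open_nonzero[OF U(4,1)])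
    have oN: "open (N \<inter> ball p r)" using q(2) by blast
    have dense: "N \<inter> ball p r \<subseteq> closure ({z \<in> U. b z \<noteq> 0} \<inter> W)"
      by (rule dense_inter[OF oN _ _ nz]) (use q(5) r(2) U(5) in blast)+
    have hol: "holomorphic_Cn a (ball p r)" "holomorphic_Cn a (N \<inter> ball p r)"
      using holomorphic_Cn_subset[OF U(3)] r(2) by (blast, blast)
    have vanish: "\<forall>z\<in>{z \<in> U. b z \<noteq> 0} \<inter> W \<inter> (N \<inter> ball p r). a z = 0"
    proof
      fix z assume z: "z \<in> {z \<in> U. b z \<noteq> 0} \<inter> W \<inter> (N \<inter> ball p r)"
      then have "f z = 0" using q(6) by blast
      then show "a z = 0" using bspec[OF U(6), of z] z by auto
    qed
    have "\<forall>z\<in>N \<inter> ball p r. a z = 0"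
      using zero_of_dense[OF oN hol(2) dense vanish] by blast
    then have az: "a z = 0" if "z \<in> ball p r" for z
      using holomorphic_Cn_identity[OF hol(1) q(1) oN _ _ that] q(1,3) by blast
    have "\<forall>z\<in>{z \<in> U. b z \<noteq> 0} \<inter> ball p r. f z = 0"
    proof
      fix z assume "z \<in> {z \<in> U. b z \<noteq> 0} \<inter> ball p r"
      then show "f z = 0" using bspec[OF U(6), of z] az by auto
    qed
    moreover have "p \<in> ball p r" "ball p r \<subseteq> closure {z \<in> U. b z \<noteq> 0}" using r U(5) by auto
    ultimately show "p \<in> Z"
      unfolding Z_def using nz open_ball by blast
  qed
  then have "closed Z" using closure_subset_eq by blast
  with oZ have "Z = {} \<or> Z = UNIV"
    using connected_UNIV connected_clopen[of UNIV] by auto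
  then show ?thesis
  proof
    assume Z: "Z = UNIV"
    define W where "W = \<Union>{W. open W \<and> (\<forall>z\<in>W. f z = 0)}"
    have "p \<in> closure W" for p
    proof -
      have "p \<in> Z" using Z by simp
      then obtain N V where N: "open N" "p \<in> N" "open V" "N \<subseteq> closure V" "\<forall>z\<in>V \<inter> N. f z = 0"
        unfolding Z_def by blast
      have "N \<subseteq> closure (V \<inter> N)"
        using N dense_inter[of N V N] closure_subset[of N] by auto
      moreover have "V \<inter> N \<subseteq> W" unfolding W_def using N by auto
      ultimately show ?thesis using N closure_mono by blast
    qed
    then show ?thesis unfolding eq_generic_def
      by (intro disjI1 exI[of _ W]) (auto simp: W_def)
  next
    assume Z: "Z = {}"
    define W where "W = \<Union>{W. open W \<and> (\<forall>z\<in>W. f z \<noteq> 0)}"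
    have "p \<in> closure W" for p
      unfolding closure_iff_nhds_not_empty
    proof safe
      fix S V assume V: "V \<subseteq> S" "p \<in> V" "open V" and e: "W \<inter> S = {}"
      obtain U a b where
      U: "open U" "p \<in> U" "holomorphic_Cn a U" "holomorphic_Cn b U"
       "U \<subseteq> closure {z \<in> U. b z \<noteq> 0}" "\<forall>z\<in>U. b z \<noteq> 0 \<longrightarrow> f z = a z / b z"
      by (rule meromorphic_CnE[OF assms, of p])
      have nz: "open {z \<in> U. b z \<noteq> 0}" by (rule open_nonzero[OF U(4,1)])
      define O' where "O' = {z \<in> U. b z \<noteq> 0} \<inter> V"
      have oO: "open O'" unfolding O'_def using V(3) nz by blast
      have sub: "O' \<subseteq> U" unfolding O'_def by blast
      have 1: "open {z \<in> O'. a z \<noteq> 0}"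
        by (rule open_nonzero[OF holomorphic_Cn_subset[OF U(3) sub] oO])
      have 2: "f z \<noteq> 0" if "z \<in> {z \<in> O'. a z \<noteq> 0}" for z
        using bspec[OF U(6), of z] that unfolding O'_def by auto
      have "{z \<in> O'. a z \<noteq> 0} \<subseteq> W" unfolding W_def using 1 2 by blast
      then have az: "a z = 0" if "z \<in> O'" for z using that e V(1) unfolding O'_def by blast
      have "\<forall>z\<in>{z \<in> U. b z \<noteq> 0} \<inter> (U \<inter> V). f z = 0"
      proof
        fix z assume "z \<in> {z \<in> U. b z \<noteq> 0} \<inter> (U \<inter> V)"
        then show "f z = 0" using bspec[OF U(6), of z] az[of z] unfolding O'_def by auto
      qed
      moreover have "open (U \<inter> V)" "p \<in> U \<inter> V" "U \<inter> V \<subseteq> closure {z \<in> U. b z \<noteq> 0}"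
        using U(1,2,5) V(2,3) by blast+
      ultimately have "p \<in> Z" unfolding Z_def using nz by blast
      then show False using Z by blast
    qed
    then show ?thesis 
      by (intro disjI2 exI[of _ W]) (auto simp: W_def)
  qed
qed

lemma meromorphic_Cn_inverse:
  assumes "meromorphic_Cn f" shows "meromorphic_Cn (\<lambda>z. inverse (f z))"
  unfolding meromorphic_Cn_def
proof
  fix p
  obtain U a b where
      U: "open U" "p \<in> U" "holomorphic_Cn a U" "holomorphic_Cn b U"
       "U \<subseteq> closure {z \<in> U. b z \<noteq> 0}" "\<forall>z\<in>U. b z \<noteq> 0 \<longrightarrow> f z = a z / b z"
      by (rule meromorphic_CnE[OF assms, of p])
  have nz: "open {z \<in> U. b z \<noteq> 0}" by (rule open_nonzero[OF U(4,1)])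
  have "\<exists>a' b'. local_quotient (\<lambda>z. inverse (f z)) U a' b'"
    using meromorphic_Cn_zero_or_nonzero[OF assms]
  proof
    assume "eq_generic f (\<lambda>_. 0)"
    then obtain W where W: "open W" "closure W = UNIV" "\<forall>z\<in>W. f z = 0" unfolding eq_generic_def by blast
    have d: "U \<subseteq> closure ({z \<in> U. b z \<noteq> 0} \<inter> W)"
      by (rule dense_inter[OF U(1,5) _ nz]) (simp add: W(2))
    have "a z = 0" if "z \<in> U" for z
    proof (rule zero_of_dense[OF U(1,3) d _ that], rule ballI)
      fix z assume "z \<in> {z \<in> U. b z \<noteq> 0} \<inter> W \<inter> U"
      then show "a z = 0" using bspec[OF U(6), of z] W(3) by auto
    qed
    then have *: "inverse (f z) = 0 / b z" if "z \<in> U" "b z \<noteq> 0" for z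
      using that bspec[OF U(6), of z] by simp
    have "local_quotient (\<lambda>z. inverse (f z)) U (\<lambda>_. 0) b"
      unfolding local_quotient_def
      by (intro conjI ballI impI U(1,4,5) holomorphic_Cn_const) (use * in simp)
    then show ?thesis by blast
  next
    assume "\<exists>W. open W \<and> closure W = UNIV \<and> (\<forall>z\<in>W. f z \<noteq> 0)"
    then obtain W where W: "open W" "closure W = UNIV" "\<forall>z\<in>W. f z \<noteq> 0" by blast
    have "U \<subseteq> closure ({z \<in> U. b z \<noteq> 0} \<inter> W)"
      by (rule dense_inter[OF U(1,5) _ nz]) (simp add: W(2))
    also have "\<dots> \<subseteq> closure {z \<in> U. a z * b z \<noteq> 0}"
    proof (rule closure_mono, rule subsetI)
      fix z assume "z \<in> {z \<in> U. b z \<noteq> 0} \<inter> W"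
      then show "z \<in> {z \<in> U. a z * b z \<noteq> 0}" using bspec[OF U(6), of z] W(3) by auto
    qed
    finally have "local_quotient (\<lambda>z. inverse (f z)) U (\<lambda>z. b z * b z) (\<lambda>z. a z * b z)"
      unfolding local_quotient_def
      by (intro conjI ballI impI U(1,3,4) holomorphic_Cn_mult) (use U(6) in auto)
    then show ?thesis by blast
  qed
  with U(2) show "\<exists>U a b. p \<in> U \<and> local_quotient (\<lambda>z. inverse (f z)) U a b" by blast
qed

lemma eq_generic_shift:
  assumes "eq_generic f g" shows "eq_generic (\<lambda>z. f (z + \<alpha>)) (\<lambda>z. g (z + \<alpha>))"
proof -
  from assms obtain W where W: "open W" "closure W = UNIV" "\<forall>z\<in>W. f z = g z" unfolding eq_generic_def by blast
  have "open ((\<lambda>z. z - \<alpha>) ` W)" using open_translation[of W "-\<alpha>"] W(1) by (simp add: image_def)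
  moreover have "closure ((\<lambda>z. z - \<alpha>) ` W) = UNIV" using W by (simp add: closure_shift surj_diff_right)
  ultimately show ?thesis unfolding eq_generic_def using W
    by (intro exI[of _ "(\<lambda>z. z - \<alpha>) ` W"]) auto
qed

quotient_type (overloaded) 'n mero = "complex ^ ('n::finite) \<Rightarrow> complex" / partial: mero_eq
  morphisms rep_mero mero_of
proof (rule part_equivpI)
  show "\<exists>x::complex ^ 'n \<Rightarrow> complex. mero_eq x x"
    unfolding mero_eq_def using meromorphic_Cn_const eq_generic_refl by blast
  show "symp (mero_eq :: _ \<Rightarrow> (complex ^ 'n \<Rightarrow> complex) \<Rightarrow> bool)"
    by (rule sympI) (auto simp: mero_eq_def eq_generic_def)
  show "transp (mero_eq :: _ \<Rightarrow> (complex ^ 'n \<Rightarrow> complex) \<Rightarrow> bool)"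
  proof (rule transpI)
    fix f g h :: "complex ^ 'n \<Rightarrow> complex" assume *: "mero_eq f g" "mero_eq g h"
    then show "mero_eq f h" using eq_generic_op2[of f g g h] 
      unfolding mero_eq_def by (metis (no_types, lifting) eq_generic_def)
  qed
qed

instantiation mero :: (finite) field
begin

lift_definition zero_mero :: "'a mero" is "\<lambda>_. 0"
  by (simp add: mero_eq_def meromorphic_Cn_const eq_generic_refl)

lift_definition one_mero :: "'a mero" is "\<lambda>_. 1"
  by (simp add: mero_eq_def meromorphic_Cn_const eq_generic_refl)

lift_definition plus_mero :: "'a mero \<Rightarrow> 'a mero \<Rightarrow> 'a mero" is "\<lambda>f g z. f z + g z"
proof -
  fix f f' g g' :: "complex ^ 'a \<Rightarrow> complex"
  assume *: "mero_eq f f'" "mero_eq g g'"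
  then obtain W where "open W" "closure W = UNIV" "\<forall>z\<in>W. f z = f' z \<and> g z = g' z"
    using eq_generic_op2[of f f' g g'] unfolding mero_eq_def by blast
  then have "eq_generic (\<lambda>z. f z + g z) (\<lambda>z. f' z + g' z)"
    unfolding eq_generic_def by (intro exI[of _ W]) simp
  then show "mero_eq (\<lambda>z. f z + g z) (\<lambda>z. f' z + g' z)"
    using * unfolding mero_eq_def by (simp add: meromorphic_Cn_op2(1))
qed

lift_definition times_mero :: "'a mero \<Rightarrow> 'a mero \<Rightarrow> 'a mero" is "\<lambda>f g z. f z * g z"
proof -
  fix f f' g g' :: "complex ^ 'a \<Rightarrow> complex"
  assume *: "mero_eq f f'" "mero_eq g g'"
  then obtain W where "open W" "closure W = UNIV" "\<forall>z\<in>W. f z = f' z \<and> g z = g' z"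
    using eq_generic_op2[of f f' g g'] unfolding mero_eq_def by blast
  then have "eq_generic (\<lambda>z. f z * g z) (\<lambda>z. f' z * g' z)"
    unfolding eq_generic_def by (intro exI[of _ W]) simp
  then show "mero_eq (\<lambda>z. f z * g z) (\<lambda>z. f' z * g' z)"
    using * unfolding mero_eq_def by (simp add: meromorphic_Cn_op2(2))
qed

lift_definition uminus_mero :: "'a mero \<Rightarrow> 'a mero" is "\<lambda>f z. - f z"
  unfolding mero_eq_def using meromorphic_Cn_uminus by (auto simp: eq_generic_def)

lift_definition inverse_mero :: "'a mero \<Rightarrow> 'a mero" is "\<lambda>f z. inverse (f z)"
  unfolding mero_eq_def using meromorphic_Cn_inverse by (auto simp: eq_generic_def)

definition minus_mero :: "'a mero \<Rightarrow> 'a mero \<Rightarrow> 'a mero" where "minus_mero f g = f + - g"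
definition divide_mero :: "'a mero \<Rightarrow> 'a mero \<Rightarrow> 'a mero" where "divide_mero f g = f * inverse g"

instance
proof
  fix f g h :: "'a mero"
  show "f + g + h = f + (g + h)"
    by transfer (simp add: mero_eq_def meromorphic_Cn_op2 eq_generic_refl add.assoc)
  show "f + g = g + f"
    by transfer (simp add: mero_eq_def meromorphic_Cn_op2 eq_generic_refl add.commute)
  show "0 + f = f" by transfer simp
  show "- f + f = 0"
    by transfer (simp add: mero_eq_def meromorphic_Cn_const eq_generic_refl)
  show "f - g = f + - g" by (simp add: minus_mero_def)
  show "f * g * h = f * (g * h)"
    by transfer (simp add: mero_eq_def meromorphic_Cn_op2 eq_generic_refl mult.assoc)
  show "f * g = g * f"
    by transfer (simp add: mero_eq_def meromorphic_Cn_op2 eq_generic_refl mult.commute)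
  show "1 * f = f" by transfer simp
  show "(f + g) * h = f * h + g * h"
    by transfer (simp add: mero_eq_def meromorphic_Cn_op2 eq_generic_refl ring_distribs)
  show "(0::'a mero) \<noteq> 1"
    by transfer (auto simp: mero_eq_def eq_generic_def)
  show "inverse f * f = 1" if "f \<noteq> 0"
    using that
  proof transfer
    fix f :: "complex ^ 'a \<Rightarrow> complex" assume *: "mero_eq f f" "\<not> mero_eq f (\<lambda>_. 0)"
    then have m: "meromorphic_Cn f" "\<not> eq_generic f (\<lambda>_. 0)"
      using meromorphic_Cn_const unfolding mero_eq_def by auto
    then obtain W where "open W" "closure W = UNIV" "\<forall>z\<in>W. f z \<noteq> 0"
      using meromorphic_Cn_zero_or_nonzero by blast
    then have "eq_generic (\<lambda>z. inverse (f z) * f z) (\<lambda>_. 1)" unfolding eq_generic_def by auto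
    then show "mero_eq (\<lambda>z. inverse (f z) * f z) (\<lambda>_. 1)"
      unfolding mero_eq_def using m meromorphic_Cn_const meromorphic_Cn_op2(2)[OF meromorphic_Cn_inverse] by blast
  qed
  show "f div g = f * inverse g" by (simp add: divide_mero_def)
  show "inverse (0::'a mero) = 0"
    by transfer (simp add: mero_eq_def meromorphic_Cn_const eq_generic_refl)
qed

end

lift_definition mero_const :: "complex \<Rightarrow> 'n::finite mero" is "\<lambda>c _. c"
  by (simp add: mero_eq_def meromorphic_Cn_const eq_generic_refl)

lift_definition shift :: "complex ^ 'n \<Rightarrow> 'n::finite mero \<Rightarrow> 'n mero" is "\<lambda>\<alpha> f z. f (z + \<alpha>)"
  by (simp add: mero_eq_def meromorphic_Cn_shift eq_generic_shift)

section \<open>Bigraded algebras and graded spaces over the meromorphic functions\<close>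

abbreviation Cring :: "complex ring"
  where "Cring \<equiv> ring_of_type_algebra"

abbreviation Mring :: "'n::finite mero ring"
  where "Mring \<equiv> ring_of_type_algebra"

text \<open>The space \<open>\<hh>\<^sup>*\<close> of degrees is \<^typ>\<open>complex ^ 'n\<close>; its unit vectors are indexed by the type \<^typ>\<open>'n\<close>.\<close>

record ('n::finite, 'a) halg = "(complex, 'a) module" +
  bideg :: "complex ^ 'n \<Rightarrow> complex ^ 'n \<Rightarrow> 'a set"
  lmom :: "'n mero \<Rightarrow> 'a"
  rmom :: "'n mero \<Rightarrow> 'a"

text \<open>The record inherits the fields \<open>mult\<close> and \<open>one\<close>; they carry meaning only when the
  space is also an algebra, and \<open>h_space\<close> below does not mention them.\<close>

record ('n::finite, 'v) hspace = "('n mero, 'v) module" +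
  deg :: "complex ^ 'n \<Rightarrow> 'v set"

definition direct_sum :: "('a, 'm) ring_scheme \<Rightarrow> ('i \<Rightarrow> 'a set) \<Rightarrow> bool"
  where "direct_sum G D \<longleftrightarrow>
    (\<forall>i. additive_subgroup (D i) G) \<and>
    (\<forall>a\<in>carrier G. \<exists>!x. (\<forall>i. x i \<in> D i) \<and> finite {i. x i \<noteq> \<zero>\<^bsub>G\<^esub>} \<and>
       a = (\<Oplus>\<^bsub>G\<^esub>i\<in>{i. x i \<noteq> \<zero>\<^bsub>G\<^esub>}. x i))"

definition moment_map :: "('n::finite, 'a, 'k) halg_scheme \<Rightarrow> ('n mero \<Rightarrow> 'a) \<Rightarrow> bool"
  where "moment_map A m \<longleftrightarrow>
    inj m \<and> range m \<subseteq> bideg A 0 0 \<and>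
    (\<forall>f g. m (f + g) = m f \<oplus>\<^bsub>A\<^esub> m g) \<and>
    (\<forall>f g. m (f * g) = m f \<otimes>\<^bsub>A\<^esub> m g) \<and>
    (\<forall>c. m (mero_const c) = c \<odot>\<^bsub>A\<^esub> \<one>\<^bsub>A\<^esub>)"

locale h_algebra = module Cring A + ring A
  for A :: "('n::finite, 'a, 'm) halg_scheme" (structure) +
  assumes smult_mult_left: "\<lbrakk>a \<in> carrier A; b \<in> carrier A\<rbrakk> \<Longrightarrow> (c \<odot> a) \<otimes> b = c \<odot> (a \<otimes> b)"
    and smult_mult_right: "\<lbrakk>a \<in> carrier A; b \<in> carrier A\<rbrakk> \<Longrightarrow> a \<otimes> (c \<odot> b) = c \<odot> (a \<otimes> b)"
    and bigraded: "direct_sum A (\<lambda>(\<alpha>, \<beta>). bideg A \<alpha> \<beta>)"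
    and bideg_smult: "a \<in> bideg A \<alpha> \<beta> \<Longrightarrow> c \<odot> a \<in> bideg A \<alpha> \<beta>"
    and bideg_mult: "\<lbrakk>a \<in> bideg A \<alpha> \<beta>; b \<in> bideg A \<gamma> \<delta>\<rbrakk> \<Longrightarrow> a \<otimes> b \<in> bideg A (\<alpha> + \<gamma>) (\<beta> + \<delta>)"
    and lmom: "moment_map A (lmom A)"
    and rmom: "moment_map A (rmom A)"
    and lmom_comm: "a \<in> bideg A \<alpha> \<beta> \<Longrightarrow> lmom A f \<otimes> a = a \<otimes> lmom A (shift \<alpha> f)"
    and rmom_comm: "a \<in> bideg A \<alpha> \<beta> \<Longrightarrow> rmom A f \<otimes> a = a \<otimes> rmom A (shift \<beta> f)"

definition h_algebra_hom ::
    "('n::finite, 'a, 'm) halg_scheme \<Rightarrow> ('n, 'b, 'k) halg_scheme \<Rightarrow> ('a \<Rightarrow> 'b) \<Rightarrow> bool"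
  where "h_algebra_hom A B \<phi> \<longleftrightarrow>
    \<phi> \<in> ring_hom A B \<and>
    (\<forall>c. \<forall>a\<in>carrier A. \<phi> (c \<odot>\<^bsub>A\<^esub> a) = c \<odot>\<^bsub>B\<^esub> \<phi> a) \<and>
    (\<forall>\<alpha> \<beta>. \<phi> ` bideg A \<alpha> \<beta> \<subseteq> bideg B \<alpha> \<beta>) \<and>
    (\<forall>f. \<phi> (lmom A f) = lmom B f) \<and> (\<forall>f. \<phi> (rmom A f) = rmom B f)"

locale h_space = module Mring V
  for V :: "('n::finite, 'v, 'm) hspace_scheme" (structure) +
  assumes graded: "direct_sum V (deg V)"
    and deg_smult: "v \<in> deg V \<alpha> \<Longrightarrow> f \<odot> v \<in> deg V \<alpha>"

text \<open>The \<open>\<hh>\<close>-algebra of difference operators, realised as operators on meromorphic functions.\<close>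

definition diff_alg :: "('n::finite, 'n mero \<Rightarrow> 'n mero) halg"
  where "diff_alg = \<lparr>
    carrier = {(\<lambda>g. \<Sum>\<beta>\<in>S. f \<beta> * shift \<beta> g) | S f. finite S},
    monoid.mult = (\<circ>),
    one = id,
    zero = (\<lambda>g. 0),
    add = (\<lambda>d e g. d g + e g),
    smult = (\<lambda>c d g. mero_const c * d g),
    bideg = (\<lambda>\<alpha> \<beta>. if \<alpha> = \<beta> then {(\<lambda>g. f * shift (- \<beta>) g) | f. True} else {\<lambda>g. 0}),
    lmom = (*),
    rmom = (*)\<rparr>"


section \<open>Tensor products\<close>

text \<open>
  Let \<open>S\<close> be a set of pairs of homogeneous components. The direct sum over \<open>(U, W) \<in> S\<close> of the
  tensor products of \<open>U\<close> and \<open>W\<close> over the meromorphic functions is presented as the free abelian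
  group on the homogeneous pairs modulo biadditivity within each \<open>U \<times> W\<close> and the balancing
  relation. Distinct components share only zero elements, and pairs with a zero entry are null, so
  one free group on the union of all \<open>U \<times> W\<close> serves for the whole sum.
  The action of \<open>f\<close> is \<open>r f\<close> on the left factor and \<open>l f\<close> on the right one. Elements of the tensor
  product are cosets.
\<close>

type_synonym ('a, 'b) tens = "(('a \<times> 'b) \<Rightarrow>\<^sub>0 int) set"

definition tensor_gens :: "('a set \<times> 'b set) set \<Rightarrow> ('a \<times> 'b) set"
  where "tensor_gens S = (\<Union>(U, W)\<in>S. U \<times> W)"

definition tensor_rels ::
    "('a, 'k) ring_scheme \<Rightarrow> ('b, 'm) ring_scheme \<Rightarrow> ('f \<Rightarrow> 'a \<Rightarrow> 'a) \<Rightarrow> ('f \<Rightarrow> 'b \<Rightarrow> 'b) \<Rightarrow>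
     ('a set \<times> 'b set) set \<Rightarrow> ('a, 'b) tens"
  where "tensor_rels A B r l S =
    {frag_of (a \<oplus>\<^bsub>A\<^esub> a', b) - frag_of (a, b) - frag_of (a', b) | U W a a' b.
       (U, W) \<in> S \<and> a \<in> U \<and> a' \<in> U \<and> b \<in> W} \<union>
    {frag_of (a, b \<oplus>\<^bsub>B\<^esub> b') - frag_of (a, b) - frag_of (a, b') | U W a b b'.
       (U, W) \<in> S \<and> a \<in> U \<and> b \<in> W \<and> b' \<in> W} \<union>
    {frag_of (r f a, b) - frag_of (a, l f b) | U W f a b. (U, W) \<in> S \<and> a \<in> U \<and> b \<in> W}"

text \<open>The map of cosets induced by a map of generators, and likewise for two arguments. As for
  \<open>rcoset_mult\<close>, the union is a single coset of \<open>N\<close> whenever the map is well defined.\<close>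

definition coset_map ::
    "('y \<Rightarrow>\<^sub>0 int) monoid \<Rightarrow> ('y \<Rightarrow>\<^sub>0 int) set \<Rightarrow> ('x \<Rightarrow> 'y) \<Rightarrow> ('x \<Rightarrow>\<^sub>0 int) set \<Rightarrow> ('y \<Rightarrow>\<^sub>0 int) set"
  where "coset_map G N k K = (\<Union>x\<in>K. N #>\<^bsub>G\<^esub> frag_extend (\<lambda>p. frag_of (k p)) x)"

definition coset_map2 ::
    "('y \<Rightarrow>\<^sub>0 int) monoid \<Rightarrow> ('y \<Rightarrow>\<^sub>0 int) set \<Rightarrow> ('x \<Rightarrow> 'z \<Rightarrow> 'y) \<Rightarrow>
     ('x \<Rightarrow>\<^sub>0 int) set \<Rightarrow> ('z \<Rightarrow>\<^sub>0 int) set \<Rightarrow> ('y \<Rightarrow>\<^sub>0 int) set"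
  where "coset_map2 G N k K K' = (\<Union>x\<in>K. \<Union>y\<in>K'.
    N #>\<^bsub>G\<^esub> frag_extend (\<lambda>p. frag_extend (\<lambda>p'. frag_of (k p p')) y) x)"

abbreviation mult_pair ::
    "('a, 'k) monoid_scheme \<Rightarrow> ('b, 'm) monoid_scheme \<Rightarrow> 'a \<times> 'b \<Rightarrow> 'a \<times> 'b \<Rightarrow> 'a \<times> 'b"
  where "mult_pair A B p p' \<equiv> (fst p \<otimes>\<^bsub>A\<^esub> fst p', snd p \<otimes>\<^bsub>B\<^esub> snd p')"


subsection \<open>Two bigraded algebras\<close>

definition aa_comps ::
    "('n::finite, 'a, 'k) halg_scheme \<Rightarrow> ('n, 'b, 'm) halg_scheme \<Rightarrow> ('a set \<times> 'b set) set"
  where "aa_comps A B = {(bideg A \<alpha> \<gamma>, bideg B \<gamma> \<beta>) | \<alpha> \<beta> \<gamma>. True}"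

definition aa_free ::
    "('n::finite, 'a, 'k) halg_scheme \<Rightarrow> ('n, 'b, 'm) halg_scheme \<Rightarrow> (('a \<times> 'b) \<Rightarrow>\<^sub>0 int) monoid"
  where "aa_free A B = free_Abelian_group (tensor_gens (aa_comps A B))"

definition aa_null ::
    "('n::finite, 'a, 'k) halg_scheme \<Rightarrow> ('n, 'b, 'm) halg_scheme \<Rightarrow> ('a, 'b) tens"
  where "aa_null A B = generate (aa_free A B)
    (tensor_rels A B (\<lambda>f a. rmom A f \<otimes>\<^bsub>A\<^esub> a) (\<lambda>f b. lmom B f \<otimes>\<^bsub>B\<^esub> b) (aa_comps A B))"

definition aa_tens ::
    "('n::finite, 'a, 'k) halg_scheme \<Rightarrow> ('n, 'b, 'm) halg_scheme \<Rightarrow> 'a \<Rightarrow> 'b \<Rightarrow> ('a, 'b) tens"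
  where "aa_tens A B a b = aa_null A B #>\<^bsub>aa_free A B\<^esub> frag_of (a, b)"

definition aa_map ::
    "('n::finite, 'a, 'k) halg_scheme \<Rightarrow> ('n, 'b, 'm) halg_scheme \<Rightarrow>
     ('c \<Rightarrow> 'a) \<Rightarrow> ('d \<Rightarrow> 'b) \<Rightarrow> ('c, 'd) tens \<Rightarrow> ('a, 'b) tens"
  where "aa_map A B \<phi> \<psi> = coset_map (aa_free A B) (aa_null A B) (map_prod \<phi> \<psi>)"

definition aa_tensor ::
    "('n::finite, 'a, 'k) halg_scheme \<Rightarrow> ('n, 'b, 'm) halg_scheme \<Rightarrow>
     ('n, ('a, 'b) tens) halg"
  where "aa_tensor A B = \<lparr>
    carrier = carrier (aa_free A B Mod aa_null A B),
    monoid.mult = coset_map2 (aa_free A B) (aa_null A B) (mult_pair A B),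
    one = aa_tens A B \<one>\<^bsub>A\<^esub> \<one>\<^bsub>B\<^esub>,
    zero = \<one>\<^bsub>aa_free A B Mod aa_null A B\<^esub>,
    add = (\<otimes>\<^bsub>aa_free A B Mod aa_null A B\<^esub>),
    smult = (\<lambda>c. aa_map A B (\<lambda>a. c \<odot>\<^bsub>A\<^esub> a) id),
    bideg = (\<lambda>\<alpha> \<beta>. (\<lambda>x. aa_null A B #>\<^bsub>aa_free A B\<^esub> x) `
      carrier (free_Abelian_group (\<Union>\<gamma>. bideg A \<alpha> \<gamma> \<times> bideg B \<gamma> \<beta>))),
    lmom = (\<lambda>f. aa_tens A B (lmom A f) \<one>\<^bsub>B\<^esub>),
    rmom = (\<lambda>f. aa_tens A B \<one>\<^bsub>A\<^esub> (rmom B f))\<rparr>"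


subsection \<open>A bigraded algebra and a graded space\<close>

definition av_comps ::
    "('n::finite, 'a, 'k) halg_scheme \<Rightarrow> ('n, 'v, 'm) hspace_scheme \<Rightarrow> ('a set \<times> 'v set) set"
  where "av_comps A V = {(bideg A \<alpha> \<beta>, deg V \<beta>) | \<alpha> \<beta>. True}"

definition av_free ::
    "('n::finite, 'a, 'k) halg_scheme \<Rightarrow> ('n, 'v, 'm) hspace_scheme \<Rightarrow> (('a \<times> 'v) \<Rightarrow>\<^sub>0 int) monoid"
  where "av_free A V = free_Abelian_group (tensor_gens (av_comps A V))"

definition av_null ::
    "('n::finite, 'a, 'k) halg_scheme \<Rightarrow> ('n, 'v, 'm) hspace_scheme \<Rightarrow> ('a, 'v) tens"
  where "av_null A V = generate (av_free A V)
    (tensor_rels A V (\<lambda>f a. rmom A f \<otimes>\<^bsub>A\<^esub> a) (\<lambda>f v. f \<odot>\<^bsub>V\<^esub> v) (av_comps A V))"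

definition av_tens ::
    "('n::finite, 'a, 'k) halg_scheme \<Rightarrow> ('n, 'v, 'm) hspace_scheme \<Rightarrow> 'a \<Rightarrow> 'v \<Rightarrow> ('a, 'v) tens"
  where "av_tens A V a v = av_null A V #>\<^bsub>av_free A V\<^esub> frag_of (a, v)"

definition av_map ::
    "('n::finite, 'a, 'k) halg_scheme \<Rightarrow> ('n, 'v, 'm) hspace_scheme \<Rightarrow>
     ('c \<Rightarrow> 'a) \<Rightarrow> ('w \<Rightarrow> 'v) \<Rightarrow> ('c, 'w) tens \<Rightarrow> ('a, 'v) tens"
  where "av_map A V \<phi> \<psi> = coset_map (av_free A V) (av_null A V) (map_prod \<phi> \<psi>)"

definition av_tensor ::
    "('n::finite, 'a, 'k) halg_scheme \<Rightarrow> ('n, 'v, 'm) hspace_scheme \<Rightarrow>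
     ('n, ('a, 'v) tens) hspace"
  where "av_tensor A V = \<lparr>
    carrier = carrier (av_free A V Mod av_null A V),
    monoid.mult = coset_map2 (av_free A V) (av_null A V) (mult_pair A V),
    one = av_tens A V \<one>\<^bsub>A\<^esub> \<one>\<^bsub>V\<^esub>,
    zero = \<one>\<^bsub>av_free A V Mod av_null A V\<^esub>,
    add = (\<otimes>\<^bsub>av_free A V Mod av_null A V\<^esub>),
    smult = (\<lambda>f. av_map A V (\<lambda>a. lmom A f \<otimes>\<^bsub>A\<^esub> a) id),
    deg = (\<lambda>\<alpha>. (\<lambda>x. av_null A V #>\<^bsub>av_free A V\<^esub> x) `
      carrier (free_Abelian_group (\<Union>\<beta>. bideg A \<alpha> \<beta> \<times> deg V \<beta>)))\<rparr>"


section \<open>Bialgebroids, corepresentations and comodule algebras\<close>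

text \<open>The canonical associators, along which iterated tensor products are identified. Each is
  determined by its values on iterated pure tensors, as these generate the domain.\<close>

definition aaa_assoc ::
    "('n::finite, 'a, 'm) halg_scheme \<Rightarrow>
     ((('a, 'a) tens, 'a) tens \<Rightarrow> ('a, ('a, 'a) tens) tens) \<Rightarrow> bool"
  where "aaa_assoc A \<Phi> \<longleftrightarrow>
    \<Phi> \<in> hom (add_monoid (aa_tensor (aa_tensor A A) A)) (add_monoid (aa_tensor A (aa_tensor A A))) \<and>
    (\<forall>\<alpha> \<beta> \<gamma> \<delta>. \<forall>a\<in>bideg A \<alpha> \<beta>. \<forall>b\<in>bideg A \<beta> \<gamma>. \<forall>c\<in>bideg A \<gamma> \<delta>.
       \<Phi> (aa_tens (aa_tensor A A) A (aa_tens A A a b) c) =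
       aa_tens A (aa_tensor A A) a (aa_tens A A b c))"

definition aav_assoc ::
    "('n::finite, 'a, 'm) halg_scheme \<Rightarrow> ('n, 'v, 'k) hspace_scheme \<Rightarrow>
     ((('a, 'a) tens, 'v) tens \<Rightarrow> ('a, ('a, 'v) tens) tens) \<Rightarrow> bool"
  where "aav_assoc A V \<Phi> \<longleftrightarrow>
    \<Phi> \<in> hom (add_monoid (av_tensor (aa_tensor A A) V)) (add_monoid (av_tensor A (av_tensor A V))) \<and>
    (\<forall>\<alpha> \<beta> \<gamma>. \<forall>a\<in>bideg A \<alpha> \<beta>. \<forall>b\<in>bideg A \<beta> \<gamma>. \<forall>v\<in>deg V \<gamma>.
       \<Phi> (av_tens (aa_tensor A A) V (aa_tens A A a b) v) =
       av_tens A (av_tensor A V) a (av_tens A V b v))"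

text \<open>The canonical identification of \<open>D \<otimes> V\<close> with \<open>V\<close>, sending \<open>f T\<^sub>-\<^sub>\<alpha> \<otimes> v\<close> to \<open>f v\<close> for \<open>v\<close> of
  degree \<open>\<alpha>\<close>.\<close>

definition dv_unit ::
    "('n::finite, 'v, 'k) hspace_scheme \<Rightarrow> (('n mero \<Rightarrow> 'n mero, 'v) tens \<Rightarrow> 'v) \<Rightarrow> bool"
  where "dv_unit V \<Psi> \<longleftrightarrow>
    \<Psi> \<in> hom (add_monoid (av_tensor diff_alg V)) (add_monoid V) \<and>
    (\<forall>\<alpha> f. \<forall>v\<in>deg V \<alpha>. \<Psi> (av_tens diff_alg V (\<lambda>g. f * shift (- \<alpha>) g) v) = f \<odot>\<^bsub>V\<^esub> v)"

text \<open>The counit laws use the embeddings \<open>x \<mapsto> T\<^sub>-\<^sub>\<alpha> \<otimes> x\<close> and \<open>x \<mapsto> x \<otimes> T\<^sub>-\<^sub>\<beta>\<close> of the component of bidegree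
  \<open>(\<alpha>, \<beta>)\<close>.\<close>

locale h_bialgebroid = h_algebra A
  for A :: "('n::finite, 'a, 'm) halg_scheme" (structure)
    and \<Delta> :: "'a \<Rightarrow> ('a, 'a) tens"
    and \<epsilon> :: "'a \<Rightarrow> 'n mero \<Rightarrow> 'n mero" +
  assumes comult_hom: "h_algebra_hom A (aa_tensor A A) \<Delta>"
    and counit_hom: "h_algebra_hom A diff_alg \<epsilon>"
    and coassoc: "\<exists>\<Phi>. aaa_assoc A \<Phi> \<and>
      (\<forall>a\<in>carrier A. \<Phi> (aa_map (aa_tensor A A) A \<Delta> id (\<Delta> a)) = aa_map A (aa_tensor A A) id \<Delta> (\<Delta> a))"
    and counit_left: "a \<in> bideg A \<alpha> \<beta> \<Longrightarrow>
      aa_map diff_alg A \<epsilon> id (\<Delta> a) = aa_tens diff_alg A (shift (- \<alpha>)) a"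
    and counit_right: "a \<in> bideg A \<alpha> \<beta> \<Longrightarrow>
      aa_map A diff_alg id \<epsilon> (\<Delta> a) = aa_tens A diff_alg a (shift (- \<beta>))"

locale left_corepresentation = h_bialgebroid A \<Delta> \<epsilon> + V: h_space V
  for A :: "('n::finite, 'a, 'm) halg_scheme" and \<Delta> \<epsilon>
    and V :: "('n, 'v, 'k) hspace_scheme" +
  fixes \<rho> :: "'v \<Rightarrow> ('a, 'v) tens"
  assumes corep_add: "\<rho> \<in> hom (add_monoid V) (add_monoid (av_tensor A V))"
    and corep_smult: "v \<in> carrier V \<Longrightarrow> \<rho> (f \<odot>\<^bsub>V\<^esub> v) = f \<odot>\<^bsub>av_tensor A V\<^esub> \<rho> v"
    and corep_deg: "v \<in> deg V \<alpha> \<Longrightarrow> \<rho> v \<in> deg (av_tensor A V) \<alpha>"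
    and corep_coassoc: "\<exists>\<Phi>. aav_assoc A V \<Phi> \<and>
      (\<forall>v\<in>carrier V. \<Phi> (av_map (aa_tensor A A) V \<Delta> id (\<rho> v)) = av_map A (av_tensor A V) id \<rho> (\<rho> v))"
    and corep_counit: "\<exists>\<Psi>. dv_unit V \<Psi> \<and> (\<forall>v\<in>carrier V. \<Psi> (av_map diff_alg V \<epsilon> id (\<rho> v)) = v)"

text \<open>The algebra need not be unital; \<open>L_unital\<close> applies when \<open>e\<close> is a unit.\<close>

locale left_comodule_algebra = left_corepresentation A \<Delta> \<epsilon> V L
  for A :: "('n::finite, 'a, 'm) halg_scheme" and \<Delta> \<epsilon>
    and V :: "('n, 'v, 'k) hspace_scheme" and L +
  assumes V_mult_closed: "\<lbrakk>v \<in> carrier V; w \<in> carrier V\<rbrakk> \<Longrightarrow> v \<otimes>\<^bsub>V\<^esub> w \<in> carrier V"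
    and V_mult_assoc: "\<lbrakk>u \<in> carrier V; v \<in> carrier V; w \<in> carrier V\<rbrakk> \<Longrightarrow>
      (u \<otimes>\<^bsub>V\<^esub> v) \<otimes>\<^bsub>V\<^esub> w = u \<otimes>\<^bsub>V\<^esub> (v \<otimes>\<^bsub>V\<^esub> w)"
    and V_l_distr: "\<lbrakk>u \<in> carrier V; v \<in> carrier V; w \<in> carrier V\<rbrakk> \<Longrightarrow>
      (u \<oplus>\<^bsub>V\<^esub> v) \<otimes>\<^bsub>V\<^esub> w = u \<otimes>\<^bsub>V\<^esub> w \<oplus>\<^bsub>V\<^esub> v \<otimes>\<^bsub>V\<^esub> w"
    and V_r_distr: "\<lbrakk>u \<in> carrier V; v \<in> carrier V; w \<in> carrier V\<rbrakk> \<Longrightarrow>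
      w \<otimes>\<^bsub>V\<^esub> (u \<oplus>\<^bsub>V\<^esub> v) = w \<otimes>\<^bsub>V\<^esub> u \<oplus>\<^bsub>V\<^esub> w \<otimes>\<^bsub>V\<^esub> v"
    and V_smult_mult: "\<lbrakk>v \<in> carrier V; w \<in> carrier V\<rbrakk> \<Longrightarrow> (f \<odot>\<^bsub>V\<^esub> v) \<otimes>\<^bsub>V\<^esub> w = f \<odot>\<^bsub>V\<^esub> (v \<otimes>\<^bsub>V\<^esub> w)"
    and V_mult_smult: "\<lbrakk>v \<in> deg V \<alpha>; w \<in> carrier V\<rbrakk> \<Longrightarrow>
      f \<odot>\<^bsub>V\<^esub> (v \<otimes>\<^bsub>V\<^esub> w) = v \<otimes>\<^bsub>V\<^esub> (shift \<alpha> f \<odot>\<^bsub>V\<^esub> w)"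
    and V_deg_mult: "\<lbrakk>v \<in> deg V \<alpha>; w \<in> deg V \<beta>\<rbrakk> \<Longrightarrow> v \<otimes>\<^bsub>V\<^esub> w \<in> deg V (\<alpha> + \<beta>)"
    and L_mult: "\<lbrakk>v \<in> carrier V; w \<in> carrier V\<rbrakk> \<Longrightarrow> L (v \<otimes>\<^bsub>V\<^esub> w) = L v \<otimes>\<^bsub>av_tensor A V\<^esub> L w"
    and L_unital: "\<lbrakk>e \<in> carrier V; \<And>v. v \<in> carrier V \<Longrightarrow> e \<otimes>\<^bsub>V\<^esub> v = v \<and> v \<otimes>\<^bsub>V\<^esub> e = v\<rbrakk> \<Longrightarrow>
      L e = av_tens A V \<one>\<^bsub>A\<^esub> e"


section \<open>Algebras given by generators and relations\<close>

text \<open>Words form a monoid under concatenation. Written additively, as the convolution product of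
  \<^type>\<open>poly_mapping\<close> requires, they make \<^typ>\<open>'g list \<Rightarrow>\<^sub>0 complex\<close> the free unital associative
  algebra on \<^typ>\<open>'g\<close>.\<close>

instantiation list :: (type) monoid_add
begin

definition zero_list :: "'a list" where "zero_list = []"
definition plus_list :: "'a list \<Rightarrow> 'a list \<Rightarrow> 'a list" where "plus_list = (@)"

instance
  by standard (simp_all add: zero_list_def plus_list_def)

end

type_synonym 'g free_alg = "'g list \<Rightarrow>\<^sub>0 complex"

definition fgen :: "'g \<Rightarrow> 'g free_alg"
  where "fgen g = Poly_Mapping.single [g] 1"

definition fconst :: "complex \<Rightarrow> 'g free_alg"
  where "fconst c = Poly_Mapping.single [] c"

abbreviation fring :: "'g free_alg ring"
  where "fring \<equiv> ring_of_type_algebra"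

definition pres_ring :: "'g free_alg set \<Rightarrow> 'g free_alg set ring"
  where "pres_ring E = fring Quot (Idl\<^bsub>fring\<^esub> E)"

definition pres_cls :: "'g free_alg set \<Rightarrow> 'g free_alg \<Rightarrow> 'g free_alg set"
  where "pres_cls E p = (Idl\<^bsub>fring\<^esub> E) +>\<^bsub>fring\<^esub> p"

text \<open>Relations making \<open>\<iota>\<close> a copy of the algebra of meromorphic functions.\<close>

definition copy_rels :: "('n::finite mero \<Rightarrow> 'g) \<Rightarrow> 'g free_alg set"
  where "copy_rels \<iota> =
    {fgen (\<iota> (f + g)) - fgen (\<iota> f) - fgen (\<iota> g) | f g. True} \<union>
    {fgen (\<iota> (f * g)) - fgen (\<iota> f) * fgen (\<iota> g) | f g. True} \<union>
    {fgen (\<iota> (mero_const c)) - fconst c | c. True}"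

text \<open>The algebra map out of a presented algebra given by its values on generators; the image of a
  coset is a singleton when these values satisfy the relations.\<close>

definition free_ext :: "(complex, 'b, 'm) module_scheme \<Rightarrow> ('g \<Rightarrow> 'b) \<Rightarrow> 'g free_alg \<Rightarrow> 'b"
  where "free_ext B \<phi> p = (\<Oplus>\<^bsub>B\<^esub>w\<in>Poly_Mapping.keys p.
    Poly_Mapping.lookup p w \<odot>\<^bsub>B\<^esub> foldr (\<lambda>g b. \<phi> g \<otimes>\<^bsub>B\<^esub> b) w \<one>\<^bsub>B\<^esub>)"

definition pres_ext :: "(complex, 'b, 'm) module_scheme \<Rightarrow> ('g \<Rightarrow> 'b) \<Rightarrow> 'g free_alg set \<Rightarrow> 'b"
  where "pres_ext B \<phi> K = the_elem (free_ext B \<phi> ` K)"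


section \<open>The dynamical R-matrix and the bialgebroid of quantum matrices\<close>

text \<open>Throughout, \<open>l\<close> is the chosen logarithm of \<open>q\<close>.\<close>

definition qpow :: "complex \<Rightarrow> complex \<Rightarrow> complex"
  where "qpow l z = exp (z * l)"

definition h0_fun :: "complex \<Rightarrow> complex \<Rightarrow> complex"
  where "h0_fun l z = (qpow l (-1) - qpow l 1) / (qpow l (-2 * z) - 1)"

definition g_fun :: "complex \<Rightarrow> complex \<Rightarrow> complex"
  where "g_fun l z = (qpow l (-2 * z) - qpow l (-2)) * (qpow l (-2 * z) - qpow l 2) / (qpow l (-2 * z) - 1)^2"

definition h_fun :: "complex \<Rightarrow> complex \<Rightarrow> complex"
  where "h_fun l z = qpow l 1 - h0_fun l z"

definition mero_diff :: "(complex \<Rightarrow> complex) \<Rightarrow> 'n \<Rightarrow> 'n \<Rightarrow> 'n::finite mero"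
  where "mero_diff \<phi> i j = mero_of (\<lambda>z. \<phi> (z $ i - z $ j))"

definition wt :: "'n \<Rightarrow> complex ^ 'n::finite"
  where "wt i = axis i 1"

text \<open>\<open>rmat l a b c d\<close> is the entry with upper indices \<open>a b\<close> and lower indices \<open>c d\<close>.\<close>

definition rmat :: "complex \<Rightarrow> 'n \<Rightarrow> 'n \<Rightarrow> 'n \<Rightarrow> 'n \<Rightarrow> 'n::{finite,linorder} mero"
  where "rmat l a b c d =
    (if a = b then (if c = a \<and> d = a then mero_const (qpow l 1) else 0)
     else if c = a \<and> d = b then (if a < b then 1 else mero_diff (g_fun l) a b)
     else if c = b \<and> d = a then mero_diff (h0_fun l) a b
     else 0)"

datatype ('i, 'm) frm_gen = T 'i 'i | Lam 'm | Mu 'm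

type_synonym 'n frm_free = "('n, 'n mero) frm_gen free_alg"

abbreviation (input) ft :: "'n::finite \<Rightarrow> 'n \<Rightarrow> 'n frm_free"
  where "ft i j \<equiv> fgen (T i j)"

abbreviation (input) flam :: "'n::finite mero \<Rightarrow> 'n frm_free"
  where "flam f \<equiv> fgen (Lam f)"

abbreviation (input) fmu :: "'n::finite mero \<Rightarrow> 'n frm_free"
  where "fmu f \<equiv> fgen (Mu f)"

definition frm_rels :: "complex \<Rightarrow> 'n::{finite,linorder} frm_free set"
  where "frm_rels l =
    copy_rels Lam \<union> copy_rels Mu \<union>
    {flam f * fmu g - fmu g * flam f | f g. True} \<union>
    {flam f * ft i j - ft i j * flam (shift (wt i) f) | f i j. True} \<union>
    {fmu f * ft i j - ft i j * fmu (shift (wt j) f) | f i j. True} \<union>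
    {(\<Sum>x\<in>UNIV. \<Sum>y\<in>UNIV. flam (rmat l x y a c) * ft x b * ft y d) -
     (\<Sum>x\<in>UNIV. \<Sum>y\<in>UNIV. fmu (rmat l b d x y) * ft c y * ft a x) | a b c d. True}"

fun frm_gen_bideg :: "('n::finite, 'm) frm_gen \<Rightarrow> (complex ^ 'n) \<times> (complex ^ 'n)"
  where
    "frm_gen_bideg (T i j) = (wt i, wt j)"
  | "frm_gen_bideg (Lam f) = (0, 0)"
  | "frm_gen_bideg (Mu f) = (0, 0)"

definition frm :: "complex \<Rightarrow> ('n::{finite,linorder}, 'n frm_free set) halg"
  where "frm l = (let Q = pres_ring (frm_rels l); \<pi> = pres_cls (frm_rels l) in \<lparr>
    carrier = carrier Q,
    monoid.mult = (\<otimes>\<^bsub>Q\<^esub>),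
    one = \<one>\<^bsub>Q\<^esub>,
    zero = \<zero>\<^bsub>Q\<^esub>,
    add = (\<oplus>\<^bsub>Q\<^esub>),
    smult = (\<lambda>c x. \<pi> (fconst c) \<otimes>\<^bsub>Q\<^esub> x),
    bideg = (\<lambda>\<alpha> \<beta>. \<pi> ` {p. \<forall>w\<in>Poly_Mapping.keys p. sum_list (map frm_gen_bideg w) = (\<alpha>, \<beta>)}),
    lmom = (\<lambda>f. \<pi> (flam f)),
    rmom = (\<lambda>f. \<pi> (fmu f))\<rparr>)"

definition frm_t :: "complex \<Rightarrow> 'n \<Rightarrow> 'n \<Rightarrow> 'n::{finite,linorder} frm_free set"
  where "frm_t l i j = pres_cls (frm_rels l) (ft i j)"

definition frm_comult ::
    "complex \<Rightarrow> 'n::{finite,linorder} frm_free set \<Rightarrow> ('n frm_free set, 'n frm_free set) tens"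
  where "frm_comult l = pres_ext (aa_tensor (frm l) (frm l)) (\<lambda>g. case g of
      T i j \<Rightarrow> (\<Oplus>\<^bsub>aa_tensor (frm l) (frm l)\<^esub>k\<in>UNIV. aa_tens (frm l) (frm l) (frm_t l i k) (frm_t l k j))
    | Lam f \<Rightarrow> aa_tens (frm l) (frm l) (lmom (frm l) f) \<one>\<^bsub>frm l\<^esub>
    | Mu f \<Rightarrow> aa_tens (frm l) (frm l) \<one>\<^bsub>frm l\<^esub> (rmom (frm l) f))"

definition frm_counit :: "complex \<Rightarrow> 'n::{finite,linorder} frm_free set \<Rightarrow> 'n mero \<Rightarrow> 'n mero"
  where "frm_counit l = pres_ext diff_alg (\<lambda>g. case g of
      T i j \<Rightarrow> (if i = j then shift (- wt i) else (\<lambda>_. 0))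
    | Lam f \<Rightarrow> (*) f
    | Mu f \<Rightarrow> (*) f)"


section \<open>The algebra with generators \<open>v\<^sub>i\<close>\<close>

datatype ('i, 'm) ext_gen = Vx 'i | Vf 'm

type_synonym 'n ext_free = "('n, 'n mero) ext_gen free_alg"

definition ext_rels :: "complex \<Rightarrow> 'n::{finite,linorder} ext_free set"
  where "ext_rels l =
    copy_rels Vf \<union>
    {fgen (Vx i) * fgen (Vx i) | i. True} \<union>
    {fgen (Vx i) * fgen (Vx j) + fgen (Vf (mero_diff (h_fun l) i j)) * fgen (Vx j) * fgen (Vx i) | i j. i < j} \<union>
    {fgen (Vf f) * fgen (Vx i) - fgen (Vx i) * fgen (Vf (shift (wt i) f)) | f i. True}"

fun ext_gen_deg :: "('n::finite, 'm) ext_gen \<Rightarrow> complex ^ 'n"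
  where
    "ext_gen_deg (Vx i) = wt i"
  | "ext_gen_deg (Vf f) = 0"

definition ext :: "complex \<Rightarrow> ('n::{finite,linorder}, 'n ext_free set) hspace"
  where "ext l = (let Q = pres_ring (ext_rels l); \<pi> = pres_cls (ext_rels l) in \<lparr>
    carrier = carrier Q,
    monoid.mult = (\<otimes>\<^bsub>Q\<^esub>),
    one = \<one>\<^bsub>Q\<^esub>,
    zero = \<zero>\<^bsub>Q\<^esub>,
    add = (\<oplus>\<^bsub>Q\<^esub>),
    smult = (\<lambda>f x. \<pi> (fgen (Vf f)) \<otimes>\<^bsub>Q\<^esub> x),
    deg = (\<lambda>\<alpha>. \<pi> ` {p. \<forall>w\<in>Poly_Mapping.keys p. sum_list (map ext_gen_deg w) = \<alpha>})\<rparr>)"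

definition ext_v :: "complex \<Rightarrow> 'n \<Rightarrow> 'n::{finite,linorder} ext_free set"
  where "ext_v l i = pres_cls (ext_rels l) (fgen (Vx i))"

end

theory Submission imports Defs begin

text \<open>An algebra map out of an algebra given by generators and relations is determined by its values on
  the generators, and exists as soon as these satisfy the relations. Uniqueness of \<open>L\<close> is the first
  half. For existence, \<open>\<Sum>\<^sub>k\<^sub>m c\<^sub>k\<^sub>m \<otimes> v\<^sub>kv\<^sub>m\<close> vanishes whenever \<open>c\<^sub>m\<^sub>k = h(\<mu>\<^sub>k - \<mu>\<^sub>m) c\<^sub>k\<^sub>m\<close> for
  \<open>k < m\<close>, because the relations of \<open>V\<close> make the sum antisymmetric. The relations
  \<open>v\<^sub>i\<^sup>2 = 0\<close> and \<open>v\<^sub>iv\<^sub>j = -h(\<lambda>\<^sub>i - \<lambda>\<^sub>j) v\<^sub>jv\<^sub>i\<close> are preserved since \<open>c\<^sub>k\<^sub>m = t\<^sub>i\<^sub>kt\<^sub>i\<^sub>m\<close> and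
  \<open>c\<^sub>k\<^sub>m = t\<^sub>i\<^sub>kt\<^sub>j\<^sub>m + h(\<lambda>\<^sub>i - \<lambda>\<^sub>j) t\<^sub>j\<^sub>kt\<^sub>i\<^sub>m\<close> are of this kind: that is a combination of RLL-relations,
  using \<open>g(-z) = h(z) h(-z)\<close>. Once the associator and the counit
  identification are known to be multiplicative, coassociativity and the counit law compare algebra
  maps out of \<open>V\<close> and hold because they hold on the generators.\<close>

section \<open>Algebras given by generators and relations\<close>

text \<open>Being a comodule algebra includes that \<open>frm l\<close> is a bialgebroid, so its
  comultiplication and counit have to be shown well defined, coassociative and counital as well. The
  moment maps of \<open>frm l\<close> are given only through generators; their injectivity is read
  off from the counit, which sends both to multiplication operators. Tensor products are cosets in
  free abelian groups, so every map or product on them must respect the relations. Balancing is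
  compatible with products because the two inner degrees agree: both factors translate a function by
  the same amount. To have a single theory of A \<otimes> A, A \<otimes> V and D \<otimes> V, the
  graded algebra V is read as a bigraded one. Directness of the gradings, which holds because the
  relations generate homogeneous ideals, is what makes the associator definable. The hypothesis on q
  enters through \<open>qpow l (-2) \<noteq> 1\<close>: it makes q^(-2(\<lambda>_i - \<lambda>_j)) -
  1 a nonzero meromorphic function for i \<noteq> j, so the identity between g and h can be computed
  in a field.\<close>

lemma ring_of_type_algebra_simps [simp]:
  "carrier (ring_of_type_algebra :: 'a::ring_1 ring) = UNIV"
  "\<one>\<^bsub>ring_of_type_algebra :: 'a ring\<^esub> = 1"
  "\<zero>\<^bsub>ring_of_type_algebra :: 'a ring\<^esub> = 0"
  "x \<otimes>\<^bsub>ring_of_type_algebra :: 'a ring\<^esub> y = x * y"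
  "x \<oplus>\<^bsub>ring_of_type_algebra :: 'a ring\<^esub> y = x + y"
  by (simp_all add: ring_of_type_algebra_def)

lemma ring_ring_of_type_algebra: "ring (ring_of_type_algebra :: 'a::ring_1 ring)"
proof (rule ringI)
  show "abelian_group (ring_of_type_algebra :: 'a ring)"
    by (rule abelian_groupI) (auto simp: add.assoc add.commute intro: exI[of _ "- _"] ab_left_minus)
  show "Group.monoid (ring_of_type_algebra :: 'a ring)"
    by (rule Group.monoidI) (auto simp: mult.assoc)
qed (simp_all add: distrib_left distrib_right)

lemma ring_of_type_algebra_minus:
  "\<ominus>\<^bsub>ring_of_type_algebra :: 'a::ring_1 ring\<^esub> x = - x"
proof -
  interpret ring "ring_of_type_algebra :: 'a ring" by (rule ring_ring_of_type_algebra)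
  show ?thesis using minus_equality[of "- x" x] by simp
qed

text \<open>The record of a bigraded algebra adds fields to the quotient ring; being a ring depends
  only on the fields compared here, so it transfers.\<close>

lemma ring_fieldcong:
  assumes "ring R" "carrier S = carrier R" "monoid.mult S = monoid.mult R" "one S = one R"
    "zero S = zero R" "add S = add R"
  shows "ring S"
proof -
  interpret R: ring R by fact
  show ?thesis
  proof (rule ringI)
    show "abelian_group S"
      by (rule abelian_groupI)
        (use assms R.add.m_assoc R.add.m_comm R.add.l_inv_ex in auto)
    show "Group.monoid S"
      by (rule Group.monoidI) (use assms R.m_assoc in auto)
  qed (use assms R.l_distr R.r_distr in auto)
qed

text \<open>The additive step imposes no disjointness of supports, so additive statements follow
  directly from their values on single words.\<close>

lemma free_alg_induct [case_names zero single add]: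
  fixes p :: "'w \<Rightarrow>\<^sub>0 'c::comm_monoid_add"
  assumes "P 0" "\<And>w c. P (Poly_Mapping.single w c)" "\<And>p q. P p \<Longrightarrow> P q \<Longrightarrow> P (p + q)"
  shows "P p"
proof -
  have "P (\<Sum>w\<in>S. Poly_Mapping.single w (Poly_Mapping.lookup p w))" if "finite S" for S
    using that by (induction S rule: finite_induct) (simp_all add: assms)
  moreover have "p = (\<Sum>w\<in>Poly_Mapping.keys p. Poly_Mapping.single w (Poly_Mapping.lookup p w))"
    by (rule poly_mapping_eqI)
      (simp add: lookup_sum lookup_single when_def sum.delta in_keys_iff)
  ultimately show ?thesis by (metis finite_keys)
qed

lemma single_mult_list:
  "Poly_Mapping.single v (a :: complex) * Poly_Mapping.single w b = Poly_Mapping.single (v @ w) (a * b)"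
  by (simp add: mult_single plus_list_def)

lemma one_free_alg: "(1 :: 'g free_alg) = Poly_Mapping.single [] 1"
  by (metis single_one zero_list_def)

lemma fgen_mult_single: "fgen g * Poly_Mapping.single w c = Poly_Mapping.single (g # w) c"
  by (simp add: fgen_def single_mult_list)

lemma fconst_commute: "fconst c * p = p * fconst c"
proof (induction p rule: free_alg_induct)
  case (single w d)
  then show ?case by (simp add: fconst_def single_mult_list mult.commute)
qed (simp_all add: algebra_simps)

lemma fconst_add: "fconst (a + b) = fconst a + fconst b"
  by (simp add: fconst_def single_add)

lemma fconst_mult: "fconst (a * b) = fconst a * fconst b"
  by (simp add: fconst_def single_mult_list)

lemma fconst_one: "fconst 1 = 1"
  by (simp add: fconst_def one_free_alg)


subsection \<open>The quotient\<close>

lemma ideal_rels: "ideal (Idl\<^bsub>fring\<^esub> E) (fring :: 'g free_alg ring)"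
  by (rule ring.genideal_ideal[OF ring_ring_of_type_algebra]) simp

lemma rels_subset: "e \<in> E \<Longrightarrow> e \<in> Idl\<^bsub>fring\<^esub> (E :: 'g free_alg set)"
  using ring.genideal_self[OF ring_ring_of_type_algebra, of E] by auto

lemma rels_ideal_add: "p \<in> Idl\<^bsub>fring\<^esub> E \<Longrightarrow> q \<in> Idl\<^bsub>fring\<^esub> E \<Longrightarrow> p + q \<in> Idl\<^bsub>fring\<^esub> (E :: 'g free_alg set)"
  using additive_subgroup.a_closed[OF ideal.axioms(1)[OF ideal_rels[of E]], of p q] by simp

lemma rels_ideal_zero: "0 \<in> Idl\<^bsub>fring\<^esub> (E :: 'g free_alg set)"
  using additive_subgroup.zero_closed[OF ideal.axioms(1)[OF ideal_rels[of E]]] by simp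

lemma rels_ideal_lmult: "p \<in> Idl\<^bsub>fring\<^esub> E \<Longrightarrow> x * p \<in> Idl\<^bsub>fring\<^esub> (E :: 'g free_alg set)"
  using ideal.I_l_closed[OF ideal_rels[of E], of p x] by simp

lemma rels_ideal_rmult: "p \<in> Idl\<^bsub>fring\<^esub> E \<Longrightarrow> p * x \<in> Idl\<^bsub>fring\<^esub> (E :: 'g free_alg set)"
  using ideal.I_r_closed[OF ideal_rels[of E], of p x] by simp

lemma rels_ideal_uminus: "p \<in> Idl\<^bsub>fring\<^esub> E \<Longrightarrow> - p \<in> Idl\<^bsub>fring\<^esub> (E :: 'g free_alg set)"
  using rels_ideal_lmult[of p E "-1"] by simp

text \<open>Closure under negation is left multiplication by -1, which is why it is absent from the
  conditions.\<close>

lemma ideal_fringI: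
  fixes J :: "'g free_alg set"
  assumes "0 \<in> J" "\<And>p q. p \<in> J \<Longrightarrow> q \<in> J \<Longrightarrow> p + q \<in> J"
    "\<And>p x. p \<in> J \<Longrightarrow> x * p \<in> J" "\<And>p x. p \<in> J \<Longrightarrow> p * x \<in> J"
  shows "ideal J fring"
proof (rule idealI[OF ring_ring_of_type_algebra])
  interpret ring "fring :: 'g free_alg ring" by (rule ring_ring_of_type_algebra)
  have neg: "- p \<in> J" if "p \<in> J" for p using assms(3)[OF that, of "-1"] by simp
  show "subgroup J (add_monoid (fring :: 'g free_alg ring))"
  proof (rule subgroup.intro)
    fix x assume "x \<in> J"
    then show "inv\<^bsub>add_monoid fring\<^esub> x \<in> J"
      using neg ring_of_type_algebra_minus[of x] by (simp add: a_inv_def)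
  qed (use assms in auto)
qed (use assms in auto)

lemma rels_ideal_minimal:
  fixes J :: "'g free_alg set"
  assumes "ideal J fring" "E \<subseteq> J"
  shows "Idl\<^bsub>fring\<^esub> E \<subseteq> J"
  by (rule ring.genideal_minimal[OF ring_ring_of_type_algebra assms])

lemma ring_pres_ring: "ring (pres_ring E)"
  unfolding pres_ring_def by (rule ideal.quotient_is_ring[OF ideal_rels])

lemma pres_cls_hom: "pres_cls E \<in> ring_hom fring (pres_ring E)"
  using ideal.rcos_ring_hom[OF ideal_rels[of E]] unfolding pres_ring_def pres_cls_def[abs_def] .

lemma pres_cls_closed [simp]: "pres_cls E p \<in> carrier (pres_ring E)"
  using ring_hom_closed[OF pres_cls_hom, of p] by simp

lemma pres_cls_add: "pres_cls E (p + q) = pres_cls E p \<oplus>\<^bsub>pres_ring E\<^esub> pres_cls E q"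
  using ring_hom_add[OF pres_cls_hom, of p q E] by simp

lemma pres_cls_mult: "pres_cls E (p * q) = pres_cls E p \<otimes>\<^bsub>pres_ring E\<^esub> pres_cls E q"
  using ring_hom_mult[OF pres_cls_hom, of p q E] by simp

lemma pres_cls_one: "pres_cls E 1 = \<one>\<^bsub>pres_ring E\<^esub>"
  using ring_hom_one[OF pres_cls_hom, of E] by simp

lemma pres_cls_zero: "pres_cls E 0 = \<zero>\<^bsub>pres_ring E\<^esub>"
  using ring_hom_zero[OF pres_cls_hom ring_ring_of_type_algebra ring_pres_ring, of E] by simp

lemma pres_ring_carrier: "carrier (pres_ring E) = range (pres_cls E)"
  by (auto simp: pres_ring_def pres_cls_def FactRing_def A_RCOSETS_def RCOSETS_def a_r_coset_def)

lemma pres_cls_iff: "pres_cls E p = pres_cls E q \<longleftrightarrow> p - q \<in> Idl\<^bsub>fring\<^esub> E"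
proof -
  interpret ideal "Idl\<^bsub>fring\<^esub> E" fring by (rule ideal_rels)
  have "pres_cls E p = pres_cls E q \<longleftrightarrow> p \<ominus>\<^bsub>fring\<^esub> q \<in> Idl\<^bsub>fring\<^esub> E"
    unfolding pres_cls_def using quotient_eq_iff_same_a_r_cos[OF ideal_axioms, of p q] by simp
  then show ?thesis by (simp add: a_minus_def ring_of_type_algebra_minus)
qed

lemma pres_cls_uminus: "pres_cls E (- p) = \<ominus>\<^bsub>pres_ring E\<^esub> pres_cls E p"
proof -
  interpret ring "pres_ring E" by (rule ring_pres_ring)
  have "pres_cls E (- p) \<oplus>\<^bsub>pres_ring E\<^esub> pres_cls E p = \<zero>\<^bsub>pres_ring E\<^esub>"
    by (simp flip: pres_cls_add add: pres_cls_zero)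
  then show ?thesis by (simp add: minus_equality)
qed

lemma pres_cls_rel: "p - q \<in> E \<Longrightarrow> pres_cls E p = pres_cls E q"
  using rels_subset pres_cls_iff by blast

lemma pres_cls_mem: "x \<in> pres_cls E p \<longleftrightarrow> x - p \<in> Idl\<^bsub>fring\<^esub> E"
  by (auto simp: pres_cls_def a_r_coset_def r_coset_def intro: bexI[of _ "x - p"])

lemma pres_cls_memberI: "p \<in> pres_cls E p"
  by (simp add: pres_cls_mem rels_ideal_zero)


subsection \<open>Maps out of a presented algebra\<close>

text \<open>The least structure in which noncommutative polynomials over the complex numbers can be
  evaluated: there is no grading and there are no moment maps.\<close>

locale cx_algebra = module Cring B + ring B
  for B :: "(complex, 'b, 'm) module_scheme" (structure) +
  assumes smult_mult_left: "\<lbrakk>a \<in> carrier B; b \<in> carrier B\<rbrakk> \<Longrightarrow> (c \<odot> a) \<otimes> b = c \<odot> (a \<otimes> b)"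
    and smult_mult_right: "\<lbrakk>a \<in> carrier B; b \<in> carrier B\<rbrakk> \<Longrightarrow> a \<otimes> (c \<odot> b) = c \<odot> (a \<otimes> b)"
begin

abbreviation "word_prod \<phi> w \<equiv> foldr (\<lambda>g b. \<phi> g \<otimes> b) w \<one>"

lemma smult_cx_0 [simp]: "x \<in> carrier B \<Longrightarrow> 0 \<odot> x = \<zero>"
  using smult_l_null[of x] by simp

context
  fixes \<phi> :: "'g \<Rightarrow> 'b"
  assumes phi [simp]: "\<And>g. \<phi> g \<in> carrier B"
begin

lemma word_prod_closed [simp]: "word_prod \<phi> w \<in> carrier B"
  by (induction w) auto

lemma word_prod_append: "word_prod \<phi> (v @ w) = word_prod \<phi> v \<otimes> word_prod \<phi> w"
proof -
  have "foldr (\<lambda>g b. \<phi> g \<otimes> b) v x = word_prod \<phi> v \<otimes> x" if "x \<in> carrier B" for x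
    using that by (induction v) (auto simp: m_assoc)
  from this[of "word_prod \<phi> w"] show ?thesis by simp
qed

text \<open>Allows p, q and p + q to be summed over one common finite set of words; words outside
  the support contribute zero.\<close>

lemma free_ext_superset:
  assumes "finite S" "Poly_Mapping.keys p \<subseteq> S"
  shows "free_ext B \<phi> p = (\<Oplus>w\<in>S. Poly_Mapping.lookup p w \<odot> word_prod \<phi> w)"
  unfolding free_ext_def using assms
  by (intro add.finprod_mono_neutral_cong_left) (auto simp: in_keys_iff)

lemma free_ext_closed [simp]: "free_ext B \<phi> p \<in> carrier B"
  unfolding free_ext_def by (rule finsum_closed) auto

lemma free_ext_add: "free_ext B \<phi> (p + q) = free_ext B \<phi> p \<oplus> free_ext B \<phi> q"
proof -
  let ?S = "Poly_Mapping.keys p \<union> Poly_Mapping.keys q"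
  have "free_ext B \<phi> (p + q) = (\<Oplus>w\<in>?S. Poly_Mapping.lookup (p + q) w \<odot> word_prod \<phi> w)"
    by (intro free_ext_superset) (use keys_add[of p q] in auto)
  also have "\<dots> = (\<Oplus>w\<in>?S. (Poly_Mapping.lookup p w \<odot> word_prod \<phi> w) \<oplus> (Poly_Mapping.lookup q w \<odot> word_prod \<phi> w))"
    by (intro finsum_cong') (auto simp: lookup_add smult_l_distr[simplified])
  also have "\<dots> = free_ext B \<phi> p \<oplus> free_ext B \<phi> q"
    by (subst finsum_addf) (auto simp: free_ext_superset[of ?S])
  finally show ?thesis .
qed

lemma free_ext_single: "free_ext B \<phi> (Poly_Mapping.single w c) = c \<odot> word_prod \<phi> w"
  by (subst free_ext_superset[of "{w}"]) auto

lemma free_ext_zero [simp]: "free_ext B \<phi> 0 = \<zero>"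
  by (simp add: free_ext_def)

lemma free_ext_mult: "free_ext B \<phi> (p * q) = free_ext B \<phi> p \<otimes> free_ext B \<phi> q"
proof (induction p rule: free_alg_induct)
  case (single w c)
  show ?case
  proof (induction q rule: free_alg_induct)
    case (single v d)
    show ?case
      by (simp add: single_mult_list free_ext_single smult_mult_left smult_mult_right word_prod_append
          smult_assoc1[symmetric, simplified] mult.commute del: foldr_append)
  qed (simp_all add: distrib_left free_ext_add r_distr)
qed (simp_all add: distrib_right free_ext_add l_distr)

lemma free_ext_gen [simp]: "free_ext B \<phi> (fgen g) = \<phi> g"
  by (simp add: fgen_def free_ext_single smult_one[simplified])

lemma free_ext_const: "free_ext B \<phi> (fconst c) = c \<odot> \<one>"
  by (simp add: fconst_def free_ext_single)

lemma free_ext_one: "free_ext B \<phi> 1 = \<one>"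
  by (simp add: one_free_alg free_ext_single smult_one[simplified])

lemma free_ext_uminus: "free_ext B \<phi> (- p) = \<ominus> free_ext B \<phi> p"
proof -
  have "free_ext B \<phi> (- p) \<oplus> free_ext B \<phi> p = \<zero>"
    by (simp flip: free_ext_add)
  then show ?thesis by (simp add: minus_equality)
qed

lemma free_ext_minus: "free_ext B \<phi> (p - q) = free_ext B \<phi> p \<ominus> free_ext B \<phi> q"
  by (simp add: a_minus_def free_ext_add free_ext_uminus flip: add_uminus_conv_diff)

lemma free_ext_minus_zero: "free_ext B \<phi> p = free_ext B \<phi> q \<Longrightarrow> free_ext B \<phi> (p - q) = \<zero>"
  by (simp add: free_ext_minus r_neg a_minus_def)

lemma free_ext_sum: "finite I \<Longrightarrow> free_ext B \<phi> (\<Sum>i\<in>I. p i) = (\<Oplus>i\<in>I. free_ext B \<phi> (p i))"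
  by (induction I rule: finite_induct) (auto simp: free_ext_add)

text \<open>The kernel of an evaluation is a two-sided ideal, so together with the relations it
  contains the ideal they generate.\<close>

lemma free_ext_rels:
  assumes "\<And>e. e \<in> E \<Longrightarrow> free_ext B \<phi> e = \<zero>" "p \<in> Idl\<^bsub>fring\<^esub> E"
  shows "free_ext B \<phi> p = \<zero>"
proof -
  have "ideal {p. free_ext B \<phi> p = \<zero>} fring"
    by (rule ideal_fringI) (auto simp: free_ext_add free_ext_mult)
  then have "Idl\<^bsub>fring\<^esub> E \<subseteq> {p. free_ext B \<phi> p = \<zero>}"
    by (rule rels_ideal_minimal) (use assms(1) in auto)
  with assms(2) show ?thesis by auto
qed

text \<open>Two representatives differ by an element of the ideal, which evaluation kills. So the
  image of a coset is a singleton and \<open>the_elem\<close> returns the value at any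
  representative.\<close>

lemma pres_ext_cls:
  assumes "\<And>e. e \<in> E \<Longrightarrow> free_ext B \<phi> e = \<zero>"
  shows "pres_ext B \<phi> (pres_cls E p) = free_ext B \<phi> p"
proof -
  have "free_ext B \<phi> x = free_ext B \<phi> p" if "x \<in> pres_cls E p" for x
  proof -
    have "free_ext B \<phi> (x - p) = \<zero>"
      by (rule free_ext_rels[OF assms]) (use that pres_cls_mem in auto)
    then show ?thesis using free_ext_add[of "x - p" p] by simp
  qed
  then have "free_ext B \<phi> ` pres_cls E p = {free_ext B \<phi> p}"
    using pres_cls_memberI by blast
  then show ?thesis by (simp add: pres_ext_def)
qed

end

end


subsection \<open>Homogeneous relations\<close>

abbreviation word_deg :: "('g \<Rightarrow> 'd::monoid_add) \<Rightarrow> 'g list \<Rightarrow> 'd"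
  where "word_deg d w \<equiv> sum_list (map d w)"

abbreviation homog :: "('g \<Rightarrow> 'd::monoid_add) \<Rightarrow> 'd \<Rightarrow> 'g free_alg set"
  where "homog d \<delta> \<equiv> {p. \<forall>w\<in>Poly_Mapping.keys p. word_deg d w = \<delta>}"

text \<open>The projection of the free algebra onto the span of the words of degree \<delta>.
  Homogeneity of an ideal is expressed as stability under these projections.\<close>

lift_definition hcomp :: "('g \<Rightarrow> 'd::monoid_add) \<Rightarrow> 'd \<Rightarrow> 'g free_alg \<Rightarrow> 'g free_alg"
  is "\<lambda>d \<delta> f w. f w when word_deg d w = \<delta>"
  by (auto intro: finite_subset[rotated])

lemma hcomp_add: "hcomp d \<delta> (p + q) = hcomp d \<delta> p + hcomp d \<delta> q"
  by transfer (auto simp: when_def)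

lemma hcomp_zero [simp]: "hcomp d \<delta> 0 = 0"
  by transfer auto

lemma hcomp_uminus: "hcomp d \<delta> (- p) = - hcomp d \<delta> p"
  by transfer (auto simp: when_def)

lemma hcomp_minus: "hcomp d \<delta> (p - q) = hcomp d \<delta> p - hcomp d \<delta> q"
  by (simp add: hcomp_add hcomp_uminus flip: add_uminus_conv_diff)

lemma hcomp_sum: "hcomp d \<delta> (\<Sum>i\<in>I. p i) = (\<Sum>i\<in>I. hcomp d \<delta> (p i))"
  by (induction I rule: infinite_finite_induct) (auto simp: hcomp_add)

lemma hcomp_single:
  "hcomp d \<delta> (Poly_Mapping.single w c) = (if word_deg d w = \<delta> then Poly_Mapping.single w c else 0)"
  by (rule poly_mapping_eqI) (auto simp: hcomp.rep_eq lookup_single when_def)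

lemma hcomp_mem: "hcomp d \<delta> p \<in> homog d \<delta>"
  by (auto simp: in_keys_iff hcomp.rep_eq when_def split: if_splits)

lemma hcomp_homog: "p \<in> homog d \<gamma> \<Longrightarrow> hcomp d \<delta> p = (if \<gamma> = \<delta> then p else 0)"
  by (intro poly_mapping_eqI) (auto simp: hcomp.rep_eq when_def in_keys_iff)

lemma hcomp_total:
  assumes "finite F" "word_deg d ` Poly_Mapping.keys p \<subseteq> F"
  shows "(\<Sum>\<delta>\<in>F. hcomp d \<delta> p) = p"
proof (rule poly_mapping_eqI)
  fix w
  show "Poly_Mapping.lookup (\<Sum>\<delta>\<in>F. hcomp d \<delta> p) w = Poly_Mapping.lookup p w"
    using assms by (auto simp: lookup_sum hcomp.rep_eq when_def in_keys_iff image_subset_iff)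
qed

lemma hcomp_outside: "\<delta> \<notin> word_deg d ` Poly_Mapping.keys p \<Longrightarrow> hcomp d \<delta> p = 0"
  by (rule poly_mapping_eqI) (auto simp: hcomp.rep_eq when_def in_keys_iff image_iff)

text \<open>Multiplying by a word translates all degrees by the degree of that word; undoing the
  translation is why degrees are taken in a group.\<close>

lemma hcomp_single_mult:
  fixes d :: "'g \<Rightarrow> 'd::ab_group_add"
  shows "hcomp d \<delta> (Poly_Mapping.single w c * p) = Poly_Mapping.single w c * hcomp d (\<delta> - word_deg d w) p"
    and "hcomp d \<delta> (p * Poly_Mapping.single w c) = hcomp d (\<delta> - word_deg d w) p * Poly_Mapping.single w c"
  by (induction p rule: free_alg_induct)
    (auto simp: single_mult_list hcomp_single hcomp_add algebra_simps)

lemma homog_zero: "0 \<in> homog d \<delta>"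
  by simp

lemma homog_add: "p \<in> homog d \<delta> \<Longrightarrow> q \<in> homog d \<delta> \<Longrightarrow> p + q \<in> homog d \<delta>"
  using keys_add[of p q] by blast

lemma homog_uminus: "p \<in> homog d \<delta> \<Longrightarrow> - p \<in> homog d \<delta>"
  by (simp add: in_keys_iff)

lemma homog_mult:
  assumes "p \<in> homog d \<gamma>" "q \<in> homog d \<delta>"
  shows "p * q \<in> homog d (\<gamma> + \<delta>)"
  using keys_mult[of p q] assms by (fastforce simp: plus_list_def)

lemma homog_gen: "fgen g \<in> homog d (d g)"
  by (simp add: fgen_def)

lemma homog_const: "fconst c \<in> homog d 0"
  by (simp add: fconst_def)

lemma homog_one: "1 \<in> homog d 0"
  by (simp add: one_free_alg)

text \<open>The induction is run on the component \<open>hcomp d \<delta> p\<close> of an arbitrary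
  p, so that both summands in the additive step stay homogeneous; on a homogeneous p the projection
  is the identity.\<close>

lemma homog_induct [consumes 1, case_names zero single add]:
  assumes "p \<in> homog d \<delta>" "P 0"
    "\<And>w c. word_deg d w = \<delta> \<Longrightarrow> P (Poly_Mapping.single w c)"
    "\<And>p q. p \<in> homog d \<delta> \<Longrightarrow> q \<in> homog d \<delta> \<Longrightarrow> P p \<Longrightarrow> P q \<Longrightarrow> P (p + q)"
  shows "P p"
proof -
  have "P (hcomp d \<delta> p)"
  proof (induction p rule: free_alg_induct)
    case (add p q)
    then show ?case unfolding hcomp_add by (intro assms(4) hcomp_mem)
  next
    case zero
    show ?case using assms(2) by simp
  next
    case (single w c)
    show ?case using assms(2) assms(3)[of w c] by (simp add: hcomp_single)
  qed
  then show ?thesis using hcomp_homog[OF assms(1)] by simp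
qed

text \<open>Relations may fail to be literally homogeneous: in \<open>frm_rels\<close>, the generators \<open>Lam 0\<close> and
  \<open>Mu 0\<close>, which are nonzero in the free algebra, multiply words of other degrees.\<close>

definition homog_rels :: "('g \<Rightarrow> 'd::monoid_add) \<Rightarrow> 'g free_alg set \<Rightarrow> bool"
  where "homog_rels d E \<longleftrightarrow> (\<forall>e\<in>E. \<forall>\<delta>. hcomp d \<delta> e \<in> Idl\<^bsub>fring\<^esub> E)"

text \<open>The elements all of whose components lie in the ideal themselves form a two-sided ideal,
  as multiplication by a word only relabels components.\<close>

lemma homog_rels_ideal:
  fixes d :: "'g \<Rightarrow> 'd::ab_group_add"
  assumes "homog_rels d E" "p \<in> Idl\<^bsub>fring\<^esub> E"
  shows "hcomp d \<delta> p \<in> Idl\<^bsub>fring\<^esub> E"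
proof -
  let ?J = "{p. \<forall>\<delta>. hcomp d \<delta> p \<in> Idl\<^bsub>fring\<^esub> E}"
  have "ideal ?J fring"
  proof (rule ideal_fringI)
    fix p x assume p: "p \<in> ?J"
    show "x * p \<in> ?J"
    proof (induction x rule: free_alg_induct)
      case (single w c)
      show ?case using p rels_ideal_lmult by (auto simp: hcomp_single_mult)
    qed (auto simp: rels_ideal_zero distrib_right hcomp_add rels_ideal_add)
    show "p * x \<in> ?J"
    proof (induction x rule: free_alg_induct)
      case (single w c)
      show ?case using p rels_ideal_rmult by (auto simp: hcomp_single_mult)
    qed (auto simp: rels_ideal_zero distrib_left hcomp_add rels_ideal_add)
  qed (auto simp: rels_ideal_zero hcomp_add rels_ideal_add)
  then have "Idl\<^bsub>fring\<^esub> E \<subseteq> ?J"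
    by (rule rels_ideal_minimal) (use assms(1) in \<open>auto simp: homog_rels_def\<close>)
  with assms(2) show ?thesis by auto
qed

lemma pres_cls_finsum:
  "finite F \<Longrightarrow> pres_cls E (\<Sum>i\<in>F. p i) = (\<Oplus>\<^bsub>pres_ring E\<^esub>i\<in>F. pres_cls E (p i))"
proof (induction F rule: finite_induct)
  case empty
  then show ?case by (simp add: pres_cls_zero abelian_monoid.finsum_empty[OF abelian_group.axioms(1)[OF ring.is_abelian_group[OF ring_pres_ring]]])
next
  case (insert x F)
  interpret ring "pres_ring E" by (rule ring_pres_ring)
  show ?case using insert by (simp add: pres_cls_add)
qed

text \<open>The components of a representative give a decomposition. For uniqueness, a second
  decomposition is lifted to homogeneous representatives; their sum differs from the first
  representative by an element of the ideal, and so does each component.\<close>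

lemma direct_sum_pres_ring:
  fixes d :: "'g \<Rightarrow> 'd::ab_group_add"
  assumes E: "homog_rels d E"
  shows "direct_sum (pres_ring E) (\<lambda>\<delta>. pres_cls E ` homog d \<delta>)"
proof -
  interpret ring "pres_ring E" by (rule ring_pres_ring)
  let ?Q = "pres_ring E" and ?\<pi> = "pres_cls E"
  have "additive_subgroup (?\<pi> ` homog d \<delta>) ?Q" for \<delta>
  proof (rule additive_subgroupI, rule subgroup.intro)
    show "?\<pi> ` homog d \<delta> \<subseteq> carrier (add_monoid ?Q)" by auto
    show "\<one>\<^bsub>add_monoid ?Q\<^esub> \<in> ?\<pi> ` homog d \<delta>"
      using imageI[OF homog_zero, of ?\<pi>] by (simp add: pres_cls_zero del: mem_Collect_eq)
    fix x assume "x \<in> ?\<pi> ` homog d \<delta>"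
    then obtain p where p: "p \<in> homog d \<delta>" "x = ?\<pi> p" by blast
    have "inv\<^bsub>add_monoid ?Q\<^esub> x = ?\<pi> (- p)" by (simp add: pres_cls_uminus p(2) a_inv_def)
    then show "inv\<^bsub>add_monoid ?Q\<^esub> x \<in> ?\<pi> ` homog d \<delta>" using homog_uminus[OF p(1)] by blast
    fix y assume "y \<in> ?\<pi> ` homog d \<delta>"
    then obtain q where q: "q \<in> homog d \<delta>" "y = ?\<pi> q" by blast
    have "x \<otimes>\<^bsub>add_monoid ?Q\<^esub> y = ?\<pi> (p + q)" by (simp add: pres_cls_add p(2) q(2))
    then show "x \<otimes>\<^bsub>add_monoid ?Q\<^esub> y \<in> ?\<pi> ` homog d \<delta>" using homog_add[OF p(1) q(1)] by blast
  qed
  moreover have "\<exists>!x. (\<forall>\<delta>. x \<delta> \<in> ?\<pi> ` homog d \<delta>) \<and> finite {\<delta>. x \<delta> \<noteq> \<zero>\<^bsub>?Q\<^esub>} \<and>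
      a = (\<Oplus>\<^bsub>?Q\<^esub>\<delta>\<in>{\<delta>. x \<delta> \<noteq> \<zero>\<^bsub>?Q\<^esub>}. x \<delta>)" if a: "a \<in> carrier ?Q" for a
  proof -
    obtain p where p: "a = ?\<pi> p" using a unfolding pres_ring_carrier by blast
    define x where "x \<delta> = ?\<pi> (hcomp d \<delta> p)" for \<delta>
    let ?F = "word_deg d ` Poly_Mapping.keys p"
    have sub: "{\<delta>. x \<delta> \<noteq> \<zero>\<^bsub>?Q\<^esub>} \<subseteq> ?F"
    proof
      fix \<delta> assume "\<delta> \<in> {\<delta>. x \<delta> \<noteq> \<zero>\<^bsub>?Q\<^esub>}"
      then show "\<delta> \<in> ?F" using hcomp_outside[of \<delta> d p] by (auto simp: x_def pres_cls_zero)
    qed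
    show ?thesis
    proof (rule ex1I[of _ x])
      have "a = (\<Oplus>\<^bsub>?Q\<^esub>\<delta>\<in>?F. x \<delta>)"
        unfolding p x_def by (simp flip: pres_cls_finsum add: hcomp_total)
      also have "\<dots> = (\<Oplus>\<^bsub>?Q\<^esub>\<delta>\<in>{\<delta>. x \<delta> \<noteq> \<zero>\<^bsub>?Q\<^esub>}. x \<delta>)"
        using sub
        by (intro add.finprod_mono_neutral_cong_right) (auto simp: x_def)
      finally have a_eq: "a = (\<Oplus>\<^bsub>?Q\<^esub>\<delta>\<in>{\<delta>. x \<delta> \<noteq> \<zero>\<^bsub>?Q\<^esub>}. x \<delta>)" .
      have "finite {\<delta>. x \<delta> \<noteq> \<zero>\<^bsub>?Q\<^esub>}"
        by (rule finite_subset[OF sub]) simp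
      moreover have "x \<delta> \<in> ?\<pi> ` homog d \<delta>" for \<delta>
        unfolding x_def by (rule imageI, rule hcomp_mem)
      ultimately show "(\<forall>\<delta>. x \<delta> \<in> ?\<pi> ` homog d \<delta>) \<and> finite {\<delta>. x \<delta> \<noteq> \<zero>\<^bsub>?Q\<^esub>} \<and>
          a = (\<Oplus>\<^bsub>?Q\<^esub>\<delta>\<in>{\<delta>. x \<delta> \<noteq> \<zero>\<^bsub>?Q\<^esub>}. x \<delta>)"
        using a_eq by blast
    next
      fix y assume y: "(\<forall>\<delta>. y \<delta> \<in> ?\<pi> ` homog d \<delta>) \<and> finite {\<delta>. y \<delta> \<noteq> \<zero>\<^bsub>?Q\<^esub>} \<and>
          a = (\<Oplus>\<^bsub>?Q\<^esub>\<delta>\<in>{\<delta>. y \<delta> \<noteq> \<zero>\<^bsub>?Q\<^esub>}. y \<delta>)"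
      have "\<exists>q. q \<in> homog d \<delta> \<and> y \<delta> = ?\<pi> q" for \<delta>
      proof -
        have "y \<delta> \<in> ?\<pi> ` homog d \<delta>" by (rule spec[OF conjunct1[OF y]])
        then show ?thesis by (rule imageE) (rule exI, rule conjI)
      qed
      then have "\<exists>q. \<forall>\<delta>. q \<delta> \<in> homog d \<delta> \<and> y \<delta> = ?\<pi> (q \<delta>)"
        by (rule choice[OF allI])
      then obtain q where q: "\<And>\<delta>. q \<delta> \<in> homog d \<delta>" "\<And>\<delta>. y \<delta> = ?\<pi> (q \<delta>)"
        by blast
      let ?S = "{\<delta>. y \<delta> \<noteq> \<zero>\<^bsub>?Q\<^esub>}"
      have fin: "finite ?S" using y by blast
      have "a = ?\<pi> (\<Sum>\<delta>\<in>?S. q \<delta>)" using y fin by (simp add: q(2) pres_cls_finsum)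
      then have *: "p - (\<Sum>\<delta>\<in>?S. q \<delta>) \<in> Idl\<^bsub>fring\<^esub> E" using p pres_cls_iff by blast
      show "y = x"
      proof
        fix \<delta>
        have "hcomp d \<delta> (\<Sum>\<gamma>\<in>?S. q \<gamma>) = (\<Sum>\<gamma>\<in>?S. if \<gamma> = \<delta> then q \<gamma> else 0)"
          unfolding hcomp_sum by (intro sum.cong refl hcomp_homog q(1))
        also have "\<dots> = (if \<delta> \<in> ?S then q \<delta> else 0)" using fin by simp
        finally have "hcomp d \<delta> p - (if \<delta> \<in> ?S then q \<delta> else 0) \<in> Idl\<^bsub>fring\<^esub> E"
          using homog_rels_ideal[OF E *, of \<delta>] by (simp add: hcomp_minus)
        then have "x \<delta> = ?\<pi> (if \<delta> \<in> ?S then q \<delta> else 0)"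
          unfolding x_def using pres_cls_iff by blast
        then show "y \<delta> = x \<delta>" using q(2)[of \<delta>] by (auto simp: pres_cls_zero split: if_splits)
      qed
    qed
  qed
  ultimately show ?thesis unfolding direct_sum_def by blast
qed


section \<open>Tensor products\<close>

subsection \<open>Quotients of free abelian groups\<close>

text \<open>The biadditive extension of \<open>k\<close>, in the form in which it occurs inside
  \<open>coset_map2\<close>.\<close>

definition lift2 :: "('y \<Rightarrow> 'z \<Rightarrow> 'w) \<Rightarrow> ('y \<Rightarrow>\<^sub>0 int) \<Rightarrow> ('z \<Rightarrow>\<^sub>0 int) \<Rightarrow> 'w \<Rightarrow>\<^sub>0 int"
  where "lift2 k x y = frag_extend (\<lambda>p. frag_extend (\<lambda>p'. frag_of (k p p')) y) x"

lemma lift2_add_left: "lift2 k (x + x') y = lift2 k x y + lift2 k x' y"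
  unfolding lift2_def by (rule frag_extend_add)

lemma lift2_add_right: "lift2 k x (y + y') = lift2 k x y + lift2 k x y'"
  unfolding lift2_def
  by (simp add: frag_extend_def[of _ x] frag_extend_add frag_cmul_distrib2 sum.distrib)

lemma lift2_zero_right [simp]: "lift2 k x 0 = 0"
  by (simp add: frag_extend_eq_0 lift2_def)

lemma lift2_zero_left [simp]: "lift2 k 0 x = 0"
  by (simp add: lift2_def)

lemma lift2_uminus_left: "lift2 k (- x) y = - lift2 k x y"
  unfolding lift2_def by (rule frag_extend_minus)

lemma lift2_uminus_right: "lift2 k x (- y) = - lift2 k x y"
  using lift2_add_right[where k = k and x = x and y = y and y' = "- y"]
  by (simp add: eq_neg_iff_add_eq_0 add.commute)

lemma lift2_diff_left: "lift2 k (x - x') y = lift2 k x y - lift2 k x' y"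
  unfolding lift2_def by (rule frag_extend_diff)

lemma lift2_diff_right: "lift2 k x (y - y') = lift2 k x y - lift2 k x y'"
  using lift2_add_right[where k = k and x = x and y = y and y' = "- y'"] by (simp add: lift2_uminus_right)

lemma lift2_of [simp]: "lift2 k (frag_of p) (frag_of p') = frag_of (k p p')"
  by (simp add: lift2_def)

definition supported_rels :: "'x set \<Rightarrow> ('x \<Rightarrow>\<^sub>0 int) set \<Rightarrow> bool"
  where "supported_rels gens rels \<longleftrightarrow> (\<forall>r\<in>rels. Poly_Mapping.keys r \<subseteq> gens)"

text \<open>Relations supported on \<open>gens\<close> lie in the free group on \<open>gens\<close>,
  so that what they generate is a subgroup of it.\<close>

locale frag_quot =
  fixes gens :: "'x set" and rels :: "('x \<Rightarrow>\<^sub>0 int) set"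
  assumes supp: "supported_rels gens rels"
begin

lemma rels_supp: "r \<in> rels \<Longrightarrow> Poly_Mapping.keys r \<subseteq> gens"
  using supp by (simp add: supported_rels_def)

definition "null = generate (free_Abelian_group gens) rels"

abbreviation "cls x \<equiv> null #>\<^bsub>free_Abelian_group gens\<^esub> x"

lemma null_subgroup: "subgroup null (free_Abelian_group gens)"
  unfolding null_def
  by (rule group.generate_is_subgroup[OF group_free_Abelian_group]) (use rels_supp in auto)

lemma null_normal: "null \<lhd> free_Abelian_group gens"
  by (rule comm_group.subgroup_imp_normal[OF abelian_free_Abelian_group null_subgroup])

lemma null_keys: "x \<in> null \<Longrightarrow> Poly_Mapping.keys x \<subseteq> gens"
  using subgroup.mem_carrier[OF null_subgroup] by simp

lemma null_zero [simp]: "0 \<in> null"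
  using subgroup.one_closed[OF null_subgroup] by simp

lemma null_add: "x \<in> null \<Longrightarrow> y \<in> null \<Longrightarrow> x + y \<in> null"
  using subgroup.m_closed[OF null_subgroup, of x y] by simp

lemma null_uminus: "x \<in> null \<Longrightarrow> - x \<in> null"
  using subgroup.m_inv_closed[OF null_subgroup, of x] by (simp add: null_keys)

lemma null_rel: "r \<in> rels \<Longrightarrow> r \<in> null"
  unfolding null_def by (rule generate.incl)

text \<open>Closure under negation takes the place of the inverse generators of
  \<open>generate\<close>, so relations enter with positive sign only.\<close>

lemma null_induct [consumes 1, case_names zero rel uminus add]:
  assumes "x \<in> null" "P 0" "\<And>r. r \<in> rels \<Longrightarrow> P r" "\<And>x. P x \<Longrightarrow> P (- x)"
    "\<And>x y. P x \<Longrightarrow> P y \<Longrightarrow> P (x + y)"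
  shows "P x"
  using assms(1) unfolding null_def
proof (induction rule: generate.induct)
  case (inv h)
  then show ?case using assms(3,4) rels_supp by simp
qed (use assms in simp_all)

text \<open>A coset is a translate of \<open>null\<close> inside the group of all finitely supported
  functions, whatever the support of x.\<close>

lemma mem_cls: "z \<in> cls x \<longleftrightarrow> z - x \<in> null"
proof
  assume "z \<in> cls x" then show "z - x \<in> null" by (auto simp: r_coset_def)
next
  assume "z - x \<in> null"
  then show "z \<in> cls x" by (auto simp: r_coset_def intro!: bexI[of _ "z - x"])
qed

lemma cls_self: "x \<in> cls x"
  by (simp add: mem_cls)

lemma cls_eqI: "x - y \<in> null \<Longrightarrow> cls x = cls y"
proof (rule Set.set_eqI)
  fix z assume xy: "x - y \<in> null"
  have "z - x \<in> null \<longleftrightarrow> z - y \<in> null"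
    using null_add[of "z - x" "x - y"] null_add[of "z - y" "- (x - y)"] null_uminus[OF xy] xy by auto
  then show "z \<in> cls x \<longleftrightarrow> z \<in> cls y" by (simp add: mem_cls)
qed

lemma cls_eq: "cls x = cls y \<longleftrightarrow> x - y \<in> null"
  using cls_eqI[of x y] cls_self[of x] by (auto simp: mem_cls)

lemma cls_zero: "cls 0 = null"
  by (rule Set.set_eqI) (simp add: mem_cls)

lemma cls_add: "Poly_Mapping.keys x \<subseteq> gens \<Longrightarrow> Poly_Mapping.keys y \<subseteq> gens \<Longrightarrow>
   cls x <#>\<^bsub>free_Abelian_group gens\<^esub> cls y = cls (x + y)"
  using normal.rcos_sum[OF null_normal, of x y] by simp

lemma quot_carrier: "carrier (free_Abelian_group gens Mod null) = cls ` {x. Poly_Mapping.keys x \<subseteq> gens}"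
  by (auto simp: carrier_FactGroup)

text \<open>The condition on relations is stated for every homomorphism with the prescribed values,
  because the homomorphism on the free group is only obtained inside the proof.\<close>

lemma lift:
  assumes H: "abelian_group H" and f: "f ` gens \<subseteq> carrier H"
    and rel: "\<And>h r. h \<in> hom (free_Abelian_group gens) (add_monoid H) \<Longrightarrow>
      (\<And>p. p \<in> gens \<Longrightarrow> h (frag_of p) = f p) \<Longrightarrow> r \<in> rels \<Longrightarrow> h r = \<zero>\<^bsub>H\<^esub>"
  obtains \<Phi> where "\<Phi> \<in> hom (free_Abelian_group gens Mod null) (add_monoid H)"
    "\<And>p. p \<in> gens \<Longrightarrow> \<Phi> (cls (frag_of p)) = f p"
proof -
  interpret H: abelian_group H by fact
  obtain h where h: "h \<in> hom (free_Abelian_group gens) (add_monoid H)" "\<And>p. p \<in> gens \<Longrightarrow> h (frag_of p) = f p"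
    using comm_group.free_Abelian_group_universal[OF H.a_comm_group, of f gens] f by auto
  interpret h: group_hom "free_Abelian_group gens" "add_monoid H" h
    using h(1) H.a_comm_group by (simp add: group_hom_def group_hom_axioms_def comm_group_def)
  have "subgroup (kernel (free_Abelian_group gens) (add_monoid H) h) (free_Abelian_group gens)"
    by (rule h.subgroup_kernel)
  moreover have "rels \<subseteq> kernel (free_Abelian_group gens) (add_monoid H) h"
    using rels_supp rel[OF h] by (auto simp: kernel_def)
  ultimately have "null \<subseteq> kernel (free_Abelian_group gens) (add_monoid H) h"
    unfolding null_def by (intro group.generate_subgroup_incl[OF group_free_Abelian_group])
  from h.FactGroup_universal_kernel[OF null_normal this]
  obtain g where "g \<in> hom (free_Abelian_group gens Mod null) (add_monoid H)"
    "\<And>x. x \<in> carrier (free_Abelian_group gens) \<Longrightarrow> g (cls x) = h x" by blast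
  with h(2) show thesis by (intro that[of g]) auto
qed

lemma cls_induct:
  assumes x: "Poly_Mapping.keys x \<subseteq> Y"
    and P0: "P (cls 0)"
    and gen: "\<And>p. p \<in> Y \<Longrightarrow> P (cls (frag_of p))" "\<And>p. p \<in> Y \<Longrightarrow> P (cls (- frag_of p))"
    and add: "\<And>x y. Poly_Mapping.keys x \<subseteq> Y \<Longrightarrow> Poly_Mapping.keys y \<subseteq> Y \<Longrightarrow>
      P (cls x) \<Longrightarrow> P (cls y) \<Longrightarrow> P (cls (x + y))"
  shows "P (cls x)"
proof -
  \<comment> \<open>Induction on the free abelian group proceeds by differences; carrying the
    statement for -x along reduces it to closure under sums.\<close>
  have "P (cls x) \<and> P (cls (- x))"
  proof (rule free_Abelian_group_induct[OF x, where P = "\<lambda>x. P (cls x) \<and> P (cls (- x))"])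
    fix x y assume *: "Poly_Mapping.keys x \<subseteq> Y" "Poly_Mapping.keys y \<subseteq> Y"
      "P (cls x) \<and> P (cls (- x))" "P (cls y) \<and> P (cls (- y))"
    have "P (cls (x + - y))" "P (cls (- x + y))"
      by (rule add; use * in simp)+
    then show "P (cls (x - y)) \<and> P (cls (- (x - y)))" by simp
  qed (use P0 gen in auto)
  then show ?thesis ..
qed

lemma lift2_keys:
  assumes "\<And>p q. p \<in> gens \<Longrightarrow> q \<in> gens \<Longrightarrow> k p q \<in> gens"
    "Poly_Mapping.keys x \<subseteq> gens" "Poly_Mapping.keys y \<subseteq> gens"
  shows "Poly_Mapping.keys (lift2 k x y) \<subseteq> gens"
proof -
  have "Poly_Mapping.keys (frag_extend (\<lambda>p'. frag_of (k p p')) y) \<subseteq> gens" if "p \<in> gens" for p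
    using keys_frag_extend[of "\<lambda>p'. frag_of (k p p')" y] assms that by fastforce
  then show ?thesis unfolding lift2_def
    using keys_frag_extend[of "\<lambda>p. frag_extend (\<lambda>p'. frag_of (k p p')) y" x] assms(2) by fastforce
qed

text \<open>Biadditivity reduces both claims to a single relation paired with a single
  generator.\<close>

lemma lift2_null:
  assumes left: "\<And>r p. r \<in> rels \<Longrightarrow> p \<in> gens \<Longrightarrow> lift2 k r (frag_of p) \<in> null"
    and right: "\<And>r p. r \<in> rels \<Longrightarrow> p \<in> gens \<Longrightarrow> lift2 k (frag_of p) r \<in> null"
    and y: "Poly_Mapping.keys y \<subseteq> gens" and x: "x \<in> null"
  shows "lift2 k x y \<in> null" "lift2 k y x \<in> null"
proof -
  note simps = lift2_add_left lift2_add_right lift2_uminus_left lift2_uminus_right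
  have diff: "a - b \<in> null" if "a \<in> null" "b \<in> null" for a b
    using null_add[OF that(1) null_uminus[OF that(2)]] by simp
  have "lift2 k x y \<in> null \<and> lift2 k y x \<in> null"
    using x
  proof (induction rule: null_induct)
    case (rel r)
    show ?case
      by (rule free_Abelian_group_induct[OF y, where P = "\<lambda>y. lift2 k r y \<in> null \<and> lift2 k y r \<in> null"])
        (use left[OF rel] right[OF rel] in \<open>auto simp: lift2_diff_left lift2_diff_right diff\<close>)
  qed (auto simp: simps intro: null_add null_uminus)
  then show "lift2 k x y \<in> null" "lift2 k y x \<in> null" by auto
qed

text \<open>Changing both representatives alters \<open>lift2 k x y\<close> by one term with a null
  left argument and one with a null right argument, so the union defining \<open>coset_map2\<close>
  is a single coset.\<close>

lemma coset_map2_cls: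
  assumes k: "\<And>p q. p \<in> gens \<Longrightarrow> q \<in> gens \<Longrightarrow> k p q \<in> gens"
    and left: "\<And>r p. r \<in> rels \<Longrightarrow> p \<in> gens \<Longrightarrow> lift2 k r (frag_of p) \<in> null"
    and right: "\<And>r p. r \<in> rels \<Longrightarrow> p \<in> gens \<Longrightarrow> lift2 k (frag_of p) r \<in> null"
    and x: "Poly_Mapping.keys x \<subseteq> gens" and y: "Poly_Mapping.keys y \<subseteq> gens"
  shows "coset_map2 (free_Abelian_group gens) null k (cls x) (cls y) = cls (lift2 k x y)"
proof -
  have "cls (lift2 k x' y') = cls (lift2 k x y)" if "x' \<in> cls x" "y' \<in> cls y" for x' y'
  proof -
    have n: "x' - x \<in> null" "y' - y \<in> null" using that by (auto simp: mem_cls)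
    have y': "Poly_Mapping.keys y' \<subseteq> gens"
      using null_keys[OF n(2)] y keys_add[of "y' - y" y] by auto
    have "lift2 k x' y' - lift2 k x y = lift2 k (x' - x) y' + lift2 k x (y' - y)"
      by (simp add: lift2_diff_left lift2_diff_right)
    also have "\<dots> \<in> null"
      by (intro null_add lift2_null[OF left right]) (use n x y' in auto)
    finally show ?thesis by (rule cls_eqI)
  qed
  then show ?thesis unfolding coset_map2_def lift2_def[symmetric] using cls_self by blast
qed

end

text \<open>Additivity spreads the condition from the relations to the whole null group, so the
  union in \<open>coset_map\<close> is one coset. Since x may have any support, induced maps can
  later be evaluated on pure tensors without degree conditions.\<close>

lemma coset_map_cls:
  assumes "frag_quot gens rels" "frag_quot Y S"
    and rel: "\<And>r. r \<in> rels \<Longrightarrow> frag_extend (\<lambda>p. frag_of (k p)) r \<in> frag_quot.null Y S"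
  shows "coset_map (free_Abelian_group Y) (frag_quot.null Y S) k (frag_quot.null gens rels #>\<^bsub>free_Abelian_group gens\<^esub> x)
     = frag_quot.null Y S #>\<^bsub>free_Abelian_group Y\<^esub> frag_extend (\<lambda>p. frag_of (k p)) x"
proof -
  interpret S: frag_quot gens rels by fact
  interpret H: frag_quot Y S by fact
  let ?k = "frag_extend (\<lambda>p. frag_of (k p))"
  have "?k z \<in> H.null" if "z \<in> S.null" for z
    using that
  proof (induction rule: S.null_induct)
    case (add x y)
    then show ?case by (simp add: frag_extend_add H.null_add)
  qed (auto simp: rel frag_extend_minus H.null_uminus)
  then have "H.cls (?k z) = H.cls (?k x)" if "z \<in> S.cls x" for z
    using that by (intro H.cls_eqI) (auto simp: S.mem_cls simp flip: frag_extend_diff)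
  then show ?thesis unfolding coset_map_def using S.cls_self by blast
qed


section \<open>Translations and constants in the field of meromorphic functions\<close>

lemma shift_shift: "shift \<alpha> (shift \<beta> f) = shift (\<alpha> + \<beta>) f"
  by transfer (simp add: mero_eq_def meromorphic_Cn_shift eq_generic_refl add.assoc)

lemma shift_zero [simp]: "shift 0 f = f"
  by transfer simp

lemma shift_cancel [simp]: "shift \<alpha> (shift (- \<alpha>) f) = f" "shift (- \<alpha>) (shift \<alpha> f) = f"
  by (simp_all add: shift_shift)

lemma shift_add: "shift \<alpha> (f + g) = shift \<alpha> f + shift \<alpha> g"
  by transfer (simp add: mero_eq_def meromorphic_Cn_shift meromorphic_Cn_op2 eq_generic_refl)

lemma shift_mult: "shift \<alpha> (f * g) = shift \<alpha> f * shift \<alpha> g"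
  by transfer (simp add: mero_eq_def meromorphic_Cn_shift meromorphic_Cn_op2 eq_generic_refl)

lemma shift_const [simp]: "shift \<alpha> (mero_const c) = mero_const c"
  by transfer (simp add: mero_eq_def meromorphic_Cn_const eq_generic_refl)

lemma mero_const_0 [simp]: "mero_const 0 = 0" by transfer (simp add: mero_eq_def meromorphic_Cn_const eq_generic_refl)

lemma mero_const_1 [simp]: "mero_const 1 = 1" by transfer (simp add: mero_eq_def meromorphic_Cn_const eq_generic_refl)

lemma shift_one [simp]: "shift \<alpha> 1 = 1"
  using shift_const[of \<alpha> 1] by simp

lemma shift_0_right [simp]: "shift \<alpha> 0 = 0"
  using shift_const[of \<alpha> 0] by simp

lemma mero_const_add: "mero_const (c + d) = mero_const c + mero_const d"
  by transfer (simp add: mero_eq_def meromorphic_Cn_const eq_generic_refl)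

lemma mero_const_mult: "mero_const (c * d) = mero_const c * mero_const d"
  by transfer (simp add: mero_eq_def meromorphic_Cn_const eq_generic_refl)


subsection \<open>Bigraded algebras with moment maps\<close>

text \<open>Weaker than \<open>h_algebra\<close>: neither injectivity of the moment maps nor directness of the grading
  is required. This makes the class closed under tensor products and wide enough to contain the
  graded space \<open>V\<close> itself.\<close>

locale bg_alg = cx_algebra A
  for A :: "('n::finite, 'a, 'm) halg_scheme" (structure) +
  assumes bideg_subgroup: "additive_subgroup (bideg A \<alpha> \<beta>) A"
    and bideg_one: "\<one> \<in> bideg A 0 0"
    and bideg_smult: "a \<in> bideg A \<alpha> \<beta> \<Longrightarrow> c \<odot> a \<in> bideg A \<alpha> \<beta>"
    and bideg_mult: "\<lbrakk>a \<in> bideg A \<alpha> \<beta>; b \<in> bideg A \<gamma> \<delta>\<rbrakk> \<Longrightarrow> a \<otimes> b \<in> bideg A (\<alpha> + \<gamma>) (\<beta> + \<delta>)"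
    and lmom_bideg: "lmom A f \<in> bideg A 0 0"
    and rmom_bideg: "rmom A f \<in> bideg A 0 0"
    and lmom_comm: "a \<in> bideg A \<alpha> \<beta> \<Longrightarrow> lmom A f \<otimes> a = a \<otimes> lmom A (shift \<alpha> f)"
    and rmom_comm: "a \<in> bideg A \<alpha> \<beta> \<Longrightarrow> rmom A f \<otimes> a = a \<otimes> rmom A (shift \<beta> f)"
begin

lemma bideg_carrier: "a \<in> bideg A \<alpha> \<beta> \<Longrightarrow> a \<in> carrier A"
  using additive_subgroup.a_Hcarr[OF bideg_subgroup] .

lemma bideg_zero: "\<zero> \<in> bideg A \<alpha> \<beta>"
  using additive_subgroup.zero_closed[OF bideg_subgroup] .

lemma bideg_add: "a \<in> bideg A \<alpha> \<beta> \<Longrightarrow> b \<in> bideg A \<alpha> \<beta> \<Longrightarrow> a \<oplus> b \<in> bideg A \<alpha> \<beta>"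
  using additive_subgroup.a_closed[OF bideg_subgroup] .

lemma bideg_uminus: "a \<in> bideg A \<alpha> \<beta> \<Longrightarrow> \<ominus> a \<in> bideg A \<alpha> \<beta>"
  using subgroup.m_inv_closed[OF additive_subgroup.a_subgroup[OF bideg_subgroup]] by (simp add: a_inv_def)

lemma bideg_finsum: "(\<And>i. i \<in> I \<Longrightarrow> x i \<in> bideg A \<alpha> \<beta>) \<Longrightarrow> (\<Oplus>i\<in>I. x i) \<in> bideg A \<alpha> \<beta>"
proof (induction I rule: infinite_finite_induct)
  case (insert i I)
  then have "x \<in> I \<rightarrow> carrier A" "x i \<in> carrier A" using bideg_carrier by auto
  with insert show ?case by (simp add: bideg_add)
qed (auto simp: bideg_zero)

lemma lmom_carrier [simp]: "lmom A f \<in> carrier A" by (rule bideg_carrier[OF lmom_bideg])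

lemma rmom_carrier [simp]: "rmom A f \<in> carrier A" by (rule bideg_carrier[OF rmom_bideg])

text \<open>The commutation rules read from right to left, with f replaced by its translate by minus
  the degree.\<close>

lemma one_bideg_shift: "c \<in> bideg A \<alpha> \<beta> \<Longrightarrow> c \<otimes> rmom A f = rmom A (shift (- \<beta>) f) \<otimes> c"
  "c \<in> bideg A \<alpha> \<beta> \<Longrightarrow> c \<otimes> lmom A f = lmom A (shift (- \<alpha>) f) \<otimes> c"
  using rmom_comm[of c \<alpha> \<beta> "shift (- \<beta>) f"] lmom_comm[of c \<alpha> \<beta> "shift (- \<alpha>) f"] by simp_all

lemma rmom_mult_bideg: "a \<in> bideg A \<alpha> \<beta> \<Longrightarrow> rmom A f \<otimes> a \<in> bideg A \<alpha> \<beta>"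
  using bideg_mult[OF rmom_bideg, of a \<alpha> \<beta> f] by simp

lemma lmom_mult_bideg: "a \<in> bideg A \<alpha> \<beta> \<Longrightarrow> lmom A f \<otimes> a \<in> bideg A \<alpha> \<beta>"
  using bideg_mult[OF lmom_bideg, of a \<alpha> \<beta> f] by simp

end

locale bg_pair = A: bg_alg A + B: bg_alg B
  for A :: "('n::finite, 'a, 'm) halg_scheme" and B :: "('n, 'b, 'k) halg_scheme"
begin

abbreviation "aa_rels \<equiv> tensor_rels A B (\<lambda>f a. rmom A f \<otimes>\<^bsub>A\<^esub> a) (\<lambda>f b. lmom B f \<otimes>\<^bsub>B\<^esub> b) (aa_comps A B)"

abbreviation "aa_gens \<equiv> tensor_gens (aa_comps A B)"

lemma gens_iff: "(a, b) \<in> aa_gens \<longleftrightarrow> (\<exists>\<alpha> \<gamma> \<beta>. a \<in> bideg A \<alpha> \<gamma> \<and> b \<in> bideg B \<gamma> \<beta>)"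
  by (auto simp: tensor_gens_def aa_comps_def) blast

lemma gensE:
  assumes "p \<in> aa_gens"
  obtains a b \<alpha> \<gamma> \<beta> where "p = (a, b)" "a \<in> bideg A \<alpha> \<gamma>" "b \<in> bideg B \<gamma> \<beta>"
  using assms gens_iff by (metis surj_pair)

lemma gensI: "a \<in> bideg A \<alpha> \<gamma> \<Longrightarrow> b \<in> bideg B \<gamma> \<beta> \<Longrightarrow> (a, b) \<in> aa_gens"
  using gens_iff by blast

lemma relsI:
  assumes "a \<in> bideg A \<alpha> \<gamma>" "b \<in> bideg B \<gamma> \<beta>"
  shows "a' \<in> bideg A \<alpha> \<gamma> \<Longrightarrow> frag_of (a \<oplus>\<^bsub>A\<^esub> a', b) - frag_of (a, b) - frag_of (a', b) \<in> aa_rels"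
    and "b' \<in> bideg B \<gamma> \<beta> \<Longrightarrow> frag_of (a, b \<oplus>\<^bsub>B\<^esub> b') - frag_of (a, b) - frag_of (a, b') \<in> aa_rels"
    and "frag_of (rmom A f \<otimes>\<^bsub>A\<^esub> a, b) - frag_of (a, lmom B f \<otimes>\<^bsub>B\<^esub> b) \<in> aa_rels"
proof -
  have comp: "(bideg A \<alpha> \<gamma>, bideg B \<gamma> \<beta>) \<in> aa_comps A B" by (auto simp: aa_comps_def)
  show "a' \<in> bideg A \<alpha> \<gamma> \<Longrightarrow> frag_of (a \<oplus>\<^bsub>A\<^esub> a', b) - frag_of (a, b) - frag_of (a', b) \<in> aa_rels"
    "b' \<in> bideg B \<gamma> \<beta> \<Longrightarrow> frag_of (a, b \<oplus>\<^bsub>B\<^esub> b') - frag_of (a, b) - frag_of (a, b') \<in> aa_rels"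
    "frag_of (rmom A f \<otimes>\<^bsub>A\<^esub> a, b) - frag_of (a, lmom B f \<otimes>\<^bsub>B\<^esub> b) \<in> aa_rels"
    using comp assms unfolding tensor_rels_def by blast+
qed

lemma relsE [consumes 1, case_names left right balance]:
  assumes "r \<in> aa_rels"
  obtains \<alpha> \<gamma> \<beta> a a' b where "a \<in> bideg A \<alpha> \<gamma>" "a' \<in> bideg A \<alpha> \<gamma>" "b \<in> bideg B \<gamma> \<beta>"
      "r = frag_of (a \<oplus>\<^bsub>A\<^esub> a', b) - frag_of (a, b) - frag_of (a', b)"
  | \<alpha> \<gamma> \<beta> a b b' where "a \<in> bideg A \<alpha> \<gamma>" "b \<in> bideg B \<gamma> \<beta>" "b' \<in> bideg B \<gamma> \<beta>"
      "r = frag_of (a, b \<oplus>\<^bsub>B\<^esub> b') - frag_of (a, b) - frag_of (a, b')"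
  | \<alpha> \<gamma> \<beta> f a b where "a \<in> bideg A \<alpha> \<gamma>" "b \<in> bideg B \<gamma> \<beta>"
      "r = frag_of (rmom A f \<otimes>\<^bsub>A\<^esub> a, b) - frag_of (a, lmom B f \<otimes>\<^bsub>B\<^esub> b)"
  using assms unfolding tensor_rels_def aa_comps_def by (elim UnE) fast+

text \<open>The moment maps have bidegree (0, 0), so every entry of a relation stays in the
  components from which the relation is built.\<close>

sublocale Q: frag_quot aa_gens aa_rels
proof
  show "supported_rels aa_gens aa_rels"
    unfolding supported_rels_def
  proof
    fix r assume "r \<in> aa_rels"
    then show "Poly_Mapping.keys r \<subseteq> aa_gens"
    proof (cases rule: relsE)
      case (left \<alpha> \<gamma> \<beta> a a' b)
      show ?thesis unfolding left
        by (intro order.trans[OF keys_diff] Un_least) (use left A.bideg_add[OF left(1,2)] in \<open>auto intro: gensI\<close>)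
    next
      case (right \<alpha> \<gamma> \<beta> a b b')
      show ?thesis unfolding right
        by (intro order.trans[OF keys_diff] Un_least) (use right B.bideg_add[OF right(2,3)] in \<open>auto intro: gensI\<close>)
    next
      case (balance \<alpha> \<gamma> \<beta> f a b)
      show ?thesis unfolding balance
        by (intro order.trans[OF keys_diff] Un_least)
          (use balance A.rmom_mult_bideg[OF balance(1)] B.lmom_mult_bideg[OF balance(2)] in \<open>auto intro: gensI\<close>)
    qed
  qed
qed

lemma free_eq: "aa_free A B = free_Abelian_group aa_gens"
  by (simp add: aa_free_def)

lemma null_eq: "aa_null A B = Q.null"
  by (simp add: aa_null_def aa_free_def Q.null_def)

lemma tens_eq: "aa_tens A B a b = Q.cls (frag_of (a, b))"
  by (simp add: aa_tens_def free_eq null_eq)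

abbreviation "AB \<equiv> aa_tensor A B"

lemma AB_simps:
  "carrier AB = Q.cls ` {x. Poly_Mapping.keys x \<subseteq> aa_gens}"
  "zero AB = Q.cls 0"
  "one AB = aa_tens A B \<one>\<^bsub>A\<^esub> \<one>\<^bsub>B\<^esub>"
  "lmom AB f = aa_tens A B (lmom A f) \<one>\<^bsub>B\<^esub>"
  "rmom AB f = aa_tens A B \<one>\<^bsub>A\<^esub> (rmom B f)"
  "bideg AB \<alpha> \<beta> = Q.cls ` {x. Poly_Mapping.keys x \<subseteq> (\<Union>\<gamma>. bideg A \<alpha> \<gamma> \<times> bideg B \<gamma> \<beta>)}"
  "x \<oplus>\<^bsub>AB\<^esub> y = x <#>\<^bsub>free_Abelian_group aa_gens\<^esub> y"
  "x \<otimes>\<^bsub>AB\<^esub> y = coset_map2 (free_Abelian_group aa_gens) Q.null (mult_pair A B) x y"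
  "c \<odot>\<^bsub>AB\<^esub> x = aa_map A B (\<lambda>a. c \<odot>\<^bsub>A\<^esub> a) id x"
  by (auto simp: aa_tensor_def free_eq null_eq Q.quot_carrier Q.cls_zero)

lemma cls_carrier: "Poly_Mapping.keys x \<subseteq> aa_gens \<Longrightarrow> Q.cls x \<in> carrier AB"
  by (auto simp: AB_simps)

lemma cls_plus: "Poly_Mapping.keys x \<subseteq> aa_gens \<Longrightarrow> Poly_Mapping.keys y \<subseteq> aa_gens \<Longrightarrow>
    Q.cls x \<oplus>\<^bsub>AB\<^esub> Q.cls y = Q.cls (x + y)"
  by (simp add: AB_simps Q.cls_add)

lemma carrierE:
  assumes "t \<in> carrier AB"
  obtains x where "Poly_Mapping.keys x \<subseteq> aa_gens" "t = Q.cls x"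
  using assms by (auto simp: AB_simps)

lemma abelian_group_AB: "abelian_group AB"
proof (rule abelian_groupI)
  fix x y z assume "x \<in> carrier AB" "y \<in> carrier AB" "z \<in> carrier AB"
  then obtain u v w where uvw: "Poly_Mapping.keys u \<subseteq> aa_gens" "x = Q.cls u"
    "Poly_Mapping.keys v \<subseteq> aa_gens" "y = Q.cls v" "Poly_Mapping.keys w \<subseteq> aa_gens" "z = Q.cls w"
    by (elim carrierE) auto
  have k: "Poly_Mapping.keys (u + v) \<subseteq> aa_gens" "Poly_Mapping.keys (v + w) \<subseteq> aa_gens"
    using uvw keys_add[of u v] keys_add[of v w] by auto
  show "x \<oplus>\<^bsub>AB\<^esub> y \<in> carrier AB" "x \<oplus>\<^bsub>AB\<^esub> y \<oplus>\<^bsub>AB\<^esub> z = x \<oplus>\<^bsub>AB\<^esub> (y \<oplus>\<^bsub>AB\<^esub> z)"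
    "x \<oplus>\<^bsub>AB\<^esub> y = y \<oplus>\<^bsub>AB\<^esub> x"
    using uvw k by (auto simp: cls_plus cls_carrier ac_simps)
next
  fix x assume "x \<in> carrier AB"
  then obtain u where u: "Poly_Mapping.keys u \<subseteq> aa_gens" "x = Q.cls u" by (rule carrierE)
  then show "\<zero>\<^bsub>AB\<^esub> \<oplus>\<^bsub>AB\<^esub> x = x" using cls_plus[of 0 u] by (simp add: AB_simps(2))
  have "Q.cls (- u) \<in> carrier AB" "Q.cls (- u) \<oplus>\<^bsub>AB\<^esub> x = \<zero>\<^bsub>AB\<^esub>"
    using u by (simp_all add: cls_carrier cls_plus AB_simps(2))
  then show "\<exists>y\<in>carrier AB. y \<oplus>\<^bsub>AB\<^esub> x = \<zero>\<^bsub>AB\<^esub>" by blast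
qed (simp add: AB_simps(2) cls_carrier)

sublocale G: abelian_group AB
  by (rule abelian_group_AB)

lemma tens_carrier [intro]: "a \<in> bideg A \<alpha> \<gamma> \<Longrightarrow> b \<in> bideg B \<gamma> \<beta> \<Longrightarrow> aa_tens A B a b \<in> carrier AB"
  unfolding tens_eq by (rule cls_carrier) (auto intro: gensI)

lemma tens_bideg: "a \<in> bideg A \<alpha> \<gamma> \<Longrightarrow> b \<in> bideg B \<gamma> \<beta> \<Longrightarrow> aa_tens A B a b \<in> bideg AB \<alpha> \<beta>"
  unfolding tens_eq AB_simps by (rule imageI) auto

lemma tens_add_left:
  assumes "a \<in> bideg A \<alpha> \<gamma>" "a' \<in> bideg A \<alpha> \<gamma>" "b \<in> bideg B \<gamma> \<beta>"
  shows "aa_tens A B (a \<oplus>\<^bsub>A\<^esub> a') b = aa_tens A B a b \<oplus>\<^bsub>AB\<^esub> aa_tens A B a' b"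
  using Q.null_rel[OF relsI(1)[OF assms(1,3,2)]] assms
  by (simp add: tens_eq cls_plus gensI Q.cls_eq diff_diff_eq)

lemma tens_add_right:
  assumes "a \<in> bideg A \<alpha> \<gamma>" "b \<in> bideg B \<gamma> \<beta>" "b' \<in> bideg B \<gamma> \<beta>"
  shows "aa_tens A B a (b \<oplus>\<^bsub>B\<^esub> b') = aa_tens A B a b \<oplus>\<^bsub>AB\<^esub> aa_tens A B a b'"
  using Q.null_rel[OF relsI(2)[OF assms]] assms
  by (simp add: tens_eq cls_plus gensI Q.cls_eq diff_diff_eq)

lemma tens_balance:
  assumes "a \<in> bideg A \<alpha> \<gamma>" "b \<in> bideg B \<gamma> \<beta>"
  shows "aa_tens A B (rmom A f \<otimes>\<^bsub>A\<^esub> a) b = aa_tens A B a (lmom B f \<otimes>\<^bsub>B\<^esub> b)"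
  using Q.null_rel[OF relsI(3)[OF assms]] by (simp add: tens_eq Q.cls_eq)

lemma tens_zero_left:
  assumes "b \<in> bideg B \<gamma> \<beta>"
  shows "aa_tens A B \<zero>\<^bsub>A\<^esub> b = \<zero>\<^bsub>AB\<^esub>"
  using tens_add_left[OF A.bideg_zero A.bideg_zero assms] tens_carrier[OF A.bideg_zero assms]
  by simp

lemma tens_zero_right:
  assumes "a \<in> bideg A \<alpha> \<gamma>"
  shows "aa_tens A B a \<zero>\<^bsub>B\<^esub> = \<zero>\<^bsub>AB\<^esub>"
  using tens_add_right[OF assms B.bideg_zero B.bideg_zero] tens_carrier[OF assms B.bideg_zero]
  by simp

lemma tens_uminus_left:
  assumes "a \<in> bideg A \<alpha> \<gamma>" "b \<in> bideg B \<gamma> \<beta>"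
  shows "aa_tens A B (\<ominus>\<^bsub>A\<^esub> a) b = \<ominus>\<^bsub>AB\<^esub> aa_tens A B a b"
proof -
  have "aa_tens A B (\<ominus>\<^bsub>A\<^esub> a) b \<oplus>\<^bsub>AB\<^esub> aa_tens A B a b = aa_tens A B (\<ominus>\<^bsub>A\<^esub> a \<oplus>\<^bsub>A\<^esub> a) b"
    using assms A.bideg_uminus by (intro tens_add_left[symmetric])
  also have "\<dots> = \<zero>\<^bsub>AB\<^esub>" using assms by (simp add: A.bideg_carrier A.l_neg tens_zero_left)
  finally show ?thesis
    using assms by (intro G.minus_equality[symmetric]) (auto intro: A.bideg_uminus tens_carrier)
qed

lemma tens_finsum_left:
  assumes "finite I" "\<And>i. i \<in> I \<Longrightarrow> x i \<in> bideg A \<alpha> \<gamma>" "b \<in> bideg B \<gamma> \<beta>"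
  shows "aa_tens A B (\<Oplus>\<^bsub>A\<^esub>i\<in>I. x i) b = (\<Oplus>\<^bsub>AB\<^esub>i\<in>I. aa_tens A B (x i) b)"
  using assms(1,2)
proof (induction I rule: finite_induct)
  case (insert i I)
  then have "x \<in> I \<rightarrow> carrier A" "x i \<in> carrier A" by (auto intro: A.bideg_carrier)
  moreover have "aa_tens A B (x j) b \<in> carrier AB" if "j \<in> insert i I" for j
    using insert(4)[OF that] assms(3) by (rule tens_carrier)
  moreover have "aa_tens A B (x i \<oplus>\<^bsub>A\<^esub> (\<Oplus>\<^bsub>A\<^esub>j\<in>I. x j)) b
      = aa_tens A B (x i) b \<oplus>\<^bsub>AB\<^esub> aa_tens A B (\<Oplus>\<^bsub>A\<^esub>j\<in>I. x j) b"
    by (rule tens_add_left[OF _ A.bideg_finsum assms(3)]) (use insert(4) in auto)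
  ultimately show ?case
    using insert by (simp add: Pi_iff)
qed (use tens_zero_left[OF assms(3)] in simp)

lemma tens_finsum_right:
  assumes "finite I" "\<And>i. i \<in> I \<Longrightarrow> x i \<in> bideg B \<gamma> \<beta>" "a \<in> bideg A \<alpha> \<gamma>"
  shows "aa_tens A B a (\<Oplus>\<^bsub>B\<^esub>i\<in>I. x i) = (\<Oplus>\<^bsub>AB\<^esub>i\<in>I. aa_tens A B a (x i))"
  using assms(1,2)
proof (induction I rule: finite_induct)
  case (insert i I)
  then have "x \<in> I \<rightarrow> carrier B" "x i \<in> carrier B" by (auto intro: B.bideg_carrier)
  moreover have "aa_tens A B a (x j) \<in> carrier AB" if "j \<in> insert i I" for j
    using assms(3) insert(4)[OF that] by (rule tens_carrier)
  moreover have "aa_tens A B a (x i \<oplus>\<^bsub>B\<^esub> (\<Oplus>\<^bsub>B\<^esub>j\<in>I. x j))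
      = aa_tens A B a (x i) \<oplus>\<^bsub>AB\<^esub> aa_tens A B a (\<Oplus>\<^bsub>B\<^esub>j\<in>I. x j)"
    by (rule tens_add_right[OF assms(3) _ B.bideg_finsum]) (use insert(4) in auto)
  ultimately show ?case
    using insert by (simp add: Pi_iff)
qed (use tens_zero_right[OF assms(3)] in simp)

text \<open>Serves both the whole tensor product and a single graded component, with Y the set of
  admissible pairs. Since -(a \<otimes> b) = (-a) \<otimes> b, closure of Y under negating the left
  entry absorbs the inverses of pure tensors.\<close>

lemma tens_span_induct:
  assumes x: "Poly_Mapping.keys x \<subseteq> Y" and Y: "Y \<subseteq> aa_gens"
    and neg: "\<And>a b. (a, b) \<in> Y \<Longrightarrow> (\<ominus>\<^bsub>A\<^esub> a, b) \<in> Y"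
    and P0: "P \<zero>\<^bsub>AB\<^esub>"
    and gen: "\<And>a b. (a, b) \<in> Y \<Longrightarrow> P (aa_tens A B a b)"
    and add: "\<And>x y. Poly_Mapping.keys x \<subseteq> Y \<Longrightarrow> Poly_Mapping.keys y \<subseteq> Y \<Longrightarrow>
      P (Q.cls x) \<Longrightarrow> P (Q.cls y) \<Longrightarrow> P (Q.cls x \<oplus>\<^bsub>AB\<^esub> Q.cls y)"
  shows "P (Q.cls x)"
proof (rule Q.cls_induct[OF x, of P])
  show "P (Q.cls 0)" using P0 by (simp add: AB_simps)
  fix p assume p: "p \<in> Y"
  then obtain a b \<alpha> \<gamma> \<beta> where ab: "p = (a, b)" "a \<in> bideg A \<alpha> \<gamma>" "b \<in> bideg B \<gamma> \<beta>"
    using Y by (metis gensE subsetD)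
  then show "P (Q.cls (frag_of p))" using gen p by (simp add: tens_eq)
  have "Q.cls (- frag_of p) \<oplus>\<^bsub>AB\<^esub> aa_tens A B a b = \<zero>\<^bsub>AB\<^esub>"
    using ab p Y by (simp add: tens_eq cls_plus AB_simps(2) subsetD)
  then have "Q.cls (- frag_of p) = \<ominus>\<^bsub>AB\<^esub> aa_tens A B a b"
    using ab p Y by (intro G.minus_equality[symmetric]) (auto intro!: cls_carrier tens_carrier)
  also have "\<dots> = aa_tens A B (\<ominus>\<^bsub>A\<^esub> a) b" using tens_uminus_left ab by simp
  finally show "P (Q.cls (- frag_of p))" using gen[OF neg] ab(1) p by simp
next
  fix x y assume *: "Poly_Mapping.keys x \<subseteq> Y" "Poly_Mapping.keys y \<subseteq> Y" "P (Q.cls x)" "P (Q.cls y)"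
  then have "Q.cls (x + y) = Q.cls x \<oplus>\<^bsub>AB\<^esub> Q.cls y" using Y by (intro cls_plus[symmetric]) auto
  then show "P (Q.cls (x + y))" using add[OF *] by simp
qed

lemma tens_induct [consumes 1, case_names zero tens add]:
  assumes "t \<in> carrier AB" "P \<zero>\<^bsub>AB\<^esub>"
    "\<And>a b \<alpha> \<gamma> \<beta>. a \<in> bideg A \<alpha> \<gamma> \<Longrightarrow> b \<in> bideg B \<gamma> \<beta> \<Longrightarrow> P (aa_tens A B a b)"
    "\<And>s t. s \<in> carrier AB \<Longrightarrow> t \<in> carrier AB \<Longrightarrow> P s \<Longrightarrow> P t \<Longrightarrow> P (s \<oplus>\<^bsub>AB\<^esub> t)"
  shows "P t"
proof -
  obtain x where x: "Poly_Mapping.keys x \<subseteq> aa_gens" "t = Q.cls x" using assms(1) by (rule carrierE)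
  show ?thesis unfolding x(2)
    by (rule tens_span_induct[OF x(1)])
      (use assms(2-) cls_carrier in \<open>auto elim!: gensE intro: gensI A.bideg_uminus\<close>)
qed

text \<open>In contrast to \<open>tens_induct\<close>, the outer degrees stay fixed and only the
  inner one varies, also in the additive step.\<close>

lemma bideg_induct [consumes 1, case_names zero tens add]:
  assumes "t \<in> bideg AB \<alpha> \<beta>" "P \<zero>\<^bsub>AB\<^esub>"
    "\<And>a b \<gamma>. a \<in> bideg A \<alpha> \<gamma> \<Longrightarrow> b \<in> bideg B \<gamma> \<beta> \<Longrightarrow> P (aa_tens A B a b)"
    "\<And>s t. s \<in> bideg AB \<alpha> \<beta> \<Longrightarrow> t \<in> bideg AB \<alpha> \<beta> \<Longrightarrow> P s \<Longrightarrow> P t \<Longrightarrow> P (s \<oplus>\<^bsub>AB\<^esub> t)"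
  shows "P t"
proof -
  let ?Y = "\<Union>\<gamma>. bideg A \<alpha> \<gamma> \<times> bideg B \<gamma> \<beta>"
  obtain x where x: "Poly_Mapping.keys x \<subseteq> ?Y" "t = Q.cls x" using assms(1) by (auto simp: AB_simps)
  show ?thesis unfolding x(2)
  proof (rule tens_span_induct[OF x(1)])
    show "P (Q.cls x \<oplus>\<^bsub>AB\<^esub> Q.cls y)" if "Poly_Mapping.keys x \<subseteq> ?Y" "Poly_Mapping.keys y \<subseteq> ?Y"
      "P (Q.cls x)" "P (Q.cls y)" for x y
      by (rule assms(4)) (use that in \<open>auto simp: AB_simps(6)\<close>)
  qed (use assms(2,3) in \<open>auto intro: gensI A.bideg_uminus\<close>)
qed

lemma bideg_AB_subgroup: "additive_subgroup (bideg AB \<alpha> \<beta>) AB"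
proof -
  let ?Y = "\<Union>\<gamma>. bideg A \<alpha> \<gamma> \<times> bideg B \<gamma> \<beta>"
  have Y: "?Y \<subseteq> aa_gens" by (auto intro: gensI)
  show ?thesis
  proof (rule additive_subgroupI, rule subgroup.intro)
    show "bideg AB \<alpha> \<beta> \<subseteq> carrier (add_monoid AB)"
      using Y by (auto simp: AB_simps(6) intro!: cls_carrier)
    show "\<one>\<^bsub>add_monoid AB\<^esub> \<in> bideg AB \<alpha> \<beta>"
      by (auto simp: AB_simps(6,2) intro!: image_eqI[of _ _ 0])
    fix s assume "s \<in> bideg AB \<alpha> \<beta>"
    then obtain x where x: "Poly_Mapping.keys x \<subseteq> ?Y" "s = Q.cls x" by (auto simp: AB_simps(6))
    have x': "Poly_Mapping.keys x \<subseteq> aa_gens" using x Y by blast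
    have "Q.cls (- x) \<oplus>\<^bsub>AB\<^esub> s = \<zero>\<^bsub>AB\<^esub>" using x x' by (simp add: cls_plus AB_simps(2))
    then have "\<ominus>\<^bsub>AB\<^esub> s = Q.cls (- x)" using x' x by (intro G.minus_equality) (auto intro!: cls_carrier)
    then show "inv\<^bsub>add_monoid AB\<^esub> s \<in> bideg AB \<alpha> \<beta>"
      using x by (auto simp: a_inv_def AB_simps(6))
    fix t assume "t \<in> bideg AB \<alpha> \<beta>"
    then obtain y where y: "Poly_Mapping.keys y \<subseteq> ?Y" "t = Q.cls y" by (auto simp: AB_simps(6))
    have y': "Poly_Mapping.keys y \<subseteq> aa_gens" using y Y by blast
    have "s \<oplus>\<^bsub>AB\<^esub> t = Q.cls (x + y)" using x y x' y' by (simp add: cls_plus)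
    moreover have "Poly_Mapping.keys (x + y) \<subseteq> ?Y" using x(1) y(1) keys_add[of x y] by blast
    ultimately show "s \<otimes>\<^bsub>add_monoid AB\<^esub> t \<in> bideg AB \<alpha> \<beta>" by (simp add: AB_simps(6))
  qed
qed

subsection \<open>The universal property\<close>

text \<open>The map f is defined on all pairs but constrained only on homogeneous ones with matching
  inner degree, which are the generators of the tensor product.\<close>

lemma tensor_lift:
  assumes H: "abelian_group H"
    and closed: "\<And>\<alpha> \<gamma> \<beta> a b. a \<in> bideg A \<alpha> \<gamma> \<Longrightarrow> b \<in> bideg B \<gamma> \<beta> \<Longrightarrow> f a b \<in> carrier H"
    and add_left: "\<And>\<alpha> \<gamma> \<beta> a a' b. a \<in> bideg A \<alpha> \<gamma> \<Longrightarrow> a' \<in> bideg A \<alpha> \<gamma> \<Longrightarrow> b \<in> bideg B \<gamma> \<beta> \<Longrightarrow>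
      f (a \<oplus>\<^bsub>A\<^esub> a') b = f a b \<oplus>\<^bsub>H\<^esub> f a' b"
    and add_right: "\<And>\<alpha> \<gamma> \<beta> a b b'. a \<in> bideg A \<alpha> \<gamma> \<Longrightarrow> b \<in> bideg B \<gamma> \<beta> \<Longrightarrow> b' \<in> bideg B \<gamma> \<beta> \<Longrightarrow>
      f a (b \<oplus>\<^bsub>B\<^esub> b') = f a b \<oplus>\<^bsub>H\<^esub> f a b'"
    and middle: "\<And>\<alpha> \<gamma> \<beta> g a b. a \<in> bideg A \<alpha> \<gamma> \<Longrightarrow> b \<in> bideg B \<gamma> \<beta> \<Longrightarrow>
      f (rmom A g \<otimes>\<^bsub>A\<^esub> a) b = f a (lmom B g \<otimes>\<^bsub>B\<^esub> b)"
  obtains \<Phi> where "\<Phi> \<in> hom (add_monoid AB) (add_monoid H)"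
    "\<And>\<alpha> \<gamma> \<beta> a b. a \<in> bideg A \<alpha> \<gamma> \<Longrightarrow> b \<in> bideg B \<gamma> \<beta> \<Longrightarrow> \<Phi> (aa_tens A B a b) = f a b"
proof -
  interpret H: abelian_group H by fact
  let ?F = "free_Abelian_group aa_gens" and ?f = "\<lambda>p. f (fst p) (snd p)"
  have f: "?f ` aa_gens \<subseteq> carrier H" using closed by (auto elim!: gensE)
  have rel: "h r = \<zero>\<^bsub>H\<^esub>"
    if h: "h \<in> hom ?F (add_monoid H)" "\<And>p. p \<in> aa_gens \<Longrightarrow> h (frag_of p) = ?f p" and r: "r \<in> aa_rels" for h r
  proof -
    interpret h: group_hom ?F "add_monoid H" h
      using h(1) H.a_comm_group by (simp add: group_hom_def group_hom_axioms_def comm_group_def)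
    have hm: "h (x - y) = h x \<ominus>\<^bsub>H\<^esub> h y" and hc: "h x \<in> carrier H"
      if "Poly_Mapping.keys x \<subseteq> aa_gens" "Poly_Mapping.keys y \<subseteq> aa_gens" for x y
      using h.hom_mult[of x "- y"] h.hom_inv[of y] h.hom_closed[of x] that
      by (auto simp: a_minus_def a_inv_def)
    have kd: "Poly_Mapping.keys (frag_of p - frag_of q) \<subseteq> aa_gens" if "p \<in> aa_gens" "q \<in> aa_gens" for p q
      using keys_diff[of "frag_of p" "frag_of q"] that by auto
    show ?thesis using r
    proof (cases rule: relsE)
      case (left \<alpha> \<gamma> \<beta> a a' b)
      then have g: "(a, b) \<in> aa_gens" "(a', b) \<in> aa_gens" "(a \<oplus>\<^bsub>A\<^esub> a', b) \<in> aa_gens"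
        by (auto intro: gensI A.bideg_add)
      have "f a b \<in> carrier H" "f a' b \<in> carrier H" using left closed by auto
      then show ?thesis
        unfolding left(4) using g left kd add_left[OF left(1-3)]
        by (simp add: hm h(2) a_minus_def H.minus_add H.a_ac H.r_neg H.r_neg1)
    next
      case (right \<alpha> \<gamma> \<beta> a b b')
      then have g: "(a, b) \<in> aa_gens" "(a, b') \<in> aa_gens" "(a, b \<oplus>\<^bsub>B\<^esub> b') \<in> aa_gens"
        by (auto intro: gensI B.bideg_add)
      have "f a b \<in> carrier H" "f a b' \<in> carrier H" using right closed by auto
      then show ?thesis
        unfolding right(4) using g right kd add_right[OF right(1-3)]
        by (simp add: hm h(2) a_minus_def H.minus_add H.a_ac H.r_neg H.r_neg1)
    next
      case (balance \<alpha> \<gamma> \<beta> g a b)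
      then have g: "(rmom A g \<otimes>\<^bsub>A\<^esub> a, b) \<in> aa_gens" "(a, lmom B g \<otimes>\<^bsub>B\<^esub> b) \<in> aa_gens"
        by (auto intro: gensI A.rmom_mult_bideg B.lmom_mult_bideg)
      have "f a (lmom B g \<otimes>\<^bsub>B\<^esub> b) \<in> carrier H" 
        by (rule closed[OF balance(1) B.lmom_mult_bideg[OF balance(2)]])
      then show ?thesis
        unfolding balance(3) using g middle[OF balance(1,2)]
        by (simp add: hm h(2) a_minus_def H.r_neg)
    qed
  qed
  obtain \<Phi> where \<Phi>: "\<Phi> \<in> hom (?F Mod Q.null) (add_monoid H)"
    "\<And>p. p \<in> aa_gens \<Longrightarrow> \<Phi> (Q.cls (frag_of p)) = ?f p"
  proof (rule Q.lift[where f = ?f and H = H, OF H f])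
    fix h r assume "h \<in> hom ?F (add_monoid H)" "\<And>p. p \<in> aa_gens \<Longrightarrow> h (frag_of p) = ?f p" "r \<in> aa_rels"
    then show "h r = \<zero>\<^bsub>H\<^esub>" by (rule rel)
  qed (use that in blast)
  have "\<Phi> \<in> hom (add_monoid AB) (add_monoid H)"
    using \<Phi>(1) by (simp add: hom_def AB_simps(1,7) Q.quot_carrier)
  then show thesis using that[of \<Phi>] \<Phi>(2) gensI by (simp add: tens_eq)
qed

end


subsection \<open>Maps between tensor products\<close>

text \<open>Balancing involves only the right moment map of the left factor and the left moment map
  of the right factor. So, beyond degrees and additivity, a map of the left factor has to respect
  just the former, and a map of the right factor (\<open>right_map\<close>) the latter.
  Multiplication by a scalar or by \<open>lmom A f\<close> qualifies, though it is not an algebra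
  homomorphism in general.\<close>

definition left_map :: "('n::finite, 'a, 'm) halg_scheme \<Rightarrow> ('n, 'b, 'k) halg_scheme \<Rightarrow> ('a \<Rightarrow> 'b) \<Rightarrow> bool"
  where "left_map A A' \<phi> \<longleftrightarrow> (\<forall>\<alpha> \<beta>. \<forall>a\<in>bideg A \<alpha> \<beta>. \<phi> a \<in> bideg A' \<alpha> \<beta> \<and>
    (\<forall>f. \<phi> (rmom A f \<otimes>\<^bsub>A\<^esub> a) = rmom A' f \<otimes>\<^bsub>A'\<^esub> \<phi> a) \<and>
    (\<forall>a'\<in>bideg A \<alpha> \<beta>. \<phi> (a \<oplus>\<^bsub>A\<^esub> a') = \<phi> a \<oplus>\<^bsub>A'\<^esub> \<phi> a'))"

definition right_map :: "('n::finite, 'a, 'm) halg_scheme \<Rightarrow> ('n, 'b, 'k) halg_scheme \<Rightarrow> ('a \<Rightarrow> 'b) \<Rightarrow> bool"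
  where "right_map A A' \<phi> \<longleftrightarrow> (\<forall>\<alpha> \<beta>. \<forall>a\<in>bideg A \<alpha> \<beta>. \<phi> a \<in> bideg A' \<alpha> \<beta> \<and>
    (\<forall>f. \<phi> (lmom A f \<otimes>\<^bsub>A\<^esub> a) = lmom A' f \<otimes>\<^bsub>A'\<^esub> \<phi> a) \<and>
    (\<forall>a'\<in>bideg A \<alpha> \<beta>. \<phi> (a \<oplus>\<^bsub>A\<^esub> a') = \<phi> a \<oplus>\<^bsub>A'\<^esub> \<phi> a'))"

lemma right_map_id: "right_map A A id"
  by (auto simp: right_map_def)

lemma (in bg_alg) left_map_smult: "left_map A A (\<lambda>a. c \<odot> a)"
  using smult_r_distr[of c] bideg_carrier smult_mult_right bideg_smult
  unfolding left_map_def by (auto simp: smult_mult_right)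

lemma left_map_lmom:
  assumes "bg_alg A"
  shows "left_map A A (\<lambda>a. lmom A f \<otimes>\<^bsub>A\<^esub> a)"
proof -
  interpret bg_alg A by fact
  \<comment> \<open>The element \<open>rmom A g\<close> has bidegree (0, 0), so
    \<open>lmom A f\<close> passes it without translation.\<close>
  have "lmom A f \<otimes>\<^bsub>A\<^esub> (rmom A g \<otimes>\<^bsub>A\<^esub> a) = rmom A g \<otimes>\<^bsub>A\<^esub> (lmom A f \<otimes>\<^bsub>A\<^esub> a)" if "a \<in> carrier A" for a g
    using that lmom_comm[OF rmom_bideg[of g], of f] by (simp flip: m_assoc)
  then show ?thesis
    unfolding left_map_def using r_distr lmom_mult_bideg by (auto simp: bideg_carrier)
qed

lemma h_algebra_hom_ring_hom: "h_algebra_hom A B \<phi> \<Longrightarrow> \<phi> \<in> ring_hom A B"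
  by (simp add: h_algebra_hom_def)

lemma h_algebra_hom_bideg: "h_algebra_hom A B \<phi> \<Longrightarrow> a \<in> bideg A \<alpha> \<beta> \<Longrightarrow> \<phi> a \<in> bideg B \<alpha> \<beta>"
  unfolding h_algebra_hom_def by blast

lemma h_algebra_hom_left_map:
  assumes "bg_alg A" "h_algebra_hom A B \<phi>"
  shows "left_map A B \<phi>" "right_map A B \<phi>"
proof -
  interpret bg_alg A by fact
  show "left_map A B \<phi>" "right_map A B \<phi>"
    using assms(2) h_algebra_hom_bideg[OF assms(2)] unfolding left_map_def right_map_def
    by (auto simp: h_algebra_hom_def ring_hom_mult ring_hom_add bideg_carrier)
qed

lemma h_algebra_hom_id: "bg_alg A \<Longrightarrow> h_algebra_hom A A id"
  by (auto simp: h_algebra_hom_def intro: ring_hom_memI)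

lemma h_algebra_hom_comp:
  "h_algebra_hom A B \<phi> \<Longrightarrow> h_algebra_hom B C \<psi> \<Longrightarrow> h_algebra_hom A C (\<psi> \<circ> \<phi>)"
  by (auto simp: h_algebra_hom_def ring_hom_closed image_subset_iff intro: ring_hom_trans)

text \<open>Each defining relation of the source is sent to one of the target, so the map of
  generators descends to cosets. The value on pure tensors is asserted for all a and b, homogeneous
  or not, as the induced map is computed on cosets of arbitrary support.\<close>

lemma aa_map_additive:
  assumes "bg_pair A B" "bg_pair A' B'" and maps: "left_map A A' \<phi>" "right_map B B' \<psi>"
  shows aa_map_closed: "t \<in> carrier (aa_tensor A B) \<Longrightarrow> aa_map A' B' \<phi> \<psi> t \<in> carrier (aa_tensor A' B')"
    and aa_map_add: "\<lbrakk>s \<in> carrier (aa_tensor A B); t \<in> carrier (aa_tensor A B)\<rbrakk> \<Longrightarrow>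
      aa_map A' B' \<phi> \<psi> (s \<oplus>\<^bsub>aa_tensor A B\<^esub> t) = aa_map A' B' \<phi> \<psi> s \<oplus>\<^bsub>aa_tensor A' B'\<^esub> aa_map A' B' \<phi> \<psi> t"
    and aa_map_zero: "aa_map A' B' \<phi> \<psi> \<zero>\<^bsub>aa_tensor A B\<^esub> = \<zero>\<^bsub>aa_tensor A' B'\<^esub>"
    and aa_map_tens: "aa_map A' B' \<phi> \<psi> (aa_tens A B a b) = aa_tens A' B' (\<phi> a) (\<psi> b)"
    and aa_map_bideg: "t \<in> bideg (aa_tensor A B) \<alpha> \<beta> \<Longrightarrow> aa_map A' B' \<phi> \<psi> t \<in> bideg (aa_tensor A' B') \<alpha> \<beta>"
proof -
  interpret S: bg_pair A B by fact
  interpret D: bg_pair A' B' by fact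
  let ?k = "frag_extend (\<lambda>p. frag_of (map_prod \<phi> \<psi> p))"
  have \<phi>: "\<phi> a \<in> bideg A' \<alpha> \<beta>" "\<phi> (rmom A f \<otimes>\<^bsub>A\<^esub> a) = rmom A' f \<otimes>\<^bsub>A'\<^esub> \<phi> a"
      "a' \<in> bideg A \<alpha> \<beta> \<Longrightarrow> \<phi> (a \<oplus>\<^bsub>A\<^esub> a') = \<phi> a \<oplus>\<^bsub>A'\<^esub> \<phi> a'"
    if "a \<in> bideg A \<alpha> \<beta>" for a a' \<alpha> \<beta> f
    using maps(1) that unfolding left_map_def by blast+
  have \<psi>: "\<psi> a \<in> bideg B' \<alpha> \<beta>" "\<psi> (lmom B f \<otimes>\<^bsub>B\<^esub> a) = lmom B' f \<otimes>\<^bsub>B'\<^esub> \<psi> a"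
      "a' \<in> bideg B \<alpha> \<beta> \<Longrightarrow> \<psi> (a \<oplus>\<^bsub>B\<^esub> a') = \<psi> a \<oplus>\<^bsub>B'\<^esub> \<psi> a'"
    if "a \<in> bideg B \<alpha> \<beta>" for a a' \<alpha> \<beta> f
    using maps(2) that unfolding right_map_def by blast+
  have rel: "?k r \<in> D.Q.null" if "r \<in> S.aa_rels" for r
    using that
  proof (cases rule: S.relsE)
    case (left \<alpha> \<gamma> \<beta> a a' b)
    then show ?thesis
      using D.Q.null_rel[OF D.relsI(1)[OF \<phi>(1)[OF left(1)] \<psi>(1)[OF left(3)] \<phi>(1)[OF left(2)]]]
      by (simp add: frag_extend_diff \<phi>(3))
  next
    case (right \<alpha> \<gamma> \<beta> a b b')
    then show ?thesis
      using D.Q.null_rel[OF D.relsI(2)[OF \<phi>(1)[OF right(1)] \<psi>(1)[OF right(2)] \<psi>(1)[OF right(3)]]]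
      by (simp add: frag_extend_diff \<psi>(3))
  next
    case (balance \<alpha> \<gamma> \<beta> f a b)
    then show ?thesis
      using D.Q.null_rel[OF D.relsI(3)[OF \<phi>(1)[OF balance(1)] \<psi>(1)[OF balance(2)]]]
      by (simp add: frag_extend_diff \<phi>(2) \<psi>(2))
  qed
  have cls: "aa_map A' B' \<phi> \<psi> (S.Q.cls x) = D.Q.cls (?k x)" for x
    unfolding aa_map_def D.free_eq D.null_eq
    by (rule coset_map_cls) (use rel S.Q.frag_quot_axioms D.Q.frag_quot_axioms in auto)
  have keys: "Poly_Mapping.keys (?k x) \<subseteq> (\<Union>\<gamma>. bideg A' \<alpha> \<gamma> \<times> bideg B' \<gamma> \<beta>)"
    if "Poly_Mapping.keys x \<subseteq> (\<Union>\<gamma>. bideg A \<alpha> \<gamma> \<times> bideg B \<gamma> \<beta>)" for x \<alpha> \<beta>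
  proof -
    have "Poly_Mapping.keys (?k x) \<subseteq> map_prod \<phi> \<psi> ` Poly_Mapping.keys x"
      using keys_frag_extend[of "\<lambda>p. frag_of (map_prod \<phi> \<psi> p)" x] by auto
    also have "\<dots> \<subseteq> (\<Union>\<gamma>. bideg A' \<alpha> \<gamma> \<times> bideg B' \<gamma> \<beta>)"
      using that \<phi>(1) \<psi>(1) by fastforce
    finally show ?thesis .
  qed
  have keys': "Poly_Mapping.keys (?k x) \<subseteq> D.aa_gens" if x: "Poly_Mapping.keys x \<subseteq> S.aa_gens" for x
  proof -
    have "Poly_Mapping.keys (?k x) \<subseteq> map_prod \<phi> \<psi> ` Poly_Mapping.keys x"
      using keys_frag_extend[of "\<lambda>p. frag_of (map_prod \<phi> \<psi> p)" x] by auto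
    also have "\<dots> \<subseteq> D.aa_gens"
    proof
      fix p' assume "p' \<in> map_prod \<phi> \<psi> ` Poly_Mapping.keys x"
      then obtain p where "p \<in> Poly_Mapping.keys x" and p: "p' = map_prod \<phi> \<psi> p" by (rule imageE)
      from subsetD[OF x this(1)] obtain a b \<alpha> \<gamma> \<beta> where "p = (a, b)" "a \<in> bideg A \<alpha> \<gamma>" "b \<in> bideg B \<gamma> \<beta>"
        by (rule S.gensE)
      then show "p' \<in> D.aa_gens" unfolding p using D.gensI[OF \<phi>(1) \<psi>(1)] by simp
    qed
    finally show ?thesis .
  qed
  show "aa_map A' B' \<phi> \<psi> t \<in> carrier (aa_tensor A' B')" if "t \<in> carrier (aa_tensor A B)"
    using that by (elim S.carrierE) (simp add: cls D.cls_carrier keys')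
  show "aa_map A' B' \<phi> \<psi> (s \<oplus>\<^bsub>aa_tensor A B\<^esub> t) = aa_map A' B' \<phi> \<psi> s \<oplus>\<^bsub>aa_tensor A' B'\<^esub> aa_map A' B' \<phi> \<psi> t"
    if "s \<in> carrier (aa_tensor A B)" "t \<in> carrier (aa_tensor A B)"
    using that by (elim S.carrierE) (simp add: cls D.cls_plus keys' S.cls_plus frag_extend_add)
  show "aa_map A' B' \<phi> \<psi> \<zero>\<^bsub>aa_tensor A B\<^esub> = \<zero>\<^bsub>aa_tensor A' B'\<^esub>"
    by (simp add: S.AB_simps(2) D.AB_simps(2) cls)
  show "aa_map A' B' \<phi> \<psi> (aa_tens A B a b) = aa_tens A' B' (\<phi> a) (\<psi> b)"
    by (simp add: S.tens_eq D.tens_eq cls)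
  show "aa_map A' B' \<phi> \<psi> t \<in> bideg (aa_tensor A' B') \<alpha> \<beta>" if "t \<in> bideg (aa_tensor A B) \<alpha> \<beta>"
    using that keys unfolding S.AB_simps(6) D.AB_simps(6) by (auto simp: cls)
qed

subsection \<open>The tensor product as a bigraded algebra\<close>

context bg_pair
begin

lemma mult_pair_gens:
  assumes "p \<in> aa_gens" "p' \<in> aa_gens"
  shows "mult_pair A B p p' \<in> aa_gens"
  using assms by (auto elim!: gensE intro!: gensI A.bideg_mult B.bideg_mult)

text \<open>The essential case is balancing multiplied from the left by c \<otimes> d. Moving the
  function past c in one factor and past d in the other translates it by minus the right degree of c
  and minus the left degree of d, and these agree for an admissible pair. Multiplication from the
  right involves no translation.\<close>

lemma mult_pair_null:
  assumes r: "r \<in> aa_rels" and p: "p \<in> aa_gens"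
  shows "lift2 (mult_pair A B) r (frag_of p) \<in> Q.null" "lift2 (mult_pair A B) (frag_of p) r \<in> Q.null"
proof -
  obtain c d \<alpha>' \<gamma>' \<beta>' where cd: "p = (c, d)" "c \<in> bideg A \<alpha>' \<gamma>'" "d \<in> bideg B \<gamma>' \<beta>'"
    using p by (rule gensE)
  note car = A.bideg_carrier B.bideg_carrier
  have "lift2 (mult_pair A B) r (frag_of p) \<in> Q.null \<and> lift2 (mult_pair A B) (frag_of p) r \<in> Q.null"
    using r
  proof (cases rule: relsE)
    case (left \<alpha> \<gamma> \<beta> a a' b)
    note m = A.bideg_mult[OF left(1) cd(2)] A.bideg_mult[OF left(2) cd(2)] B.bideg_mult[OF left(3) cd(3)]
      A.bideg_mult[OF cd(2) left(1)] A.bideg_mult[OF cd(2) left(2)] B.bideg_mult[OF cd(3) left(3)]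
    show ?thesis
      using Q.null_rel[OF relsI(1)[OF m(1,3,2)]] Q.null_rel[OF relsI(1)[OF m(4,6,5)]] left cd
      by (simp add: lift2_diff_left lift2_diff_right car A.l_distr A.r_distr)
  next
    case (right \<alpha> \<gamma> \<beta> a b b')
    note m = A.bideg_mult[OF right(1) cd(2)] B.bideg_mult[OF right(2) cd(3)] B.bideg_mult[OF right(3) cd(3)]
      A.bideg_mult[OF cd(2) right(1)] B.bideg_mult[OF cd(3) right(2)] B.bideg_mult[OF cd(3) right(3)]
    show ?thesis
      using Q.null_rel[OF relsI(2)[OF m(1-3)]] Q.null_rel[OF relsI(2)[OF m(4-6)]] right cd
      by (simp add: lift2_diff_left lift2_diff_right car B.l_distr B.r_distr)
  next
    case (balance \<alpha> \<gamma> \<beta> f a b)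
    note m = A.bideg_mult[OF balance(1) cd(2)] B.bideg_mult[OF balance(2) cd(3)]
      A.bideg_mult[OF cd(2) balance(1)] B.bideg_mult[OF cd(3) balance(2)]
    note c = car(1)[OF balance(1)] car(2)[OF balance(2)] car(1)[OF cd(2)] car(2)[OF cd(3)]
    have "c \<otimes>\<^bsub>A\<^esub> (rmom A f \<otimes>\<^bsub>A\<^esub> a) = rmom A (shift (- \<gamma>') f) \<otimes>\<^bsub>A\<^esub> (c \<otimes>\<^bsub>A\<^esub> a)"
      using A.one_bideg_shift(1)[OF cd(2), of f] c by (simp flip: A.m_assoc)
    moreover have "d \<otimes>\<^bsub>B\<^esub> (lmom B f \<otimes>\<^bsub>B\<^esub> b) = lmom B (shift (- \<gamma>') f) \<otimes>\<^bsub>B\<^esub> (d \<otimes>\<^bsub>B\<^esub> b)"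
      using B.one_bideg_shift(2)[OF cd(3), of f] c by (simp flip: B.m_assoc)
    ultimately show ?thesis
      using Q.null_rel[OF relsI(3)[OF m(1,2), of f]]
        Q.null_rel[OF relsI(3)[OF m(3,4), of "shift (- \<gamma>') f"]] balance cd c
      by (simp add: lift2_diff_left lift2_diff_right A.m_assoc B.m_assoc)
  qed
  then show "lift2 (mult_pair A B) r (frag_of p) \<in> Q.null" "lift2 (mult_pair A B) (frag_of p) r \<in> Q.null"
    by blast+
qed

lemma cls_mult:
  assumes "Poly_Mapping.keys x \<subseteq> aa_gens" "Poly_Mapping.keys y \<subseteq> aa_gens"
  shows "Q.cls x \<otimes>\<^bsub>AB\<^esub> Q.cls y = Q.cls (lift2 (mult_pair A B) x y)"
  unfolding AB_simps(8)
  by (rule Q.coset_map2_cls) (use mult_pair_gens mult_pair_null assms in auto)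

lemma lift2_gens:
  assumes "Poly_Mapping.keys x \<subseteq> aa_gens" "Poly_Mapping.keys y \<subseteq> aa_gens"
  shows "Poly_Mapping.keys (lift2 (mult_pair A B) x y) \<subseteq> aa_gens"
  by (rule Q.lift2_keys) (use mult_pair_gens assms in auto)

lemma tens_mult:
  assumes "a \<in> bideg A \<alpha> \<gamma>" "b \<in> bideg B \<gamma> \<beta>" "a' \<in> bideg A \<alpha>' \<gamma>'" "b' \<in> bideg B \<gamma>' \<beta>'"
  shows "aa_tens A B a b \<otimes>\<^bsub>AB\<^esub> aa_tens A B a' b' = aa_tens A B (a \<otimes>\<^bsub>A\<^esub> a') (b \<otimes>\<^bsub>B\<^esub> b')"
  unfolding tens_eq using assms by (subst cls_mult) (auto intro: gensI)

lemma AB_mult_closed [simp]: "s \<in> carrier AB \<Longrightarrow> t \<in> carrier AB \<Longrightarrow> s \<otimes>\<^bsub>AB\<^esub> t \<in> carrier AB"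
  by (elim carrierE) (simp add: cls_mult cls_carrier lift2_gens)

lemma AB_l_distr:
  "s \<in> carrier AB \<Longrightarrow> s' \<in> carrier AB \<Longrightarrow> t \<in> carrier AB \<Longrightarrow>
    (s \<oplus>\<^bsub>AB\<^esub> s') \<otimes>\<^bsub>AB\<^esub> t = s \<otimes>\<^bsub>AB\<^esub> t \<oplus>\<^bsub>AB\<^esub> s' \<otimes>\<^bsub>AB\<^esub> t"
proof (elim carrierE)
  fix x y z assume "Poly_Mapping.keys x \<subseteq> aa_gens" "Poly_Mapping.keys y \<subseteq> aa_gens"
    "Poly_Mapping.keys z \<subseteq> aa_gens" "s = Q.cls x" "s' = Q.cls y" "t = Q.cls z"
  moreover from this have "Poly_Mapping.keys (x + y) \<subseteq> aa_gens" using keys_add[of x y] by blast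
  ultimately show ?thesis by (simp add: cls_plus cls_mult lift2_gens lift2_add_left)
qed

lemma AB_r_distr:
  "s \<in> carrier AB \<Longrightarrow> s' \<in> carrier AB \<Longrightarrow> t \<in> carrier AB \<Longrightarrow>
    t \<otimes>\<^bsub>AB\<^esub> (s \<oplus>\<^bsub>AB\<^esub> s') = t \<otimes>\<^bsub>AB\<^esub> s \<oplus>\<^bsub>AB\<^esub> t \<otimes>\<^bsub>AB\<^esub> s'"
proof (elim carrierE)
  fix x y z assume "Poly_Mapping.keys x \<subseteq> aa_gens" "Poly_Mapping.keys y \<subseteq> aa_gens"
    "Poly_Mapping.keys z \<subseteq> aa_gens" "s = Q.cls x" "s' = Q.cls y" "t = Q.cls z"
  moreover from this have "Poly_Mapping.keys (x + y) \<subseteq> aa_gens" using keys_add[of x y] by blast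
  ultimately show ?thesis by (simp add: cls_plus cls_mult lift2_gens lift2_add_right)
qed

lemma AB_mult_zero [simp]:
  "t \<in> carrier AB \<Longrightarrow> \<zero>\<^bsub>AB\<^esub> \<otimes>\<^bsub>AB\<^esub> t = \<zero>\<^bsub>AB\<^esub>"
  "t \<in> carrier AB \<Longrightarrow> t \<otimes>\<^bsub>AB\<^esub> \<zero>\<^bsub>AB\<^esub> = \<zero>\<^bsub>AB\<^esub>"
  by (elim carrierE, simp add: AB_simps(2) cls_mult)+

lemma AB_one_carrier: "\<one>\<^bsub>AB\<^esub> \<in> carrier AB"
  unfolding AB_simps(3) using A.bideg_one B.bideg_one by (rule tens_carrier)

text \<open>Additivity in each variable reduces the claim to pure tensors, where it is associativity
  in the two factors.\<close>

lemma AB_assoc: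
  assumes "s \<in> carrier AB" "t \<in> carrier AB" "u \<in> carrier AB"
  shows "(s \<otimes>\<^bsub>AB\<^esub> t) \<otimes>\<^bsub>AB\<^esub> u = s \<otimes>\<^bsub>AB\<^esub> (t \<otimes>\<^bsub>AB\<^esub> u)"
  using assms(1)
proof (induction rule: tens_induct)
  case (tens a b \<alpha> \<gamma> \<beta>)
  note ab = tens
  show ?case using assms(2)
  proof (induction rule: tens_induct)
    case (tens c d \<alpha>' \<gamma>' \<beta>')
    note cd = tens
    show ?case using assms(3)
    proof (induction rule: tens_induct)
      case (tens e f \<alpha>'' \<gamma>'' \<beta>'')
      show ?case
        using ab cd tens by (simp add: tens_mult[OF ab cd] tens_mult[OF cd tens]
            tens_mult[OF A.bideg_mult[OF ab(1) cd(1)] B.bideg_mult[OF ab(2) cd(2)] tens]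
            tens_mult[OF ab A.bideg_mult[OF cd(1) tens(1)] B.bideg_mult[OF cd(2) tens(2)]]
            A.m_assoc B.m_assoc A.bideg_carrier B.bideg_carrier)
    qed (use ab cd in \<open>simp_all add: tens_carrier AB_r_distr\<close>)
  qed (use ab assms in \<open>simp_all add: tens_carrier AB_l_distr AB_r_distr\<close>)
qed (use assms in \<open>simp_all add: AB_l_distr\<close>)

lemma AB_one_mult:
  assumes "t \<in> carrier AB"
  shows "\<one>\<^bsub>AB\<^esub> \<otimes>\<^bsub>AB\<^esub> t = t" "t \<otimes>\<^bsub>AB\<^esub> \<one>\<^bsub>AB\<^esub> = t"
proof -
  have "\<one>\<^bsub>AB\<^esub> \<otimes>\<^bsub>AB\<^esub> t = t \<and> t \<otimes>\<^bsub>AB\<^esub> \<one>\<^bsub>AB\<^esub> = t" using assms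
  proof (induction rule: tens_induct)
    case (tens a b \<alpha> \<gamma> \<beta>)
    then show ?case unfolding AB_simps(3)
      using tens_mult[OF tens A.bideg_one B.bideg_one] tens_mult[OF A.bideg_one B.bideg_one tens]
      by (simp add: A.bideg_carrier B.bideg_carrier)
  qed (simp_all add: AB_one_carrier AB_l_distr AB_r_distr)
  then show "\<one>\<^bsub>AB\<^esub> \<otimes>\<^bsub>AB\<^esub> t = t" "t \<otimes>\<^bsub>AB\<^esub> \<one>\<^bsub>AB\<^esub> = t" by auto
qed

lemma ring_AB: "ring AB"
proof (rule ringI)
  show "Group.monoid AB"
    by (rule Group.monoidI) (auto simp: AB_one_carrier AB_assoc AB_one_mult)
qed (auto simp: AB_l_distr AB_r_distr abelian_group_AB)

lemma bg_pair_self: "bg_pair A B" ..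

text \<open>Scalar multiplication of the tensor product is by definition an induced map, so its
  additivity and degree rules are instances of those for \<open>aa_map\<close>.\<close>

lemmas smult_map = aa_map_additive[OF bg_pair_self bg_pair_self A.left_map_smult right_map_id, folded AB_simps(9)]

lemma bg_alg_AB: "bg_alg AB"
proof -
  interpret R: ring AB by (rule ring_AB)
  note simps = smult_map A.bideg_smult tens_carrier
  have mod: "module Cring AB"
  proof (rule moduleI)
    show "cring Cring" by (rule cring_from_type_algebra)
    show "abelian_group AB" by (rule abelian_group_AB)
    fix c d t assume t: "t \<in> carrier AB"
    show "c \<odot>\<^bsub>AB\<^esub> t \<in> carrier AB" using smult_map(1)[OF t] .
    show "(c \<oplus>\<^bsub>Cring\<^esub> d) \<odot>\<^bsub>AB\<^esub> t = c \<odot>\<^bsub>AB\<^esub> t \<oplus>\<^bsub>AB\<^esub> d \<odot>\<^bsub>AB\<^esub> t"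
      using t
    proof (induction rule: tens_induct)
      case (tens a b \<alpha> \<gamma> \<beta>)
      then show ?case using A.smult_l_distr[of c d a]
        by (simp add: smult_map(4) A.bideg_carrier tens_add_left[OF A.bideg_smult[OF tens(1)] A.bideg_smult[OF tens(1)] tens(2)])
    next
      case (add s t)
      then show ?case by (simp add: smult_map(1,2) G.a_ac)
    qed (simp add: smult_map(3))
    show "(c \<otimes>\<^bsub>Cring\<^esub> d) \<odot>\<^bsub>AB\<^esub> t = c \<odot>\<^bsub>AB\<^esub> (d \<odot>\<^bsub>AB\<^esub> t)"
      using t
    proof (induction rule: tens_induct)
      case (tens a b \<alpha> \<gamma> \<beta>)
      then show ?case using A.smult_assoc1[of c d a] by (simp add: smult_map(4) A.bideg_carrier)
    next
      case (add s t)
      then show ?case by (simp add: smult_map(1,2))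
    qed (simp add: smult_map(3))
    show "\<one>\<^bsub>Cring\<^esub> \<odot>\<^bsub>AB\<^esub> t = t"
      using t
    proof (induction rule: tens_induct)
      case (tens a b \<alpha> \<gamma> \<beta>)
      then show ?case using A.smult_one[of a] by (simp add: smult_map(4) A.bideg_carrier)
    next
      case (add s t)
      then show ?case by (simp add: smult_map(1,2))
    qed (simp add: smult_map(3))
    fix s assume "s \<in> carrier AB"
    then show "c \<odot>\<^bsub>AB\<^esub> (t \<oplus>\<^bsub>AB\<^esub> s) = c \<odot>\<^bsub>AB\<^esub> t \<oplus>\<^bsub>AB\<^esub> c \<odot>\<^bsub>AB\<^esub> s"
      using t by (simp add: smult_map(2))
  qed
  have sm: "(c \<odot>\<^bsub>AB\<^esub> s) \<otimes>\<^bsub>AB\<^esub> t = c \<odot>\<^bsub>AB\<^esub> (s \<otimes>\<^bsub>AB\<^esub> t) \<and> s \<otimes>\<^bsub>AB\<^esub> (c \<odot>\<^bsub>AB\<^esub> t) = c \<odot>\<^bsub>AB\<^esub> (s \<otimes>\<^bsub>AB\<^esub> t)"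
    if s: "s \<in> carrier AB" and t: "t \<in> carrier AB" for s t c
    using s
  proof (induction rule: tens_induct)
    case (tens a b \<alpha> \<gamma> \<beta>)
    note ab = tens
    show ?case using t
    proof (induction rule: tens_induct)
      case (tens a' b' \<alpha>' \<gamma>' \<beta>')
      show ?case
        using ab tens tens_mult[OF ab A.bideg_smult[OF tens(1)] tens(2), of c]
          tens_mult[OF A.bideg_smult[OF ab(1)] ab(2) tens, of c]
        by (simp add: tens_mult[OF ab tens] smult_map(4) A.smult_mult_left A.smult_mult_right A.bideg_carrier)
    qed (use ab in \<open>simp_all add: smult_map(1-3) tens_carrier AB_r_distr\<close>)
  qed (use t in \<open>simp_all add: smult_map(1-3) AB_l_distr\<close>)
  have mult: "s \<otimes>\<^bsub>AB\<^esub> t \<in> bideg AB (\<alpha> + \<gamma>) (\<beta> + \<delta>)" if s: "s \<in> bideg AB \<alpha> \<beta>" and t: "t \<in> bideg AB \<gamma> \<delta>" for s t \<alpha> \<beta> \<gamma> \<delta>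
  proof -
    note car = additive_subgroup.a_Hcarr[OF bideg_AB_subgroup]
    note zero = additive_subgroup.zero_closed[OF bideg_AB_subgroup]
    note ad = additive_subgroup.a_closed[OF bideg_AB_subgroup]
    show ?thesis using s
    proof (induction rule: bideg_induct)
      case (tens a b \<kappa>)
      note ab = tens
      show ?case using t
      proof (induction rule: bideg_induct)
        case (tens a' b' \<kappa>')
        show ?case unfolding tens_mult[OF ab tens]
          by (rule tens_bideg[OF A.bideg_mult[OF ab(1) tens(1)] B.bideg_mult[OF ab(2) tens(2)]])
      qed (use ab in \<open>simp_all add: tens_carrier AB_r_distr zero car ad\<close>)
    qed (use t in \<open>simp_all add: AB_l_distr zero car ad\<close>)
  qed
  have lcomm: "lmom AB f \<otimes>\<^bsub>AB\<^esub> t = t \<otimes>\<^bsub>AB\<^esub> lmom AB (shift \<alpha> f)"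
    and rcomm: "rmom AB f \<otimes>\<^bsub>AB\<^esub> t = t \<otimes>\<^bsub>AB\<^esub> rmom AB (shift \<beta> f)" if t: "t \<in> bideg AB \<alpha> \<beta>" for t \<alpha> \<beta> f
  proof -
    have lc: "lmom AB f \<in> carrier AB" "rmom AB f \<in> carrier AB" for f unfolding AB_simps(4,5)
      by (rule tens_carrier[OF A.lmom_bideg B.bideg_one], rule tens_carrier[OF A.bideg_one B.rmom_bideg])
    note car = additive_subgroup.a_Hcarr[OF bideg_AB_subgroup]
    show "lmom AB f \<otimes>\<^bsub>AB\<^esub> t = t \<otimes>\<^bsub>AB\<^esub> lmom AB (shift \<alpha> f)" using t
    proof (induction rule: bideg_induct)
      case (tens a b \<gamma>)
      show ?case unfolding AB_simps(4)
        using tens_mult[OF A.lmom_bideg B.bideg_one tens, of f] tens_mult[OF tens A.lmom_bideg B.bideg_one, of "shift \<alpha> f"]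
          A.lmom_comm[OF tens(1), of f] B.bideg_carrier[OF tens(2)] by simp
    qed (use lc in \<open>simp_all add: AB_l_distr AB_r_distr car\<close>)
    show "rmom AB f \<otimes>\<^bsub>AB\<^esub> t = t \<otimes>\<^bsub>AB\<^esub> rmom AB (shift \<beta> f)" using t
    proof (induction rule: bideg_induct)
      case (tens a b \<gamma>)
      show ?case unfolding AB_simps(5)
        using tens_mult[OF A.bideg_one B.rmom_bideg tens, of f] tens_mult[OF tens A.bideg_one B.rmom_bideg, of "shift \<beta> f"]
          B.rmom_comm[OF tens(2), of f] A.bideg_carrier[OF tens(1)] by simp
    qed (use lc in \<open>simp_all add: AB_l_distr AB_r_distr car\<close>)
  qed
  show ?thesis
  proof (intro bg_alg.intro cx_algebra.intro mod ring_AB cx_algebra_axioms.intro bg_alg_axioms.intro)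
    show "\<one>\<^bsub>AB\<^esub> \<in> bideg AB 0 0" unfolding AB_simps(3)
      by (rule tens_bideg[OF A.bideg_one B.bideg_one])
    show "lmom AB f \<in> bideg AB 0 0" for f unfolding AB_simps(4)
      by (rule tens_bideg[OF A.lmom_bideg B.bideg_one])
    show "rmom AB f \<in> bideg AB 0 0" for f unfolding AB_simps(5)
      by (rule tens_bideg[OF A.bideg_one B.rmom_bideg])
    show "c \<odot>\<^bsub>AB\<^esub> t \<in> bideg AB \<alpha> \<beta>" if "t \<in> bideg AB \<alpha> \<beta>" for c t \<alpha> \<beta>
      using smult_map(5)[OF that] .
  qed (use sm bideg_AB_subgroup mult lcomm rcomm in auto)
qed

end

section \<open>Algebra maps induced on tensor products\<close>

lemma bg_pairI: "bg_alg A \<Longrightarrow> bg_alg B \<Longrightarrow> bg_pair A B"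
  by (simp add: bg_pair_def)

lemma h_algebra_hom_aa_map:
  assumes bg: "bg_alg A" "bg_alg B" "bg_alg A'" "bg_alg B'"
    and hom: "h_algebra_hom A A' \<phi>" "h_algebra_hom B B' \<psi>"
  shows "h_algebra_hom (aa_tensor A B) (aa_tensor A' B') (aa_map A' B' \<phi> \<psi>)"
proof -
  interpret S: bg_pair A B by (rule bg_pairI) fact+
  interpret D: bg_pair A' B' by (rule bg_pairI) fact+
  interpret SR: bg_alg S.AB by (rule S.bg_alg_AB)
  interpret DR: bg_alg D.AB by (rule D.bg_alg_AB)
  note map = aa_map_additive[OF S.bg_pair_self D.bg_pair_self h_algebra_hom_left_map(1)[OF bg(1) hom(1)]
      h_algebra_hom_left_map(2)[OF bg(2) hom(2)]]
  note \<phi> = h_algebra_hom_ring_hom[OF hom(1)] and \<psi> = h_algebra_hom_ring_hom[OF hom(2)]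
  have mult: "aa_map A' B' \<phi> \<psi> (s \<otimes>\<^bsub>S.AB\<^esub> t) = aa_map A' B' \<phi> \<psi> s \<otimes>\<^bsub>D.AB\<^esub> aa_map A' B' \<phi> \<psi> t"
    if s: "s \<in> carrier S.AB" and t: "t \<in> carrier S.AB" for s t
    using s
  proof (induction rule: S.tens_induct)
    case (tens a b \<alpha> \<gamma> \<beta>)
    note ab = tens
    note ab' = h_algebra_hom_bideg[OF hom(1) ab(1)] h_algebra_hom_bideg[OF hom(2) ab(2)]
    show ?case using t
    proof (induction rule: S.tens_induct)
      case (tens a' b' \<alpha>' \<gamma>' \<beta>')
      note cd' = h_algebra_hom_bideg[OF hom(1) tens(1)] h_algebra_hom_bideg[OF hom(2) tens(2)]
      show ?case
        using ab tens by (simp add: S.tens_mult[OF ab tens] map(4) D.tens_mult[OF ab' cd']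
            ring_hom_mult[OF \<phi>] ring_hom_mult[OF \<psi>] S.A.bideg_carrier S.B.bideg_carrier)
    next
      case (add s t)
      then show ?case using ab by (simp add: map(1,2) S.tens_carrier SR.r_distr DR.r_distr)
    qed (use ab in \<open>simp_all add: map(1,3) S.tens_carrier\<close>)
  next
    case (add s s')
    then show ?case using t by (simp add: map(1,2) SR.l_distr DR.l_distr)
  qed (use t in \<open>simp_all add: map(1,3)\<close>)
  have smult: "aa_map A' B' \<phi> \<psi> (c \<odot>\<^bsub>S.AB\<^esub> t) = c \<odot>\<^bsub>D.AB\<^esub> aa_map A' B' \<phi> \<psi> t" if "t \<in> carrier S.AB" for c t
    using that
  proof (induction rule: S.tens_induct)
    case (tens a b \<alpha> \<gamma> \<beta>)
    then show ?case using hom(1) S.A.bideg_carrier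
      by (simp add: map(4) S.smult_map(4) D.smult_map(4) h_algebra_hom_def)
  qed (simp_all add: map(1-3) S.smult_map(1-3) D.smult_map(1-3))
  show ?thesis
    unfolding h_algebra_hom_def
    using hom \<phi> \<psi>
    by (intro conjI ring_hom_memI allI ballI smult map(1,2) mult)
      (auto simp: S.AB_simps(3-5) D.AB_simps(3-5) map(4) h_algebra_hom_def ring_hom_one intro: map(5))
qed


subsection \<open>The associator\<close>

text \<open>The left entry x of an outer pure tensor is homogeneous and is decomposed inside its own
  component; this keeps the right degree of b equal to the left degree of c.\<close>

lemma tens3_induct [consumes 4, case_names zero tens add]:
  assumes "bg_alg A" "bg_alg B" "bg_alg C" "t \<in> carrier (aa_tensor (aa_tensor A B) C)"
    and zero: "P \<zero>\<^bsub>aa_tensor (aa_tensor A B) C\<^esub>"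
    and tens: "\<And>a b c \<alpha> \<beta> \<gamma> \<delta>. a \<in> bideg A \<alpha> \<beta> \<Longrightarrow> b \<in> bideg B \<beta> \<gamma> \<Longrightarrow> c \<in> bideg C \<gamma> \<delta> \<Longrightarrow>
      P (aa_tens (aa_tensor A B) C (aa_tens A B a b) c)"
    and add: "\<And>s t. s \<in> carrier (aa_tensor (aa_tensor A B) C) \<Longrightarrow> t \<in> carrier (aa_tensor (aa_tensor A B) C) \<Longrightarrow>
      P s \<Longrightarrow> P t \<Longrightarrow> P (s \<oplus>\<^bsub>aa_tensor (aa_tensor A B) C\<^esub> t)"
  shows "P t"
proof -
  interpret AB: bg_pair A B by (rule bg_pairI) fact+
  interpret C: bg_alg C by fact
  interpret AB_C: bg_pair AB.AB C by (rule bg_pairI[OF AB.bg_alg_AB]) fact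
  show ?thesis using assms(4)
  proof (induction rule: AB_C.tens_induct)
    case (tens x c \<alpha> \<gamma> \<delta>)
    note c = tens(2)
    show ?case using tens(1)
    proof (induction rule: AB.bideg_induct)
      case zero
      then show ?case using assms(5) AB_C.tens_zero_left[OF c] by simp
    next
      case (tens a b \<beta>)
      then show ?case using assms(6) c by blast
    next
      case (add s t)
      then show ?case
        using assms(7)[OF AB_C.tens_carrier[OF add(1) c] AB_C.tens_carrier[OF add(2) c]]
          AB_C.tens_add_left[OF add(1,2) c] by simp
    qed
  qed (use zero add in auto)
qed

text \<open>The map cannot be read off a representative of \<open>x \<otimes> c\<close> directly, since \<open>x\<close> is itself a class. For
  fixed \<open>c\<close> of left degree \<open>\<gamma>\<close> it is a map on the whole of \<open>A \<otimes> B\<close>, vanishing on the \<open>a \<otimes> b\<close> with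
  \<open>b\<close> of another right degree.\<close>

lemma associator:
  assumes "bg_alg A" "bg_alg B" "bg_alg C"
    and B_deg: "\<And>b \<beta> \<gamma> \<beta>' \<gamma>'. b \<in> bideg B \<beta> \<gamma> \<Longrightarrow> b \<in> bideg B \<beta>' \<gamma>' \<Longrightarrow> b \<noteq> \<zero>\<^bsub>B\<^esub> \<Longrightarrow> \<gamma> = \<gamma>'"
    and C_deg: "\<And>c \<gamma> \<delta> \<gamma>' \<delta>'. c \<in> bideg C \<gamma> \<delta> \<Longrightarrow> c \<in> bideg C \<gamma>' \<delta>' \<Longrightarrow> c \<noteq> \<zero>\<^bsub>C\<^esub> \<Longrightarrow> \<gamma> = \<gamma>'"
  obtains \<Phi> where "\<Phi> \<in> ring_hom (aa_tensor (aa_tensor A B) C) (aa_tensor A (aa_tensor B C))"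
    "\<And>a b c \<alpha> \<beta> \<gamma> \<delta>. a \<in> bideg A \<alpha> \<beta> \<Longrightarrow> b \<in> bideg B \<beta> \<gamma> \<Longrightarrow> c \<in> bideg C \<gamma> \<delta> \<Longrightarrow>
      \<Phi> (aa_tens (aa_tensor A B) C (aa_tens A B a b) c) = aa_tens A (aa_tensor B C) a (aa_tens B C b c)"
proof -
  interpret AB: bg_pair A B by (rule bg_pairI) fact+
  interpret BC: bg_pair B C by (rule bg_pairI) fact+
  interpret AB_C: bg_pair AB.AB C by (rule bg_pairI[OF AB.bg_alg_AB]) fact
  interpret A_BC: bg_pair A BC.AB by (rule bg_pairI[OF _ BC.bg_alg_AB]) fact
  interpret H: bg_alg A_BC.AB by (rule A_BC.bg_alg_AB)
  interpret L: bg_alg AB_C.AB by (rule AB_C.bg_alg_AB)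
  let ?AB = "AB.AB" and ?H = "A_BC.AB" and ?L = "AB_C.AB"
  define val where "val \<gamma> c a b = (if \<exists>\<beta>. b \<in> bideg B \<beta> \<gamma>
    then aa_tens A (aa_tensor B C) a (aa_tens B C b c) else \<zero>\<^bsub>?H\<^esub>)" for \<gamma> c a b
  have val_in: "val \<gamma> c a b = aa_tens A (aa_tensor B C) a (aa_tens B C b c)"
    if "b \<in> bideg B \<beta> \<gamma>" for \<gamma> c a b \<beta>
    using that by (auto simp: val_def)
  have val_out: "val \<gamma> c a b = \<zero>\<^bsub>?H\<^esub>"
    if "a \<in> bideg A \<alpha> \<beta>" "b \<in> bideg B \<beta> \<gamma>'" "c \<in> bideg C \<gamma> \<delta>" "\<gamma>' \<noteq> \<gamma>" for \<gamma> \<gamma>' c a b \<alpha> \<beta> \<delta>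
  proof (cases "\<exists>\<beta>. b \<in> bideg B \<beta> \<gamma>")
    case True
    \<comment> \<open>An element with two different right degrees is zero, so the two branches of
      \<open>val\<close> cannot conflict.\<close>
    then have b: "b = \<zero>\<^bsub>B\<^esub>" using B_deg that by blast
    show ?thesis unfolding val_def b
      using BC.tens_zero_left[OF that(3)] A_BC.tens_zero_right[OF that(1)] by simp
  qed (simp add: val_def)
  have triple: "aa_tens A (aa_tensor B C) a (aa_tens B C b c) \<in> carrier ?H"
    if "a \<in> bideg A \<alpha> \<beta>" "b \<in> bideg B \<beta> \<gamma>" "c \<in> bideg C \<gamma> \<delta>" for a b c \<alpha> \<beta> \<gamma> \<delta>
    by (rule A_BC.tens_carrier[OF that(1) BC.tens_bideg[OF that(2,3)]])
  have "\<exists>\<phi>. \<phi> \<in> hom (add_monoid ?AB) (add_monoid ?H) \<and>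
      (\<forall>\<alpha> \<beta> \<gamma>' a b. a \<in> bideg A \<alpha> \<beta> \<longrightarrow> b \<in> bideg B \<beta> \<gamma>' \<longrightarrow> \<phi> (aa_tens A B a b) = val \<gamma> c a b)"
    if c: "c \<in> bideg C \<gamma> \<delta>" for \<gamma> c \<delta>
  proof (rule AB.tensor_lift[where H = ?H and f = "val \<gamma> c"])
    show "abelian_group ?H" by (rule A_BC.abelian_group_AB)
    fix \<alpha> \<beta> \<gamma>' a b assume ab: "a \<in> bideg A \<alpha> \<beta>" "b \<in> bideg B \<beta> \<gamma>'"
    show "val \<gamma> c a b \<in> carrier ?H"
      using triple[OF ab(1)] val_in[of b \<beta> \<gamma>] val_out[OF ab c] ab c by (cases "\<gamma>' = \<gamma>") auto
    show "val \<gamma> c (a \<oplus>\<^bsub>A\<^esub> a') b = val \<gamma> c a b \<oplus>\<^bsub>?H\<^esub> val \<gamma> c a' b" if a': "a' \<in> bideg A \<alpha> \<beta>" for a'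
    proof (cases "\<gamma>' = \<gamma>")
      case True
      with ab have b: "b \<in> bideg B \<beta> \<gamma>" by simp
      show ?thesis unfolding val_in[OF b]
        by (rule A_BC.tens_add_left[OF ab(1) a' BC.tens_bideg[OF b c]])
    next
      case False
      show ?thesis
        using val_out[OF ab c False] val_out[OF a' ab(2) c False]
          val_out[OF AB.A.bideg_add[OF ab(1) a'] ab(2) c False] by simp
    qed
    show "val \<gamma> c a (b \<oplus>\<^bsub>B\<^esub> b') = val \<gamma> c a b \<oplus>\<^bsub>?H\<^esub> val \<gamma> c a b'" if b': "b' \<in> bideg B \<beta> \<gamma>'" for b'
    proof (cases "\<gamma>' = \<gamma>")
      case True
      with ab b' have b: "b \<in> bideg B \<beta> \<gamma>" "b' \<in> bideg B \<beta> \<gamma>" by simp_all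
      show ?thesis
        unfolding val_in[OF b(1)] val_in[OF b(2)] val_in[OF AB.B.bideg_add[OF b]] BC.tens_add_left[OF b c]
        by (rule A_BC.tens_add_right[OF ab(1) BC.tens_bideg[OF b(1) c] BC.tens_bideg[OF b(2) c]])
    next
      case False
      show ?thesis
        using val_out[OF ab c False] val_out[OF ab(1) b' c False]
          val_out[OF ab(1) AB.B.bideg_add[OF ab(2) b'] c False] by simp
    qed
    fix f
    show "val \<gamma> c (rmom A f \<otimes>\<^bsub>A\<^esub> a) b = val \<gamma> c a (lmom B f \<otimes>\<^bsub>B\<^esub> b)"
    proof (cases "\<gamma>' = \<gamma>")
      case True
      with ab have b: "b \<in> bideg B \<beta> \<gamma>" by simp
      have "aa_tens B C (lmom B f \<otimes>\<^bsub>B\<^esub> b) c = lmom BC.AB f \<otimes>\<^bsub>BC.AB\<^esub> aa_tens B C b c"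
        unfolding BC.AB_simps(4) using BC.tens_mult[OF AB.B.lmom_bideg BC.B.bideg_one b c]
        by (simp add: BC.B.bideg_carrier[OF c])
      then show ?thesis unfolding val_in[OF b] val_in[OF AB.B.lmom_mult_bideg[OF b]]
        using A_BC.tens_balance[OF ab(1) BC.tens_bideg[OF b c]] by simp
    next
      case False
      show ?thesis
        using val_out[OF AB.A.rmom_mult_bideg[OF ab(1)] ab(2) c False]
          val_out[OF ab(1) AB.B.lmom_mult_bideg[OF ab(2)] c False] by simp
    qed
  qed blast
  note ex_\<phi> = this
  \<comment> \<open>Existence is known separately for each c, while the outer lift requires a
    function of c; hence the choice.\<close>
  define \<phi> where "\<phi> \<gamma> c = (SOME \<phi>. \<phi> \<in> hom (add_monoid ?AB) (add_monoid ?H) \<and>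
      (\<forall>\<alpha> \<beta> \<gamma>' a b. a \<in> bideg A \<alpha> \<beta> \<longrightarrow> b \<in> bideg B \<beta> \<gamma>' \<longrightarrow> \<phi> (aa_tens A B a b) = val \<gamma> c a b))" for \<gamma> c
  have \<phi>: "\<phi> \<gamma> c \<in> hom (add_monoid ?AB) (add_monoid ?H) \<and>
      (\<forall>\<alpha> \<beta> \<gamma>' a b. a \<in> bideg A \<alpha> \<beta> \<longrightarrow> b \<in> bideg B \<beta> \<gamma>' \<longrightarrow> \<phi> \<gamma> c (aa_tens A B a b) = val \<gamma> c a b)"
    if "c \<in> bideg C \<gamma> \<delta>" for \<gamma> c \<delta>
    unfolding \<phi>_def by (rule someI_ex[OF ex_\<phi>[OF that]])
  have \<phi>_add: "\<phi> \<gamma> c (s \<oplus>\<^bsub>?AB\<^esub> t) = \<phi> \<gamma> c s \<oplus>\<^bsub>?H\<^esub> \<phi> \<gamma> c t"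
    and \<phi>_closed: "\<phi> \<gamma> c s \<in> carrier ?H"
    if "c \<in> bideg C \<gamma> \<delta>" "s \<in> carrier ?AB" "t \<in> carrier ?AB" for \<gamma> c \<delta> s t
    using \<phi>[OF that(1)] that(2,3) by (auto simp: hom_def Pi_iff)
  have \<phi>_zero: "\<phi> \<gamma> c \<zero>\<^bsub>?AB\<^esub> = \<zero>\<^bsub>?H\<^esub>" if "c \<in> bideg C \<gamma> \<delta>" for \<gamma> c \<delta>
    using \<phi>_add[OF that AB.G.zero_closed AB.G.zero_closed] \<phi>_closed[OF that AB.G.zero_closed AB.G.zero_closed] by simp
  have \<phi>_tens: "\<phi> \<gamma> c (aa_tens A B a b) = aa_tens A (aa_tensor B C) a (aa_tens B C b c)"
    if "a \<in> bideg A \<alpha> \<beta>" "b \<in> bideg B \<beta> \<gamma>" "c \<in> bideg C \<gamma> \<delta>" for \<gamma> c \<delta> a b \<alpha> \<beta>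
    using conjunct2[OF \<phi>[OF that(3)]] that(1,2) val_in[OF that(2)] by auto
  note carAB = additive_subgroup.a_Hcarr[OF AB.bideg_AB_subgroup]
  have \<phi>_add_right: "\<phi> \<gamma> (c \<oplus>\<^bsub>C\<^esub> c') x = \<phi> \<gamma> c x \<oplus>\<^bsub>?H\<^esub> \<phi> \<gamma> c' x"
    if x: "x \<in> bideg ?AB \<alpha> \<gamma>" and c: "c \<in> bideg C \<gamma> \<delta>" "c' \<in> bideg C \<gamma> \<delta>" for \<gamma> c c' \<delta> x \<alpha>
    using x
  proof (induction rule: AB.bideg_induct)
    case zero
    then show ?case using \<phi>_zero c AB.A.bideg_add BC.B.bideg_add[OF c] by simp
  next
    case (tens a b \<beta>)
    show ?case
      unfolding \<phi>_tens[OF tens c(1)] \<phi>_tens[OF tens c(2)] \<phi>_tens[OF tens BC.B.bideg_add[OF c]]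
        BC.tens_add_right[OF tens(2) c]
      by (rule A_BC.tens_add_right[OF tens(1) BC.tens_bideg[OF tens(2) c(1)] BC.tens_bideg[OF tens(2) c(2)]])
  next
    case (add s t)
    note st = carAB[OF add(1)] carAB[OF add(2)]
    show ?case
      using add(3,4) \<phi>_closed[OF c(1) st] \<phi>_closed[OF c(2) st] \<phi>_closed[OF c(1) st(2,1)] \<phi>_closed[OF c(2) st(2,1)]
      by (simp add: \<phi>_add[OF c(1) st] \<phi>_add[OF c(2) st] \<phi>_add[OF BC.B.bideg_add[OF c] st] A_BC.G.a_ac)
  qed
  have \<phi>_null: "\<phi> \<gamma> \<zero>\<^bsub>C\<^esub> x = \<zero>\<^bsub>?H\<^esub>" if x: "x \<in> bideg ?AB \<alpha> \<gamma>" for \<gamma> x \<alpha>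
    using \<phi>_add_right[OF x BC.B.bideg_zero BC.B.bideg_zero]
      \<phi>_closed[OF BC.B.bideg_zero carAB[OF x] carAB[OF x]] by simp
  \<comment> \<open>Zero lies in every component, so c determines its left degree only when nonzero.
    The value zero at c = 0 agrees with every \<open>\<phi> \<gamma>\<close> by
    \<open>\<phi>_null\<close>.\<close>
  define F where "F x c = (if c = \<zero>\<^bsub>C\<^esub> then \<zero>\<^bsub>?H\<^esub> else \<phi> (THE \<gamma>. \<exists>\<delta>. c \<in> bideg C \<gamma> \<delta>) c x)" for x c
  have F: "F x c = \<phi> \<gamma> c x" if x: "x \<in> bideg ?AB \<alpha> \<gamma>" and c: "c \<in> bideg C \<gamma> \<delta>" for x c \<alpha> \<gamma> \<delta>
  proof (cases "c = \<zero>\<^bsub>C\<^esub>")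
    case False
    have "(THE \<gamma>. \<exists>\<delta>. c \<in> bideg C \<gamma> \<delta>) = \<gamma>"
      using C_deg[OF c _ False] c by (intro the_equality) blast+
    then show ?thesis using False by (simp add: F_def)
  qed (simp add: F_def \<phi>_null[OF x])
  obtain \<Phi> where \<Phi>: "\<Phi> \<in> hom (add_monoid ?L) (add_monoid ?H)"
    "\<And>\<alpha> \<gamma> \<beta> x c. x \<in> bideg ?AB \<alpha> \<gamma> \<Longrightarrow> c \<in> bideg C \<gamma> \<beta> \<Longrightarrow> \<Phi> (aa_tens ?AB C x c) = F x c"
  proof (rule AB_C.tensor_lift[where H = ?H and f = F])
    show "abelian_group ?H" by (rule A_BC.abelian_group_AB)
    fix \<alpha> \<gamma> \<delta> x c assume xc: "x \<in> bideg ?AB \<alpha> \<gamma>" "c \<in> bideg C \<gamma> \<delta>"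
    show "F x c \<in> carrier ?H" using F[OF xc] \<phi>_closed[OF xc(2) carAB[OF xc(1)] carAB[OF xc(1)]] by simp
    show "F (x \<oplus>\<^bsub>?AB\<^esub> x') c = F x c \<oplus>\<^bsub>?H\<^esub> F x' c" if x': "x' \<in> bideg ?AB \<alpha> \<gamma>" for x'
      using F[OF xc] F[OF x' xc(2)] F[OF additive_subgroup.a_closed[OF AB.bideg_AB_subgroup xc(1) x'] xc(2)]
        \<phi>_add[OF xc(2) carAB[OF xc(1)] carAB[OF x']] by simp
    show "F x (c \<oplus>\<^bsub>C\<^esub> c') = F x c \<oplus>\<^bsub>?H\<^esub> F x c'" if c': "c' \<in> bideg C \<gamma> \<delta>" for c'
      using F[OF xc] F[OF xc(1) c'] F[OF xc(1) BC.B.bideg_add[OF xc(2) c']] \<phi>_add_right[OF xc c'] by simp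
    fix f
    have fc: "lmom C f \<otimes>\<^bsub>C\<^esub> c \<in> bideg C \<gamma> \<delta>" by (rule BC.B.lmom_mult_bideg[OF xc(2)])
    have fx: "rmom ?AB f \<otimes>\<^bsub>?AB\<^esub> x \<in> bideg ?AB \<alpha> \<gamma>" if "x \<in> bideg ?AB \<alpha> \<gamma>" for x
      by (rule bg_alg.rmom_mult_bideg[OF AB.bg_alg_AB that])
    \<comment> \<open>The right moment map of A \<otimes> B acts on b alone, so outer balancing
      becomes balancing of b against c.\<close>
    have "\<phi> \<gamma> c (rmom ?AB f \<otimes>\<^bsub>?AB\<^esub> x) = \<phi> \<gamma> (lmom C f \<otimes>\<^bsub>C\<^esub> c) x"
      using xc(1)
    proof (induction rule: AB.bideg_induct)
      case zero
      have "rmom ?AB f \<in> carrier ?AB" by (rule bg_alg.rmom_carrier[OF AB.bg_alg_AB])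
      then show ?case by (simp add: \<phi>_zero[OF xc(2)] \<phi>_zero[OF fc])
    next
      case (tens a b \<beta>)
      have "rmom ?AB f \<otimes>\<^bsub>?AB\<^esub> aa_tens A B a b = aa_tens A B a (rmom B f \<otimes>\<^bsub>B\<^esub> b)"
        unfolding AB.AB_simps(5) using AB.tens_mult[OF AB.A.bideg_one AB.B.rmom_bideg tens]
        by (simp add: AB.A.bideg_carrier[OF tens(1)])
      then show ?case
        using \<phi>_tens[OF tens(1) AB.B.rmom_mult_bideg[OF tens(2)] xc(2)] \<phi>_tens[OF tens fc]
          BC.tens_balance[OF tens(2) xc(2)] by simp
    next
      case (add s t)
      note st = carAB[OF add(1)] carAB[OF add(2)]
      have "rmom ?AB f \<in> carrier ?AB" by (rule bg_alg.rmom_carrier[OF AB.bg_alg_AB])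
      then show ?case
        using add(3,4) st \<phi>_add[OF fc st] \<phi>_add[OF xc(2) carAB[OF fx[OF add(1)]] carAB[OF fx[OF add(2)]]]
        by (simp add: AB.AB_r_distr)
    qed
    then show "F (rmom ?AB f \<otimes>\<^bsub>?AB\<^esub> x) c = F x (lmom C f \<otimes>\<^bsub>C\<^esub> c)"
      using F[OF fx[OF xc(1)] xc(2)] F[OF xc(1) fc] by simp
  qed (use that in blast)
  have pure: "\<Phi> (aa_tens ?AB C (aa_tens A B a b) c) = aa_tens A (aa_tensor B C) a (aa_tens B C b c)"
    if "a \<in> bideg A \<alpha> \<beta>" "b \<in> bideg B \<beta> \<gamma>" "c \<in> bideg C \<gamma> \<delta>" for a b c \<alpha> \<beta> \<gamma> \<delta>
    using \<Phi>(2)[OF AB.tens_bideg[OF that(1,2)] that(3)] F[OF AB.tens_bideg[OF that(1,2)] that(3)] \<phi>_tens[OF that]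
    by simp
  have closed: "\<Phi> t \<in> carrier ?H" and add: "\<Phi> (s \<oplus>\<^bsub>?L\<^esub> t) = \<Phi> s \<oplus>\<^bsub>?H\<^esub> \<Phi> t"
    if "s \<in> carrier ?L" "t \<in> carrier ?L" for s t
    using \<Phi>(1) that by (auto simp: hom_def Pi_iff)
  have zero: "\<Phi> \<zero>\<^bsub>?L\<^esub> = \<zero>\<^bsub>?H\<^esub>"
    using add[OF AB_C.G.zero_closed AB_C.G.zero_closed] closed[OF AB_C.G.zero_closed AB_C.G.zero_closed] by simp
  have ltriple: "aa_tens ?AB C (aa_tens A B a b) c \<in> carrier ?L"
    if "a \<in> bideg A \<alpha> \<beta>" "b \<in> bideg B \<beta> \<gamma>" "c \<in> bideg C \<gamma> \<delta>" for a b c \<alpha> \<beta> \<gamma> \<delta>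
    by (rule AB_C.tens_carrier[OF AB.tens_bideg[OF that(1,2)] that(3)])
  \<comment> \<open>Products of triple pure tensors are formed factor by factor on both sides, so
    the values already known on pure tensors settle the claim up to additivity.\<close>
  have mult: "\<Phi> (s \<otimes>\<^bsub>?L\<^esub> t) = \<Phi> s \<otimes>\<^bsub>?H\<^esub> \<Phi> t" if s: "s \<in> carrier ?L" and t: "t \<in> carrier ?L" for s t
    using assms(1-3) s
  proof (induction s rule: tens3_induct)
    case (tens a b c \<alpha> \<beta> \<gamma> \<delta>)
    note abc = tens
    show ?case using assms(1-3) t
    proof (induction t rule: tens3_induct)
      case (tens a' b' c' \<alpha>' \<beta>' \<gamma>' \<delta>')
      show ?case
        unfolding pure[OF abc] pure[OF tens]
          AB_C.tens_mult[OF AB.tens_bideg[OF abc(1,2)] abc(3) AB.tens_bideg[OF tens(1,2)] tens(3)]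
          A_BC.tens_mult[OF abc(1) BC.tens_bideg[OF abc(2,3)] tens(1) BC.tens_bideg[OF tens(2,3)]]
          AB.tens_mult[OF abc(1,2) tens(1,2)] BC.tens_mult[OF abc(2,3) tens(2,3)]
        by (rule pure[OF AB.A.bideg_mult[OF abc(1) tens(1)] AB.B.bideg_mult[OF abc(2) tens(2)]
              BC.B.bideg_mult[OF abc(3) tens(3)]])
    next
      case (add u v)
      then show ?case using ltriple[OF abc] by (simp add: L.r_distr H.r_distr \<open>\<And>s t. s \<in> carrier ?L \<Longrightarrow> t \<in> carrier ?L \<Longrightarrow> \<Phi> (s \<oplus>\<^bsub>?L\<^esub> t) = \<Phi> s \<oplus>\<^bsub>?H\<^esub> \<Phi> t\<close> closed)
    qed (use ltriple[OF abc] in \<open>simp add: zero closed\<close>)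
  next
    case (add u v)
    then show ?case using t by (simp add: L.l_distr H.l_distr \<open>\<And>s t. s \<in> carrier ?L \<Longrightarrow> t \<in> carrier ?L \<Longrightarrow> \<Phi> (s \<oplus>\<^bsub>?L\<^esub> t) = \<Phi> s \<oplus>\<^bsub>?H\<^esub> \<Phi> t\<close> closed)
  qed (use t in \<open>simp add: zero closed\<close>)
  have "\<Phi> \<in> ring_hom ?L ?H"
    by (rule ring_hom_memI)
      (use closed mult add pure[OF AB.A.bideg_one AB.B.bideg_one BC.B.bideg_one] in
        \<open>simp_all add: AB_C.AB_simps(3) AB.AB_simps(3) BC.AB_simps(3) A_BC.AB_simps(3)\<close>)
  then show thesis using that[of \<Phi>] pure by blast
qed

subsection \<open>Graded algebras as bigraded algebras\<close>

text \<open>A graded algebra becomes bigraded by concentrating the second degree in \<open>0\<close>. Its right moment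
  map plays no role and is set to zero, which satisfies the required commutation for every degree.\<close>

definition as_halg :: "('n::finite, 'v, 'm) hspace_scheme \<Rightarrow> ('n, 'v) halg"
  where "as_halg V = \<lparr>
    carrier = carrier V,
    monoid.mult = (\<otimes>\<^bsub>V\<^esub>),
    one = \<one>\<^bsub>V\<^esub>,
    zero = \<zero>\<^bsub>V\<^esub>,
    add = (\<oplus>\<^bsub>V\<^esub>),
    smult = (\<lambda>c v. mero_const c \<odot>\<^bsub>V\<^esub> v),
    bideg = (\<lambda>\<alpha> \<beta>. if \<beta> = 0 then deg V \<alpha> else {\<zero>\<^bsub>V\<^esub>}),
    lmom = (\<lambda>f. f \<odot>\<^bsub>V\<^esub> \<one>\<^bsub>V\<^esub>),
    rmom = (\<lambda>f. \<zero>\<^bsub>V\<^esub>)\<rparr>"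

lemma as_halg_simps [simp]:
  "carrier (as_halg V) = carrier V" "monoid.mult (as_halg V) = monoid.mult V" "one (as_halg V) = one V"
  "zero (as_halg V) = zero V" "add (as_halg V) = add V" "c \<odot>\<^bsub>as_halg V\<^esub> v = mero_const c \<odot>\<^bsub>V\<^esub> v"
  "bideg (as_halg V) \<alpha> \<beta> = (if \<beta> = 0 then deg V \<alpha> else {\<zero>\<^bsub>V\<^esub>})"
  "lmom (as_halg V) f = f \<odot>\<^bsub>V\<^esub> \<one>\<^bsub>V\<^esub>" "rmom (as_halg V) f = \<zero>\<^bsub>V\<^esub>"
  by (simp_all add: as_halg_def)

text \<open>The second condition makes the action of f left multiplication by its image in V, so
  that balancing over the space V is balancing over V as a bigraded algebra.\<close>

definition gr_alg :: "('n::finite, 'v, 'm) hspace_scheme \<Rightarrow> bool"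
  where "gr_alg V \<longleftrightarrow> bg_alg (as_halg V) \<and> (\<forall>f. \<forall>v\<in>carrier V. f \<odot>\<^bsub>V\<^esub> v = (f \<odot>\<^bsub>V\<^esub> \<one>\<^bsub>V\<^esub>) \<otimes>\<^bsub>V\<^esub> v)"

text \<open>Used in both directions. The two families of components are not literally equal, since
  the bigraded reading adds components {0}, but each component is contained in one of the other
  family.\<close>

lemma tensor_rels_mono:
  assumes "\<And>U W. (U, W) \<in> S \<Longrightarrow> \<exists>U' W'. (U', W') \<in> S' \<and> U \<subseteq> U' \<and> W \<subseteq> W' \<and> (\<forall>f. \<forall>b\<in>W. l f b = l' f b)"
    and add: "add B = add B'"
  shows "tensor_rels A B r l S \<subseteq> tensor_rels A B' r l' S'"
proof
  fix x assume "x \<in> tensor_rels A B r l S"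
  then consider U W a a' b where "(U, W) \<in> S" "a \<in> U" "a' \<in> U" "b \<in> W"
      "x = frag_of (a \<oplus>\<^bsub>A\<^esub> a', b) - frag_of (a, b) - frag_of (a', b)"
    | U W a b b' where "(U, W) \<in> S" "a \<in> U" "b \<in> W" "b' \<in> W"
      "x = frag_of (a, b \<oplus>\<^bsub>B\<^esub> b') - frag_of (a, b) - frag_of (a, b')"
    | U W f a b where "(U, W) \<in> S" "a \<in> U" "b \<in> W" "x = frag_of (r f a, b) - frag_of (a, l f b)"
    unfolding tensor_rels_def by (elim UnE) fast+
  then show "x \<in> tensor_rels A B' r l' S'"
  proof cases
    case (1 U W a a' b)
    with assms(1)[OF 1(1)] obtain U' W' where "(U', W') \<in> S'" "a \<in> U'" "a' \<in> U'" "b \<in> W'" by blast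
    with 1(5) show ?thesis unfolding tensor_rels_def by blast
  next
    case (2 U W a b b')
    with assms(1)[OF 2(1)] obtain U' W' where "(U', W') \<in> S'" "a \<in> U'" "b \<in> W'" "b' \<in> W'" by blast
    with 2(5) show ?thesis unfolding tensor_rels_def add by blast
  next
    case (3 U W f a b)
    with assms(1)[OF 3(1)] obtain U' W' where "(U', W') \<in> S'" "a \<in> U'" "b \<in> W'" "l f b = l' f b" by blast
    with 3(4) have "(U', W') \<in> S' \<and> a \<in> U' \<and> b \<in> W' \<and> x = frag_of (r f a, b) - frag_of (a, l' f b)" by simp
    then show ?thesis unfolding tensor_rels_def by blast
  qed
qed

lemma tensor_gens_mono:
  assumes "\<And>U W. (U, W) \<in> S \<Longrightarrow> \<exists>U' W'. (U', W') \<in> S' \<and> U \<subseteq> U' \<and> W \<subseteq> W'"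
  shows "tensor_gens S \<subseteq> tensor_gens S'"
proof
  fix p assume "p \<in> tensor_gens S"
  then obtain U W where UW: "(U, W) \<in> S" "p \<in> U \<times> W" unfolding tensor_gens_def by blast
  with assms[OF UW(1)] obtain U' W' where "(U', W') \<in> S'" "p \<in> U' \<times> W'" by blast
  then show "p \<in> tensor_gens S'" unfolding tensor_gens_def by blast
qed

text \<open>Under these hypotheses the constructions for a graded space coincide with those for its
  bigraded reading, so that \<open>av_tensor\<close> inherits the theory of
  \<open>aa_tensor\<close>.\<close>

locale av_pair =
  fixes A :: "('n::finite, 'a, 'm) halg_scheme" and V :: "('n, 'v, 'k) hspace_scheme"
  assumes bg_A: "bg_alg A" and gr_V: "gr_alg V"
begin

sublocale P: bg_pair A "as_halg V"
  using bg_A gr_V by (intro bg_pairI) (simp_all add: gr_alg_def)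

lemma smult_mult: "v \<in> carrier V \<Longrightarrow> f \<odot>\<^bsub>V\<^esub> v = (f \<odot>\<^bsub>V\<^esub> \<one>\<^bsub>V\<^esub>) \<otimes>\<^bsub>V\<^esub> v"
  using gr_V unfolding gr_alg_def by blast

lemma deg_carrier: "v \<in> deg V \<alpha> \<Longrightarrow> v \<in> carrier V"
  using P.B.bideg_carrier[of v \<alpha> 0] by simp

lemma zero_deg: "\<zero>\<^bsub>V\<^esub> \<in> deg V \<alpha>"
  using P.B.bideg_zero[of \<alpha> 0] by simp

text \<open>A component {0} of \<open>as_halg V\<close> lies in every \<open>deg V \<gamma>\<close>;
  conversely \<open>deg V \<gamma>\<close> is the component of second degree 0.\<close>

lemma comps_le:
  "(U, W) \<in> aa_comps A (as_halg V) \<Longrightarrow> \<exists>U' W'. (U', W') \<in> av_comps A V \<and> U \<subseteq> U' \<and> W \<subseteq> W' \<and> W' \<subseteq> carrier V"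
  "(U, W) \<in> av_comps A V \<Longrightarrow> \<exists>U' W'. (U', W') \<in> aa_comps A (as_halg V) \<and> U \<subseteq> U' \<and> W \<subseteq> W' \<and> W' \<subseteq> carrier V"
proof -
  assume "(U, W) \<in> aa_comps A (as_halg V)"
  then obtain \<alpha> \<beta> \<gamma> where *: "U = bideg A \<alpha> \<gamma>" "W = bideg (as_halg V) \<gamma> \<beta>" by (auto simp: aa_comps_def)
  have "(bideg A \<alpha> \<gamma>, deg V \<gamma>) \<in> av_comps A V" by (auto simp: av_comps_def)
  moreover have "W \<subseteq> deg V \<gamma>" using * zero_deg by auto
  moreover have "deg V \<gamma> \<subseteq> carrier V" using deg_carrier by blast
  ultimately show "\<exists>U' W'. (U', W') \<in> av_comps A V \<and> U \<subseteq> U' \<and> W \<subseteq> W' \<and> W' \<subseteq> carrier V"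
    using *(1) by (intro exI[of _ "bideg A \<alpha> \<gamma>"] exI[of _ "deg V \<gamma>"]) simp
next
  assume "(U, W) \<in> av_comps A V"
  then obtain \<alpha> \<gamma> where *: "U = bideg A \<alpha> \<gamma>" "W = deg V \<gamma>" by (auto simp: av_comps_def)
  have "(bideg A \<alpha> \<gamma>, bideg (as_halg V) \<gamma> 0) \<in> aa_comps A (as_halg V)" unfolding aa_comps_def by blast
  moreover have "deg V \<gamma> \<subseteq> carrier V" using deg_carrier by blast
  ultimately show "\<exists>U' W'. (U', W') \<in> aa_comps A (as_halg V) \<and> U \<subseteq> U' \<and> W \<subseteq> W' \<and> W' \<subseteq> carrier V"
    using * by (intro exI[of _ "bideg A \<alpha> \<gamma>"] exI[of _ "bideg (as_halg V) \<gamma> 0"]) simp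
qed

lemma av_gens_eq: "tensor_gens (av_comps A V) = tensor_gens (aa_comps A (as_halg V))"
proof (rule subset_antisym)
  show "tensor_gens (av_comps A V) \<subseteq> tensor_gens (aa_comps A (as_halg V))"
    by (rule tensor_gens_mono) (use comps_le(2) in metis)
  show "tensor_gens (aa_comps A (as_halg V)) \<subseteq> tensor_gens (av_comps A V)"
    by (rule tensor_gens_mono) (use comps_le(1) in metis)
qed

lemma av_free_eq: "av_free A V = aa_free A (as_halg V)"
  by (simp add: av_free_def aa_free_def av_gens_eq)

lemma av_rels_eq: "tensor_rels A V (\<lambda>f a. rmom A f \<otimes>\<^bsub>A\<^esub> a) (\<lambda>f v. f \<odot>\<^bsub>V\<^esub> v) (av_comps A V)
    = tensor_rels A (as_halg V) (\<lambda>f a. rmom A f \<otimes>\<^bsub>A\<^esub> a) (\<lambda>f v. lmom (as_halg V) f \<otimes>\<^bsub>as_halg V\<^esub> v) (aa_comps A (as_halg V))"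
proof (rule subset_antisym; rule tensor_rels_mono)
  fix U W assume "(U, W) \<in> av_comps A V"
  from comps_le(2)[OF this] show "\<exists>U' W'. (U', W') \<in> aa_comps A (as_halg V) \<and> U \<subseteq> U' \<and> W \<subseteq> W' \<and>
      (\<forall>f. \<forall>b\<in>W. f \<odot>\<^bsub>V\<^esub> b = lmom (as_halg V) f \<otimes>\<^bsub>as_halg V\<^esub> b)"
    using smult_mult by (metis as_halg_simps(2,8) subsetD)
next
  fix U W assume "(U, W) \<in> aa_comps A (as_halg V)"
  from comps_le(1)[OF this] show "\<exists>U' W'. (U', W') \<in> av_comps A V \<and> U \<subseteq> U' \<and> W \<subseteq> W' \<and>
      (\<forall>f. \<forall>b\<in>W. lmom (as_halg V) f \<otimes>\<^bsub>as_halg V\<^esub> b = f \<odot>\<^bsub>V\<^esub> b)"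
    using smult_mult by (metis as_halg_simps(2,8) subsetD)
qed simp_all

lemma av_null_eq: "av_null A V = aa_null A (as_halg V)"
  by (simp add: av_null_def aa_null_def av_free_eq av_rels_eq)

lemma av_tens_eq: "av_tens A V = aa_tens A (as_halg V)"
  by (intro ext) (simp add: av_tens_def aa_tens_def av_free_eq av_null_eq)

lemma av_map_eq: "av_map A V = aa_map A (as_halg V)"
  by (intro ext) (simp add: av_map_def aa_map_def av_free_eq av_null_eq)

lemma av_tensor_simps:
  "carrier (av_tensor A V) = carrier (aa_tensor A (as_halg V))"
  "monoid.mult (av_tensor A V) = monoid.mult (aa_tensor A (as_halg V))"
  "one (av_tensor A V) = one (aa_tensor A (as_halg V))"
  "zero (av_tensor A V) = zero (aa_tensor A (as_halg V))"
  "add (av_tensor A V) = add (aa_tensor A (as_halg V))"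
  "deg (av_tensor A V) \<alpha> = bideg (aa_tensor A (as_halg V)) \<alpha> 0"
  "f \<odot>\<^bsub>av_tensor A V\<^esub> t = aa_map A (as_halg V) (\<lambda>a. lmom A f \<otimes>\<^bsub>A\<^esub> a) id t"
  by (simp_all add: av_tensor_def aa_tensor_def av_free_eq av_null_eq av_tens_eq av_map_eq)

lemmas smult_map = aa_map_additive[OF P.bg_pair_self P.bg_pair_self left_map_lmom[OF bg_A] right_map_id,
    folded av_tensor_simps(7)]

text \<open>The action of functions on A \<otimes> V, given as an induced map, becomes a
  multiplication; linearity over functions can then be deduced from multiplicativity.\<close>

lemma av_smult:
  assumes "t \<in> carrier P.AB"
  shows "f \<odot>\<^bsub>av_tensor A V\<^esub> t = lmom P.AB f \<otimes>\<^bsub>P.AB\<^esub> t"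
  using assms
proof (induction rule: P.tens_induct)
  case zero
  have "lmom P.AB f \<in> carrier P.AB" by (rule bg_alg.lmom_carrier[OF P.bg_alg_AB])
  then show ?case by (simp add: smult_map(3))
next
  case (tens a v \<alpha> \<gamma> \<beta>)
  have "lmom P.AB f \<otimes>\<^bsub>P.AB\<^esub> aa_tens A (as_halg V) a v = aa_tens A (as_halg V) (lmom A f \<otimes>\<^bsub>A\<^esub> a) v"
    unfolding P.AB_simps(4) P.tens_mult[OF P.A.lmom_bideg P.B.bideg_one tens]
    using P.B.l_one[OF P.B.bideg_carrier[OF tens(2)]] by simp
  then show ?case by (simp add: smult_map(4))
next
  case (add s t)
  have "lmom P.AB f \<in> carrier P.AB" by (rule bg_alg.lmom_carrier[OF P.bg_alg_AB])
  with add show ?case by (simp add: smult_map(2) P.AB_r_distr)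
qed

text \<open>Equality of records makes A \<otimes> (A \<otimes> V) a product of the same kind, to
  which everything applies again. The condition on \<open>smult A\<close> reconciles two scalar
  actions: \<open>as_halg\<close> lets scalars act as constant functions, hence through
  \<open>lmom\<close>, while \<open>aa_tensor\<close> uses the scalars of A.\<close>

lemma as_halg_av:
  assumes smult: "\<And>c. smult A c = (\<lambda>a. lmom A (mero_const c) \<otimes>\<^bsub>A\<^esub> a)"
  shows "as_halg (av_tensor A V) = aa_tensor A (as_halg V)"
proof (rule halg.equality)
  show "smult (as_halg (av_tensor A V)) = smult (aa_tensor A (as_halg V))"
    by (intro ext) (simp add: av_tensor_simps P.AB_simps smult)
  show "lmom (as_halg (av_tensor A V)) = lmom (aa_tensor A (as_halg V))"
    by (rule ext) (simp add: av_tensor_simps(3) P.AB_simps(3,4) smult_map(4))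
  show "rmom (as_halg (av_tensor A V)) = rmom (aa_tensor A (as_halg V))"
    by (rule ext) (use P.tens_zero_right[OF P.A.bideg_one] in \<open>simp add: av_tensor_simps(4) P.AB_simps(5)\<close>)
  \<comment> \<open>For nonzero second degree the right entry of every pure tensor is zero.\<close>
  have "bideg P.AB \<alpha> \<beta> = {\<zero>\<^bsub>P.AB\<^esub>}" if "\<beta> \<noteq> 0" for \<alpha> \<beta>
  proof
    show "bideg P.AB \<alpha> \<beta> \<subseteq> {\<zero>\<^bsub>P.AB\<^esub>}"
    proof
      fix t assume "t \<in> bideg P.AB \<alpha> \<beta>"
      then have "t = \<zero>\<^bsub>P.AB\<^esub>"
      proof (induction rule: P.bideg_induct)
        case (tens a v \<gamma>)
        then show ?case using that P.tens_zero_right[OF tens(1)] by simp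
      qed simp_all
      then show "t \<in> {\<zero>\<^bsub>P.AB\<^esub>}" by simp
    qed
    show "{\<zero>\<^bsub>P.AB\<^esub>} \<subseteq> bideg P.AB \<alpha> \<beta>"
      using additive_subgroup.zero_closed[OF P.bideg_AB_subgroup] by simp
  qed
  then show "bideg (as_halg (av_tensor A V)) = bideg (aa_tensor A (as_halg V))"
    by (intro ext) (simp add: av_tensor_simps(4,6))
qed (simp_all add: av_tensor_simps)

lemma gr_alg_av:
  assumes smult: "\<And>c. smult A c = (\<lambda>a. lmom A (mero_const c) \<otimes>\<^bsub>A\<^esub> a)"
  shows "gr_alg (av_tensor A V)"
proof -
  have "f \<odot>\<^bsub>av_tensor A V\<^esub> \<one>\<^bsub>av_tensor A V\<^esub> = lmom P.AB f" for f
    using arg_cong[OF as_halg_av[OF smult], of lmom] by (metis as_halg_simps(8))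
  then show ?thesis
    unfolding gr_alg_def using as_halg_av[OF smult] P.bg_alg_AB
    by (simp add: av_tensor_simps(1,2) av_smult)
qed

end


section \<open>Presented bigraded algebras\<close>

text \<open>The moment maps take values in the free algebra rather than among the generators, so
  that zero can serve as right moment map. Both \<open>frm l\<close> and
  \<open>as_halg (ext l)\<close> are literal instances.\<close>

definition pres_halg ::
    "'g free_alg set \<Rightarrow> ('g \<Rightarrow> (complex ^ 'n) \<times> (complex ^ 'n)) \<Rightarrow> ('n mero \<Rightarrow> 'g free_alg) \<Rightarrow>
     ('n mero \<Rightarrow> 'g free_alg) \<Rightarrow> ('n::finite, 'g free_alg set) halg"
  where "pres_halg E d lf rf = \<lparr>
    carrier = carrier (pres_ring E),
    monoid.mult = (\<otimes>\<^bsub>pres_ring E\<^esub>),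
    one = \<one>\<^bsub>pres_ring E\<^esub>,
    zero = \<zero>\<^bsub>pres_ring E\<^esub>,
    add = (\<oplus>\<^bsub>pres_ring E\<^esub>),
    smult = (\<lambda>c x. pres_cls E (fconst c) \<otimes>\<^bsub>pres_ring E\<^esub> x),
    bideg = (\<lambda>\<alpha> \<beta>. pres_cls E ` homog d (\<alpha>, \<beta>)),
    lmom = (\<lambda>f. pres_cls E (lf f)),
    rmom = (\<lambda>f. pres_cls E (rf f))\<rparr>"

lemma pres_halg_simps [simp]:
  "carrier (pres_halg E d lf rf) = carrier (pres_ring E)"
  "monoid.mult (pres_halg E d lf rf) = monoid.mult (pres_ring E)"
  "one (pres_halg E d lf rf) = one (pres_ring E)"
  "zero (pres_halg E d lf rf) = zero (pres_ring E)"
  "add (pres_halg E d lf rf) = add (pres_ring E)"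
  "c \<odot>\<^bsub>pres_halg E d lf rf\<^esub> x = pres_cls E (fconst c) \<otimes>\<^bsub>pres_ring E\<^esub> x"
  "bideg (pres_halg E d lf rf) \<alpha> \<beta> = pres_cls E ` homog d (\<alpha>, \<beta>)"
  "lmom (pres_halg E d lf rf) f = pres_cls E (lf f)"
  "rmom (pres_halg E d lf rf) f = pres_cls E (rf f)"
  by (simp_all add: pres_halg_def)

lemma carrier_presE:
  assumes "x \<in> carrier (pres_ring E)"
  obtains p where "x = pres_cls E p"
  using assms unfolding pres_ring_carrier by (rule imageE)

lemma direct_sum_fieldcong:
  assumes "carrier S = carrier R" "add S = add R" "zero S = zero R" "direct_sum R D"
  shows "direct_sum S D"
proof -
  have s: "subgroup H (add_monoid S) \<longleftrightarrow> subgroup H (add_monoid R)" for H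
  proof -
    have i: "inv\<^bsub>add_monoid S\<^esub> x = inv\<^bsub>add_monoid R\<^esub> x" for x
      by (simp add: m_inv_def assms)
    show ?thesis unfolding subgroup_def using i by (simp add: assms)
  qed
  have f: "finsum S x F = finsum R x F" for x :: "'i \<Rightarrow> _" and F
    by (simp add: finsum_def finprod_def assms)
  show ?thesis
    using assms(4) unfolding direct_sum_def additive_subgroup_def s f unfolding assms(1,3) .
qed

lemma ex1_unique: "\<exists>!x. P x \<Longrightarrow> P x \<Longrightarrow> P y \<Longrightarrow> x = y"
  by blast

text \<open>A nonzero element of two components would have two decompositions, one concentrated at i
  and one at j.\<close>

lemma direct_sum_disjoint:
  fixes D :: "'i \<Rightarrow> 'a set"
  assumes R: "ring R" and ds: "direct_sum R D" and a: "a \<in> D i" "a \<in> D j" "a \<noteq> \<zero>\<^bsub>R\<^esub>"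
  shows "i = j"
proof (rule ccontr)
  assume "i \<noteq> j"
  interpret ring R by fact
  have sub: "additive_subgroup (D k) R" for k using ds unfolding direct_sum_def by blast
  have zero: "\<zero>\<^bsub>R\<^esub> \<in> D k" for k using additive_subgroup.zero_closed[OF sub] .
  have car: "a \<in> carrier R" using additive_subgroup.a_Hcarr[OF sub a(1)] .
  define u where "u k = (\<lambda>m. if m = k then a else \<zero>\<^bsub>R\<^esub>)" for k :: 'i
  have *: "(\<forall>m. u k m \<in> D m) \<and> finite {m. u k m \<noteq> \<zero>\<^bsub>R\<^esub>} \<and> a = (\<Oplus>\<^bsub>R\<^esub>m\<in>{m. u k m \<noteq> \<zero>\<^bsub>R\<^esub>}. u k m)"
    if "a \<in> D k" for k :: 'i
  proof -
    have "{m. u k m \<noteq> \<zero>\<^bsub>R\<^esub>} = {k}" using a(3) by (auto simp: u_def)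
    moreover have "finsum R (u k) {k} = a" using car by (simp add: u_def)
    ultimately show ?thesis using that zero by (auto simp: u_def)
  qed
  have "u i = u j"
  proof (rule ex1_unique[where P = "\<lambda>x. (\<forall>m. x m \<in> D m) \<and> finite {m. x m \<noteq> \<zero>\<^bsub>R\<^esub>} \<and>
      a = (\<Oplus>\<^bsub>R\<^esub>m\<in>{m. x m \<noteq> \<zero>\<^bsub>R\<^esub>}. x m)"])
    show "\<exists>!x. (\<forall>m. x m \<in> D m) \<and> finite {m. x m \<noteq> \<zero>\<^bsub>R\<^esub>} \<and> a = (\<Oplus>\<^bsub>R\<^esub>m\<in>{m. x m \<noteq> \<zero>\<^bsub>R\<^esub>}. x m)"
      by (rule bspec[OF conjunct2[OF ds[unfolded direct_sum_def]] car])
  qed (rule *[OF a(1)], rule *[OF a(2)])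
  then have "u i i = u j i" by simp
  then show False using \<open>i \<noteq> j\<close> a(3) by (simp add: u_def)
qed

lemma ring_pres_halg: "ring (pres_halg E d lf rf)"
  by (rule ring_fieldcong[OF ring_pres_ring]) simp_all

lemma cx_algebra_pres_halg: "cx_algebra (pres_halg E d lf rf)"
proof -
  interpret ring "pres_ring E" by (rule ring_pres_ring)
  have mod: "module Cring (pres_halg E d lf rf)"
  proof (rule moduleI)
    show "cring Cring" by (rule cring_from_type_algebra)
    show "abelian_group (pres_halg E d lf rf)" by (rule ring.is_abelian_group[OF ring_pres_halg])
  qed (simp_all add: fconst_add fconst_mult fconst_one pres_cls_add pres_cls_mult pres_cls_one l_distr r_distr m_assoc)
  have comm: "x \<otimes>\<^bsub>pres_ring E\<^esub> (pres_cls E (fconst c) \<otimes>\<^bsub>pres_ring E\<^esub> y) =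
      pres_cls E (fconst c) \<otimes>\<^bsub>pres_ring E\<^esub> (x \<otimes>\<^bsub>pres_ring E\<^esub> y)"
    if xy: "x \<in> carrier (pres_ring E)" "y \<in> carrier (pres_ring E)" for x y c
  proof -
    obtain p q where p: "x = pres_cls E p" "y = pres_cls E q"
      using xy by (elim carrier_presE) blast
    have "p * (fconst c * q) = fconst c * (p * q)"
      using fconst_commute[of c p] by (simp flip: mult.assoc)
    then show ?thesis unfolding p by (simp flip: pres_cls_mult)
  qed
  show ?thesis
    by (intro cx_algebra.intro mod ring_pres_halg cx_algebra_axioms.intro) (use comm in \<open>simp_all add: m_assoc\<close>)
qed

lemma direct_sum_pres_halg:
  assumes "homog_rels d E"
  shows "direct_sum (pres_halg E d lf rf) (\<lambda>(\<alpha>, \<beta>). bideg (pres_halg E d lf rf) \<alpha> \<beta>)"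
proof -
  have "(\<lambda>(\<alpha>, \<beta>). bideg (pres_halg E d lf rf) \<alpha> \<beta>) = (\<lambda>\<delta>. pres_cls E ` homog d \<delta>)"
    by (auto simp: fun_eq_iff)
  then show ?thesis
    using direct_sum_fieldcong[OF _ _ _ direct_sum_pres_ring[OF assms], of "pres_halg E d lf rf"] by simp
qed

text \<open>Commutation with the moment maps is required on generators only; it spreads to words
  because translations compose.\<close>

locale pres_bg =
  fixes E :: "'g free_alg set" and d :: "'g \<Rightarrow> (complex ^ 'n::finite) \<times> (complex ^ 'n)"
    and lf rf :: "'n mero \<Rightarrow> 'g free_alg"
  assumes homog_E: "homog_rels d E"
    and homog_lf: "lf f \<in> homog d 0" and homog_rf: "rf f \<in> homog d 0"
    and lf_gen: "pres_cls E (lf f * fgen g) = pres_cls E (fgen g * lf (shift (fst (d g)) f))"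
    and rf_gen: "pres_cls E (rf f * fgen g) = pres_cls E (fgen g * rf (shift (snd (d g)) f))"
begin

abbreviation "P \<equiv> pres_halg E d lf rf"

abbreviation "\<pi> \<equiv> pres_cls E"

lemma mom_word:
  "\<pi> (lf f * Poly_Mapping.single w c) = \<pi> (Poly_Mapping.single w c * lf (shift (fst (word_deg d w)) f))"
  "\<pi> (rf f * Poly_Mapping.single w c) = \<pi> (Poly_Mapping.single w c * rf (shift (snd (word_deg d w)) f))"
proof -
  interpret ring "pres_ring E" by (rule ring_pres_ring)
  have "\<pi> (lf f * Poly_Mapping.single w c) = \<pi> (Poly_Mapping.single w c * lf (shift (fst (word_deg d w)) f)) \<and>
    \<pi> (rf f * Poly_Mapping.single w c) = \<pi> (Poly_Mapping.single w c * rf (shift (snd (word_deg d w)) f))"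
  proof (induction w arbitrary: f)
    case Nil
    show ?case using fconst_commute[of c "lf f"] fconst_commute[of c "rf f"] by (simp add: fconst_def)
  next
    case (Cons g w)
    let ?s = "Poly_Mapping.single w c"
    have gs: "Poly_Mapping.single (g # w) c = fgen g * ?s" by (simp add: fgen_mult_single)
    \<comment> \<open>One argument for both moment maps: m is \<open>lf\<close> or
      \<open>rf\<close>, and \<alpha>, \<beta> are the corresponding degrees of the letter and of
      the remaining word.\<close>
    have step: "\<pi> (m f * (fgen g * ?s)) = \<pi> (fgen g * ?s * m (shift (\<beta> + \<alpha>) f))"
      if "\<pi> (m f * fgen g) = \<pi> (fgen g * m (shift \<alpha> f))"
        "\<pi> (m (shift \<alpha> f) * ?s) = \<pi> (?s * m (shift \<beta> (shift \<alpha> f)))" for m :: "'n mero \<Rightarrow> 'g free_alg" and \<alpha> \<beta>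
    proof -
      have "\<pi> (m f * (fgen g * ?s)) = \<pi> (m f * fgen g) \<otimes>\<^bsub>pres_ring E\<^esub> \<pi> ?s"
        by (simp flip: pres_cls_mult add: mult.assoc)
      also have "\<dots> = \<pi> (fgen g) \<otimes>\<^bsub>pres_ring E\<^esub> \<pi> (m (shift \<alpha> f) * ?s)"
        unfolding that(1) by (simp flip: pres_cls_mult add: mult.assoc)
      also have "\<dots> = \<pi> (fgen g * ?s * m (shift (\<beta> + \<alpha>) f))"
        unfolding that(2) by (simp flip: pres_cls_mult add: mult.assoc shift_shift)
      finally show ?thesis .
    qed
    show ?case unfolding gs
      using step[of lf "fst (d g)" "fst (word_deg d w)", OF lf_gen]
        step[of rf "snd (d g)" "snd (word_deg d w)", OF rf_gen] Cons
      by (simp add: add.commute)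
  qed
  then show "\<pi> (lf f * Poly_Mapping.single w c) = \<pi> (Poly_Mapping.single w c * lf (shift (fst (word_deg d w)) f))"
    "\<pi> (rf f * Poly_Mapping.single w c) = \<pi> (Poly_Mapping.single w c * rf (shift (snd (word_deg d w)) f))"
    by auto
qed

lemma mom_homog:
  assumes "p \<in> homog d (\<alpha>, \<beta>)"
  shows "\<pi> (lf f * p) = \<pi> (p * lf (shift \<alpha> f))" "\<pi> (rf f * p) = \<pi> (p * rf (shift \<beta> f))"
proof -
  have "\<pi> (lf f * p) = \<pi> (p * lf (shift \<alpha> f)) \<and> \<pi> (rf f * p) = \<pi> (p * rf (shift \<beta> f))"
    using assms
  proof (induction p rule: homog_induct)
    case (single w c)
    show ?case using mom_word[of f w c] unfolding single by simp
  next
    case (add p q)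
    then show ?case by (simp add: distrib_left distrib_right pres_cls_add)
  qed simp
  then show "\<pi> (lf f * p) = \<pi> (p * lf (shift \<alpha> f))" "\<pi> (rf f * p) = \<pi> (p * rf (shift \<beta> f))" by auto
qed

lemma pi_homog: "p \<in> homog d (\<alpha>, \<beta>) \<Longrightarrow> \<pi> p \<in> bideg P \<alpha> \<beta>"
  unfolding pres_halg_simps(7) by (rule imageI)

lemma bideg_PE:
  assumes "x \<in> bideg P \<alpha> \<beta>"
  obtains p where "p \<in> homog d (\<alpha>, \<beta>)" "x = \<pi> p"
  using assms unfolding pres_halg_simps(7) by (elim imageE)

lemma bg_alg_P: "bg_alg P"
proof (intro bg_alg.intro cx_algebra_pres_halg bg_alg_axioms.intro)
  show "additive_subgroup (bideg P \<alpha> \<beta>) P" for \<alpha> \<beta>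
    using direct_sum_pres_halg[OF homog_E, of lf rf] unfolding direct_sum_def by (metis case_prod_conv)
  show "\<one>\<^bsub>P\<^esub> \<in> bideg P 0 0"
    using pi_homog[of 1 0 0] homog_one[of d] by (simp only: pres_cls_one pres_halg_simps(3) zero_prod_def)
  show "lmom P f \<in> bideg P 0 0" for f
    using pi_homog[of "lf f" 0 0] homog_lf[of f] by (simp only: pres_halg_simps(8) zero_prod_def)
  show "rmom P f \<in> bideg P 0 0" for f
    using pi_homog[of "rf f" 0 0] homog_rf[of f] by (simp only: pres_halg_simps(9) zero_prod_def)
next
  fix a \<alpha> \<beta> assume "a \<in> bideg P \<alpha> \<beta>"
  then obtain p where p: "p \<in> homog d (\<alpha>, \<beta>)" "a = \<pi> p" by (rule bideg_PE)
  show "c \<odot>\<^bsub>P\<^esub> a \<in> bideg P \<alpha> \<beta>" for c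
    using pi_homog[of "fconst c * p" \<alpha> \<beta>] homog_mult[OF homog_const p(1), of c]
    by (simp only: p(2) pres_halg_simps(6) pres_cls_mult add_0)
  show "lmom P f \<otimes>\<^bsub>P\<^esub> a = a \<otimes>\<^bsub>P\<^esub> lmom P (shift \<alpha> f)" "rmom P f \<otimes>\<^bsub>P\<^esub> a = a \<otimes>\<^bsub>P\<^esub> rmom P (shift \<beta> f)" for f
    using mom_homog[OF p(1), of f] by (simp_all only: p(2) pres_halg_simps pres_cls_mult)
  fix b \<gamma> \<delta> assume "b \<in> bideg P \<gamma> \<delta>"
  then obtain q where q: "q \<in> homog d (\<gamma>, \<delta>)" "b = \<pi> q" by (rule bideg_PE)
  show "a \<otimes>\<^bsub>P\<^esub> b \<in> bideg P (\<alpha> + \<gamma>) (\<beta> + \<delta>)"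
    using pi_homog[of "p * q" "\<alpha> + \<gamma>" "\<beta> + \<delta>"] homog_mult[OF p(1) q(1)]
    by (simp only: p(2) q(2) pres_halg_simps(2) pres_cls_mult add_Pair)
qed

lemma bideg_disjoint:
  assumes "a \<in> bideg P \<alpha> \<beta>" "a \<in> bideg P \<gamma> \<delta>" "a \<noteq> \<zero>\<^bsub>P\<^esub>"
  shows "\<alpha> = \<gamma> \<and> \<beta> = \<delta>"
  using direct_sum_disjoint[OF ring_pres_halg direct_sum_pres_halg[OF homog_E], of a lf rf "(\<alpha>, \<beta>)" "(\<gamma>, \<delta>)"] assms
  by simp

text \<open>A word is sent to a product of homogeneous values whose degrees add up to the degree of
  the word, so it suffices to prescribe degrees on generators.\<close>

lemma pres_ext_hom:
  fixes B :: "('n, 'b, 'k) halg_scheme"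
  assumes B: "bg_alg B" and \<phi>: "\<And>g. \<phi> g \<in> bideg B (fst (d g)) (snd (d g))"
    and rels: "\<And>e. e \<in> E \<Longrightarrow> free_ext B \<phi> e = \<zero>\<^bsub>B\<^esub>"
    and mom: "\<And>f. free_ext B \<phi> (lf f) = lmom B f" "\<And>f. free_ext B \<phi> (rf f) = rmom B f"
  shows "h_algebra_hom P B (pres_ext B \<phi>)" "\<And>g. pres_ext B \<phi> (\<pi> (fgen g)) = \<phi> g"
proof -
  interpret B: bg_alg B by fact
  have \<phi>c: "\<phi> g \<in> carrier B" for g by (rule B.bideg_carrier[OF \<phi>])
  have cls: "pres_ext B \<phi> (\<pi> p) = free_ext B \<phi> p" for p
    by (rule B.pres_ext_cls) (use \<phi>c rels in auto)
  note ext = B.free_ext_add[OF \<phi>c] B.free_ext_mult[OF \<phi>c] B.free_ext_one[OF \<phi>c] B.free_ext_closed[OF \<phi>c]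
    B.free_ext_const[OF \<phi>c] B.free_ext_gen[OF \<phi>c]
  have word: "B.word_prod \<phi> w \<in> bideg B (fst (word_deg d w)) (snd (word_deg d w))" for w
    by (induction w) (auto simp: B.bideg_one intro: B.bideg_mult \<phi>)
  have deg: "free_ext B \<phi> p \<in> bideg B \<alpha> \<beta>" if "p \<in> homog d (\<alpha>, \<beta>)" for p \<alpha> \<beta>
    using that
  proof (induction p rule: homog_induct)
    case zero
    then show ?case using B.bideg_zero B.free_ext_zero[of \<phi>] \<phi>c by simp
  next
    case (single w c)
    then show ?case using word[of w] by (simp add: B.free_ext_single[OF \<phi>c] B.bideg_smult)
  next
    case (add p q)
    then show ?case by (simp add: ext B.bideg_add)
  qed
  show "pres_ext B \<phi> (\<pi> (fgen g)) = \<phi> g" for g by (simp add: cls ext)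
  show "h_algebra_hom P B (pres_ext B \<phi>)"
    unfolding h_algebra_hom_def
  proof (intro conjI ring_hom_memI allI ballI)
    fix x assume "x \<in> carrier P"
    then obtain p where p: "x = \<pi> p" by (auto elim: carrier_presE)
    show "pres_ext B \<phi> x \<in> carrier B" by (simp add: p cls ext)
    show "pres_ext B \<phi> (c \<odot>\<^bsub>P\<^esub> x) = c \<odot>\<^bsub>B\<^esub> pres_ext B \<phi> x" for c
      using B.smult_mult_left[of "\<one>\<^bsub>B\<^esub>" "free_ext B \<phi> p" c] by (simp add: p cls ext flip: pres_cls_mult)
    fix y assume "y \<in> carrier P"
    then obtain q where q: "y = \<pi> q" by (auto elim: carrier_presE)
    show "pres_ext B \<phi> (x \<otimes>\<^bsub>P\<^esub> y) = pres_ext B \<phi> x \<otimes>\<^bsub>B\<^esub> pres_ext B \<phi> y"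
      by (simp add: p q cls ext flip: pres_cls_mult)
    show "pres_ext B \<phi> (x \<oplus>\<^bsub>P\<^esub> y) = pres_ext B \<phi> x \<oplus>\<^bsub>B\<^esub> pres_ext B \<phi> y"
      by (simp add: p q cls ext flip: pres_cls_add)
  next
    show "pres_ext B \<phi> ` bideg P \<alpha> \<beta> \<subseteq> bideg B \<alpha> \<beta>" for \<alpha> \<beta>
    proof
      fix z assume "z \<in> pres_ext B \<phi> ` bideg P \<alpha> \<beta>"
      then obtain x where x: "x \<in> bideg P \<alpha> \<beta>" "z = pres_ext B \<phi> x" by (rule imageE)
      from x(1) obtain p where "p \<in> homog d (\<alpha>, \<beta>)" "x = \<pi> p" by (rule bideg_PE)
      then show "z \<in> bideg B \<alpha> \<beta>" unfolding x(2) using deg[of p \<alpha> \<beta>] by (simp only: cls)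
    qed
  qed (simp_all add: cls ext mom flip: pres_cls_one)
qed

end

text \<open>Only ring homomorphisms are compared. Complex linearity is automatic, since in the
  quotient the scalar c equals the generator \<open>\<iota> (mero_const c)\<close>.\<close>

lemma pres_hom_eq:
  assumes copy: "copy_rels \<iota> \<subseteq> E" and B: "ring B"
    and h: "h \<in> ring_hom (pres_halg E d lf rf) B" and k: "k \<in> ring_hom (pres_halg E d lf rf) B"
    and gens: "\<And>g. h (pres_cls E (fgen g)) = k (pres_cls E (fgen g))"
    and x: "x \<in> carrier (pres_ring E)"
  shows "h x = k x"
proof -
  obtain p where p: "x = pres_cls E p" using x by (rule carrier_presE)
  have const: "pres_cls E (fconst c) = pres_cls E (fgen (\<iota> (mero_const c)))" for c
    by (rule pres_cls_rel[symmetric]) (use copy in \<open>auto simp: copy_rels_def\<close>)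
  have single: "h (pres_cls E (Poly_Mapping.single w c)) = k (pres_cls E (Poly_Mapping.single w c))" for w c
  proof (induction w)
    case Nil
    show ?case using gens const[of c] by (simp add: fconst_def)
  next
    case (Cons g w)
    have eq: "Poly_Mapping.single (g # w) c = fgen g * Poly_Mapping.single w c"
      by (simp add: fgen_mult_single)
    show ?case unfolding eq pres_cls_mult
      using ring_hom_mult[OF h, of "pres_cls E (fgen g)" "pres_cls E (Poly_Mapping.single w c)"]
        ring_hom_mult[OF k, of "pres_cls E (fgen g)" "pres_cls E (Poly_Mapping.single w c)"] Cons gens
      by simp
  qed
  show ?thesis unfolding p
  proof (induction p rule: free_alg_induct)
    case zero
    show ?case unfolding pres_cls_zero
      using ring_hom_zero[OF h ring_pres_halg B] ring_hom_zero[OF k ring_pres_halg B] by simp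
  next
    case (add p q)
    show ?case unfolding pres_cls_add
      using ring_hom_add[OF h, of "pres_cls E p" "pres_cls E q"] ring_hom_add[OF k, of "pres_cls E p" "pres_cls E q"] add
      by simp
  qed (rule single)
qed

subsection \<open>Homogeneity of the relations\<close>

text \<open>One degree may be exempted from the check, because that component is the relation minus
  its other components. For an RLL-relation only the terms of unexpected degree then have to be
  examined.\<close>

lemma homog_relsI:
  fixes d :: "'g \<Rightarrow> 'd::ab_group_add"
  assumes "\<And>e. e \<in> E \<Longrightarrow> \<exists>\<delta>0. \<forall>\<delta>. \<delta> \<noteq> \<delta>0 \<longrightarrow> hcomp d \<delta> e \<in> Idl\<^bsub>fring\<^esub> E"
  shows "homog_rels d E"
  unfolding homog_rels_def
proof (intro ballI allI)
  fix e \<delta> assume e: "e \<in> E"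
  obtain \<delta>0 where \<delta>0: "\<And>\<delta>. \<delta> \<noteq> \<delta>0 \<Longrightarrow> hcomp d \<delta> e \<in> Idl\<^bsub>fring\<^esub> E" using assms[OF e] by auto
  let ?F = "insert \<delta>0 (word_deg d ` Poly_Mapping.keys e)"
  have "e = (\<Sum>\<delta>\<in>?F. hcomp d \<delta> e)" by (rule hcomp_total[symmetric]) auto
  also have "\<dots> = hcomp d \<delta>0 e + (\<Sum>\<delta>\<in>?F - {\<delta>0}. hcomp d \<delta> e)" by (rule sum.remove) auto
  finally have eq: "hcomp d \<delta>0 e = e + - (\<Sum>\<delta>\<in>?F - {\<delta>0}. hcomp d \<delta> e)" by (simp add: algebra_simps)
  have sum: "(\<Sum>\<delta>\<in>F. hcomp d \<delta> e) \<in> Idl\<^bsub>fring\<^esub> E" if "\<delta>0 \<notin> F" for F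
    using that by (induction F rule: infinite_finite_induct) (auto intro: rels_ideal_zero rels_ideal_add \<delta>0)
  have "hcomp d \<delta>0 e \<in> Idl\<^bsub>fring\<^esub> E"
    unfolding eq by (rule rels_ideal_add[OF rels_subset[OF e] rels_ideal_uminus[OF sum]]) simp
  then show "hcomp d \<delta> e \<in> Idl\<^bsub>fring\<^esub> E" using \<delta>0 by (cases "\<delta> = \<delta>0") auto
qed

lemma hcomp_ideal:
  "e \<in> homog d \<delta>' \<Longrightarrow> e \<in> Idl\<^bsub>fring\<^esub> E \<Longrightarrow> hcomp d \<delta> e \<in> Idl\<^bsub>fring\<^esub> E"
  using hcomp_homog[of e d \<delta>' \<delta>] by (simp add: rels_ideal_zero del: mem_Collect_eq)

lemma homog_minus: "p \<in> homog d \<delta> \<Longrightarrow> q \<in> homog d \<delta> \<Longrightarrow> p - q \<in> homog d \<delta>"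
  using homog_add[OF _ homog_uminus, of p d \<delta> q] by (simp only: diff_conv_add_uminus)

lemma homog_gen': "d g = \<delta> \<Longrightarrow> fgen g \<in> homog d \<delta>"
  using homog_gen[of g d] by simp

lemma homog_mult0: "p \<in> homog d 0 \<Longrightarrow> q \<in> homog d \<delta> \<Longrightarrow> p * q \<in> homog d \<delta>"
  using homog_mult[of p d 0 q \<delta>] by (simp only: add_0)

lemma homog_mult0': "p \<in> homog d \<delta> \<Longrightarrow> q \<in> homog d 0 \<Longrightarrow> p * q \<in> homog d \<delta>"
  using homog_mult[of p d \<delta> q 0] by (simp only: add_0_right)

lemma homog_copy_rels:
  assumes "\<And>f. d (\<iota> f) = 0" "e \<in> copy_rels \<iota>"
  shows "e \<in> homog d 0"
proof -
  have g: "fgen (\<iota> f) \<in> homog d 0" for f by (rule homog_gen') (rule assms(1))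
  consider f h where "e = fgen (\<iota> (f + h)) - fgen (\<iota> f) - fgen (\<iota> h)"
    | f h where "e = fgen (\<iota> (f * h)) - fgen (\<iota> f) * fgen (\<iota> h)"
    | c where "e = fgen (\<iota> (mero_const c)) - fconst c"
    using assms(2) unfolding copy_rels_def by blast
  then show ?thesis
    by cases (simp_all only: homog_minus homog_mult0 homog_const g)
qed

lemma copy_rels_cls:
  assumes "copy_rels \<iota> \<subseteq> E"
  shows "pres_cls E (fgen (\<iota> (f + g))) = pres_cls E (fgen (\<iota> f)) \<oplus>\<^bsub>pres_ring E\<^esub> pres_cls E (fgen (\<iota> g))"
    and "pres_cls E (fgen (\<iota> (f * g))) = pres_cls E (fgen (\<iota> f)) \<otimes>\<^bsub>pres_ring E\<^esub> pres_cls E (fgen (\<iota> g))"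
    and "pres_cls E (fgen (\<iota> (mero_const c))) = pres_cls E (fconst c)"
proof -
  have "fgen (\<iota> (f + g)) - (fgen (\<iota> f) + fgen (\<iota> g)) \<in> E" "fgen (\<iota> (f * g)) - fgen (\<iota> f) * fgen (\<iota> g) \<in> E"
    "fgen (\<iota> (mero_const c)) - fconst c \<in> E"
    using assms unfolding copy_rels_def diff_diff_eq by blast+
  then show "pres_cls E (fgen (\<iota> (f + g))) = pres_cls E (fgen (\<iota> f)) \<oplus>\<^bsub>pres_ring E\<^esub> pres_cls E (fgen (\<iota> g))"
    "pres_cls E (fgen (\<iota> (f * g))) = pres_cls E (fgen (\<iota> f)) \<otimes>\<^bsub>pres_ring E\<^esub> pres_cls E (fgen (\<iota> g))"
    "pres_cls E (fgen (\<iota> (mero_const c))) = pres_cls E (fconst c)"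
    by (simp_all only: pres_cls_rel flip: pres_cls_add pres_cls_mult)
qed

text \<open>The letter \<open>\<iota> 0\<close> is nonzero in the free algebra; it enters the ideal
  through the scalar relation for c = 0.\<close>

lemma copy_rels_zero:
  assumes "copy_rels \<iota> \<subseteq> E"
  shows "pres_cls E (fgen (\<iota> 0)) = \<zero>\<^bsub>pres_ring E\<^esub>" "fgen (\<iota> 0) \<in> Idl\<^bsub>fring\<^esub> E"
proof -
  show 1: "pres_cls E (fgen (\<iota> 0)) = \<zero>\<^bsub>pres_ring E\<^esub>"
    using copy_rels_cls(3)[OF assms, of 0] by (simp add: fconst_def pres_cls_zero)
  show "fgen (\<iota> 0) \<in> Idl\<^bsub>fring\<^esub> E"
    using 1 pres_cls_iff[of E "fgen (\<iota> 0)" 0] by (simp add: pres_cls_zero)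
qed


section \<open>The algebra of difference operators\<close>

lemma diff_alg_simps:
  "monoid.mult diff_alg = (\<circ>)" "one diff_alg = id" "zero diff_alg = (\<lambda>g. 0)"
  "d \<oplus>\<^bsub>diff_alg\<^esub> e = (\<lambda>g. d g + e g)" "c \<odot>\<^bsub>diff_alg\<^esub> d = (\<lambda>g. mero_const c * d g)"
  "bideg diff_alg \<alpha> \<beta> = (if \<alpha> = \<beta> then {(\<lambda>g. f * shift (- \<beta>) g) | f. True} else {\<lambda>g. 0})"
  "lmom diff_alg = (*)" "rmom diff_alg = (*)"
  by (simp_all add: diff_alg_def)

lemma diff_alg_carrier: "d \<in> carrier diff_alg \<longleftrightarrow> (\<exists>S f. finite S \<and> d = (\<lambda>g. \<Sum>\<beta>\<in>S. f \<beta> * shift \<beta> g))"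
  by (auto simp: diff_alg_def)

lemma diff_alg_zero_mem: "(\<lambda>g. 0) \<in> carrier diff_alg"
  unfolding diff_alg_carrier by (intro exI[of _ "{}"]) simp

lemma diff_alg_monomial: "(\<lambda>g. f * shift \<beta> g) \<in> carrier diff_alg"
  unfolding diff_alg_carrier by (intro exI[of _ "{\<beta>}"] exI[of _ "\<lambda>_. f"]) simp

lemma diff_alg_add_mem:
  assumes "d \<in> carrier diff_alg" "e \<in> carrier diff_alg"
  shows "(\<lambda>g. d g + e g) \<in> carrier diff_alg"
proof -
  obtain S f where d: "finite S" "d = (\<lambda>g. \<Sum>\<beta>\<in>S. f \<beta> * shift \<beta> g)"
    using assms(1) unfolding diff_alg_carrier by blast
  obtain S' f' where e: "finite S'" "e = (\<lambda>g. \<Sum>\<beta>\<in>S'. f' \<beta> * shift \<beta> g)"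
    using assms(2) unfolding diff_alg_carrier by blast
  let ?u = "\<lambda>\<beta>. (if \<beta> \<in> S then f \<beta> else 0) + (if \<beta> \<in> S' then f' \<beta> else 0)"
  have "(\<Sum>\<beta>\<in>S \<union> S'. ?u \<beta> * shift \<beta> g) = d g + e g" for g
  proof -
    have "(\<Sum>\<beta>\<in>S \<union> S'. (if \<beta> \<in> S then f \<beta> else 0) * shift \<beta> g) = d g"
      unfolding d(2) using d(1) e(1) by (intro sum.mono_neutral_cong_right) auto
    moreover have "(\<Sum>\<beta>\<in>S \<union> S'. (if \<beta> \<in> S' then f' \<beta> else 0) * shift \<beta> g) = e g"
      unfolding e(2) using d(1) e(1) by (intro sum.mono_neutral_cong_right) auto
    ultimately show ?thesis by (simp only: distrib_right sum.distrib)
  qed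
  then show ?thesis unfolding diff_alg_carrier
    using d(1) e(1) by (intro exI[of _ "S \<union> S'"] exI[of _ ?u]) auto
qed

lemma diff_alg_induct [consumes 1, case_names zero monomial add]:
  assumes "d \<in> carrier diff_alg" "P (\<lambda>g. 0)" "\<And>f \<beta>. P (\<lambda>g. f * shift \<beta> g)"
    "\<And>d e. d \<in> carrier diff_alg \<Longrightarrow> e \<in> carrier diff_alg \<Longrightarrow> P d \<Longrightarrow> P e \<Longrightarrow> P (\<lambda>g. d g + e g)"
  shows "P d"
proof -
  obtain S f where d: "finite S" "d = (\<lambda>g. \<Sum>\<beta>\<in>S. f \<beta> * shift \<beta> g)"
    using assms(1) unfolding diff_alg_carrier by blast
  have "(\<lambda>g. \<Sum>\<beta>\<in>S. f \<beta> * shift \<beta> g) \<in> carrier diff_alg \<and> P (\<lambda>g. \<Sum>\<beta>\<in>S. f \<beta> * shift \<beta> g)"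
    using d(1)
  proof (induction S rule: finite_induct)
    case (insert \<beta> S)
    then show ?case
      using assms(4)[OF diff_alg_monomial conjunct1[OF insert.IH] assms(3) conjunct2[OF insert.IH], of "f \<beta>" \<beta>]
        diff_alg_add_mem[OF diff_alg_monomial conjunct1[OF insert.IH], of "f \<beta>" \<beta>]
      by simp
  qed (use assms(2) diff_alg_zero_mem in simp)
  then show ?thesis unfolding d(2) by blast
qed

text \<open>Composition distributes over a sum in its right factor only because difference operators
  are additive.\<close>

lemma diff_alg_additive:
  assumes "d \<in> carrier diff_alg"
  shows "d (g + h) = d g + d h" "d 0 = 0"
proof -
  have "(\<forall>g h. d (g + h) = d g + d h) \<and> d 0 = 0" using assms
    by (induction rule: diff_alg_induct) (auto simp: shift_add algebra_simps)
  then show "d (g + h) = d g + d h" "d 0 = 0" by auto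
qed

lemma diff_alg_comp_mem:
  assumes "d \<in> carrier diff_alg" "e \<in> carrier diff_alg"
  shows "d \<circ> e \<in> carrier diff_alg"
  using assms(1)
proof (induction rule: diff_alg_induct)
  case (monomial f \<beta>)
  show ?case using assms(2)
  proof (induction rule: diff_alg_induct)
    case (monomial f' \<beta>')
    have "(\<lambda>g. f * shift \<beta> g) \<circ> (\<lambda>g. f' * shift \<beta>' g) = (\<lambda>g. (f * shift \<beta> f') * shift (\<beta> + \<beta>') g)"
      by (auto simp: shift_mult shift_shift mult.assoc)
    then show ?case using diff_alg_monomial by metis
  next
    case (add e e')
    then show ?case using diff_alg_add_mem[OF add(3,4)] by (simp add: o_def shift_add distrib_left)
  qed (use diff_alg_zero_mem in \<open>simp add: o_def\<close>)
next
  case (add d d')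
  then show ?case using diff_alg_add_mem[OF add(3,4)] by (simp add: o_def)
qed (use diff_alg_zero_mem in \<open>simp add: o_def\<close>)

lemma diff_alg_id_mem: "id \<in> carrier diff_alg"
  using diff_alg_monomial[of 1 0] by (simp add: id_def)

lemma diff_alg_scale_mem:
  assumes "d \<in> carrier diff_alg"
  shows "(\<lambda>g. f * d g) \<in> carrier diff_alg"
  using diff_alg_comp_mem[OF diff_alg_monomial[of f 0] assms] by (simp add: o_def)

lemma ring_diff_alg: "ring (diff_alg :: ('n::finite, 'n mero \<Rightarrow> 'n mero) halg)"
proof (rule ringI)
  let ?D = "diff_alg :: ('n, 'n mero \<Rightarrow> 'n mero) halg"
  show "abelian_group ?D"
  proof (rule abelian_groupI)
    fix d assume "d \<in> carrier ?D"
    then have "(\<lambda>g. - 1 * d g) \<in> carrier ?D" by (rule diff_alg_scale_mem)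
    then show "\<exists>e\<in>carrier ?D. e \<oplus>\<^bsub>?D\<^esub> d = \<zero>\<^bsub>?D\<^esub>"
      by (intro bexI[of _ "\<lambda>g. - 1 * d g"]) (simp_all add: diff_alg_simps)
  qed (auto simp: diff_alg_simps diff_alg_add_mem diff_alg_zero_mem algebra_simps)
  show "Group.monoid ?D"
    by (rule Group.monoidI) (auto simp: diff_alg_simps diff_alg_comp_mem diff_alg_id_mem)
qed (auto simp: diff_alg_simps diff_alg_additive fun_eq_iff)

lemma bg_alg_diff_alg: "bg_alg (diff_alg :: ('n::finite, 'n mero \<Rightarrow> 'n mero) halg)"
proof -
  let ?D = "diff_alg :: ('n, 'n mero \<Rightarrow> 'n mero) halg"
  interpret ring ?D by (rule ring_diff_alg)
  have mod: "module Cring ?D"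
  proof (rule moduleI)
    show "cring Cring" by (rule cring_from_type_algebra)
    show "abelian_group ?D" by (rule is_abelian_group)
  qed (auto simp: diff_alg_simps diff_alg_scale_mem mero_const_add mero_const_mult distrib_left distrib_right mult.assoc)
  have smr: "d \<circ> (\<lambda>g. mero_const c * e g) = (\<lambda>g. mero_const c * d (e g))"
    if "d \<in> carrier ?D" for d e :: "'n mero \<Rightarrow> 'n mero" and c
    using that
    by (induction rule: diff_alg_induct) (auto simp: fun_eq_iff shift_mult algebra_simps)
  have zero_bideg: "(\<lambda>g. 0) \<in> bideg ?D \<alpha> \<beta>" for \<alpha> \<beta>
    by (auto simp: diff_alg_simps intro: exI[of _ 0])
  \<comment> \<open>A uniform form for both branches of the grading: off the diagonal the
    coefficient is zero.\<close>
  have bidegE: "\<exists>f. d = (\<lambda>g. f * shift (- \<beta>) g) \<and> (\<alpha> = \<beta> \<or> f = 0)" if "d \<in> bideg ?D \<alpha> \<beta>" for d \<alpha> \<beta>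
    using that by (auto simp: diff_alg_simps intro: exI[of _ 0] split: if_splits)
  have bidegI: "(\<lambda>g. f * shift (- \<beta>) g) \<in> bideg ?D \<alpha> \<beta>" if "\<alpha> = \<beta> \<or> f = 0" for f \<alpha> \<beta>
    using that zero_bideg by (auto simp: diff_alg_simps)
  show ?thesis
  proof (intro bg_alg.intro cx_algebra.intro mod ring_diff_alg cx_algebra_axioms.intro bg_alg_axioms.intro)
    show "(c \<odot>\<^bsub>?D\<^esub> a) \<otimes>\<^bsub>?D\<^esub> b = c \<odot>\<^bsub>?D\<^esub> (a \<otimes>\<^bsub>?D\<^esub> b)"
      "a \<otimes>\<^bsub>?D\<^esub> (c \<odot>\<^bsub>?D\<^esub> b) = c \<odot>\<^bsub>?D\<^esub> (a \<otimes>\<^bsub>?D\<^esub> b)" if "a \<in> carrier ?D" "b \<in> carrier ?D" for a b c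
      using smr[OF that(1)] by (auto simp: diff_alg_simps fun_eq_iff)
    show "additive_subgroup (bideg ?D \<alpha> \<beta>) ?D" for \<alpha> \<beta>
    proof (rule additive_subgroupI, rule subgroup.intro)
      show "bideg ?D \<alpha> \<beta> \<subseteq> carrier (add_monoid ?D)"
        using bidegE[of _ \<alpha> \<beta>] diff_alg_monomial by fastforce
      show "\<one>\<^bsub>add_monoid ?D\<^esub> \<in> bideg ?D \<alpha> \<beta>" using zero_bideg by (simp add: diff_alg_simps(3))
      fix d assume d: "d \<in> bideg ?D \<alpha> \<beta>"
      then obtain f where f: "d = (\<lambda>g. f * shift (- \<beta>) g)" "\<alpha> = \<beta> \<or> f = 0" using bidegE by blast
      have "(\<lambda>g. - f * shift (- \<beta>) g) \<oplus>\<^bsub>?D\<^esub> d = \<zero>\<^bsub>?D\<^esub>" by (simp add: diff_alg_simps f(1))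
      then have "\<ominus>\<^bsub>?D\<^esub> d = (\<lambda>g. - f * shift (- \<beta>) g)"
        by (rule minus_equality) (simp_all only: f(1) diff_alg_monomial)
      then show "inv\<^bsub>add_monoid ?D\<^esub> d \<in> bideg ?D \<alpha> \<beta>"
        using bidegI[of \<alpha> \<beta> "- f"] f(2) by (simp add: a_inv_def)
      fix e assume "e \<in> bideg ?D \<alpha> \<beta>"
      then obtain f' where f': "e = (\<lambda>g. f' * shift (- \<beta>) g)" "\<alpha> = \<beta> \<or> f' = 0" using bidegE by blast
      have "d \<oplus>\<^bsub>?D\<^esub> e = (\<lambda>g. (f + f') * shift (- \<beta>) g)" by (simp add: diff_alg_simps f f' distrib_right)
      then show "d \<otimes>\<^bsub>add_monoid ?D\<^esub> e \<in> bideg ?D \<alpha> \<beta>" using bidegI[of \<alpha> \<beta> "f + f'"] f f' by auto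
    qed
    show "\<one>\<^bsub>?D\<^esub> \<in> bideg ?D 0 0" using bidegI[of 0 0 1] by (simp add: diff_alg_simps(2) id_def)
    show "lmom ?D f \<in> bideg ?D 0 0" "rmom ?D f \<in> bideg ?D 0 0" for f
      using bidegI[of 0 0 f] by (simp_all add: diff_alg_simps(7,8))
  next
    fix d \<alpha> \<beta> assume "d \<in> bideg ?D \<alpha> \<beta>"
    then obtain f where f: "d = (\<lambda>g. f * shift (- \<beta>) g)" "\<alpha> = \<beta> \<or> f = 0" using bidegE by blast
    show "c \<odot>\<^bsub>?D\<^esub> d \<in> bideg ?D \<alpha> \<beta>" for c
      using bidegI[of \<alpha> \<beta> "mero_const c * f"] f by (auto simp: diff_alg_simps(5) mult.assoc)
    show "lmom ?D h \<otimes>\<^bsub>?D\<^esub> d = d \<otimes>\<^bsub>?D\<^esub> lmom ?D (shift \<alpha> h)"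
      "rmom ?D h \<otimes>\<^bsub>?D\<^esub> d = d \<otimes>\<^bsub>?D\<^esub> rmom ?D (shift \<beta> h)" for h
      using f by (auto simp: diff_alg_simps shift_mult fun_eq_iff)
    fix e \<gamma> \<delta> assume "e \<in> bideg ?D \<gamma> \<delta>"
    then obtain f' where f': "e = (\<lambda>g. f' * shift (- \<delta>) g)" "\<gamma> = \<delta> \<or> f' = 0" using bidegE by blast
    have "d \<otimes>\<^bsub>?D\<^esub> e = (\<lambda>g. (f * shift (- \<beta>) f') * shift (- (\<beta> + \<delta>)) g)"
      by (auto simp: diff_alg_simps(1) f f' shift_mult shift_shift mult.assoc)
    then show "d \<otimes>\<^bsub>?D\<^esub> e \<in> bideg ?D (\<alpha> + \<gamma>) (\<beta> + \<delta>)"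
      using bidegI[of "\<alpha> + \<gamma>" "\<beta> + \<delta>" "f * shift (- \<beta>) f'"] f f' by auto
  qed
qed

lemma diff_alg_finsum:
  assumes "\<And>i. i \<in> I \<Longrightarrow> d i \<in> carrier diff_alg"
  shows "(\<Oplus>\<^bsub>diff_alg\<^esub>i\<in>I. d i) = (\<lambda>g. \<Sum>i\<in>I. d i g)"
proof -
  interpret ring diff_alg by (rule ring_diff_alg)
  show ?thesis using assms
  proof (induction I rule: infinite_finite_induct)
    case (insert i I)
    then have "d \<in> I \<rightarrow> carrier diff_alg" "d i \<in> carrier diff_alg" by auto
    with insert show ?case by (simp add: diff_alg_simps(4))
  qed (simp_all add: diff_alg_simps(3))
qed

lemma diff_alg_finsum2:
  assumes "\<And>i j. d i j \<in> carrier diff_alg"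
  shows "(\<Oplus>\<^bsub>diff_alg\<^esub>i\<in>I. \<Oplus>\<^bsub>diff_alg\<^esub>j\<in>J. d i j) = (\<lambda>g. \<Sum>i\<in>I. \<Sum>j\<in>J. d i j g)"
proof -
  interpret ring diff_alg by (rule ring_diff_alg)
  have "(\<lambda>g. \<Sum>j\<in>J. d i j g) \<in> carrier diff_alg" for i
    using finsum_closed[of "d i" J] assms by (simp add: diff_alg_finsum Pi_iff)
  then show ?thesis using assms by (simp add: diff_alg_finsum)
qed

section \<open>The two presented algebras\<close>

text \<open>What the relations \<open>copy_rels\<close> demand of the images of functions;
  injectivity and degrees are treated separately.\<close>

definition mom_hom :: "('n::finite, 'a, 'm) halg_scheme \<Rightarrow> ('n mero \<Rightarrow> 'a) \<Rightarrow> bool"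
  where "mom_hom B m \<longleftrightarrow> (\<forall>f g. m (f + g) = m f \<oplus>\<^bsub>B\<^esub> m g) \<and>
    (\<forall>f g. m (f * g) = m f \<otimes>\<^bsub>B\<^esub> m g) \<and> (\<forall>c. m (mero_const c) = c \<odot>\<^bsub>B\<^esub> \<one>\<^bsub>B\<^esub>)"

lemma mom_hom_pres:
  assumes "copy_rels \<iota> \<subseteq> E"
  shows "mom_hom (pres_halg E d lf rf) (\<lambda>f. pres_cls E (fgen (\<iota> f)))"
proof -
  interpret ring "pres_ring E" by (rule ring_pres_ring)
  show ?thesis by (simp add: mom_hom_def copy_rels_cls[OF assms])
qed

lemma mom_hom_diff_alg: "mom_hom diff_alg (*)"
  by (auto simp: mom_hom_def diff_alg_simps fun_eq_iff algebra_simps)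

lemma (in bg_pair) mom_hom_left:
  assumes "mom_hom A (lmom A)"
  shows "mom_hom AB (lmom AB)"
  using assms tens_add_left[OF A.lmom_bideg A.lmom_bideg B.bideg_one]
    tens_mult[OF A.lmom_bideg B.bideg_one A.lmom_bideg B.bideg_one]
  by (simp add: mom_hom_def AB_simps(3,4) smult_map(4))

text \<open>Scalars of the tensor product act on the left factor. A constant in the right factor is
  therefore rewritten through \<open>lmom B\<close>, moved across by balancing and read as a value
  of \<open>rmom A\<close>; this is where three moment maps meet.\<close>

lemma (in bg_pair) mom_hom_right:
  assumes "mom_hom B (rmom B)" "mom_hom A (rmom A)" "mom_hom B (lmom B)"
  shows "mom_hom AB (rmom AB)"
proof -
  have "aa_tens A B \<one>\<^bsub>A\<^esub> (rmom B (mero_const c)) = c \<odot>\<^bsub>AB\<^esub> \<one>\<^bsub>AB\<^esub>" for c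
    using tens_balance[OF A.bideg_one B.bideg_one, of "mero_const c"] assms
    by (simp add: mom_hom_def AB_simps(3) smult_map(4))
  then show ?thesis
    using assms(1) tens_add_right[OF A.bideg_one B.rmom_bideg B.rmom_bideg]
      tens_mult[OF A.bideg_one B.rmom_bideg A.bideg_one B.rmom_bideg]
    by (simp add: mom_hom_def AB_simps(5))
qed

lemma free_ext_copy_rels:
  fixes B :: "('n::finite, 'b, 'k) halg_scheme"
  assumes B: "bg_alg B" and \<phi>: "\<And>g. \<phi> g \<in> carrier B" and mom: "mom_hom B (\<lambda>f. \<phi> (\<iota> f))"
    and e: "e \<in> copy_rels \<iota>"
  shows "free_ext B \<phi> e = \<zero>\<^bsub>B\<^esub>"
proof -
  interpret B: bg_alg B by fact
  note ext = B.free_ext_add[OF \<phi>] B.free_ext_mult[OF \<phi>] B.free_ext_gen[OF \<phi>] B.free_ext_const[OF \<phi>]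
  have m: "\<phi> (\<iota> (f + g)) = \<phi> (\<iota> f) \<oplus>\<^bsub>B\<^esub> \<phi> (\<iota> g)" "\<phi> (\<iota> (f * g)) = \<phi> (\<iota> f) \<otimes>\<^bsub>B\<^esub> \<phi> (\<iota> g)"
    "\<phi> (\<iota> (mero_const c)) = c \<odot>\<^bsub>B\<^esub> \<one>\<^bsub>B\<^esub>" for f g c
    using mom by (simp_all add: mom_hom_def)
  consider f g where "e = fgen (\<iota> (f + g)) - (fgen (\<iota> f) + fgen (\<iota> g))"
    | f g where "e = fgen (\<iota> (f * g)) - fgen (\<iota> f) * fgen (\<iota> g)"
    | c where "e = fgen (\<iota> (mero_const c)) - fconst c"
    using e unfolding copy_rels_def diff_diff_eq by blast
  then show ?thesis
    by cases (simp_all only: B.free_ext_minus_zero[OF \<phi>] ext m)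
qed

text \<open>The zero-weight (ice) condition: for a nonzero entry the lower pair of indices is the
  upper pair up to order.\<close>

lemma rmat_weights: "rmat l a b c d \<noteq> 0 \<Longrightarrow> wt a + wt b = wt c + wt d"
proof (rule ccontr)
  assume nz: "rmat l a b c d \<noteq> 0" and neq: "wt a + wt b \<noteq> wt c + wt d"
  have "\<not> (c = a \<and> d = b)" using neq by blast
  moreover have "\<not> (c = b \<and> d = a)" using neq add.commute[of "wt a" "wt b"] by blast
  ultimately have "rmat l a b c d = 0" unfolding rmat_def by (split if_split)+ blast
  then show False using nz by blast
qed

section \<open>The bialgebroid as a presented algebra\<close>

lemma frm_eq: "frm l = pres_halg (frm_rels l) frm_gen_bideg (\<lambda>f. fgen (Lam f)) (\<lambda>f. fgen (Mu f))"
  by (simp add: frm_def pres_halg_def Let_def)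

lemma frm_copy_rels: "copy_rels Lam \<subseteq> frm_rels l" "copy_rels Mu \<subseteq> frm_rels l"
  unfolding frm_rels_def by blast+

lemma frm_relsI:
  "fgen (Lam f) * fgen (Mu g) - fgen (Mu g) * fgen (Lam f) \<in> frm_rels l"
  "fgen (Lam f) * fgen (T i j) - fgen (T i j) * fgen (Lam (shift (wt i) f)) \<in> frm_rels l"
  "fgen (Mu f) * fgen (T i j) - fgen (T i j) * fgen (Mu (shift (wt j) f)) \<in> frm_rels l"
  "(\<Sum>x\<in>UNIV. \<Sum>y\<in>UNIV. fgen (Lam (rmat l x y a c)) * fgen (T x b) * fgen (T y d)) -
     (\<Sum>x\<in>UNIV. \<Sum>y\<in>UNIV. fgen (Mu (rmat l b d x y)) * fgen (T c y) * fgen (T a x)) \<in> frm_rels l"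
proof -
  show "fgen (Lam f) * fgen (Mu g) - fgen (Mu g) * fgen (Lam f) \<in> frm_rels l"
    unfolding frm_rels_def
    by (rule UnI1, rule UnI1, rule UnI1, rule UnI2, rule CollectI, rule exI, rule exI, rule conjI[OF refl TrueI])
  show "fgen (Lam f) * fgen (T i j) - fgen (T i j) * fgen (Lam (shift (wt i) f)) \<in> frm_rels l"
    unfolding frm_rels_def
    by (rule UnI1, rule UnI1, rule UnI2, rule CollectI, rule exI, rule exI, rule exI, rule conjI[OF refl TrueI])
  show "fgen (Mu f) * fgen (T i j) - fgen (T i j) * fgen (Mu (shift (wt j) f)) \<in> frm_rels l"
    unfolding frm_rels_def
    by (rule UnI1, rule UnI2, rule CollectI, rule exI, rule exI, rule exI, rule conjI[OF refl TrueI])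
  show "(\<Sum>x\<in>UNIV. \<Sum>y\<in>UNIV. fgen (Lam (rmat l x y a c)) * fgen (T x b) * fgen (T y d)) -
     (\<Sum>x\<in>UNIV. \<Sum>y\<in>UNIV. fgen (Mu (rmat l b d x y)) * fgen (T c y) * fgen (T a x)) \<in> frm_rels l"
    unfolding frm_rels_def
    by (rule UnI2, rule CollectI, rule exI, rule exI, rule exI, rule exI, rule conjI[OF refl TrueI])
qed

lemma frm_rels_cases [consumes 1, case_names Lam Mu comm lam mu rll]:
  assumes "e \<in> frm_rels l"
  obtains "e \<in> copy_rels Lam" | "e \<in> copy_rels Mu"
  | f g where "e = fgen (Lam f) * fgen (Mu g) - fgen (Mu g) * fgen (Lam f)"
  | f i j where "e = fgen (Lam f) * fgen (T i j) - fgen (T i j) * fgen (Lam (shift (wt i) f))"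
  | f i j where "e = fgen (Mu f) * fgen (T i j) - fgen (T i j) * fgen (Mu (shift (wt j) f))"
  | a b c d where "e = (\<Sum>x\<in>UNIV. \<Sum>y\<in>UNIV. fgen (Lam (rmat l x y a c)) * fgen (T x b) * fgen (T y d)) -
     (\<Sum>x\<in>UNIV. \<Sum>y\<in>UNIV. fgen (Mu (rmat l b d x y)) * fgen (T c y) * fgen (T a x))"
  using assms unfolding frm_rels_def by (elim UnE) blast+

lemma homog_frm_rels: "homog_rels frm_gen_bideg (frm_rels l)"
proof (rule homog_relsI)
  fix e :: "'a frm_free" assume e: "e \<in> frm_rels l"
  let ?d = "frm_gen_bideg :: ('a, 'a mero) frm_gen \<Rightarrow> _"
  let ?I = "Idl\<^bsub>fring\<^esub> (frm_rels l)"
  have Lam: "fgen (Lam f) \<in> homog ?d 0" and Mu: "fgen (Mu f) \<in> homog ?d 0" for f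
    by (rule homog_gen', simp add: zero_prod_def)+
  have tt: "fgen (T i j) \<in> homog ?d (wt i, wt j)" for i j
    by (rule homog_gen') simp
  have single: "\<exists>\<delta>0. \<forall>\<delta>. \<delta> \<noteq> \<delta>0 \<longrightarrow> hcomp ?d \<delta> e \<in> ?I" if "e \<in> homog ?d \<delta>0" for \<delta>0
    using hcomp_ideal[OF that rels_subset[OF e]] by auto
  show "\<exists>\<delta>0. \<forall>\<delta>. \<delta> \<noteq> \<delta>0 \<longrightarrow> hcomp ?d \<delta> e \<in> ?I"
    using e
  proof (cases rule: frm_rels_cases)
    case Lam
    show ?thesis by (rule single, rule homog_copy_rels[OF _ Lam]) (simp add: zero_prod_def)
  next
    case Mu
    show ?thesis by (rule single, rule homog_copy_rels[OF _ Mu]) (simp add: zero_prod_def)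
  next
    case (comm f g)
    show ?thesis by (rule single, unfold comm) (rule homog_minus homog_mult0 Lam Mu)+
  next
    case (lam f i j)
    show ?thesis
      by (rule single, unfold lam, rule homog_minus[OF homog_mult0[OF Lam tt] homog_mult0'[OF tt Lam]])
  next
    case (mu f i j)
    show ?thesis
      by (rule single, unfold mu, rule homog_minus[OF homog_mult0[OF Mu tt] homog_mult0'[OF tt Mu]])
  next
    case (rll a b c d)
    let ?\<delta>0 = "(wt a + wt c, wt b + wt d)"
    \<comment> \<open>A term with nonzero entry has the expected degree by the zero-weight
      condition. A term with zero entry may have another degree, but it contains the letter of the
      zero function and so lies in the ideal.\<close>
    have mono: "hcomp ?d \<delta> (fgen (\<iota> r) * fgen (T i j) * fgen (T k m)) \<in> ?I"
      if \<delta>: "\<delta> \<noteq> ?\<delta>0" and r: "r \<noteq> 0 \<Longrightarrow> (wt i + wt k, wt j + wt m) = ?\<delta>0"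
        and \<iota>: "fgen (\<iota> r) \<in> homog ?d 0" "copy_rels \<iota> \<subseteq> frm_rels l" for \<iota> r i j k m \<delta>
    proof -
      have h: "fgen (\<iota> r) * fgen (T i j) * fgen (T k m) \<in> homog ?d (wt i + wt k, wt j + wt m)"
        using homog_mult[OF homog_mult0[OF \<iota>(1) tt] tt, of i j k m] by (simp only: add_Pair)
      show ?thesis
      proof (cases "r = 0")
        case True
        have "fgen (\<iota> r) \<in> ?I" unfolding True by (rule copy_rels_zero(2)[OF \<iota>(2)])
        then have "fgen (\<iota> r) * fgen (T i j) * fgen (T k m) \<in> ?I"
          by (intro rels_ideal_rmult)
        then show ?thesis by (rule hcomp_ideal[OF h])
      next
        case False
        then have "(wt i + wt k, wt j + wt m) \<noteq> \<delta>" using r \<delta> by auto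
        then show ?thesis using hcomp_homog[OF h, of \<delta>] rels_ideal_zero by simp
      qed
    qed
    have sum: "(\<Sum>x\<in>(UNIV :: 'a set). \<Sum>y\<in>(UNIV :: 'a set). F x y) \<in> ?I" if "\<And>x y. F x y \<in> ?I" for F
    proof -
      have *: "(\<Sum>i\<in>I. u i) \<in> ?I" if "\<And>i. u i \<in> ?I" for I :: "'a set" and u
        using that by (induction I rule: infinite_finite_induct) (auto intro: rels_ideal_zero rels_ideal_add)
      show ?thesis by (intro * that)
    qed
    have "hcomp ?d \<delta> e \<in> ?I" if \<delta>: "\<delta> \<noteq> ?\<delta>0" for \<delta>
      unfolding rll hcomp_minus hcomp_sum unfolding diff_conv_add_uminus
      by (intro rels_ideal_add rels_ideal_uminus sum mono \<delta> Lam Mu frm_copy_rels)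
        (use rmat_weights in \<open>force simp: add.commute\<close>)+
    then show ?thesis by blast
  qed
qed

lemma pres_bg_frm: "pres_bg (frm_rels l) frm_gen_bideg (\<lambda>f. fgen (Lam f)) (\<lambda>f. fgen (Mu f))"
proof
  let ?E = "frm_rels l :: 'a frm_free set" and ?d = "frm_gen_bideg :: ('a, 'a mero) frm_gen \<Rightarrow> _"
  show "homog_rels ?d ?E" by (rule homog_frm_rels)
  show "fgen (Lam f) \<in> homog ?d 0" "fgen (Mu f) \<in> homog ?d 0" for f
    by (rule homog_gen', simp add: zero_prod_def)+
  fix f g
  have comm: "pres_cls ?E (fgen (Lam f) * fgen (Mu h)) = pres_cls ?E (fgen (Mu h) * fgen (Lam f))" for f h
    by (rule pres_cls_rel, rule frm_relsI)
  have same: "pres_cls ?E (fgen (\<iota> f) * fgen (\<iota> h)) = pres_cls ?E (fgen (\<iota> h) * fgen (\<iota> f))"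
    if "copy_rels \<iota> \<subseteq> ?E" for \<iota> f h
    using copy_rels_cls(2)[OF that, of f h] copy_rels_cls(2)[OF that, of h f] by (simp add: mult.commute pres_cls_mult)
  have gen: "pres_cls ?E (fgen (Lam f) * fgen (T i j)) = pres_cls ?E (fgen (T i j) * fgen (Lam (shift (wt i) f)))"
    "pres_cls ?E (fgen (Mu f) * fgen (T i j)) = pres_cls ?E (fgen (T i j) * fgen (Mu (shift (wt j) f)))" for i j
    by (rule pres_cls_rel, rule frm_relsI)+
  show "pres_cls ?E (fgen (Lam f) * fgen g) = pres_cls ?E (fgen g * fgen (Lam (shift (fst (?d g)) f)))"
    using gen(1) comm same[OF frm_copy_rels(1)] by (cases g) auto
  show "pres_cls ?E (fgen (Mu f) * fgen g) = pres_cls ?E (fgen g * fgen (Mu (shift (snd (?d g)) f)))"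
    using gen(2) comm same[OF frm_copy_rels(2)] by (cases g) auto
qed

lemma bg_alg_frm: "bg_alg (frm l)"
  unfolding frm_eq by (rule pres_bg.bg_alg_P[OF pres_bg_frm])

lemma frm_mom:
  "lmom (frm l) = (\<lambda>f. pres_cls (frm_rels l) (fgen (Lam f)))"
  "rmom (frm l) = (\<lambda>f. pres_cls (frm_rels l) (fgen (Mu f)))"
  by (auto simp: frm_eq)

lemma frm_moments: "mom_hom (frm l) (lmom (frm l))" "mom_hom (frm l) (rmom (frm l))"
  unfolding frm_mom unfolding frm_eq
  by (rule mom_hom_pres[OF frm_copy_rels(1)], rule mom_hom_pres[OF frm_copy_rels(2)])

lemma frm_t_bideg: "frm_t l i j \<in> bideg (frm l) (wt i) (wt j)"
  unfolding frm_t_def frm_eq by (rule pres_bg.pi_homog[OF pres_bg_frm], rule homog_gen') simp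

lemma frm_gen_simps:
  "pres_cls (frm_rels l) (fgen (T i j)) = frm_t l i j"
  "pres_cls (frm_rels l) (fgen (Lam f)) = lmom (frm l) f"
  "pres_cls (frm_rels l) (fgen (Mu f)) = rmom (frm l) f"
  by (simp_all add: frm_t_def frm_eq)

lemma frm_rll:
  "(\<Oplus>\<^bsub>frm l\<^esub>x\<in>UNIV. \<Oplus>\<^bsub>frm l\<^esub>y\<in>UNIV. lmom (frm l) (rmat l x y a c) \<otimes>\<^bsub>frm l\<^esub> frm_t l x b \<otimes>\<^bsub>frm l\<^esub> frm_t l y d)
   = (\<Oplus>\<^bsub>frm l\<^esub>x\<in>UNIV. \<Oplus>\<^bsub>frm l\<^esub>y\<in>UNIV. rmom (frm l) (rmat l b d x y) \<otimes>\<^bsub>frm l\<^esub> frm_t l c y \<otimes>\<^bsub>frm l\<^esub> frm_t l a x)"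
proof -
  let ?E = "frm_rels l"
  have fs: "finsum (frm l) = finsum (pres_ring ?E)"
    by (intro ext) (simp add: finsum_def finprod_def frm_eq)
  have "pres_cls ?E (\<Sum>x\<in>UNIV. \<Sum>y\<in>UNIV. fgen (Lam (rmat l x y a c)) * fgen (T x b) * fgen (T y d)) =
    pres_cls ?E (\<Sum>x\<in>UNIV. \<Sum>y\<in>UNIV. fgen (Mu (rmat l b d x y)) * fgen (T c y) * fgen (T a x))"
    by (rule pres_cls_rel, rule frm_relsI)
  then show ?thesis
    by (simp add: pres_cls_finsum pres_cls_mult frm_gen_simps fs) (simp add: frm_eq)
qed

text \<open>Serves the counit and the comultiplication alike. The commutation relations hold in any
  bigraded algebra by the degrees of the images, and the copies of the function field by
  \<open>mom_hom\<close>; what remains is RLL.\<close>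

lemma frm_universal:
  fixes B :: "('n::{finite,linorder}, 'b, 'k) halg_scheme" and \<phi> :: "('n, 'n mero) frm_gen \<Rightarrow> 'b"
  assumes B: "bg_alg B" and deg: "\<And>i j. \<phi> (T i j) \<in> bideg B (wt i) (wt j)"
    and Lam: "\<And>f. \<phi> (Lam f) = lmom B f" and Mu: "\<And>f. \<phi> (Mu f) = rmom B f"
    and mom: "mom_hom B (lmom B)" "mom_hom B (rmom B)"
    and rll: "\<And>a b c d.
      (\<Oplus>\<^bsub>B\<^esub>x\<in>UNIV. \<Oplus>\<^bsub>B\<^esub>y\<in>UNIV. lmom B (rmat l x y a c) \<otimes>\<^bsub>B\<^esub> \<phi> (T x b) \<otimes>\<^bsub>B\<^esub> \<phi> (T y d))
       = (\<Oplus>\<^bsub>B\<^esub>x\<in>UNIV. \<Oplus>\<^bsub>B\<^esub>y\<in>UNIV. rmom B (rmat l b d x y) \<otimes>\<^bsub>B\<^esub> \<phi> (T c y) \<otimes>\<^bsub>B\<^esub> \<phi> (T a x))"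
  shows "h_algebra_hom (frm l) B (pres_ext B \<phi>)" "\<And>i j. pres_ext B \<phi> (frm_t l i j) = \<phi> (T i j)"
proof -
  interpret B: bg_alg B by fact
  interpret F: pres_bg "frm_rels l" frm_gen_bideg "\<lambda>f. fgen (Lam f)" "\<lambda>f. fgen (Mu f)" by (rule pres_bg_frm)
  have \<phi>: "\<phi> g \<in> bideg B (fst (frm_gen_bideg g)) (snd (frm_gen_bideg g))" for g
    by (cases g) (auto simp: deg Lam Mu B.lmom_bideg B.rmom_bideg)
  have \<phi>c: "\<phi> g \<in> carrier B" for g by (rule B.bideg_carrier[OF \<phi>])
  note ext = B.free_ext_add[OF \<phi>c] B.free_ext_mult[OF \<phi>c] B.free_ext_gen[OF \<phi>c] B.free_ext_sum[OF \<phi>c finite]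
  have rels: "free_ext B \<phi> e = \<zero>\<^bsub>B\<^esub>" if "e \<in> frm_rels l" for e
    using that
  proof (cases rule: frm_rels_cases)
    case Lam
    show ?thesis by (rule free_ext_copy_rels[OF B \<phi>c _ Lam]) (simp add: assms(3) mom)
  next
    case Mu
    show ?thesis by (rule free_ext_copy_rels[OF B \<phi>c _ Mu]) (simp add: assms(4) mom)
  next
    case (comm f g)
    show ?thesis unfolding comm
      by (rule B.free_ext_minus_zero[OF \<phi>c]) (use B.lmom_comm[OF B.rmom_bideg] in \<open>simp add: ext Lam Mu\<close>)
  next
    case (lam f i j)
    show ?thesis unfolding lam
      by (rule B.free_ext_minus_zero[OF \<phi>c]) (use B.lmom_comm[OF deg] in \<open>simp add: ext Lam\<close>)
  next
    case (mu f i j)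
    show ?thesis unfolding mu
      by (rule B.free_ext_minus_zero[OF \<phi>c]) (use B.rmom_comm[OF deg] in \<open>simp add: ext Mu\<close>)
  next
    case (rll a b c d)
    show ?thesis unfolding rll
      by (rule B.free_ext_minus_zero[OF \<phi>c]) (use assms(7)[of a c b d] in \<open>simp add: ext Lam Mu\<close>)
  qed
  show "h_algebra_hom (frm l) B (pres_ext B \<phi>)"
    unfolding frm_eq by (rule F.pres_ext_hom[OF B \<phi> rels]) (simp_all add: ext Lam Mu)
  show "pres_ext B \<phi> (frm_t l i j) = \<phi> (T i j)" for i j
    unfolding frm_t_def by (rule F.pres_ext_hom(2)[OF B \<phi> rels]) (simp_all add: ext Lam Mu)
qed

lemma frm_hom_eq:
  assumes "ring B" "h \<in> ring_hom (frm l) B" "k \<in> ring_hom (frm l) B"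
    and "\<And>i j. h (frm_t l i j) = k (frm_t l i j)" "\<And>f. h (lmom (frm l) f) = k (lmom (frm l) f)"
    "\<And>f. h (rmom (frm l) f) = k (rmom (frm l) f)" "x \<in> carrier (frm l)"
  shows "h x = k x"
proof (rule pres_hom_eq[OF frm_copy_rels(1) assms(1) assms(2,3)[unfolded frm_eq]])
  show "h (pres_cls (frm_rels l) (fgen g)) = k (pres_cls (frm_rels l) (fgen g))" for g
    by (cases g) (simp_all add: frm_gen_simps assms(4-6))
  show "x \<in> carrier (pres_ring (frm_rels l))" using assms(7) by (simp add: frm_eq)
qed

subsection \<open>The counit\<close>

lemma frm_counit_hom:
  fixes i j :: "'n::{finite,linorder}"
  shows "h_algebra_hom (frm l :: ('n, 'n frm_free set) halg) diff_alg (frm_counit l)"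
    and "frm_counit l (frm_t l i j) = (if i = j then shift (- wt i) else (\<lambda>_. 0))"
proof -
  let ?\<phi> = "\<lambda>g :: ('n, 'n mero) frm_gen. case g of T i j \<Rightarrow> (if i = j then shift (- wt i) else (\<lambda>_. 0)) | Lam f \<Rightarrow> (*) f | Mu f \<Rightarrow> (*) f"
  interpret D: bg_alg "diff_alg :: ('n, 'n mero \<Rightarrow> 'n mero) halg" by (rule bg_alg_diff_alg)
  have deg: "?\<phi> (T i j) \<in> bideg diff_alg (wt i) (wt j)" for i j
    using D.bideg_zero[of "wt i" "wt j"] by (auto simp: diff_alg_simps intro: exI[of _ 1])
  have rll: "(\<Oplus>\<^bsub>diff_alg\<^esub>x\<in>UNIV. \<Oplus>\<^bsub>diff_alg\<^esub>y\<in>UNIV. lmom diff_alg (rmat l x y a c) \<otimes>\<^bsub>diff_alg\<^esub> ?\<phi> (T x b) \<otimes>\<^bsub>diff_alg\<^esub> ?\<phi> (T y d))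
       = (\<Oplus>\<^bsub>diff_alg\<^esub>x\<in>UNIV. \<Oplus>\<^bsub>diff_alg\<^esub>y\<in>UNIV. rmom diff_alg (rmat l b d x y) \<otimes>\<^bsub>diff_alg\<^esub> ?\<phi> (T c y) \<otimes>\<^bsub>diff_alg\<^esub> ?\<phi> (T a x))" for a b c d
  proof -
    note car = D.bideg_carrier[OF deg] D.bideg_carrier[OF D.lmom_bideg] D.bideg_carrier[OF D.rmom_bideg]
    \<comment> \<open>Off-diagonal generators are sent to zero, so each side of RLL collapses to one
      term, with the same entry \<open>rmat l b d a c\<close>. The translations attached to it agree
      by the zero-weight condition.\<close>
    have "rmat l b d a c * shift (- wt b) (shift (- wt d) g) = rmat l b d a c * shift (- wt c) (shift (- wt a) g)" for g
    proof (cases "rmat l b d a c = 0")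
      case False
      have "- wt b + - wt d = - (wt b + wt d)" by simp
      also have "\<dots> = - wt c + - wt a" unfolding rmat_weights[OF False] by simp
      finally show ?thesis by (simp only: shift_shift)
    qed simp
    then have "(\<lambda>g. rmat l b d a c * shift (- wt b) (shift (- wt d) g)) =
      (\<lambda>g. rmat l b d a c * shift (- wt c) (shift (- wt a) g))" by (rule ext)
    moreover have "(\<Sum>x\<in>UNIV. \<Sum>y\<in>UNIV. (lmom diff_alg (rmat l x y a c) \<otimes>\<^bsub>diff_alg\<^esub> ?\<phi> (T x b) \<otimes>\<^bsub>diff_alg\<^esub> ?\<phi> (T y d)) g)
        = rmat l b d a c * shift (- wt b) (shift (- wt d) g)" for g
    proof -
      have "(\<Sum>x\<in>UNIV. \<Sum>y\<in>UNIV. (lmom diff_alg (rmat l x y a c) \<otimes>\<^bsub>diff_alg\<^esub> ?\<phi> (T x b) \<otimes>\<^bsub>diff_alg\<^esub> ?\<phi> (T y d)) g)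
        = (\<Sum>x\<in>UNIV. \<Sum>y\<in>UNIV. if x = b then (if y = d then rmat l x y a c * shift (- wt x) (shift (- wt y) g) else 0) else 0)"
        by (intro sum.cong refl) (auto simp: diff_alg_simps)
      also have "\<dots> = rmat l b d a c * shift (- wt b) (shift (- wt d) g)"
        by (subst sum.swap) simp
      finally show ?thesis .
    qed
    moreover have "(\<Sum>x\<in>UNIV. \<Sum>y\<in>UNIV. (rmom diff_alg (rmat l b d x y) \<otimes>\<^bsub>diff_alg\<^esub> ?\<phi> (T c y) \<otimes>\<^bsub>diff_alg\<^esub> ?\<phi> (T a x)) g)
        = rmat l b d a c * shift (- wt c) (shift (- wt a) g)" for g
    proof -
      have "(\<Sum>x\<in>UNIV. \<Sum>y\<in>UNIV. (rmom diff_alg (rmat l b d x y) \<otimes>\<^bsub>diff_alg\<^esub> ?\<phi> (T c y) \<otimes>\<^bsub>diff_alg\<^esub> ?\<phi> (T a x)) g)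
        = (\<Sum>x\<in>UNIV. \<Sum>y\<in>UNIV. if x = a then (if y = c then rmat l b d x y * shift (- wt y) (shift (- wt x) g) else 0) else 0)"
        by (intro sum.cong refl) (auto simp: diff_alg_simps)
      also have "\<dots> = rmat l b d a c * shift (- wt c) (shift (- wt a) g)"
        by (subst sum.swap) simp
      finally show ?thesis .
    qed
    ultimately show ?thesis
      by (simp add: diff_alg_finsum2 car D.m_closed del: frm_gen.case)
  qed
  note univ = frm_universal[OF bg_alg_diff_alg deg _ _ _ _ rll]
  show "h_algebra_hom (frm l :: ('n, 'n frm_free set) halg) diff_alg (frm_counit l)"
    unfolding frm_counit_def by (rule univ) (simp_all add: diff_alg_simps mom_hom_diff_alg)
  show "frm_counit l (frm_t l i j) = (if i = j then shift (- wt i) else (\<lambda>_. 0))"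
    unfolding frm_counit_def by (subst univ(2)) (simp_all add: diff_alg_simps mom_hom_diff_alg)
qed

section \<open>The axioms of an h-algebra for the bialgebroid\<close>

lemma h_algebra_hom_mom:
  "h_algebra_hom A B \<phi> \<Longrightarrow> \<phi> (lmom A f) = lmom B f" "h_algebra_hom A B \<phi> \<Longrightarrow> \<phi> (rmom A f) = rmom B f"
  by (auto simp: h_algebra_hom_def)

text \<open>Injectivity of the moment maps is the delicate point, since a presentation could
  collapse functions. The counit sends both images of f to multiplication by f, and evaluating that
  operator at 1 recovers f.\<close>

lemma h_algebra_frm: "h_algebra (frm l :: ('n::{finite,linorder}, 'n frm_free set) halg)"
proof -
  let ?A = "frm l :: ('n, 'n frm_free set) halg"
  interpret A: bg_alg ?A by (rule bg_alg_frm)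
  have eps: "frm_counit l (lmom ?A f) = (*) f" "frm_counit l (rmom ?A f) = (*) f" for f
    by (simp_all add: h_algebra_hom_mom[OF frm_counit_hom(1)] diff_alg_simps)
  have inj: "f = g" if "(*) f = ((*) g :: 'n mero \<Rightarrow> 'n mero)" for f g
    using fun_cong[OF that, of 1] by simp
  have "inj (lmom ?A)" "inj (rmom ?A)"
    by (rule injI, rule inj, metis eps)+
  moreover have "mom_hom ?A (lmom ?A)" "mom_hom ?A (rmom ?A)"
    by (rule frm_moments)+
  ultimately have mm: "moment_map ?A (lmom ?A)" "moment_map ?A (rmom ?A)"
    using A.lmom_bideg A.rmom_bideg unfolding moment_map_def mom_hom_def by blast+
  have "direct_sum ?A (\<lambda>(\<alpha>, \<beta>). bideg ?A \<alpha> \<beta>)"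
    unfolding frm_eq by (rule direct_sum_pres_halg[OF homog_frm_rels])
  then show ?thesis
    by (intro h_algebra.intro h_algebra_axioms.intro A.module_axioms A.ring_axioms mm A.smult_mult_left
        A.smult_mult_right A.bideg_smult A.bideg_mult A.lmom_comm A.rmom_comm)
qed


section \<open>The comultiplication\<close>

subsection \<open>Double sums\<close>

lemma (in abelian_monoid) finsum_swap:
  assumes "finite I" "finite J" "\<And>i j. F i j \<in> carrier G"
  shows "(\<Oplus>i\<in>I. \<Oplus>j\<in>J. F i j) = (\<Oplus>j\<in>J. \<Oplus>i\<in>I. F i j)"
  using assms(1)
proof (induction I rule: finite_induct)
  case empty
  then show ?case by simp
next
  case (insert i I)
  have "(\<Oplus>j\<in>J. \<Oplus>i\<in>insert i I. F i j) = (\<Oplus>j\<in>J. F i j \<oplus> (\<Oplus>i\<in>I. F i j))"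
    using insert assms(3) by simp
  also have "\<dots> = (\<Oplus>j\<in>J. F i j) \<oplus> (\<Oplus>j\<in>J. \<Oplus>i\<in>I. F i j)"
    using assms(3) by (intro finsum_addf) auto
  finally show ?case using insert assms(3) by simp
qed

text \<open>Bundles the double sums of the RLL-relations, so that reordering four summation indices
  is a single step.\<close>

definition sum2 :: "('a, 'm) ring_scheme \<Rightarrow> ('i::finite \<Rightarrow> 'j::finite \<Rightarrow> 'a) \<Rightarrow> 'a"
  where "sum2 R F = (\<Oplus>\<^bsub>R\<^esub>i\<in>UNIV. \<Oplus>\<^bsub>R\<^esub>j\<in>UNIV. F i j)"

context ring
begin

lemma sum2_closed: "(\<And>i j. F i j \<in> carrier R) \<Longrightarrow> sum2 R F \<in> carrier R"
  unfolding sum2_def by (auto intro!: finsum_closed)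

lemma sum2_transpose: "(\<And>i j. F i j \<in> carrier R) \<Longrightarrow> sum2 R F = sum2 R (\<lambda>j i. F i j)"
  unfolding sum2_def by (rule finsum_swap) auto

lemma sum2_swap:
  assumes "\<And>i j k m. F i j k m \<in> carrier R"
  shows "sum2 R (\<lambda>i j. sum2 R (\<lambda>k m. F i j k m)) = sum2 R (\<lambda>k m. sum2 R (\<lambda>i j. F i j k m))"
proof -
  have c: "(\<Oplus>m\<in>UNIV. F i j k m) \<in> carrier R" "(\<Oplus>j\<in>UNIV. F i j k m) \<in> carrier R"
    "(\<Oplus>j\<in>UNIV. \<Oplus>m\<in>UNIV. F i j k m) \<in> carrier R" for i j k m
    using assms by (auto intro!: finsum_closed)
  have "sum2 R (\<lambda>i j. sum2 R (\<lambda>k m. F i j k m)) = (\<Oplus>i\<in>UNIV. \<Oplus>k\<in>UNIV. \<Oplus>j\<in>UNIV. \<Oplus>m\<in>UNIV. F i j k m)"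
    unfolding sum2_def by (subst finsum_swap[of UNIV UNIV "\<lambda>j k. \<Oplus>m\<in>UNIV. F _ j k m"]) (auto simp: c)
  also have "\<dots> = (\<Oplus>k\<in>UNIV. \<Oplus>i\<in>UNIV. \<Oplus>j\<in>UNIV. \<Oplus>m\<in>UNIV. F i j k m)"
    by (rule finsum_swap) (auto simp: c)
  also have "\<dots> = (\<Oplus>k\<in>UNIV. \<Oplus>i\<in>UNIV. \<Oplus>m\<in>UNIV. \<Oplus>j\<in>UNIV. F i j k m)"
    by (subst finsum_swap[of UNIV UNIV "\<lambda>j m. F _ j _ m"]) (auto simp: assms)
  also have "\<dots> = (\<Oplus>k\<in>UNIV. \<Oplus>m\<in>UNIV. \<Oplus>i\<in>UNIV. \<Oplus>j\<in>UNIV. F i j k m)"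
    by (subst finsum_swap[of UNIV UNIV "\<lambda>i m. \<Oplus>j\<in>UNIV. F i j _ m"]) (auto simp: c)
  finally show ?thesis unfolding sum2_def .
qed

lemma sum2_lmult: "a \<in> carrier R \<Longrightarrow> (\<And>i j. F i j \<in> carrier R) \<Longrightarrow> a \<otimes> sum2 R F = sum2 R (\<lambda>i j. a \<otimes> F i j)"
  unfolding sum2_def by (simp add: finsum_rdistr Pi_iff finsum_closed)

lemma finsum_mult_finsum:
  assumes "\<And>i. f i \<in> carrier R" "\<And>j. g j \<in> carrier R"
  shows "(\<Oplus>i\<in>UNIV. f i) \<otimes> (\<Oplus>j\<in>UNIV. g j) = sum2 R (\<lambda>i j. f i \<otimes> g j)"
  unfolding sum2_def using assms finsum_swap[of UNIV UNIV "\<lambda>i j. f i \<otimes> g j"]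
  by (simp add: finsum_ldistr finsum_rdistr Pi_iff finsum_closed)

end

lemma ring_hom_finsum:
  assumes "ring R" "ring S" "h \<in> ring_hom R S" "finite I" "\<And>i. f i \<in> carrier R"
  shows "h (\<Oplus>\<^bsub>R\<^esub>i\<in>I. f i) = (\<Oplus>\<^bsub>S\<^esub>i\<in>I. h (f i))"
proof -
  interpret R: ring R by fact
  interpret S: ring S by fact
  have c: "h (f i) \<in> carrier S" for i using ring_hom_closed[OF assms(3,5)] .
  show ?thesis using assms(4)
    by (induction I rule: finite_induct)
      (auto simp: ring_hom_zero[OF assms(3,1,2)] ring_hom_add[OF assms(3)] assms(5) c Pi_iff R.finsum_closed)
qed

lemma (in bg_pair) tens_sum2_left:
  assumes "\<And>i j. F i j \<in> bideg A \<alpha> \<gamma>" "b \<in> bideg B \<gamma> \<beta>"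
  shows "aa_tens A B (sum2 A F) b = sum2 AB (\<lambda>i j. aa_tens A B (F i j) b)"
proof -
  have "(\<Oplus>\<^bsub>A\<^esub>j\<in>UNIV. F i j) \<in> bideg A \<alpha> \<gamma>" for i using assms(1) by (intro A.bideg_finsum)
  then show ?thesis unfolding sum2_def
    by (subst tens_finsum_left[OF finite _ assms(2)], assumption)
      (subst tens_finsum_left[OF finite assms(1) assms(2)], rule refl)
qed

lemma (in bg_pair) tens_sum2_right:
  assumes "\<And>i j. F i j \<in> bideg B \<gamma> \<beta>" "a \<in> bideg A \<alpha> \<gamma>"
  shows "aa_tens A B a (sum2 B F) = sum2 AB (\<lambda>i j. aa_tens A B a (F i j))"
proof -
  have "(\<Oplus>\<^bsub>B\<^esub>j\<in>UNIV. F i j) \<in> bideg B \<gamma> \<beta>" for i using assms(1) by (intro B.bideg_finsum)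
  then show ?thesis unfolding sum2_def
    by (subst tens_finsum_right[OF finite _ assms(2)], assumption)
      (subst tens_finsum_right[OF finite assms(1) assms(2)], rule refl)
qed

lemma mom_hom_zero: "cx_algebra B \<Longrightarrow> mom_hom B m \<Longrightarrow> m 0 = \<zero>\<^bsub>B\<^esub>"
proof -
  assume "cx_algebra B" and m: "mom_hom B m"
  then interpret cx_algebra B by simp
  show ?thesis using m mero_const_0 unfolding mom_hom_def by (metis one_closed smult_cx_0)
qed

subsection \<open>Compatibility with the relations\<close>

text \<open>RLL is used twice. In the left factor it turns R(\<lambda>) into R of the inner
  variable, balancing carries this R over to the right factor, and RLL there turns it into
  R(\<mu>).\<close>

lemma frm_comult_hom:
  fixes l :: complex and i j :: "'n::{finite,linorder}"
  defines "A \<equiv> frm l :: ('n, 'n frm_free set) halg"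
  shows "h_algebra_hom A (aa_tensor A A) (frm_comult l)"
    and "frm_comult l (frm_t l i j) = (\<Oplus>\<^bsub>aa_tensor A A\<^esub>k\<in>UNIV. aa_tens A A (frm_t l i k) (frm_t l k j))"
proof -
  have bgA: "bg_alg A" unfolding A_def by (rule bg_alg_frm)
  interpret P: bg_pair A A by (rule bg_pairI[OF bgA bgA])
  interpret B: bg_alg "aa_tensor A A" by (rule P.bg_alg_AB)
  let ?AA = "aa_tensor A A" and ?t = "frm_t l :: 'n \<Rightarrow> 'n \<Rightarrow> _" and ?r = "rmat l :: 'n \<Rightarrow> _"
  let ?\<phi> = "\<lambda>g :: ('n, 'n mero) frm_gen. case g of
      T i j \<Rightarrow> (\<Oplus>\<^bsub>?AA\<^esub>k\<in>UNIV. aa_tens A A (?t i k) (?t k j))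
    | Lam f \<Rightarrow> aa_tens A A (lmom A f) \<one>\<^bsub>A\<^esub>
    | Mu f \<Rightarrow> aa_tens A A \<one>\<^bsub>A\<^esub> (rmom A f)"
  define D where "D i j = (\<Oplus>\<^bsub>?AA\<^esub>k\<in>UNIV. aa_tens A A (?t i k) (?t k j))" for i j
  have mA: "mom_hom A (lmom A)" "mom_hom A (rmom A)" unfolding A_def by (rule frm_moments)+
  have t: "?t i j \<in> bideg A (wt i) (wt j)" for i j unfolding A_def by (rule frm_t_bideg)
  have tt: "?t i j \<otimes>\<^bsub>A\<^esub> ?t k m \<in> bideg A (wt i + wt k) (wt j + wt m)" for i j k m
    by (rule P.A.bideg_mult[OF t t])
  note tc = P.A.bideg_carrier[OF t] and ttc = P.A.bideg_carrier[OF tt]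
  have ttens: "aa_tens A A (?t i k) (?t k j) \<in> bideg ?AA (wt i) (wt j)" for i j k
    by (rule P.tens_bideg[OF t t])
  have Dd: "D i j \<in> bideg ?AA (wt i) (wt j)" for i j
    unfolding D_def by (rule B.bideg_finsum[OF ttens])
  have z: "lmom A 0 = \<zero>\<^bsub>A\<^esub>" "rmom A 0 = \<zero>\<^bsub>A\<^esub>"
    using mom_hom_zero[OF P.A.cx_algebra_axioms] mA by auto
  have rll: "sum2 A (\<lambda>x y. lmom A (?r x y a c) \<otimes>\<^bsub>A\<^esub> (?t x b \<otimes>\<^bsub>A\<^esub> ?t y d)) =
      sum2 A (\<lambda>x y. rmom A (?r b d x y) \<otimes>\<^bsub>A\<^esub> (?t c y \<otimes>\<^bsub>A\<^esub> ?t a x))" for a b c d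
    using frm_rll[of l a c b d] unfolding A_def[symmetric] sum2_def by (simp add: P.A.m_assoc tc)
  have DD: "D i j \<otimes>\<^bsub>?AA\<^esub> D i' j' = sum2 ?AA (\<lambda>k m. aa_tens A A (?t i k \<otimes>\<^bsub>A\<^esub> ?t i' m) (?t k j \<otimes>\<^bsub>A\<^esub> ?t m j'))" for i j i' j'
    unfolding D_def using B.finsum_mult_finsum[of "\<lambda>k. aa_tens A A (?t i k) (?t k j)" "\<lambda>k. aa_tens A A (?t i' k) (?t k j')"]
    by (simp add: B.bideg_carrier[OF ttens] P.tens_mult[OF t t t t])
  \<comment> \<open>The degree may disagree when r = 0, since then the product is zero and lies in
    every component. This is how vanishing R-entries are kept inside one sum.\<close>
  have bl: "lmom A r \<otimes>\<^bsub>A\<^esub> u \<in> bideg A \<alpha>' \<beta>" if "u \<in> bideg A \<alpha> \<beta>" "r \<noteq> 0 \<Longrightarrow> \<alpha> = \<alpha>'" for r u \<alpha> \<alpha>' \<beta>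
    using that P.A.lmom_mult_bideg[OF that(1)] P.A.bideg_zero by (cases "r = 0") (auto simp: z P.A.bideg_carrier)
  have br: "rmom A r \<otimes>\<^bsub>A\<^esub> u \<in> bideg A \<alpha> \<beta>'" if "u \<in> bideg A \<alpha> \<beta>" "r \<noteq> 0 \<Longrightarrow> \<beta> = \<beta>'" for r u \<alpha> \<beta>' \<beta>
    using that P.A.rmom_mult_bideg[OF that(1)] P.A.bideg_zero by (cases "r = 0") (auto simp: z P.A.bideg_carrier)
  have bal: "aa_tens A A (rmom A r \<otimes>\<^bsub>A\<^esub> u) v = aa_tens A A u (lmom A r \<otimes>\<^bsub>A\<^esub> v)"
    if "u \<in> bideg A \<alpha> \<gamma>" "v \<in> bideg A \<gamma>' \<beta>" "r \<noteq> 0 \<Longrightarrow> \<gamma> = \<gamma>'" for r u v \<alpha> \<beta> \<gamma> \<gamma>'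
    using that P.tens_balance[of u \<alpha> \<gamma> v \<beta> r] P.tens_zero_left[OF that(2)] P.tens_zero_right[OF that(1)]
    by (cases "r = 0") (auto simp: z P.A.bideg_carrier)
  have w: "wt x + wt y = wt a + wt c" if "?r x y a c \<noteq> 0" for x y a c using rmat_weights[OF that] .
  have w': "wt y + wt x = wt k + wt m" "wt y + wt x = wt a + wt c" if "?r k m x y \<noteq> 0" "?r x y a c \<noteq> 0" for x y k m a c
    using rmat_weights[OF that(1)] rmat_weights[OF that(2)] by (simp_all add: add.commute)
  have "sum2 ?AA (\<lambda>x y. lmom ?AA (?r x y a c) \<otimes>\<^bsub>?AA\<^esub> (D x b \<otimes>\<^bsub>?AA\<^esub> D y d)) =
      sum2 ?AA (\<lambda>x y. rmom ?AA (?r b d x y) \<otimes>\<^bsub>?AA\<^esub> (D c y \<otimes>\<^bsub>?AA\<^esub> D a x))" for a b c d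
  proof -
    have quad: "aa_tens A A (?t i k \<otimes>\<^bsub>A\<^esub> ?t i' m) (?t k j \<otimes>\<^bsub>A\<^esub> ?t m j') \<in> bideg ?AA (wt i + wt i') (wt j + wt j')" for i i' j j' k m
      by (rule P.tens_bideg[OF tt tt])
    have wl: "lmom A (?r x y a c) \<otimes>\<^bsub>A\<^esub> (?t x k \<otimes>\<^bsub>A\<^esub> ?t y m) \<in> bideg A (wt a + wt c) (wt k + wt m)" for x y k m a c
      by (rule bl[OF tt w])
    have wr: "rmom A (?r k m x y) \<otimes>\<^bsub>A\<^esub> (?t c y \<otimes>\<^bsub>A\<^esub> ?t a x) \<in> bideg A (wt c + wt a) (wt k + wt m)" for x y k m a c
      by (rule br[OF tt]) (drule w, simp add: add.commute)
    have l_mult: "lmom ?AA f \<otimes>\<^bsub>?AA\<^esub> aa_tens A A u v = aa_tens A A (lmom A f \<otimes>\<^bsub>A\<^esub> u) v"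
      if "u \<in> bideg A \<alpha> \<gamma>" "v \<in> bideg A \<gamma> \<beta>" for f u v \<alpha> \<beta> \<gamma>
      unfolding P.AB_simps(4) using P.tens_mult[OF P.A.lmom_bideg P.A.bideg_one that] that(2) by (simp add: P.A.bideg_carrier)
    have r_mult: "rmom ?AA f \<otimes>\<^bsub>?AA\<^esub> aa_tens A A u v = aa_tens A A u (rmom A f \<otimes>\<^bsub>A\<^esub> v)"
      if "u \<in> bideg A \<alpha> \<gamma>" "v \<in> bideg A \<gamma> \<beta>" for f u v \<alpha> \<beta> \<gamma>
      unfolding P.AB_simps(5) using P.tens_mult[OF P.A.bideg_one P.A.rmom_bideg that] that(1) by (simp add: P.A.bideg_carrier)
    have c1: "aa_tens A A (lmom A (?r x y a c) \<otimes>\<^bsub>A\<^esub> (?t x k \<otimes>\<^bsub>A\<^esub> ?t y m)) (?t k b \<otimes>\<^bsub>A\<^esub> ?t m d) \<in> carrier ?AA" for x y k m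
      by (rule P.tens_carrier[OF wl tt])
    have c2: "aa_tens A A (rmom A (?r k m x y) \<otimes>\<^bsub>A\<^esub> (?t c y \<otimes>\<^bsub>A\<^esub> ?t a x)) (?t k b \<otimes>\<^bsub>A\<^esub> ?t m d) \<in> carrier ?AA" for x y k m
      by (rule P.tens_carrier[OF wr tt])
    have wl': "lmom A (?r k m x y) \<otimes>\<^bsub>A\<^esub> (?t k b \<otimes>\<^bsub>A\<^esub> ?t m d) \<in> bideg A (wt y + wt x) (wt b + wt d)" for x y k m
      by (rule bl[OF tt]) (drule w, simp add: add.commute)
    have wr': "rmom A (?r b d k m) \<otimes>\<^bsub>A\<^esub> (?t y m \<otimes>\<^bsub>A\<^esub> ?t x k) \<in> bideg A (wt y + wt x) (wt b + wt d)" for x y k m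
      by (rule br[OF tt]) (drule w, simp add: add.commute)
    have c3: "aa_tens A A (?t c y \<otimes>\<^bsub>A\<^esub> ?t a x) (rmom A (?r b d k m) \<otimes>\<^bsub>A\<^esub> (?t y m \<otimes>\<^bsub>A\<^esub> ?t x k)) \<in> carrier ?AA" for x y k m
      by (rule P.tens_carrier[OF tt wr'])
    have "sum2 ?AA (\<lambda>x y. lmom ?AA (?r x y a c) \<otimes>\<^bsub>?AA\<^esub> (D x b \<otimes>\<^bsub>?AA\<^esub> D y d)) =
      sum2 ?AA (\<lambda>x y. sum2 ?AA (\<lambda>k m. aa_tens A A (lmom A (?r x y a c) \<otimes>\<^bsub>A\<^esub> (?t x k \<otimes>\<^bsub>A\<^esub> ?t y m)) (?t k b \<otimes>\<^bsub>A\<^esub> ?t m d)))"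
      by (simp only: DD B.sum2_lmult[OF B.lmom_carrier B.bideg_carrier[OF quad]] l_mult[OF tt tt])
    also have "\<dots> = sum2 ?AA (\<lambda>k m. sum2 ?AA (\<lambda>x y. aa_tens A A (lmom A (?r x y a c) \<otimes>\<^bsub>A\<^esub> (?t x k \<otimes>\<^bsub>A\<^esub> ?t y m)) (?t k b \<otimes>\<^bsub>A\<^esub> ?t m d)))"
      by (rule B.sum2_swap[OF c1])
    also have "\<dots> = sum2 ?AA (\<lambda>k m. sum2 ?AA (\<lambda>x y. aa_tens A A (rmom A (?r k m x y) \<otimes>\<^bsub>A\<^esub> (?t c y \<otimes>\<^bsub>A\<^esub> ?t a x)) (?t k b \<otimes>\<^bsub>A\<^esub> ?t m d)))"
      by (simp only: P.tens_sum2_left[OF wl tt, symmetric] P.tens_sum2_left[OF wr tt, symmetric] rll)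
    also have "\<dots> = sum2 ?AA (\<lambda>x y. sum2 ?AA (\<lambda>k m. aa_tens A A (rmom A (?r k m x y) \<otimes>\<^bsub>A\<^esub> (?t c y \<otimes>\<^bsub>A\<^esub> ?t a x)) (?t k b \<otimes>\<^bsub>A\<^esub> ?t m d)))"
      by (rule B.sum2_swap[OF c2])
    also have "\<dots> = sum2 ?AA (\<lambda>x y. sum2 ?AA (\<lambda>k m. aa_tens A A (?t c y \<otimes>\<^bsub>A\<^esub> ?t a x) (lmom A (?r k m x y) \<otimes>\<^bsub>A\<^esub> (?t k b \<otimes>\<^bsub>A\<^esub> ?t m d))))"
    proof -
      have "aa_tens A A (rmom A (?r k m x y) \<otimes>\<^bsub>A\<^esub> (?t c y \<otimes>\<^bsub>A\<^esub> ?t a x)) (?t k b \<otimes>\<^bsub>A\<^esub> ?t m d) =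
        aa_tens A A (?t c y \<otimes>\<^bsub>A\<^esub> ?t a x) (lmom A (?r k m x y) \<otimes>\<^bsub>A\<^esub> (?t k b \<otimes>\<^bsub>A\<^esub> ?t m d))" for x y k m
        by (rule bal[OF tt tt]) (drule w, simp add: add.commute)
      then show ?thesis by (simp only:)
    qed
    also have "\<dots> = sum2 ?AA (\<lambda>x y. sum2 ?AA (\<lambda>k m. aa_tens A A (?t c y \<otimes>\<^bsub>A\<^esub> ?t a x) (rmom A (?r b d k m) \<otimes>\<^bsub>A\<^esub> (?t y m \<otimes>\<^bsub>A\<^esub> ?t x k))))"
      by (simp only: P.tens_sum2_right[OF wl' tt, symmetric] P.tens_sum2_right[OF wr' tt, symmetric] rll)
    also have "\<dots> = sum2 ?AA (\<lambda>k m. sum2 ?AA (\<lambda>x y. aa_tens A A (?t c y \<otimes>\<^bsub>A\<^esub> ?t a x) (rmom A (?r b d k m) \<otimes>\<^bsub>A\<^esub> (?t y m \<otimes>\<^bsub>A\<^esub> ?t x k))))"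
      by (rule B.sum2_swap[OF c3])
    \<comment> \<open>The transposition puts the inner indices into the order in which they occur in
      the product of \<open>D c m\<close> and \<open>D a k\<close>.\<close>
    also have "\<dots> = sum2 ?AA (\<lambda>k m. sum2 ?AA (\<lambda>y x. aa_tens A A (?t c y \<otimes>\<^bsub>A\<^esub> ?t a x) (rmom A (?r b d k m) \<otimes>\<^bsub>A\<^esub> (?t y m \<otimes>\<^bsub>A\<^esub> ?t x k))))"
      by (subst B.sum2_transpose[OF c3]) (rule refl)
    also have "\<dots> = sum2 ?AA (\<lambda>k m. rmom ?AA (?r b d k m) \<otimes>\<^bsub>?AA\<^esub> (D c m \<otimes>\<^bsub>?AA\<^esub> D a k))"
      by (simp only: DD B.sum2_lmult[OF B.rmom_carrier B.bideg_carrier[OF quad]] r_mult[OF tt tt])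
    finally show ?thesis .
  qed
  note main = this
  have rllB: "(\<Oplus>\<^bsub>?AA\<^esub>x\<in>UNIV. \<Oplus>\<^bsub>?AA\<^esub>y\<in>UNIV. lmom ?AA (?r x y a c) \<otimes>\<^bsub>?AA\<^esub> ?\<phi> (T x b) \<otimes>\<^bsub>?AA\<^esub> ?\<phi> (T y d))
       = (\<Oplus>\<^bsub>?AA\<^esub>x\<in>UNIV. \<Oplus>\<^bsub>?AA\<^esub>y\<in>UNIV. rmom ?AA (?r b d x y) \<otimes>\<^bsub>?AA\<^esub> ?\<phi> (T c y) \<otimes>\<^bsub>?AA\<^esub> ?\<phi> (T a x))" for a b c d
  proof -
    have "?\<phi> (T i j) = D i j" for i j by (simp add: D_def)
    then show ?thesis using main[of a c b d] unfolding sum2_def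
      by (simp only: B.m_assoc[OF B.lmom_carrier B.bideg_carrier[OF Dd] B.bideg_carrier[OF Dd]]
          B.m_assoc[OF B.rmom_carrier B.bideg_carrier[OF Dd] B.bideg_carrier[OF Dd]])
  qed
  have deg: "?\<phi> (T i j) \<in> bideg ?AA (wt i) (wt j)" for i j
    using Dd[of i j] by (simp add: D_def)
  note univ = frm_universal[OF P.bg_alg_AB deg _ _ P.mom_hom_left[OF mA(1)] P.mom_hom_right[OF mA(2,2,1)] rllB]
  have eq: "frm_comult l = pres_ext ?AA ?\<phi>" unfolding frm_comult_def A_def by (rule refl)
  show "h_algebra_hom A ?AA (frm_comult l)"
    unfolding eq unfolding A_def[symmetric] using univ(1) by (simp add: P.AB_simps(4,5) flip: A_def)
  show "frm_comult l (frm_t l i j) = (\<Oplus>\<^bsub>?AA\<^esub>k\<in>UNIV. aa_tens A A (frm_t l i k) (frm_t l k j))"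
    unfolding eq using univ(2)[of i j] by (simp add: P.AB_simps(4,5))
qed

subsection \<open>Coassociativity and the counit laws\<close>

lemma ring_hom_add_hom: "h \<in> ring_hom R S \<Longrightarrow> h \<in> hom (add_monoid R) (add_monoid S)"
  by (simp add: ring_hom_def hom_def)

lemma frm_bideg_disjoint:
  assumes "a \<in> bideg (frm l) \<alpha> \<beta>" "a \<in> bideg (frm l) \<gamma> \<delta>" "a \<noteq> \<zero>\<^bsub>frm l\<^esub>"
  shows "\<alpha> = \<gamma>" "\<beta> = \<delta>"
  using pres_bg.bideg_disjoint[OF pres_bg_frm] assms unfolding frm_eq by blast+

text \<open>Evaluates the composite of \<phi> \<otimes> \<psi> with the comultiplication on
  generators, for both sides of coassociativity and for both counit laws.\<close>

lemma frm_comult_aux: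
  fixes l :: complex and \<phi> \<psi> :: "'n::{finite,linorder} frm_free set \<Rightarrow> _" and i j :: 'n
  defines "A \<equiv> frm l :: ('n, 'n frm_free set) halg"
  assumes "bg_alg B" "bg_alg C" "h_algebra_hom A B \<phi>" "h_algebra_hom A C \<psi>"
  shows "aa_map B C \<phi> \<psi> (frm_comult l (frm_t l i j)) = (\<Oplus>\<^bsub>aa_tensor B C\<^esub>k\<in>UNIV. aa_tens B C (\<phi> (frm_t l i k)) (\<psi> (frm_t l k j)))"
    and "h_algebra_hom A (aa_tensor B C) (aa_map B C \<phi> \<psi> \<circ> frm_comult l)"
proof -
  have bgA: "bg_alg A" unfolding A_def by (rule bg_alg_frm)
  interpret P: bg_pair A A by (rule bg_pairI[OF bgA bgA])
  interpret AA: bg_alg "aa_tensor A A" by (rule P.bg_alg_AB)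
  interpret BC: bg_pair B C by (rule bg_pairI) fact+
  have hom: "h_algebra_hom (aa_tensor A A) (aa_tensor B C) (aa_map B C \<phi> \<psi>)"
    by (rule h_algebra_hom_aa_map) (use bgA assms in auto)
  have t: "frm_t l i j \<in> bideg A (wt i) (wt j)" for i j unfolding A_def by (rule frm_t_bideg)
  have tens: "aa_map B C \<phi> \<psi> (aa_tens A A a b) = aa_tens B C (\<phi> a) (\<psi> b)" for a b
    by (rule aa_map_tens[OF P.bg_pair_self BC.bg_pair_self h_algebra_hom_left_map(1)[OF bgA assms(4)]
          h_algebra_hom_left_map(2)[OF bgA assms(5)]])
  have \<Delta>: "h_algebra_hom A (aa_tensor A A) (frm_comult l)" unfolding A_def by (rule frm_comult_hom(1))
  have \<Delta>t: "frm_comult l (frm_t l i j) = (\<Oplus>\<^bsub>aa_tensor A A\<^esub>k\<in>UNIV. aa_tens A A (frm_t l i k) (frm_t l k j))"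
    unfolding A_def by (rule frm_comult_hom(2))
  show "aa_map B C \<phi> \<psi> (frm_comult l (frm_t l i j)) = (\<Oplus>\<^bsub>aa_tensor B C\<^esub>k\<in>UNIV. aa_tens B C (\<phi> (frm_t l i k)) (\<psi> (frm_t l k j)))"
    unfolding \<Delta>t
    by (subst ring_hom_finsum[OF AA.ring_axioms BC.ring_AB h_algebra_hom_ring_hom[OF hom] finite])
      (auto simp: tens intro: P.tens_carrier[OF t t])
  show "h_algebra_hom A (aa_tensor B C) (aa_map B C \<phi> \<psi> \<circ> frm_comult l)"
    by (rule h_algebra_hom_comp[OF \<Delta> hom])
qed

lemma frm_coassoc:
  fixes l :: complex
  defines "A \<equiv> frm l :: ('n::{finite,linorder}, 'n frm_free set) halg"
  shows "\<exists>\<Phi>. aaa_assoc A \<Phi> \<and> (\<forall>a\<in>carrier A.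
    \<Phi> (aa_map (aa_tensor A A) A (frm_comult l) id (frm_comult l a)) = aa_map A (aa_tensor A A) id (frm_comult l) (frm_comult l a))"
proof -
  have bgA: "bg_alg A" unfolding A_def by (rule bg_alg_frm)
  interpret P: bg_pair A A by (rule bg_pairI[OF bgA bgA])
  let ?AA = "aa_tensor A A"
  have bgAA: "bg_alg ?AA" by (rule P.bg_alg_AB)
  interpret L: bg_pair ?AA A by (rule bg_pairI[OF bgAA bgA])
  interpret H: bg_pair A ?AA by (rule bg_pairI[OF bgA bgAA])
  let ?L = "aa_tensor ?AA A" and ?H = "aa_tensor A ?AA" and ?\<Delta> = "frm_comult l" and ?t = "frm_t l"
  have ringL: "ring ?L" and ringH: "ring ?H" by (rule L.ring_AB, rule H.ring_AB)
  interpret RH: ring ?H by (rule ringH)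
  have hD: "h_algebra_hom A ?AA ?\<Delta>" unfolding A_def by (rule frm_comult_hom(1))
  have hI: "h_algebra_hom A A id" by (rule h_algebra_hom_id[OF bgA])
  have t: "?t i j \<in> bideg A (wt i) (wt j)" for i j unfolding A_def by (rule frm_t_bideg)
  have \<Delta>t: "frm_comult l (?t i j) = (\<Oplus>\<^bsub>?AA\<^esub>k\<in>UNIV. aa_tens A A (?t i k) (?t k j))" for i j
    unfolding A_def by (rule frm_comult_hom(2))
  have disj: "\<alpha> = \<gamma>" "\<beta> = \<delta>" if "a \<in> bideg A \<alpha> \<beta>" "a \<in> bideg A \<gamma> \<delta>" "a \<noteq> \<zero>\<^bsub>A\<^esub>" for a \<alpha> \<beta> \<gamma> \<delta>
    using frm_bideg_disjoint that unfolding A_def by blast+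
  \<comment> \<open>Directness of the grading of \<open>frm l\<close> supplies the degree conditions
    under which the associator exists.\<close>
  obtain \<Phi> where \<Phi>: "\<Phi> \<in> ring_hom ?L ?H"
    "\<And>a b c \<alpha> \<beta> \<gamma> \<delta>. a \<in> bideg A \<alpha> \<beta> \<Longrightarrow> b \<in> bideg A \<beta> \<gamma> \<Longrightarrow> c \<in> bideg A \<gamma> \<delta> \<Longrightarrow>
      \<Phi> (aa_tens ?AA A (aa_tens A A a b) c) = aa_tens A ?AA a (aa_tens A A b c)"
    by (rule associator[OF bgA bgA bgA disj(2) disj(1)]) (use that in blast)+
  define h where "h = aa_map ?AA A ?\<Delta> id \<circ> ?\<Delta>"
  define k where "k = aa_map A ?AA id ?\<Delta> \<circ> ?\<Delta>"
  have h: "h_algebra_hom A ?L h" "h (?t i j) = (\<Oplus>\<^bsub>?L\<^esub>k\<in>UNIV. aa_tens ?AA A (?\<Delta> (?t i k)) (?t k j))" for i j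
    unfolding h_def A_def
    by (rule frm_comult_aux(2)[OF bgAA[unfolded A_def] bgA[unfolded A_def] hD[unfolded A_def] hI[unfolded A_def]])
      (use frm_comult_aux(1)[OF bgAA[unfolded A_def] bgA[unfolded A_def] hD[unfolded A_def] hI[unfolded A_def]] in simp)
  have k: "h_algebra_hom A ?H k" "k (?t i j) = (\<Oplus>\<^bsub>?H\<^esub>k\<in>UNIV. aa_tens A ?AA (?t i k) (?\<Delta> (?t k j)))" for i j
    unfolding k_def A_def
    by (rule frm_comult_aux(2)[OF bgA[unfolded A_def] bgAA[unfolded A_def] hI[unfolded A_def] hD[unfolded A_def]])
      (use frm_comult_aux(1)[OF bgA[unfolded A_def] bgAA[unfolded A_def] hI[unfolded A_def] hD[unfolded A_def]] in simp)
  have "\<Phi> (h x) = k x" if "x \<in> carrier A" for x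
  proof -
    have "(\<Phi> \<circ> h) x = k x"
    proof (rule frm_hom_eq[of ?H "\<Phi> \<circ> h" l, folded A_def, OF ringH])
      show "\<Phi> \<circ> h \<in> ring_hom A ?H" by (rule ring_hom_trans[OF h_algebra_hom_ring_hom[OF h(1)] \<Phi>(1)])
      show "k \<in> ring_hom A ?H" by (rule h_algebra_hom_ring_hom[OF k(1)])
      show "(\<Phi> \<circ> h) (lmom A f) = k (lmom A f)" "(\<Phi> \<circ> h) (rmom A f) = k (rmom A f)" for f
        using \<Phi>(2)[OF P.A.lmom_bideg P.A.bideg_one P.A.bideg_one, of f] \<Phi>(2)[OF P.A.bideg_one P.A.bideg_one P.A.rmom_bideg, of f]
        by (simp_all add: h_algebra_hom_mom[OF h(1)] h_algebra_hom_mom[OF k(1)] L.AB_simps(4,5) H.AB_simps(4,5) P.AB_simps(3-5))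
      show "x \<in> carrier A" by fact
      fix i j
      have c: "aa_tens ?AA A (aa_tens A A (?t i m) (?t m k)) (?t k j) \<in> bideg ?L (wt i) (wt j)" for m k
        by (rule L.tens_bideg[OF P.tens_bideg[OF t t] t])
      have c': "aa_tens A ?AA (?t i m) (aa_tens A A (?t m k) (?t k j)) \<in> carrier ?H" for m k
        by (rule H.tens_carrier[OF t P.tens_bideg[OF t t]])
      interpret bgL: bg_alg ?L by (rule L.bg_alg_AB)
      have "h (?t i j) = (\<Oplus>\<^bsub>?L\<^esub>k\<in>UNIV. \<Oplus>\<^bsub>?L\<^esub>m\<in>UNIV. aa_tens ?AA A (aa_tens A A (?t i m) (?t m k)) (?t k j))"
        unfolding h(2) \<Delta>t
        by (subst L.tens_finsum_left[OF finite P.tens_bideg[OF t t] t]) (rule refl)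
      then have "(\<Phi> \<circ> h) (?t i j) = (\<Oplus>\<^bsub>?H\<^esub>k\<in>UNIV. \<Oplus>\<^bsub>?H\<^esub>m\<in>UNIV. aa_tens A ?AA (?t i m) (aa_tens A A (?t m k) (?t k j)))"
        by (simp add: ring_hom_finsum[OF ringL ringH \<Phi>(1) finite] bgL.bideg_carrier[OF bgL.bideg_finsum[OF c]]
            bgL.bideg_carrier[OF c] \<Phi>(2)[OF t t t])
      \<comment> \<open>The two sides are the same double sum over intermediate indices, taken in
        opposite orders.\<close>
      also have "\<dots> = (\<Oplus>\<^bsub>?H\<^esub>m\<in>UNIV. \<Oplus>\<^bsub>?H\<^esub>k\<in>UNIV. aa_tens A ?AA (?t i m) (aa_tens A A (?t m k) (?t k j)))"
        by (rule H.G.finsum_swap[OF finite finite c'])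
      also have "\<dots> = k (?t i j)"
        unfolding k(2) \<Delta>t
        by (subst H.tens_finsum_right[OF finite P.tens_bideg[OF t t] t]) (rule refl)
      finally show "(\<Phi> \<circ> h) (?t i j) = k (?t i j)" .
    qed
    then show ?thesis by simp
  qed
  then show ?thesis
    using \<Phi> ring_hom_add_hom[OF \<Phi>(1)] by (intro exI[of _ \<Phi>]) (auto simp: aaa_assoc_def h_def k_def)
qed

text \<open>The right-hand side of a counit law, such as T_(-\<alpha>) \<otimes> a, depends on the
  bidegree of a and is not given as one map on the whole algebra. The family K records it degree by
  degree; multiplicativity with added degrees is enough to compare it with h along words.\<close>

lemma frm_bideg_eq:
  fixes l :: complex and K :: "(complex, 'n::{finite,linorder}) vec \<Rightarrow> (complex, 'n) vec \<Rightarrow> 'n frm_free set \<Rightarrow> 'b"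
  defines "A \<equiv> frm l :: ('n, 'n frm_free set) halg"
  assumes B: "ring B" and h: "h \<in> ring_hom A B"
    and K0: "\<And>\<alpha> \<beta>. K \<alpha> \<beta> \<zero>\<^bsub>A\<^esub> = \<zero>\<^bsub>B\<^esub>"
    and Kadd: "\<And>\<alpha> \<beta> x y. x \<in> bideg A \<alpha> \<beta> \<Longrightarrow> y \<in> bideg A \<alpha> \<beta> \<Longrightarrow> K \<alpha> \<beta> (x \<oplus>\<^bsub>A\<^esub> y) = K \<alpha> \<beta> x \<oplus>\<^bsub>B\<^esub> K \<alpha> \<beta> y"
    and Kmult: "\<And>\<alpha> \<beta> \<gamma> \<delta> x y. x \<in> bideg A \<alpha> \<beta> \<Longrightarrow> y \<in> bideg A \<gamma> \<delta> \<Longrightarrow>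
      K (\<alpha> + \<gamma>) (\<beta> + \<delta>) (x \<otimes>\<^bsub>A\<^esub> y) = K \<alpha> \<beta> x \<otimes>\<^bsub>B\<^esub> K \<gamma> \<delta> y"
    and gens: "\<And>i j. h (frm_t l i j) = K (wt i) (wt j) (frm_t l i j)"
      "\<And>f. h (lmom A f) = K 0 0 (lmom A f)" "\<And>f. h (rmom A f) = K 0 0 (rmom A f)"
    and a: "a \<in> bideg A \<alpha> \<beta>"
  shows "h a = K \<alpha> \<beta> a"
proof -
  let ?E = "frm_rels l :: 'n frm_free set" and ?d = "frm_gen_bideg :: ('n, 'n mero) frm_gen \<Rightarrow> _"
  interpret F: pres_bg ?E ?d "\<lambda>f. fgen (Lam f)" "\<lambda>f. fgen (Mu f)" by (rule pres_bg_frm)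
  have AP: "A = F.P" by (simp add: A_def frm_eq)
  interpret A: bg_alg A unfolding A_def by (rule bg_alg_frm)
  have \<pi>: "F.\<pi> p \<in> bideg A \<alpha> \<beta>" if "p \<in> homog ?d (\<alpha>, \<beta>)" for p \<alpha> \<beta>
    unfolding AP by (rule F.pi_homog[OF that])
  have word: "h (F.\<pi> (Poly_Mapping.single w c)) =
      K (fst (word_deg ?d w)) (snd (word_deg ?d w)) (F.\<pi> (Poly_Mapping.single w c))" for w c
  proof (induction w)
    case Nil
    have "F.\<pi> (Poly_Mapping.single [] c) = lmom A (mero_const c)"
    proof -
      have "F.\<pi> (fconst c) = F.\<pi> (fgen (Lam (mero_const c)))"
        by (rule copy_rels_cls(3)[OF frm_copy_rels(1), symmetric])
      then show ?thesis by (simp add: A_def frm_eq fconst_def)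
    qed
    then show ?case by (simp add: gens)
  next
    case (Cons g w)
    have eq: "F.\<pi> (Poly_Mapping.single (g # w) c) = F.\<pi> (fgen g) \<otimes>\<^bsub>A\<^esub> F.\<pi> (Poly_Mapping.single w c)"
      by (simp add: AP pres_cls_mult[symmetric] fgen_mult_single)
    have g: "h (F.\<pi> (fgen g)) = K (fst (?d g)) (snd (?d g)) (F.\<pi> (fgen g))"
      by (cases g) (simp_all add: frm_gen_simps gens flip: A_def)
    have dg: "F.\<pi> (fgen g) \<in> bideg A (fst (?d g)) (snd (?d g))"
      by (rule \<pi>) (simp add: fgen_def)
    have dw: "F.\<pi> (Poly_Mapping.single w c) \<in> bideg A (fst (word_deg ?d w)) (snd (word_deg ?d w))"
      by (rule \<pi>) simp
    show ?case
      unfolding eq ring_hom_mult[OF h A.bideg_carrier[OF dg] A.bideg_carrier[OF dw]] g Cons Kmult[OF dg dw, symmetric]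
      by simp
  qed
  obtain p where p: "p \<in> homog ?d (\<alpha>, \<beta>)" "a = F.\<pi> p" using a unfolding AP by (rule F.bideg_PE)
  have "h (F.\<pi> p) = K \<alpha> \<beta> (F.\<pi> p)" using p(1)
  proof (induction p rule: homog_induct)
    case zero
    have "F.\<pi> 0 = \<zero>\<^bsub>A\<^esub>" by (simp add: AP pres_cls_zero)
    then show ?case using K0 ring_hom_zero[OF h A.ring_axioms B] by simp
  next
    case (single w c)
    then show ?case using word[of w c] by simp
  next
    case (add p q)
    have "F.\<pi> (p + q) = F.\<pi> p \<oplus>\<^bsub>A\<^esub> F.\<pi> q" by (simp add: AP pres_cls_add)
    then show ?case
      using add(3,4) Kadd[OF \<pi>[OF add(1)] \<pi>[OF add(2)]]
        ring_hom_add[OF h A.bideg_carrier[OF \<pi>[OF add(1)]] A.bideg_carrier[OF \<pi>[OF add(2)]]] by simp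
  qed
  then show ?thesis unfolding p(2) .
qed

lemma shift_mem_diff_alg: "shift (- \<alpha>) \<in> bideg diff_alg \<alpha> \<alpha>"
  by (auto simp: diff_alg_simps intro: exI[of _ 1])

lemma shift_comp: "shift (- \<alpha>) \<circ> shift (- \<beta>) = shift (- (\<alpha> + \<beta>))"
  by (auto simp: fun_eq_iff shift_shift)

lemma shift_0_id: "shift 0 = id"
  by (auto simp: fun_eq_iff)

lemma (in abelian_monoid) finsum_delta:
  assumes "\<And>j. f j \<in> carrier G"
  shows "(\<Oplus>j\<in>(UNIV :: 'i::finite set). if i = j then f j else \<zero>) = f i"
  using add.finprod_singleton[of i UNIV f] assms by simp

lemma frm_counit_laws:
  fixes l :: complex and a :: "'n::{finite,linorder} frm_free set"
  defines "A \<equiv> frm l :: ('n, 'n frm_free set) halg"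
  assumes a: "a \<in> bideg A \<alpha> \<beta>"
  shows "aa_map diff_alg A (frm_counit l) id (frm_comult l a) = aa_tens diff_alg A (shift (- \<alpha>)) a"
    and "aa_map A diff_alg id (frm_counit l) (frm_comult l a) = aa_tens A diff_alg a (shift (- \<beta>))"
proof -
  let ?D = "diff_alg :: ('n, 'n mero \<Rightarrow> 'n mero) halg" and ?t = "frm_t l :: 'n \<Rightarrow> 'n \<Rightarrow> _"
  have bgA: "bg_alg A" unfolding A_def by (rule bg_alg_frm)
  have bgD: "bg_alg ?D" by (rule bg_alg_diff_alg)
  interpret L: bg_pair ?D A by (rule bg_pairI[OF bgD bgA])
  interpret R: bg_pair A ?D by (rule bg_pairI[OF bgA bgD])
  interpret RL: ring L.AB by (rule L.ring_AB)
  interpret RR: ring R.AB by (rule R.ring_AB)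
  have hE: "h_algebra_hom A ?D (frm_counit l)" unfolding A_def by (rule frm_counit_hom(1))
  have hI: "h_algebra_hom A A id" by (rule h_algebra_hom_id[OF bgA])
  have t: "?t i j \<in> bideg A (wt i) (wt j)" for i j unfolding A_def by (rule frm_t_bideg)
  define h where "h = aa_map ?D A (frm_counit l) id \<circ> frm_comult l"
  define k where "k = aa_map A ?D id (frm_counit l) \<circ> frm_comult l"
  have h: "h_algebra_hom A L.AB h" "h (?t i j) = (\<Oplus>\<^bsub>L.AB\<^esub>k\<in>UNIV. aa_tens ?D A (frm_counit l (?t i k)) (?t k j))" for i j
    unfolding h_def A_def
    by (rule frm_comult_aux(2)[OF bgD[unfolded A_def] bgA[unfolded A_def] hE[unfolded A_def] hI[unfolded A_def]])
      (use frm_comult_aux(1)[OF bgD[unfolded A_def] bgA[unfolded A_def] hE[unfolded A_def] hI[unfolded A_def]] in simp)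
  have k: "h_algebra_hom A R.AB k" "k (?t i j) = (\<Oplus>\<^bsub>R.AB\<^esub>k\<in>UNIV. aa_tens A ?D (?t i k) (frm_counit l (?t k j)))" for i j
    unfolding k_def A_def
    by (rule frm_comult_aux(2)[OF bgA[unfolded A_def] bgD[unfolded A_def] hI[unfolded A_def] hE[unfolded A_def]])
      (use frm_comult_aux(1)[OF bgA[unfolded A_def] bgD[unfolded A_def] hI[unfolded A_def] hE[unfolded A_def]] in simp)
  have e: "frm_counit l (?t i j) = (if i = j then shift (- wt i) else \<zero>\<^bsub>?D\<^esub>)" for i j
    using frm_counit_hom(2)[of l i j] by (simp add: diff_alg_simps(3))
  note s = shift_mem_diff_alg
  have one: "\<one>\<^bsub>?D\<^esub> = shift (- 0)" by (simp add: diff_alg_simps shift_0_id)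
  have "h a = aa_tens ?D A (shift (- \<alpha>)) a"
  proof (rule frm_bideg_eq[where l = l and K = "\<lambda>\<alpha> \<beta>. aa_tens ?D A (shift (- \<alpha>))", folded A_def, OF L.ring_AB h_algebra_hom_ring_hom[OF h(1)] _ _ _ _ _ _ a])
    fix \<alpha> \<beta> :: "(complex, 'n) vec"
    show "aa_tens ?D A (shift (- \<alpha>)) \<zero>\<^bsub>A\<^esub> = \<zero>\<^bsub>L.AB\<^esub>" by (rule L.tens_zero_right[OF s])
    fix x y
    show "aa_tens ?D A (shift (- \<alpha>)) (x \<oplus>\<^bsub>A\<^esub> y) = aa_tens ?D A (shift (- \<alpha>)) x \<oplus>\<^bsub>L.AB\<^esub> aa_tens ?D A (shift (- \<alpha>)) y"
      if "x \<in> bideg A \<alpha> \<beta>" "y \<in> bideg A \<alpha> \<beta>" by (rule L.tens_add_right[OF s that])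
    fix \<gamma> \<delta>
    show "aa_tens ?D A (shift (- (\<alpha> + \<gamma>))) (x \<otimes>\<^bsub>A\<^esub> y) = aa_tens ?D A (shift (- \<alpha>)) x \<otimes>\<^bsub>L.AB\<^esub> aa_tens ?D A (shift (- \<gamma>)) y"
      if "x \<in> bideg A \<alpha> \<beta>" "y \<in> bideg A \<gamma> \<delta>"
      using L.tens_mult[OF s that(1) s that(2)] by (simp only: diff_alg_simps(1) shift_comp)
  next
    fix i j
    have "aa_tens ?D A (frm_counit l (?t i k)) (?t k j) = (if i = k then aa_tens ?D A (shift (- wt k)) (?t k j) else \<zero>\<^bsub>L.AB\<^esub>)" for k
      using L.tens_zero_left[OF t] by (simp add: e)
    then show "h (?t i j) = aa_tens ?D A (shift (- wt i)) (?t i j)"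
      unfolding h(2) using L.tens_carrier[OF s t] by (simp add: L.G.finsum_delta)
  next
    fix f
    \<comment> \<open>Both moment maps of the difference operators are multiplication by f, so
      balancing moves f from the left factor to \<open>lmom A f\<close> in the right one; the
      translation of degree 0 is the identity.\<close>
    show "h (lmom A f) = aa_tens ?D A (shift (- 0)) (lmom A f)"
      using L.tens_balance[OF L.A.bideg_one L.B.bideg_one, of f]
      by (simp add: h_algebra_hom_mom[OF h(1)] L.AB_simps(4) one[symmetric] L.A.bideg_carrier[OF L.A.bideg_one] diff_alg_simps(7,8) del: minus_zero)
        (simp add: diff_alg_simps)
    show "h (rmom A f) = aa_tens ?D A (shift (- 0)) (rmom A f)"
      by (simp add: h_algebra_hom_mom[OF h(1)] L.AB_simps(5) one[symmetric] del: minus_zero)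
  qed
  then show "aa_map diff_alg A (frm_counit l) id (frm_comult l a) = aa_tens diff_alg A (shift (- \<alpha>)) a"
    by (simp add: h_def)
  have "k a = aa_tens A ?D a (shift (- \<beta>))"
  proof (rule frm_bideg_eq[where l = l and K = "\<lambda>\<alpha> \<beta> a. aa_tens A ?D a (shift (- \<beta>))", folded A_def, OF R.ring_AB h_algebra_hom_ring_hom[OF k(1)] _ _ _ _ _ _ a])
    fix \<alpha> \<beta> :: "(complex, 'n) vec"
    show "aa_tens A ?D \<zero>\<^bsub>A\<^esub> (shift (- \<beta>)) = \<zero>\<^bsub>R.AB\<^esub>" by (rule R.tens_zero_left[OF s])
    fix x y
    show "aa_tens A ?D (x \<oplus>\<^bsub>A\<^esub> y) (shift (- \<beta>)) = aa_tens A ?D x (shift (- \<beta>)) \<oplus>\<^bsub>R.AB\<^esub> aa_tens A ?D y (shift (- \<beta>))"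
      if "x \<in> bideg A \<alpha> \<beta>" "y \<in> bideg A \<alpha> \<beta>" by (rule R.tens_add_left[OF that s])
    fix \<gamma> \<delta>
    show "aa_tens A ?D (x \<otimes>\<^bsub>A\<^esub> y) (shift (- (\<beta> + \<delta>))) = aa_tens A ?D x (shift (- \<beta>)) \<otimes>\<^bsub>R.AB\<^esub> aa_tens A ?D y (shift (- \<delta>))"
      if "x \<in> bideg A \<alpha> \<beta>" "y \<in> bideg A \<gamma> \<delta>"
      using R.tens_mult[OF that(1) s that(2) s] by (simp only: diff_alg_simps(1) shift_comp)
  next
    fix i j
    have "aa_tens A ?D (?t i k) (frm_counit l (?t k j)) = (if j = k then aa_tens A ?D (?t i k) (shift (- wt k)) else \<zero>\<^bsub>R.AB\<^esub>)" for k
      using R.tens_zero_right[OF t] by (simp add: e)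
    then show "k (?t i j) = aa_tens A ?D (?t i j) (shift (- wt j))"
      unfolding k(2) using R.tens_carrier[OF t s] by (simp add: R.G.finsum_delta)
  next
    fix f
    show "k (rmom A f) = aa_tens A ?D (rmom A f) (shift (- 0))"
      using R.tens_balance[OF L.B.bideg_one L.A.bideg_one, of f]
      by (simp add: h_algebra_hom_mom[OF k(1)] R.AB_simps(5) one[symmetric] L.B.bideg_carrier[OF L.B.bideg_one] diff_alg_simps(7,8) del: minus_zero)
        (simp add: diff_alg_simps)
    show "k (lmom A f) = aa_tens A ?D (lmom A f) (shift (- 0))"
      by (simp add: h_algebra_hom_mom[OF k(1)] R.AB_simps(4) one[symmetric] del: minus_zero)
  qed
  then show "aa_map A diff_alg id (frm_counit l) (frm_comult l a) = aa_tens A diff_alg a (shift (- \<beta>))"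
    by (simp add: k_def)
qed

lemma h_bialgebroid_frm:
  "h_bialgebroid (frm l :: ('n::{finite,linorder}, 'n frm_free set) halg) (frm_comult l) (frm_counit l)"
  by (intro h_bialgebroid.intro h_bialgebroid_axioms.intro h_algebra_frm frm_comult_hom(1) frm_counit_hom(1)
      frm_coassoc frm_counit_laws)


section \<open>Meromorphic identities\<close>

lemma meromorphic_holomorphic_Cn:
  assumes "holomorphic_Cn f UNIV"
  shows "meromorphic_Cn f"
proof -
  have "local_quotient f UNIV f (\<lambda>_. 1)"
    unfolding local_quotient_def by (simp add: assms holomorphic_Cn_const)
  then show ?thesis unfolding meromorphic_Cn_def by blast
qed

lemma mero_eq_refl: "meromorphic_Cn f \<Longrightarrow> mero_eq f f"
  by (simp add: mero_eq_def eq_generic_refl)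

lemma mero_of_ops:
  assumes "meromorphic_Cn f" "meromorphic_Cn g"
  shows "mero_of f + mero_of g = mero_of (\<lambda>z. f z + g z)" "mero_of f * mero_of g = mero_of (\<lambda>z. f z * g z)"
    "- mero_of f = mero_of (\<lambda>z. - f z)" "inverse (mero_of f) = mero_of (\<lambda>z. inverse (f z))"
  using assms by (simp_all add: plus_mero.abs_eq times_mero.abs_eq uminus_mero.abs_eq inverse_mero.abs_eq mero_eq_refl)

lemma mero_const_of: "mero_const c = mero_of (\<lambda>_. c)"
  by (simp add: mero_const_def)

text \<open>The function q^(-2(\<lambda>_i - \<lambda>_j)), in which g, h0 and h are
  rational.\<close>

definition uexp :: "complex \<Rightarrow> 'n \<Rightarrow> 'n \<Rightarrow> complex ^ 'n::finite \<Rightarrow> complex"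
  where "uexp l i j z = qpow l (-2 * (z $ i - z $ j))"

lemma holomorphic_uexp: "holomorphic_Cn (uexp l i j) U"
  unfolding holomorphic_Cn_def
proof
  fix z :: "complex ^ 'a"
  let ?lin = "\<lambda>v :: complex ^ 'a. -2 * (v $ i - v $ j) * l"
  have "((\<lambda>z. z $ k) has_derivative (\<lambda>v. v $ k)) (at z)" for k
    by (rule bounded_linear.has_derivative[OF bounded_linear_vec_nth has_derivative_ident])
  then have "(?lin has_derivative ?lin) (at z)"
    by (intro has_derivative_mult_left has_derivative_mult_right has_derivative_diff)
  from has_derivative_compose[OF this has_field_derivative_imp_has_derivative[OF DERIV_exp]]
  have "(uexp l i j has_derivative (\<lambda>v. exp (?lin z) * ?lin v)) (at z)"
    by (simp add: uexp_def[abs_def] qpow_def)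
  moreover have "exp (?lin z) * ?lin (c *s v) = c * (exp (?lin z) * ?lin v)" for c v
    by (simp add: algebra_simps)
  ultimately show "\<exists>D. (uexp l i j has_derivative D) (at z) \<and> (\<forall>c v. D (c *s v) = c * D v)"
    by (intro exI[of _ "\<lambda>v. exp (?lin z) * ?lin v"] conjI allI)
qed

lemma meromorphic_uexp: "meromorphic_Cn (uexp l i j)"
  by (rule meromorphic_holomorphic_Cn[OF holomorphic_uexp])

definition mero_qpow :: "complex \<Rightarrow> 'n \<Rightarrow> 'n \<Rightarrow> 'n::finite mero"
  where "mero_qpow l i j = mero_of (uexp l i j)"

lemma meromorphic_minus_const: "meromorphic_Cn f \<Longrightarrow> meromorphic_Cn (\<lambda>z. f z - c)"
  using meromorphic_Cn_op2(1)[OF _ meromorphic_Cn_const[of "- c"], of f] by simp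

lemma mero_minus_const:
  assumes "meromorphic_Cn f"
  shows "mero_of f - mero_const c = mero_of (\<lambda>z. f z - c)"
proof -
  have "- mero_of (\<lambda>_. c) = mero_of (\<lambda>_ :: complex ^ 'a. - c)"
    by (rule mero_of_ops(3)[OF meromorphic_Cn_const meromorphic_Cn_const])
  then show ?thesis
    unfolding diff_conv_add_uminus mero_const_of using mero_of_ops(1)[OF assms meromorphic_Cn_const, of "- c"] by simp
qed

text \<open>Passes from pointwise formulas to rational expressions in \<open>mero_qpow\<close>.
  Inversion of classes is pointwise inversion with inverse 0 = 0, so the poles cause no case
  distinction.\<close>

lemma mero_diff_h0: "mero_diff (h0_fun l) i j = mero_const (qpow l (-1) - qpow l 1) * inverse (mero_qpow l i j - 1)"
proof -
  note m = meromorphic_minus_const[OF meromorphic_uexp, of l i j 1]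
  have u: "mero_qpow l i j - 1 = mero_of (\<lambda>z. uexp l i j z - 1)"
    using mero_minus_const[OF meromorphic_uexp, of l i j 1] by (simp add: mero_qpow_def)
  have "mero_diff (h0_fun l) i j = mero_of (\<lambda>z. (qpow l (-1) - qpow l 1) * inverse (uexp l i j z - 1))"
    by (simp only: mero_diff_def h0_fun_def divide_inverse uexp_def)
  also have "\<dots> = mero_const (qpow l (-1) - qpow l 1) * inverse (mero_qpow l i j - 1)"
    unfolding u mero_const_of mero_of_ops(4)[OF m m]
    by (rule mero_of_ops(2)[OF meromorphic_Cn_const meromorphic_Cn_inverse[OF m], symmetric])
  finally show ?thesis .
qed

lemma mero_diff_h: "mero_diff (h_fun l) i j = mero_const (qpow l 1) - mero_diff (h0_fun l) i j"
proof -
  let ?h = "\<lambda>z :: complex ^ 'a. h0_fun l (z $ i - z $ j)"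
  have "meromorphic_Cn (\<lambda>z. (qpow l (-1) - qpow l 1) * inverse (uexp l i j z - 1))"
    by (intro meromorphic_Cn_op2(2) meromorphic_Cn_const meromorphic_Cn_inverse meromorphic_minus_const meromorphic_uexp)
  then have h0: "meromorphic_Cn ?h"
    by (simp only: h0_fun_def divide_inverse uexp_def)
  have "mero_const (qpow l 1) + - mero_of ?h = mero_of (\<lambda>z. qpow l 1 + - ?h z)"
    unfolding mero_const_of mero_of_ops(3)[OF h0 h0]
    by (rule mero_of_ops(1)[OF meromorphic_Cn_const meromorphic_Cn_uminus[OF h0]])
  then show ?thesis by (simp add: mero_diff_def h_fun_def)
qed

lemma mero_diff_g: "mero_diff (g_fun l) i j = (mero_qpow l i j - mero_const (qpow l (-2))) *
    (mero_qpow l i j - mero_const (qpow l 2)) * (inverse (mero_qpow l i j - 1) * inverse (mero_qpow l i j - 1))"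
proof -
  note m = meromorphic_minus_const[OF meromorphic_uexp, of l i j]
  have u: "mero_qpow l i j - mero_const c = mero_of (\<lambda>z. uexp l i j z - c)" for c
    using mero_minus_const[OF meromorphic_uexp, of l i j c] by (simp only: mero_qpow_def)
  have u1: "mero_qpow l i j - 1 = mero_of (\<lambda>z. uexp l i j z - 1)"
    using u[of 1] by simp
  have "mero_diff (g_fun l) i j = mero_of (\<lambda>z. (uexp l i j z - qpow l (-2)) * (uexp l i j z - qpow l 2) *
      (inverse (uexp l i j z - 1) * inverse (uexp l i j z - 1)))"
    by (simp only: mero_diff_def g_fun_def divide_inverse uexp_def power2_eq_square inverse_mult_distrib)
  then show ?thesis unfolding u u1 mero_of_ops(4)[OF m m]
    by (simp only: mero_of_ops(2) m meromorphic_Cn_op2(2) meromorphic_Cn_inverse)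
qed

lemma mero_qpow_swap: "mero_qpow l i j * mero_qpow l j i = 1"
proof -
  have "uexp l i j z * uexp l j i z = 1" for z
    by (simp add: uexp_def qpow_def algebra_simps flip: exp_add)
  then have "mero_qpow l i j * mero_qpow l j i = mero_of (\<lambda>_. 1)"
    unfolding mero_qpow_def by (simp only: mero_of_ops(2)[OF meromorphic_uexp meromorphic_uexp])
  then show ?thesis by (simp flip: mero_const_of)
qed

text \<open>A holomorphic function equal to 1 on a dense set is 1 everywhere, but at the unit vector
  e_i this one takes the value q^(-2).\<close>

lemma mero_qpow_neq_1:
  assumes "i \<noteq> j" "qpow l (-2) \<noteq> 1"
  shows "mero_qpow l i j \<noteq> 1"
proof
  assume "mero_qpow l i j = 1"
  then have "mero_of (uexp l i j) = mero_of (\<lambda>_. 1)"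
    by (simp add: mero_qpow_def flip: mero_const_of)
  then have "mero_eq (uexp l i j) (\<lambda>_. 1)"
    using Quotient3_rel[OF Quotient3_mero, of "uexp l i j" "\<lambda>_. 1"] mero_eq_refl[OF meromorphic_uexp[of l i j]]
      mero_eq_refl[OF meromorphic_Cn_const[of 1]]
    by blast
  then obtain W where W: "open W" "closure W = UNIV" "\<forall>z\<in>W. uexp l i j z = 1"
    unfolding mero_eq_def eq_generic_def by blast
  have "uexp l i j (axis i 1) + - 1 = 0"
    by (rule zero_of_dense[of UNIV "\<lambda>z. uexp l i j z + - 1" W])
      (use W holomorphic_Cn_add[OF holomorphic_uexp[of l i j UNIV] holomorphic_Cn_const[of "- 1"]] in auto)
  then show False using assms by (simp add: axis_def uexp_def)
qed

text \<open>Here u and v stand for q^(-2z) and q^(2z); the two sides are g(-z) and h(z)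
  h(-z).\<close>

lemma field_exchange:
  fixes q u v :: "'a::field"
  assumes q: "q \<noteq> 0" and uv: "u * v = 1" and u: "u \<noteq> 1"
  shows "(v - inverse q * inverse q) * (v - q * q) * (inverse (v - 1) * inverse (v - 1)) =
    (q - (inverse q - q) * inverse (u - 1)) * (q - (inverse q - q) * inverse (v - 1))"
proof -
  have v: "v = inverse u" "u \<noteq> 0" using uv by (auto simp: inverse_unique[symmetric])
  have a: "u - 1 \<noteq> 0" "1 - u \<noteq> 0" using u by auto
  have e: "inverse (inverse u - 1) = u / (1 - u)" using v a by (simp add: field_simps)
  have s: "q - (inverse q - q) * inverse (u - 1) = (q * q * u - 1) / (q * (u - 1))"
    using q a by (simp add: field_simps)
  have t: "q - (inverse q - q) * (u / (1 - u)) = (q * q - u) / (q * (1 - u))"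
    using q a by (simp add: field_simps)
  have w: "inverse u - inverse q * inverse q = (q * q - u) / (q * q * u)" "inverse u - q * q = (1 - q * q * u) / u"
    using q v by (simp_all add: field_simps)
  have m: "q * q * u - 1 = - (1 - q * q * u)" "u - 1 = - (1 - u)" by simp_all
  \<comment> \<open>With S = q^2 - u, P = 1 - q^2 u and r = 1 - u, the rewritten equation is this
    identity, in which P, S and r are treated as independent.\<close>
  have gen: "S / (q * q * u) * (P / u) * (u / r * (u / r)) = (- P / (q * - r)) * (S / (q * r))"
    if "r \<noteq> 0" for P S r
    using q v that by (simp add: field_simps)
  show ?thesis unfolding v(1) e s t w unfolding m by (rule gen[OF a(2)])
qed

lemma mero_exchange:
  assumes "i \<noteq> j" "qpow l (-2) \<noteq> 1"
  shows "mero_diff (g_fun l) j i = mero_diff (h_fun l) i j * mero_diff (h_fun l) j i"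
proof -
  let ?q = "mero_const (qpow l 1) :: 'a mero"
  have "qpow l 1 * qpow l (-1) = 1" by (simp add: qpow_def flip: exp_add)
  then have qi: "?q * mero_const (qpow l (-1)) = 1" by (simp flip: mero_const_mult)
  then have q: "?q \<noteq> 0" "mero_const (qpow l (-1)) = inverse ?q" by (auto simp: inverse_unique)
  have "qpow l 2 = qpow l 1 * qpow l 1" "qpow l (-2) = qpow l (-1) * qpow l (-1)"
    by (simp_all add: qpow_def flip: exp_add)
  then have q2: "mero_const (qpow l 2) = ?q * ?q" "mero_const (qpow l (-2)) = inverse ?q * inverse ?q"
    by (simp_all only: mero_const_mult q(2))
  have "mero_const (qpow l (-1) - qpow l 1) + ?q = mero_const (qpow l (-1))" by (simp flip: mero_const_add)
  then have q3: "mero_const (qpow l (-1) - qpow l 1) = inverse ?q - ?q"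
    unfolding q(2) by (simp add: eq_diff_eq)
  show ?thesis
    unfolding mero_diff_g mero_diff_h mero_diff_h0 q2 q3
    by (rule field_exchange[OF q(1) mero_qpow_swap mero_qpow_neq_1[OF assms]])
qed

section \<open>Exchange relations between the generators of the bialgebroid\<close>

text \<open>By the zero-weight condition an RLL sum over two distinct indices has at most the terms
  (p, q) and (q, p).\<close>

lemma (in ring) sum2_two:
  assumes c: "\<And>x y. F x y \<in> carrier R" and pq: "p \<noteq> q"
    and z: "\<And>x y. (x, y) \<noteq> (p, q) \<Longrightarrow> (x, y) \<noteq> (q, p) \<Longrightarrow> F x y = \<zero>"
  shows "sum2 R F = F p q \<oplus> F q p"
proof -
  have inner: "(\<Oplus>y\<in>UNIV. F x y) = (if p = x then F p q else \<zero>) \<oplus> (if q = x then F q p else \<zero>)" for x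
  proof -
    have "(\<Oplus>y\<in>UNIV. F x y) = (\<Oplus>y\<in>UNIV. (if q = y then (if p = x then F p y else \<zero>) else \<zero>) \<oplus>
        (if p = y then (if q = x then F q y else \<zero>) else \<zero>))"
      using c z pq by (intro add.finprod_cong') auto
    also have "\<dots> = (\<Oplus>y\<in>UNIV. if q = y then (if p = x then F p y else \<zero>) else \<zero>) \<oplus>
        (\<Oplus>y\<in>UNIV. if p = y then (if q = x then F q y else \<zero>) else \<zero>)"
      using c by (intro finsum_addf) auto
    also have "\<dots> = (if p = x then F p q else \<zero>) \<oplus> (if q = x then F q p else \<zero>)"
      using c by (subst (1 2) finsum_delta) auto
    finally show ?thesis .
  qed
  have "sum2 R F = (\<Oplus>x\<in>UNIV. if p = x then F p q else \<zero>) \<oplus> (\<Oplus>x\<in>UNIV. if q = x then F q p else \<zero>)"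
    unfolding sum2_def inner using c by (intro finsum_addf) auto
  then show ?thesis using c finsum_delta[of "\<lambda>_. F p q" p] finsum_delta[of "\<lambda>_. F q p" q] by simp
qed

lemma (in ring) sum2_one:
  assumes c: "\<And>x y. F x y \<in> carrier R" and z: "\<And>x y. (x, y) \<noteq> (p, p) \<Longrightarrow> F x y = \<zero>"
  shows "sum2 R F = F p p"
proof -
  have inner: "(\<Oplus>y\<in>UNIV. F x y) = (if p = x then F x p else \<zero>)" for x
  proof -
    have "(\<Oplus>y\<in>UNIV. F x y) = (\<Oplus>y\<in>UNIV. if p = y then (if p = x then F x y else \<zero>) else \<zero>)"
      using c z by (intro add.finprod_cong') auto
    then show ?thesis using c by (subst (asm) finsum_delta) auto
  qed
  show ?thesis unfolding sum2_def inner using c by (simp add: finsum_delta)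
qed

lemma rmat_simps:
  "rmat l a a a a = mero_const (qpow l 1)"
  "a < b \<Longrightarrow> rmat l a b a b = 1"
  "b < a \<Longrightarrow> rmat l a b a b = mero_diff (g_fun l) a b"
  "a \<noteq> b \<Longrightarrow> rmat l a b b a = mero_diff (h0_fun l) a b"
  by (auto simp: rmat_def)

lemma rmat_zero_lower: "(x, y) \<noteq> (a, c) \<Longrightarrow> (x, y) \<noteq> (c, a) \<Longrightarrow> rmat l x y a c = 0"
  unfolding rmat_def by (split if_split)+ blast

lemma rmat_zero_upper: "(x, y) \<noteq> (b, d) \<Longrightarrow> (x, y) \<noteq> (d, b) \<Longrightarrow> rmat l b d x y = 0"
  unfolding rmat_def by (split if_split)+ blast

context
  fixes l :: complex and A :: "('n::{finite,linorder}, 'n frm_free set) halg"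
  defines "A \<equiv> frm l"
begin

interpretation bg_alg A
  unfolding A_def by (rule bg_alg_frm)

abbreviation "tt i j \<equiv> frm_t l (i::'n) j"

abbreviation "hh i j \<equiv> mero_diff (h_fun l) (i::'n) j"

abbreviation "hz i j \<equiv> mero_diff (h0_fun l) (i::'n) j"

lemma t_closed: "tt i j \<in> carrier A"
  unfolding A_def by (rule bg_alg.bideg_carrier[OF bg_alg_frm frm_t_bideg])

lemma frm_mom_simps:
  "lmom A (f + g) = lmom A f \<oplus>\<^bsub>A\<^esub> lmom A g" "rmom A (f + g) = rmom A f \<oplus>\<^bsub>A\<^esub> rmom A g"
  "lmom A (f * g) = lmom A f \<otimes>\<^bsub>A\<^esub> lmom A g" "rmom A (f * g) = rmom A f \<otimes>\<^bsub>A\<^esub> rmom A g"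
  "lmom A (mero_const c) = rmom A (mero_const c)" "lmom A 1 = \<one>\<^bsub>A\<^esub>" "rmom A 1 = \<one>\<^bsub>A\<^esub>"
  "lmom A 0 = \<zero>\<^bsub>A\<^esub>" "rmom A 0 = \<zero>\<^bsub>A\<^esub>"
proof -
  have m: "mom_hom A (lmom A)" "mom_hom A (rmom A)" unfolding A_def by (rule frm_moments)+
  show "lmom A (f + g) = lmom A f \<oplus>\<^bsub>A\<^esub> lmom A g" "rmom A (f + g) = rmom A f \<oplus>\<^bsub>A\<^esub> rmom A g"
    "lmom A (f * g) = lmom A f \<otimes>\<^bsub>A\<^esub> lmom A g" "rmom A (f * g) = rmom A f \<otimes>\<^bsub>A\<^esub> rmom A g"
    "lmom A (mero_const c) = rmom A (mero_const c)"
    using m by (simp_all add: mom_hom_def)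
  have "lmom A (mero_const 1) = \<one>\<^bsub>A\<^esub>" "rmom A (mero_const 1) = \<one>\<^bsub>A\<^esub>"
    using m smult_one[simplified, of "\<one>\<^bsub>A\<^esub>"] by (simp_all only: mom_hom_def one_closed)
  then show "lmom A 1 = \<one>\<^bsub>A\<^esub>" "rmom A 1 = \<one>\<^bsub>A\<^esub>" by simp_all
  show "lmom A 0 = \<zero>\<^bsub>A\<^esub>" "rmom A 0 = \<zero>\<^bsub>A\<^esub>"
    using mom_hom_zero[OF cx_algebra_axioms m(1)] mom_hom_zero[OF cx_algebra_axioms m(2)] by auto
qed

lemma frm_rll2:
  "sum2 A (\<lambda>x y. lmom A (rmat l x y a c) \<otimes>\<^bsub>A\<^esub> (tt x b \<otimes>\<^bsub>A\<^esub> tt y d)) =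
   sum2 A (\<lambda>x y. rmom A (rmat l b d x y) \<otimes>\<^bsub>A\<^esub> (tt c y \<otimes>\<^bsub>A\<^esub> tt a x))"
  using frm_rll[of l a c b d] unfolding A_def[symmetric] sum2_def by (simp add: m_assoc t_closed)

lemma frm_rll_right:
  assumes "b < d"
  shows "sum2 A (\<lambda>x y. rmom A (rmat l b d x y) \<otimes>\<^bsub>A\<^esub> (tt c y \<otimes>\<^bsub>A\<^esub> tt a x)) =
    tt c d \<otimes>\<^bsub>A\<^esub> tt a b \<oplus>\<^bsub>A\<^esub> rmom A (hz b d) \<otimes>\<^bsub>A\<^esub> (tt c b \<otimes>\<^bsub>A\<^esub> tt a d)"
  using assms by (subst sum2_two[of _ b d])
    (auto simp: t_closed rmat_zero_upper frm_mom_simps rmat_simps)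

lemma frm_rll_left:
  assumes "a \<noteq> c"
  shows "sum2 A (\<lambda>x y. lmom A (rmat l x y a c) \<otimes>\<^bsub>A\<^esub> (tt x b \<otimes>\<^bsub>A\<^esub> tt y d)) =
    lmom A (rmat l a c a c) \<otimes>\<^bsub>A\<^esub> (tt a b \<otimes>\<^bsub>A\<^esub> tt c d) \<oplus>\<^bsub>A\<^esub> lmom A (hz c a) \<otimes>\<^bsub>A\<^esub> (tt c b \<otimes>\<^bsub>A\<^esub> tt a d)"
  using assms by (subst sum2_two[of _ a c])
    (auto simp: t_closed rmat_zero_lower frm_mom_simps rmat_simps)

text \<open>The sum h + h0 is the constant q, on which both moment maps agree; hence
  \<open>lmom\<close> on the right in both cases.\<close>

lemma mom_h_split:
  "lmom A (hh i j) \<oplus>\<^bsub>A\<^esub> lmom A (hz i j) = lmom A (mero_const (qpow l 1))"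
  "rmom A (hh i j) \<oplus>\<^bsub>A\<^esub> rmom A (hz i j) = lmom A (mero_const (qpow l 1))"
  by (simp_all add: mero_diff_h frm_mom_simps(5) flip: frm_mom_simps(1,2))

text \<open>RLL with both rows equal to i reads q t_ik t_im = t_im t_ik + h0(\<mu>_k - \<mu>_m) t_ik
  t_im. Writing q = h + h0 and cancelling the h0 term leaves the claim.\<close>

lemma exchange_same_row:
  assumes "k < m"
  shows "tt i m \<otimes>\<^bsub>A\<^esub> tt i k = rmom A (hh k m) \<otimes>\<^bsub>A\<^esub> (tt i k \<otimes>\<^bsub>A\<^esub> tt i m)"
proof -
  let ?Y = "tt i m \<otimes>\<^bsub>A\<^esub> tt i k" and ?U = "tt i k \<otimes>\<^bsub>A\<^esub> tt i m"
  have c: "?Y \<in> carrier A" "?U \<in> carrier A" by (simp_all add: t_closed)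
  have "sum2 A (\<lambda>x y. lmom A (rmat l x y i i) \<otimes>\<^bsub>A\<^esub> (tt x k \<otimes>\<^bsub>A\<^esub> tt y m)) =
      lmom A (mero_const (qpow l 1)) \<otimes>\<^bsub>A\<^esub> ?U"
    by (subst sum2_one[of _ i]) (auto simp: t_closed rmat_zero_lower frm_mom_simps(8) rmat_simps(1))
  then have "?Y \<oplus>\<^bsub>A\<^esub> rmom A (hz k m) \<otimes>\<^bsub>A\<^esub> ?U = (rmom A (hh k m) \<oplus>\<^bsub>A\<^esub> rmom A (hz k m)) \<otimes>\<^bsub>A\<^esub> ?U"
    using frm_rll2[of i i k m] frm_rll_right[OF assms, of i i] by (simp add: mom_h_split)
  then show ?thesis using c by (simp add: l_distr)
qed

text \<open>Put H = h(\<lambda>_i - \<lambda>_j). Adding H times RLL for the rows (i, j) to RLL for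
  the rows (j, i) makes h and h0 of \<lambda> combine to q; then q is split again, now as h + h0 of
  \<mu>.\<close>

lemma exchange_two_rows:
  assumes "i < j" "k < m" "qpow l (-2) \<noteq> 1"
  shows "tt i m \<otimes>\<^bsub>A\<^esub> tt j k \<oplus>\<^bsub>A\<^esub> lmom A (hh i j) \<otimes>\<^bsub>A\<^esub> (tt j m \<otimes>\<^bsub>A\<^esub> tt i k) =
    rmom A (hh k m) \<otimes>\<^bsub>A\<^esub> (tt i k \<otimes>\<^bsub>A\<^esub> tt j m \<oplus>\<^bsub>A\<^esub> lmom A (hh i j) \<otimes>\<^bsub>A\<^esub> (tt j k \<otimes>\<^bsub>A\<^esub> tt i m))"
proof -
  define X' Y Z W where "X' = tt i k \<otimes>\<^bsub>A\<^esub> tt j m" and "Y = tt i m \<otimes>\<^bsub>A\<^esub> tt j k"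
    and "Z = tt j m \<otimes>\<^bsub>A\<^esub> tt i k" and "W = tt j k \<otimes>\<^bsub>A\<^esub> tt i m"
  define a b r q H H' K where "a = lmom A (hz i j)" and "b = lmom A (hz j i)" and "r = rmom A (hz k m)"
    and "q = lmom A (mero_const (qpow l 1))" and "H = lmom A (hh i j)" and "H' = lmom A (hh j i)" and "K = rmom A (hh k m)"
  have c: "X' \<in> carrier A" "Y \<in> carrier A" "Z \<in> carrier A" "W \<in> carrier A"
    by (simp_all add: X'_def Y_def Z_def W_def t_closed)
  have s: "a \<in> carrier A" "b \<in> carrier A" "r \<in> carrier A" "q \<in> carrier A" "H \<in> carrier A" "H' \<in> carrier A" "K \<in> carrier A"
    by (simp_all add: a_def b_def r_def q_def H_def H'_def K_def)
  have split: "H \<oplus>\<^bsub>A\<^esub> a = q" "H' \<oplus>\<^bsub>A\<^esub> b = q" "K \<oplus>\<^bsub>A\<^esub> r = q"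
    by (simp_all add: H_def H'_def K_def a_def b_def r_def q_def mom_h_split)
  \<comment> \<open>The left moment map passes the image of the right one, which has bidegree (0,
    0), without translation.\<close>
  have HK: "K \<otimes>\<^bsub>A\<^esub> H = H \<otimes>\<^bsub>A\<^esub> K"
    using lmom_comm[OF rmom_bideg[of "hh k m"], of "hh i j"] by (simp add: H_def K_def)
  \<comment> \<open>RLL for the rows (i, j); as i < j, the diagonal entry is 1.\<close>
  have 1: "X' \<oplus>\<^bsub>A\<^esub> b \<otimes>\<^bsub>A\<^esub> W = Z \<oplus>\<^bsub>A\<^esub> r \<otimes>\<^bsub>A\<^esub> W"
    using frm_rll2[of i j k m] frm_rll_right[OF assms(2), of j i] frm_rll_left[of i j k m] assms(1) c
    by (simp add: rmat_simps frm_mom_simps X'_def Z_def W_def b_def r_def)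
  \<comment> \<open>With the rows swapped the diagonal entry is g(\<lambda>_j - \<lambda>_i), which
    factors as h(\<lambda>_i - \<lambda>_j) h(\<lambda>_j - \<lambda>_i).\<close>
  have "lmom A (rmat l j i j i) = H \<otimes>\<^bsub>A\<^esub> H'"
    using mero_exchange[of i j l] assms by (simp add: rmat_simps H_def H'_def flip: frm_mom_simps(3))
  then have 3: "H \<otimes>\<^bsub>A\<^esub> H' \<otimes>\<^bsub>A\<^esub> W \<oplus>\<^bsub>A\<^esub> a \<otimes>\<^bsub>A\<^esub> X' = Y \<oplus>\<^bsub>A\<^esub> r \<otimes>\<^bsub>A\<^esub> X'"
    using frm_rll2[of j i k m] frm_rll_right[OF assms(2), of i j] frm_rll_left[of j i k m] assms(1) c
    by (simp add: X'_def Y_def W_def a_def r_def)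
  \<comment> \<open>The terms carrying h0(\<mu>) from both relations; they occur on both sides and
    are cancelled at the end.\<close>
  let ?e = "r \<otimes>\<^bsub>A\<^esub> X' \<oplus>\<^bsub>A\<^esub> H \<otimes>\<^bsub>A\<^esub> (r \<otimes>\<^bsub>A\<^esub> W)"
  have "Y \<oplus>\<^bsub>A\<^esub> H \<otimes>\<^bsub>A\<^esub> Z \<oplus>\<^bsub>A\<^esub> ?e = (Y \<oplus>\<^bsub>A\<^esub> r \<otimes>\<^bsub>A\<^esub> X') \<oplus>\<^bsub>A\<^esub> H \<otimes>\<^bsub>A\<^esub> (Z \<oplus>\<^bsub>A\<^esub> r \<otimes>\<^bsub>A\<^esub> W)"
    using c s by (simp add: r_distr a_ac)
  also have "\<dots> = (H \<oplus>\<^bsub>A\<^esub> a) \<otimes>\<^bsub>A\<^esub> X' \<oplus>\<^bsub>A\<^esub> H \<otimes>\<^bsub>A\<^esub> ((H' \<oplus>\<^bsub>A\<^esub> b) \<otimes>\<^bsub>A\<^esub> W)"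
    unfolding 1[symmetric] 3[symmetric] using c s by (simp add: r_distr l_distr a_ac m_assoc)
  also have "\<dots> = (K \<oplus>\<^bsub>A\<^esub> r) \<otimes>\<^bsub>A\<^esub> X' \<oplus>\<^bsub>A\<^esub> H \<otimes>\<^bsub>A\<^esub> ((K \<oplus>\<^bsub>A\<^esub> r) \<otimes>\<^bsub>A\<^esub> W)"
    unfolding split ..
  also have "\<dots> = K \<otimes>\<^bsub>A\<^esub> (X' \<oplus>\<^bsub>A\<^esub> H \<otimes>\<^bsub>A\<^esub> W) \<oplus>\<^bsub>A\<^esub> ?e"
    using c s HK by (simp add: r_distr l_distr a_ac flip: m_assoc)
  finally have "Y \<oplus>\<^bsub>A\<^esub> H \<otimes>\<^bsub>A\<^esub> Z = K \<otimes>\<^bsub>A\<^esub> (X' \<oplus>\<^bsub>A\<^esub> H \<otimes>\<^bsub>A\<^esub> W)"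
    using c s by (subst (asm) add.right_cancel) auto
  then show ?thesis by (simp add: X'_def Y_def Z_def W_def H_def K_def)
qed

end


section \<open>The exterior algebra\<close>

lemma word_deg_pair: "word_deg (\<lambda>g. (d g, 0 :: 'b::monoid_add)) w = (word_deg d w, 0)"
  by (induction w) (simp_all add: zero_prod_def)

lemma ext_copy_rels: "copy_rels Vf \<subseteq> ext_rels l"
  unfolding ext_rels_def by blast

lemma ext_relsI:
  "fgen (Vx i) * fgen (Vx i) \<in> ext_rels l"
  "i < j \<Longrightarrow> fgen (Vx i) * fgen (Vx j) + fgen (Vf (mero_diff (h_fun l) i j)) * fgen (Vx j) * fgen (Vx i) \<in> ext_rels l"
  "fgen (Vf f) * fgen (Vx i) - fgen (Vx i) * fgen (Vf (shift (wt i) f)) \<in> ext_rels l"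
proof -
  show "fgen (Vx i) * fgen (Vx i) \<in> ext_rels l"
    unfolding ext_rels_def by (rule UnI1, rule UnI1, rule UnI2, rule CollectI, rule exI, rule conjI[OF refl TrueI])
  show "fgen (Vx i) * fgen (Vx j) + fgen (Vf (mero_diff (h_fun l) i j)) * fgen (Vx j) * fgen (Vx i) \<in> ext_rels l"
    if "i < j"
    unfolding ext_rels_def by (rule UnI1, rule UnI2, rule CollectI, rule exI, rule exI, rule conjI[OF refl that])
  show "fgen (Vf f) * fgen (Vx i) - fgen (Vx i) * fgen (Vf (shift (wt i) f)) \<in> ext_rels l"
    unfolding ext_rels_def by (rule UnI2, rule CollectI, rule exI, rule exI, rule conjI[OF refl TrueI])
qed

lemma ext_rels_cases [consumes 1, case_names Vf square exchange comm]:
  assumes "e \<in> ext_rels l"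
  obtains "e \<in> copy_rels Vf" | i where "e = fgen (Vx i) * fgen (Vx i)"
  | i j where "i < j" "e = fgen (Vx i) * fgen (Vx j) + fgen (Vf (mero_diff (h_fun l) i j)) * fgen (Vx j) * fgen (Vx i)"
  | f i where "e = fgen (Vf f) * fgen (Vx i) - fgen (Vx i) * fgen (Vf (shift (wt i) f))"
  using assms unfolding ext_rels_def by (elim UnE) blast+

text \<open>Stated for any degree in which functions have degree 0, to cover both
  \<open>ext_gen_deg\<close> and its pairing with a second degree 0.\<close>

lemma homog_ext_rels:
  fixes d :: "('n::{finite,linorder}, 'n mero) ext_gen \<Rightarrow> 'd::ab_group_add"
  assumes "\<And>f. d (Vf f) = 0"
  shows "homog_rels d (ext_rels l :: 'n ext_free set)"
proof (rule homog_relsI)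
  fix e :: "'n ext_free" assume e: "e \<in> ext_rels l"
  have f: "fgen (Vf f) \<in> homog d 0" for f by (rule homog_gen') (rule assms)
  have v: "fgen (Vx i) \<in> homog d (d (Vx i))" for i by (rule homog_gen)
  have single: "\<exists>\<delta>0. \<forall>\<delta>. \<delta> \<noteq> \<delta>0 \<longrightarrow> hcomp d \<delta> e \<in> Idl\<^bsub>fring\<^esub> (ext_rels l)" if "e \<in> homog d \<delta>0" for \<delta>0
    using hcomp_ideal[OF that rels_subset[OF e]] by auto
  show "\<exists>\<delta>0. \<forall>\<delta>. \<delta> \<noteq> \<delta>0 \<longrightarrow> hcomp d \<delta> e \<in> Idl\<^bsub>fring\<^esub> (ext_rels l)"
    using e
  proof (cases rule: ext_rels_cases)
    case Vf
    show ?thesis by (rule single[OF homog_copy_rels[where d=d and \<iota>=Vf, OF assms Vf]])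
  next
    case (square i)
    show ?thesis by (rule single, unfold square) (rule homog_mult[OF v v])
  next
    case (exchange i j)
    have "fgen (Vf g) * fgen (Vx j) * fgen (Vx i) \<in> homog d (d (Vx i) + d (Vx j))" for g
      using homog_mult[OF homog_mult0[OF f v] v, of g j i] by (simp only: add.commute)
    then show ?thesis
      by (intro single[of "d (Vx i) + d (Vx j)"], unfold exchange) (rule homog_add[OF homog_mult[OF v v]])
  next
    case (comm g i)
    show ?thesis
      by (rule single, unfold comm) (rule homog_minus[OF homog_mult0[OF f v] homog_mult0'[OF v f]])
  qed
qed

text \<open>No word has nonzero second degree, so for \<beta> \<noteq> 0 the homogeneous part of the
  free algebra is {0}, in agreement with \<open>as_halg\<close>.\<close>

lemma as_halg_ext:
  "as_halg (ext l :: ('n::{finite,linorder}, 'n ext_free set) hspace) =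
    pres_halg (ext_rels l) (\<lambda>g. (ext_gen_deg g, 0)) (\<lambda>f. fgen (Vf f)) (\<lambda>f. 0)"
proof -
  let ?E = "ext_rels l :: 'n ext_free set" and ?d = "\<lambda>g :: ('n, 'n mero) ext_gen. (ext_gen_deg g, 0 :: (complex, 'n) vec)"
  interpret ring "pres_ring ?E" by (rule ring_pres_ring)
  have bideg: "(if \<beta> = 0 then pres_cls ?E ` homog ext_gen_deg \<alpha> else {\<zero>\<^bsub>pres_ring ?E\<^esub>}) =
    pres_cls ?E ` homog ?d (\<alpha>, \<beta>)" for \<alpha> \<beta>
  proof (cases "\<beta> = 0")
    case False
    have "homog ?d (\<alpha>, \<beta>) = {0}"
      using False by (auto simp: word_deg_pair simp flip: keys_eq_empty)
    then show ?thesis using False by (simp add: pres_cls_zero)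
  qed (simp add: word_deg_pair)
  show ?thesis
    by (simp add: as_halg_def pres_halg_def ext_def Let_def copy_rels_cls(3)[OF ext_copy_rels] pres_cls_zero bideg cong: if_cong)
qed

lemma pres_bg_ext: "pres_bg (ext_rels l) (\<lambda>g. (ext_gen_deg g, 0)) (\<lambda>f. fgen (Vf f)) (\<lambda>f. 0)"
proof
  let ?E = "ext_rels l :: 'a ext_free set" and ?d = "\<lambda>g :: ('a, 'a mero) ext_gen. (ext_gen_deg g, 0 :: (complex, 'a) vec)"
  show "homog_rels ?d ?E" by (rule homog_ext_rels) (simp add: zero_prod_def)
  show "fgen (Vf f) \<in> homog ?d 0" for f by (rule homog_gen') (simp add: zero_prod_def)
  show "0 \<in> homog ?d 0" by (rule homog_zero)
  fix f :: "'a mero" and g :: "('a, 'a mero) ext_gen"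
  have v: "pres_cls ?E (fgen (Vf f) * fgen (Vx i)) = pres_cls ?E (fgen (Vx i) * fgen (Vf (shift (wt i) f)))" for i
    by (rule pres_cls_rel, rule ext_relsI)
  have same: "pres_cls ?E (fgen (Vf f) * fgen (Vf h)) = pres_cls ?E (fgen (Vf h) * fgen (Vf f))" for h
    using copy_rels_cls(2)[OF ext_copy_rels, of l f h] copy_rels_cls(2)[OF ext_copy_rels, of l h f]
    by (simp add: mult.commute pres_cls_mult)
  show "pres_cls ?E (fgen (Vf f) * fgen g) = pres_cls ?E (fgen g * fgen (Vf (shift (fst (?d g)) f)))"
    using v same by (cases g) auto
qed simp

lemma gr_alg_ext: "gr_alg (ext l)"
proof -
  interpret ring "pres_ring (ext_rels l)" by (rule ring_pres_ring)
  have "bg_alg (as_halg (ext l))" unfolding as_halg_ext by (rule pres_bg.bg_alg_P[OF pres_bg_ext])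
  then show ?thesis unfolding gr_alg_def by (simp add: ext_def Let_def)
qed

lemma h_space_ext: "h_space (ext l :: ('n::{finite,linorder}, 'n ext_free set) hspace)"
proof -
  let ?V = "ext l :: ('n, 'n ext_free set) hspace"
  interpret V: bg_alg "as_halg ?V" using gr_alg_ext unfolding gr_alg_def by blast
  interpret Q: ring "pres_ring (ext_rels l :: 'n ext_free set)" by (rule ring_pres_ring)
  have simps: "carrier ?V = carrier (pres_ring (ext_rels l))" "add ?V = add (pres_ring (ext_rels l))"
    "zero ?V = zero (pres_ring (ext_rels l))" "deg ?V = (\<lambda>\<alpha>. pres_cls (ext_rels l) ` homog ext_gen_deg \<alpha>)"
    "f \<odot>\<^bsub>?V\<^esub> v = pres_cls (ext_rels l) (fgen (Vf f)) \<otimes>\<^bsub>pres_ring (ext_rels l)\<^esub> v" for f v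
    by (simp_all add: ext_def Let_def)
  have smult: "f \<odot>\<^bsub>?V\<^esub> v = f \<odot>\<^bsub>?V\<^esub> \<one>\<^bsub>?V\<^esub> \<otimes>\<^bsub>?V\<^esub> v" if "v \<in> carrier ?V" for f v
    using gr_alg_ext[where 'a='n, of l] that unfolding gr_alg_def by blast
  have one: "pres_cls (ext_rels l :: 'n ext_free set) (fgen (Vf 1)) = \<one>\<^bsub>pres_ring (ext_rels l)\<^esub>"
    using copy_rels_cls(3)[OF ext_copy_rels, of l 1] by (simp add: fconst_one pres_cls_one)
  have mod: "module Mring ?V"
  proof (rule moduleI)
    show "cring (Mring :: 'n mero ring)" by (rule cring_from_type_algebra)
    show "abelian_group ?V"
      by (rule abelian_groupI) (use Q.add.m_assoc Q.add.m_comm Q.add.l_inv_ex in \<open>auto simp: simps\<close>)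
  qed (auto simp: simps copy_rels_cls[OF ext_copy_rels] one Q.l_distr Q.r_distr Q.m_assoc)
  have "direct_sum ?V (deg ?V)"
    unfolding simps(4)
    by (rule direct_sum_fieldcong[OF _ _ _ direct_sum_pres_ring[OF homog_ext_rels]]) (simp_all add: simps)
  moreover have "f \<odot>\<^bsub>?V\<^esub> v \<in> deg ?V \<alpha>" if "v \<in> deg ?V \<alpha>" for v \<alpha> f
    using V.lmom_mult_bideg[of v \<alpha> 0 f] that V.bideg_carrier[of v \<alpha> 0] smult by simp
  ultimately show ?thesis
    by (intro h_space.intro h_space_axioms.intro mod)
qed

lemma ext_v_deg: "ext_v l i \<in> bideg (as_halg (ext l)) (wt i) 0"
  unfolding ext_v_def as_halg_ext by (rule pres_bg.pi_homog[OF pres_bg_ext], rule homog_gen') simp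

lemma ext_smult_one: "f \<odot>\<^bsub>ext l\<^esub> \<one>\<^bsub>ext l\<^esub> = pres_cls (ext_rels l) (fgen (Vf f))"
proof -
  interpret ring "pres_ring (ext_rels l)" by (rule ring_pres_ring)
  show ?thesis by (simp add: ext_def Let_def)
qed

lemma ext_v_relations:
  "ext_v l i \<otimes>\<^bsub>ext l\<^esub> ext_v l i = \<zero>\<^bsub>ext l\<^esub>"
  "i < j \<Longrightarrow> ext_v l i \<otimes>\<^bsub>ext l\<^esub> ext_v l j \<oplus>\<^bsub>ext l\<^esub>
    lmom (as_halg (ext l)) (mero_diff (h_fun l) i j) \<otimes>\<^bsub>ext l\<^esub> (ext_v l j \<otimes>\<^bsub>ext l\<^esub> ext_v l i) = \<zero>\<^bsub>ext l\<^esub>"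
proof -
  have simps: "monoid.mult (ext l) = monoid.mult (pres_ring (ext_rels l))" "add (ext l) = add (pres_ring (ext_rels l))"
    "zero (ext l) = pres_cls (ext_rels l) 0"
    by (simp_all add: ext_def Let_def pres_cls_zero)
  show "ext_v l i \<otimes>\<^bsub>ext l\<^esub> ext_v l i = \<zero>\<^bsub>ext l\<^esub>"
    unfolding simps ext_v_def pres_cls_mult[symmetric] by (rule pres_cls_rel) (simp add: ext_relsI)
  assume ij: "i < j"
  show "ext_v l i \<otimes>\<^bsub>ext l\<^esub> ext_v l j \<oplus>\<^bsub>ext l\<^esub>
    lmom (as_halg (ext l)) (mero_diff (h_fun l) i j) \<otimes>\<^bsub>ext l\<^esub> (ext_v l j \<otimes>\<^bsub>ext l\<^esub> ext_v l i) = \<zero>\<^bsub>ext l\<^esub>"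
    unfolding as_halg_simps ext_smult_one unfolding simps ext_v_def pres_cls_mult[symmetric] pres_cls_add[symmetric]
    by (rule pres_cls_rel) (use ext_relsI(2)[OF ij] in \<open>simp add: mult.assoc\<close>)
qed

lemma ext_hom_eq:
  assumes "ring B" "h \<in> ring_hom (as_halg (ext l)) B" "k \<in> ring_hom (as_halg (ext l)) B"
    and "\<And>i. h (ext_v l i) = k (ext_v l i)" "\<And>f. h (lmom (as_halg (ext l)) f) = k (lmom (as_halg (ext l)) f)"
    and "x \<in> carrier (ext l)"
  shows "h x = k x"
proof (rule pres_hom_eq[OF ext_copy_rels assms(1) assms(2,3)[unfolded as_halg_ext]])
  show "h (pres_cls (ext_rels l) (fgen g)) = k (pres_cls (ext_rels l) (fgen g))" for g
    using assms(4,5) by (cases g) (simp_all add: ext_v_def ext_smult_one)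
  show "x \<in> carrier (pres_ring (ext_rels l))" using assms(6) by (simp add: ext_def Let_def)
qed

text \<open>Permits changing a map outside the carrier, as happens when the coaction is made
  extensional.\<close>

lemma h_algebra_hom_cong:
  assumes "bg_alg A" "h_algebra_hom A B \<phi>" "\<And>a. a \<in> carrier A \<Longrightarrow> \<psi> a = \<phi> a"
  shows "h_algebra_hom A B \<psi>"
proof -
  interpret bg_alg A by fact
  have \<phi>: "\<phi> \<in> ring_hom A B" by (rule h_algebra_hom_ring_hom[OF assms(2)])
  have "\<psi> \<in> ring_hom A B"
    using ring_hom_closed[OF \<phi>] ring_hom_mult[OF \<phi>] ring_hom_add[OF \<phi>] ring_hom_one[OF \<phi>]
    by (intro ring_hom_memI) (simp_all add: assms(3))
  moreover have "\<psi> ` bideg A \<alpha> \<beta> \<subseteq> bideg B \<alpha> \<beta>" for \<alpha> \<beta>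
    using h_algebra_hom_bideg[OF assms(2)] assms(3)[OF bideg_carrier] by auto
  ultimately show ?thesis
    using assms(2) unfolding h_algebra_hom_def by (simp add: assms(3))
qed

section \<open>The coaction\<close>

text \<open>Adding the transposed sum gives S + S = 0, and the scalar 1/2 removes the factor. The
  diagonal is covered as well, since the hypothesis with i = j reads F i i + F i i = 0.\<close>

lemma (in cx_algebra) sum2_antisymmetric:
  assumes c: "\<And>i j. F i j \<in> carrier B" and anti: "\<And>i j. F i j \<oplus> F j i = \<zero>"
  shows "sum2 B F = \<zero>"
proof -
  let ?S = "sum2 B F"
  have S: "?S \<in> carrier B" by (rule sum2_closed[OF c])
  have "?S \<oplus> ?S = sum2 B F \<oplus> sum2 B (\<lambda>j i. F i j)" using sum2_transpose[of F] c by simp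
  also have "\<dots> = (\<Oplus>i\<in>UNIV. (\<Oplus>j\<in>UNIV. F i j) \<oplus> (\<Oplus>j\<in>UNIV. F j i))"
    unfolding sum2_def using c by (intro finsum_addf[symmetric]) (auto intro!: finsum_closed)
  also have "\<dots> = (\<Oplus>i\<in>UNIV. \<Oplus>j\<in>UNIV. F i j \<oplus> F j i)"
    using c by (simp add: finsum_addf Pi_iff)
  also have "\<dots> = \<zero>" by (simp add: anti)
  finally have "(1/2) \<odot> (?S \<oplus> ?S) = \<zero>" by (simp add: smult_r_null[simplified])
  moreover have "(1/2) \<odot> (?S \<oplus> ?S) = (1/2 + 1/2) \<odot> ?S"
    using smult_l_distr[of "1/2" "1/2" ?S] smult_r_distr[of "1/2" ?S ?S] S by simp
  ultimately show ?thesis using smult_one[of ?S] S by simp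
qed

text \<open>Short names for the objects of the theorem. W is V read as a bigraded algebra;
  \<open>q2\<close> is the form in which the hypothesis on q reaches the exchange relations.\<close>

locale coaction =
  fixes l :: complex and A :: "('n::{finite,linorder}, 'n frm_free set) halg"
    and V :: "('n, 'n ext_free set) hspace" and W :: "('n, 'n ext_free set) halg"
  assumes q2: "qpow l (-2) \<noteq> 1"
    and A_eq: "A = frm l" and V_eq: "V = ext l" and W_eq: "W = as_halg V"
begin

lemma bg_A: "bg_alg A" unfolding A_eq by (rule bg_alg_frm)

lemma av_AV: "av_pair A V"
  unfolding V_eq by (rule av_pair.intro[OF bg_A gr_alg_ext])

lemma bg_W: "bg_alg W"
  unfolding W_eq V_eq using gr_alg_ext unfolding gr_alg_def by blast

sublocale P: bg_pair A W
  by (rule bg_pairI[OF bg_A bg_W])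

sublocale B: bg_alg "aa_tensor A W"
  by (rule P.bg_alg_AB)

abbreviation "t i j \<equiv> frm_t l (i :: 'n) j"

abbreviation "v i \<equiv> ext_v l (i :: 'n)"

abbreviation "h i j \<equiv> mero_diff (h_fun l) (i :: 'n) j"

lemma t: "t i j \<in> bideg A (wt i) (wt j)"
  unfolding A_eq by (rule frm_t_bideg)

lemma v: "v i \<in> bideg W (wt i) 0"
  unfolding W_eq V_eq by (rule ext_v_deg)

lemma vv: "v i \<otimes>\<^bsub>W\<^esub> v j \<in> bideg W (wt i + wt j) 0"
  using P.B.bideg_mult[OF v v, of i j] by simp

lemma v_square: "v i \<otimes>\<^bsub>W\<^esub> v i = \<zero>\<^bsub>W\<^esub>"
  using ext_v_relations(1)[of l i] by (simp add: W_eq V_eq)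

lemma v_exchange: "i < j \<Longrightarrow> v i \<otimes>\<^bsub>W\<^esub> v j \<oplus>\<^bsub>W\<^esub> lmom W (h i j) \<otimes>\<^bsub>W\<^esub> (v j \<otimes>\<^bsub>W\<^esub> v i) = \<zero>\<^bsub>W\<^esub>"
  using ext_v_relations(2)[of i j l] by (simp add: W_eq V_eq)

lemma tens_exterior_zero:
  assumes c: "\<And>k m. c k m \<in> bideg A \<alpha> (wt k + wt m)"
    and anti: "\<And>k m. k < m \<Longrightarrow> c m k = rmom A (h k m) \<otimes>\<^bsub>A\<^esub> c k m"
  shows "sum2 P.AB (\<lambda>k m. aa_tens A W (c k m) (v k \<otimes>\<^bsub>W\<^esub> v m)) = \<zero>\<^bsub>P.AB\<^esub>"
proof (rule B.sum2_antisymmetric)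
  fix k m :: 'n
  show car: "aa_tens A W (c k m) (v k \<otimes>\<^bsub>W\<^esub> v m) \<in> carrier P.AB" for k m
    by (rule P.tens_carrier[OF c vv])
  have less: "aa_tens A W (c k m) (v k \<otimes>\<^bsub>W\<^esub> v m) \<oplus>\<^bsub>P.AB\<^esub> aa_tens A W (c m k) (v m \<otimes>\<^bsub>W\<^esub> v k) = \<zero>\<^bsub>P.AB\<^esub>"
    if km: "k < m" for k m
  proof -
    have vv': "v m \<otimes>\<^bsub>W\<^esub> v k \<in> bideg W (wt k + wt m) 0" using vv[of m k] by (simp add: add.commute)
    \<comment> \<open>Balancing turns h in the variable \<mu> of A into h in the variable \<lambda>
      of W, where the exchange relation of the generators applies.\<close>
    have "aa_tens A W (c m k) (v m \<otimes>\<^bsub>W\<^esub> v k) = aa_tens A W (c k m) (lmom W (h k m) \<otimes>\<^bsub>W\<^esub> (v m \<otimes>\<^bsub>W\<^esub> v k))"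
      unfolding anti[OF km] by (rule P.tens_balance[OF c vv'])
    then have "aa_tens A W (c k m) (v k \<otimes>\<^bsub>W\<^esub> v m) \<oplus>\<^bsub>P.AB\<^esub> aa_tens A W (c m k) (v m \<otimes>\<^bsub>W\<^esub> v k) =
        aa_tens A W (c k m) (v k \<otimes>\<^bsub>W\<^esub> v m \<oplus>\<^bsub>W\<^esub> lmom W (h k m) \<otimes>\<^bsub>W\<^esub> (v m \<otimes>\<^bsub>W\<^esub> v k))"
      by (simp add: P.tens_add_right[OF c vv P.B.lmom_mult_bideg[OF vv']])
    then show ?thesis unfolding v_exchange[OF km] using P.tens_zero_right[OF c] by simp
  qed
  consider "k < m" | "m < k" | "k = m" using linorder_less_linear[of k m] by blast
  then show "aa_tens A W (c k m) (v k \<otimes>\<^bsub>W\<^esub> v m) \<oplus>\<^bsub>P.AB\<^esub> aa_tens A W (c m k) (v m \<otimes>\<^bsub>W\<^esub> v k) = \<zero>\<^bsub>P.AB\<^esub>"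
  proof cases
    case 2
    then show ?thesis using less[OF 2] P.G.a_comm[OF car car] by simp
  next
    case 3
    then show ?thesis using P.tens_zero_right[OF c] by (simp add: v_square)
  qed (rule less)
qed

definition gen_coaction :: "('n, 'n mero) ext_gen \<Rightarrow> ('n frm_free set, 'n ext_free set) tens"
  where "gen_coaction g = (case g of Vx i \<Rightarrow> (\<Oplus>\<^bsub>P.AB\<^esub>j\<in>UNIV. aa_tens A W (t i j) (v j)) | Vf f \<Rightarrow> lmom P.AB f)"

abbreviation "D i \<equiv> \<Oplus>\<^bsub>P.AB\<^esub>j\<in>UNIV. aa_tens A W (t i j) (v j)"

lemma tv: "aa_tens A W (t i j) (v j) \<in> bideg P.AB (wt i) 0"
  by (rule P.tens_bideg[OF t v])

lemma D_bideg: "D i \<in> bideg P.AB (wt i) 0"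
  by (rule B.bideg_finsum[OF tv])

lemma D_mult: "D i \<otimes>\<^bsub>P.AB\<^esub> D j = sum2 P.AB (\<lambda>k m. aa_tens A W (t i k \<otimes>\<^bsub>A\<^esub> t j m) (v k \<otimes>\<^bsub>W\<^esub> v m))"
  using B.finsum_mult_finsum[of "\<lambda>k. aa_tens A W (t i k) (v k)" "\<lambda>m. aa_tens A W (t j m) (v m)"]
  by (simp add: B.bideg_carrier[OF tv] P.tens_mult[OF t v t v])

lemma tt: "t i k \<otimes>\<^bsub>A\<^esub> t j m \<in> bideg A (wt i + wt j) (wt k + wt m)"
  by (rule P.A.bideg_mult[OF t t])

lemma D_square: "D i \<otimes>\<^bsub>P.AB\<^esub> D i = \<zero>\<^bsub>P.AB\<^esub>"
  unfolding D_mult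
  by (rule tens_exterior_zero[OF tt]) (unfold A_eq, rule exchange_same_row)

lemma D_exchange:
  assumes "i < j"
  shows "D i \<otimes>\<^bsub>P.AB\<^esub> D j \<oplus>\<^bsub>P.AB\<^esub> lmom P.AB (h i j) \<otimes>\<^bsub>P.AB\<^esub> (D j \<otimes>\<^bsub>P.AB\<^esub> D i) = \<zero>\<^bsub>P.AB\<^esub>"
proof -
  let ?w = "\<lambda>k m. t j k \<otimes>\<^bsub>A\<^esub> t i m"
  have w: "?w k m \<in> bideg A (wt i + wt j) (wt k + wt m)" for k m
    using tt[of j k i m] by (simp add: add.commute)
  note hw = P.A.lmom_mult_bideg[OF w]
  have lm: "lmom P.AB f \<otimes>\<^bsub>P.AB\<^esub> aa_tens A W (?w k m) (v k \<otimes>\<^bsub>W\<^esub> v m) =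
      aa_tens A W (lmom A f \<otimes>\<^bsub>A\<^esub> ?w k m) (v k \<otimes>\<^bsub>W\<^esub> v m)" for f k m
    unfolding P.AB_simps(4) P.tens_mult[OF P.A.lmom_bideg P.B.bideg_one w vv]
    by (simp add: P.B.bideg_carrier[OF vv])
  have c1: "aa_tens A W (t i k \<otimes>\<^bsub>A\<^esub> t j m) (v k \<otimes>\<^bsub>W\<^esub> v m) \<in> carrier P.AB" for k m
    by (rule P.tens_carrier[OF tt vv])
  have c2: "aa_tens A W (?w k m) (v k \<otimes>\<^bsub>W\<^esub> v m) \<in> carrier P.AB" for k m
    by (rule P.tens_carrier[OF w vv])
  have c3: "aa_tens A W (lmom A f \<otimes>\<^bsub>A\<^esub> ?w k m) (v k \<otimes>\<^bsub>W\<^esub> v m) \<in> carrier P.AB" for f k m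
    by (rule P.tens_carrier[OF hw vv])
  have add2: "sum2 P.AB F \<oplus>\<^bsub>P.AB\<^esub> sum2 P.AB G = sum2 P.AB (\<lambda>k m. F k m \<oplus>\<^bsub>P.AB\<^esub> G k m)"
    if "\<And>k m. F k m \<in> carrier P.AB" "\<And>k m. G k m \<in> carrier P.AB" for F G :: "'n \<Rightarrow> 'n \<Rightarrow> _"
    unfolding sum2_def using that by (simp add: P.G.finsum_addf Pi_iff P.G.finsum_closed)
  \<comment> \<open>Everything is collected into one double sum; its coefficients are the
    combinations treated in \<open>exchange_two_rows\<close>.\<close>
  have "D i \<otimes>\<^bsub>P.AB\<^esub> D j \<oplus>\<^bsub>P.AB\<^esub> lmom P.AB (h i j) \<otimes>\<^bsub>P.AB\<^esub> (D j \<otimes>\<^bsub>P.AB\<^esub> D i) =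
      sum2 P.AB (\<lambda>k m. aa_tens A W (t i k \<otimes>\<^bsub>A\<^esub> t j m \<oplus>\<^bsub>A\<^esub> lmom A (h i j) \<otimes>\<^bsub>A\<^esub> ?w k m) (v k \<otimes>\<^bsub>W\<^esub> v m))"
    unfolding D_mult B.sum2_lmult[OF B.lmom_carrier c2] lm add2[OF c1 c3] P.tens_add_left[OF tt hw vv] by (rule refl)
  also have "\<dots> = \<zero>\<^bsub>P.AB\<^esub>"
  proof (rule tens_exterior_zero)
    show "t i k \<otimes>\<^bsub>A\<^esub> t j m \<oplus>\<^bsub>A\<^esub> lmom A (h i j) \<otimes>\<^bsub>A\<^esub> ?w k m \<in> bideg A (wt i + wt j) (wt k + wt m)" for k m
      by (rule P.A.bideg_add[OF tt hw])
    show "t i m \<otimes>\<^bsub>A\<^esub> t j k \<oplus>\<^bsub>A\<^esub> lmom A (h i j) \<otimes>\<^bsub>A\<^esub> ?w m k =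
      rmom A (h k m) \<otimes>\<^bsub>A\<^esub> (t i k \<otimes>\<^bsub>A\<^esub> t j m \<oplus>\<^bsub>A\<^esub> lmom A (h i j) \<otimes>\<^bsub>A\<^esub> ?w k m)" if "k < m" for k m
      unfolding A_eq by (rule exchange_two_rows[OF assms that q2])
  qed
  finally show ?thesis .
qed

definition "L0 = pres_ext P.AB gen_coaction"

lemma L0: "h_algebra_hom W P.AB L0" "L0 (v i) = D i"
proof -
  interpret E: pres_bg "ext_rels l" "\<lambda>g. (ext_gen_deg g, 0)" "\<lambda>f. fgen (Vf f)" "\<lambda>f. 0" by (rule pres_bg_ext)
  have WP: "W = pres_halg (ext_rels l) (\<lambda>g. (ext_gen_deg g, 0)) (\<lambda>f. fgen (Vf f)) (\<lambda>f. 0)"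
    unfolding W_eq V_eq by (rule as_halg_ext)
  have deg: "gen_coaction g \<in> bideg P.AB (fst (ext_gen_deg g, 0)) (snd (ext_gen_deg g, 0))" for g
    by (cases g) (simp_all add: gen_coaction_def D_bideg B.lmom_bideg)
  have c: "gen_coaction g \<in> carrier P.AB" for g by (rule B.bideg_carrier[OF deg])
  note ext = B.free_ext_add[OF c] B.free_ext_mult[OF c] B.free_ext_gen[OF c]
  have gens: "gen_coaction (Vx i) = D i" "gen_coaction (Vf f) = lmom P.AB f" for i f
    by (simp_all add: gen_coaction_def)
  have mA: "mom_hom A (lmom A)" unfolding A_eq by (rule frm_moments)
  note Dc = B.bideg_carrier[OF D_bideg]
  have rels: "free_ext P.AB gen_coaction e = \<zero>\<^bsub>P.AB\<^esub>" if "e \<in> ext_rels l" for e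
    using that
  proof (cases rule: ext_rels_cases)
    case Vf
    show ?thesis
      by (rule free_ext_copy_rels[OF P.bg_alg_AB c _ Vf]) (use P.mom_hom_left[OF mA] in \<open>simp add: gens\<close>)
  next
    case (square i)
    show ?thesis unfolding square ext gens by (rule D_square)
  next
    case (exchange i j)
    show ?thesis
      unfolding exchange ext gens B.m_assoc[OF B.lmom_carrier Dc Dc] by (rule D_exchange[OF exchange(1)])
  next
    case (comm f i)
    show ?thesis unfolding comm
      by (rule B.free_ext_minus_zero[OF c]) (unfold ext gens, rule B.lmom_comm[OF D_bideg])
  qed
  have mom: "free_ext P.AB gen_coaction (fgen (Vf f)) = lmom P.AB f" "free_ext P.AB gen_coaction 0 = rmom P.AB f" for f
  proof -
    show "free_ext P.AB gen_coaction (fgen (Vf f)) = lmom P.AB f" by (simp only: ext gens)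
    \<comment> \<open>The right moment map of W is zero, so that of A \<otimes> W is 1 \<otimes> 0 =
      0, the value of the zero polynomial.\<close>
    have "rmom W f = \<zero>\<^bsub>W\<^esub>" by (simp add: W_eq)
    then show "free_ext P.AB gen_coaction 0 = rmom P.AB f"
      using P.tens_zero_right[OF P.A.bideg_one] by (simp add: P.AB_simps(5) B.free_ext_zero[OF c])
  qed
  show "h_algebra_hom W P.AB L0"
    unfolding L0_def by (subst (1) WP) (rule E.pres_ext_hom(1)[OF P.bg_alg_AB deg rels mom])
  have "L0 (pres_cls (ext_rels l) (fgen (Vx i))) = gen_coaction (Vx i)"
    unfolding L0_def by (rule E.pres_ext_hom(2)[OF P.bg_alg_AB deg rels mom])
  then show "L0 (v i) = D i" by (simp add: ext_v_def gens)
qed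

text \<open>The theorem asks for an extensional map on the carrier, so that uniqueness is equality
  of functions.\<close>

definition "L = restrict L0 (carrier V)"

lemma W_carrier: "carrier W = carrier V" by (simp add: W_eq)

lemma L: "h_algebra_hom W P.AB L" "L (v i) = D i"
proof -
  show "h_algebra_hom W P.AB L"
    by (rule h_algebra_hom_cong[OF bg_W L0(1)]) (simp add: L_def W_carrier)
  have "v i \<in> carrier V" using P.B.bideg_carrier[OF v] by (simp add: W_carrier)
  then show "L (v i) = D i" using L0(2) by (simp add: L_def)
qed

text \<open>The analogue of \<open>frm_comult_aux\<close> for the coaction: it gives both sides of
  coassociativity and the left side of the counit law on generators.\<close>

lemma L_map:
  assumes "bg_alg C" "bg_alg C'" "h_algebra_hom A C \<phi>" "h_algebra_hom W C' \<psi>"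
  shows "h_algebra_hom W (aa_tensor C C') (aa_map C C' \<phi> \<psi> \<circ> L)"
    and "(aa_map C C' \<phi> \<psi> \<circ> L) (v i) = (\<Oplus>\<^bsub>aa_tensor C C'\<^esub>j\<in>UNIV. aa_tens C C' (\<phi> (t i j)) (\<psi> (v j)))"
proof -
  interpret C: bg_pair C C' by (rule bg_pairI) fact+
  have hom: "h_algebra_hom P.AB C.AB (aa_map C C' \<phi> \<psi>)"
    by (rule h_algebra_hom_aa_map[OF bg_A bg_W assms])
  have tens: "aa_map C C' \<phi> \<psi> (aa_tens A W a b) = aa_tens C C' (\<phi> a) (\<psi> b)" for a b
    by (rule aa_map_tens[OF P.bg_pair_self C.bg_pair_self h_algebra_hom_left_map(1)[OF bg_A assms(3)]
          h_algebra_hom_left_map(2)[OF bg_W assms(4)]])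
  show "h_algebra_hom W (aa_tensor C C') (aa_map C C' \<phi> \<psi> \<circ> L)"
    by (rule h_algebra_hom_comp[OF L(1) hom])
  show "(aa_map C C' \<phi> \<psi> \<circ> L) (v i) = (\<Oplus>\<^bsub>aa_tensor C C'\<^esub>j\<in>UNIV. aa_tens C C' (\<phi> (t i j)) (\<psi> (v j)))"
    by (simp add: L(2) ring_hom_finsum[OF P.ring_AB C.ring_AB h_algebra_hom_ring_hom[OF hom] finite B.bideg_carrier[OF tv]] tens)
qed

end


section \<open>Coassociativity and the counit law for the coaction\<close>

lemma frm_smult: "smult (frm l) c = (\<lambda>a. lmom (frm l) (mero_const c) \<otimes>\<^bsub>frm l\<^esub> a)"
  unfolding frm_eq by (simp add: pres_halg_def copy_rels_cls(3)[OF frm_copy_rels(1)])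

lemma ext_moments: "mom_hom (as_halg (ext l)) (lmom (as_halg (ext l)))"
proof -
  have eq: "lmom (as_halg (ext l)) = (\<lambda>f. pres_cls (ext_rels l) (fgen (Vf f)))"
    by (rule HOL.ext) (simp add: ext_smult_one)
  show ?thesis
    unfolding eq unfolding as_halg_ext by (rule mom_hom_pres[OF ext_copy_rels])
qed

context coaction
begin

lemma gr_V: "gr_alg V" unfolding V_eq by (rule gr_alg_ext)

lemma W_simps:
  "monoid.mult W = monoid.mult V" "one W = one V" "zero W = zero V" "add W = add V" "deg V \<alpha> = bideg W \<alpha> 0"
  "x \<in> carrier V \<Longrightarrow> f \<odot>\<^bsub>V\<^esub> x = lmom W f \<otimes>\<^bsub>W\<^esub> x"
  using gr_V by (simp_all add: W_eq gr_alg_def)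

lemma L_closed: "x \<in> carrier V \<Longrightarrow> L x \<in> carrier P.AB"
  using ring_hom_closed[OF h_algebra_hom_ring_hom[OF L(1)], of x] by (simp add: W_carrier)

lemmas av_eq = av_pair.av_tens_eq[OF av_AV, folded W_eq] av_pair.av_map_eq[OF av_AV, folded W_eq]

lemmas av_simps = av_pair.av_tensor_simps(1-6)[OF av_AV, folded W_eq]

lemma av_smult: "x \<in> carrier P.AB \<Longrightarrow> f \<odot>\<^bsub>av_tensor A V\<^esub> x = lmom P.AB f \<otimes>\<^bsub>P.AB\<^esub> x"
  by (rule av_pair.av_smult[OF av_AV, folded W_eq])

lemma W_hom_eq:
  assumes "ring B" "\<phi> \<in> ring_hom W B" "\<psi> \<in> ring_hom W B"
    and "\<And>i. \<phi> (v i) = \<psi> (v i)" "\<And>f. \<phi> (lmom W f) = \<psi> (lmom W f)" "x \<in> carrier V"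
  shows "\<phi> x = \<psi> x"
  by (rule ext_hom_eq[of B \<phi> l \<psi> x, folded V_eq, folded W_eq]) fact+

lemma L_coassoc:
  "\<exists>\<Phi>. aav_assoc A V \<Phi> \<and> (\<forall>x\<in>carrier V.
    \<Phi> (av_map (aa_tensor A A) V (frm_comult l) id (L x)) = av_map A (av_tensor A V) id L (L x))"
proof -
  let ?AA = "aa_tensor A A" and ?\<Delta> = "frm_comult l"
  interpret AA: bg_pair A A by (rule bg_pairI[OF bg_A bg_A])
  have bgAA: "bg_alg ?AA" by (rule AA.bg_alg_AB)
  interpret L: bg_pair ?AA W by (rule bg_pairI[OF bgAA bg_W])
  interpret H: bg_pair A P.AB by (rule bg_pairI[OF bg_A P.bg_alg_AB])
  interpret bgL: bg_alg L.AB by (rule L.bg_alg_AB)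
  have smult: "smult A c = (\<lambda>a. lmom A (mero_const c) \<otimes>\<^bsub>A\<^esub> a)" for c
    unfolding A_eq by (rule frm_smult)
  \<comment> \<open>Read as a bigraded algebra, A \<otimes> V is A \<otimes> W. So A \<otimes> (A
    \<otimes> V) is covered by the bigraded theory, and the associator is available with W as third
    factor.\<close>
  have asav: "as_halg (av_tensor A V) = P.AB"
    unfolding W_eq by (rule av_pair.as_halg_av[OF av_AV smult])
  have avL: "av_pair ?AA V" by (rule av_pair.intro[OF bgAA gr_V])
  have avH: "av_pair A (av_tensor A V)"
    by (rule av_pair.intro[OF bg_A av_pair.gr_alg_av[OF av_AV smult]])
  note L_eq = av_pair.av_tens_eq[OF avL, folded W_eq] av_pair.av_map_eq[OF avL, folded W_eq]
    av_pair.av_tensor_simps(1,5)[OF avL, folded W_eq]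
  note H_eq = av_pair.av_tens_eq[OF avH, unfolded asav] av_pair.av_map_eq[OF avH, unfolded asav]
    av_pair.av_tensor_simps(1,5)[OF avH, unfolded asav]
  have hD: "h_algebra_hom A ?AA ?\<Delta>" unfolding A_eq by (rule frm_comult_hom(1))
  have hA: "h_algebra_hom A A id" and hW: "h_algebra_hom W W id"
    by (rule h_algebra_hom_id[OF bg_A], rule h_algebra_hom_id[OF bg_W])
  have \<Delta>t: "?\<Delta> (t i j) = (\<Oplus>\<^bsub>?AA\<^esub>k\<in>UNIV. aa_tens A A (t i k) (t k j))" for i j
    unfolding A_eq by (rule frm_comult_hom(2))
  have A_deg: "\<beta> = \<delta>" if "a \<in> bideg A \<alpha> \<beta>" "a \<in> bideg A \<gamma> \<delta>" "a \<noteq> \<zero>\<^bsub>A\<^esub>" for a \<alpha> \<beta> \<gamma> \<delta>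
    using frm_bideg_disjoint(2) that unfolding A_eq by blast
  have W_deg: "\<alpha> = \<gamma>" if "x \<in> bideg W \<alpha> \<beta>" "x \<in> bideg W \<gamma> \<delta>" "x \<noteq> \<zero>\<^bsub>W\<^esub>" for x \<alpha> \<beta> \<gamma> \<delta>
    using pres_bg.bideg_disjoint[OF pres_bg_ext] that unfolding W_eq V_eq as_halg_ext by blast
  obtain \<Phi> where \<Phi>: "\<Phi> \<in> ring_hom L.AB H.AB"
    "\<And>a b c \<alpha> \<beta> \<gamma> \<delta>. a \<in> bideg A \<alpha> \<beta> \<Longrightarrow> b \<in> bideg A \<beta> \<gamma> \<Longrightarrow> c \<in> bideg W \<gamma> \<delta> \<Longrightarrow>
      \<Phi> (aa_tens ?AA W (aa_tens A A a b) c) = aa_tens A P.AB a (aa_tens A W b c)"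
    by (rule associator[OF bg_A bg_A bg_W A_deg W_deg]) (use that in blast)+
  define h where "h = aa_map ?AA W ?\<Delta> id \<circ> L"
  define k where "k = aa_map A P.AB id L \<circ> L"
  have h: "h_algebra_hom W L.AB h" "h (v i) = (\<Oplus>\<^bsub>L.AB\<^esub>j\<in>UNIV. aa_tens ?AA W (?\<Delta> (t i j)) (v j))" for i
    unfolding h_def using L_map[OF bgAA bg_W hD hW] by simp_all
  have k: "h_algebra_hom W H.AB k" "k (v i) = (\<Oplus>\<^bsub>H.AB\<^esub>j\<in>UNIV. aa_tens A P.AB (t i j) (D j))" for i
    unfolding k_def using L_map[OF bg_A P.bg_alg_AB hA L(1)] by (simp_all add: L(2))
  have "(\<Phi> \<circ> h) x = k x" if "x \<in> carrier V" for x
  proof (rule W_hom_eq[OF H.ring_AB _ h_algebra_hom_ring_hom[OF k(1)] _ _ that])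
    show "\<Phi> \<circ> h \<in> ring_hom W H.AB" by (rule ring_hom_trans[OF h_algebra_hom_ring_hom[OF h(1)] \<Phi>(1)])
    show "(\<Phi> \<circ> h) (lmom W f) = k (lmom W f)" for f
      using \<Phi>(2)[OF P.A.lmom_bideg P.A.bideg_one P.B.bideg_one, of f]
      by (simp add: h_algebra_hom_mom[OF h(1)] h_algebra_hom_mom[OF k(1)] L.AB_simps(4) H.AB_simps(4) AA.AB_simps(4) P.AB_simps(3))
    fix i
    have c: "aa_tens ?AA W (aa_tens A A (t i m) (t m j)) (v j) \<in> bideg L.AB (wt i) 0" for m j
      by (rule L.tens_bideg[OF AA.tens_bideg[OF t t] v])
    have c': "aa_tens A P.AB (t i m) (aa_tens A W (t m j) (v j)) \<in> carrier H.AB" for m j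
      by (rule H.tens_carrier[OF t tv])
    have "h (v i) = (\<Oplus>\<^bsub>L.AB\<^esub>j\<in>UNIV. \<Oplus>\<^bsub>L.AB\<^esub>m\<in>UNIV. aa_tens ?AA W (aa_tens A A (t i m) (t m j)) (v j))"
      unfolding h(2) \<Delta>t
      by (subst L.tens_finsum_left[OF finite AA.tens_bideg[OF t t] v]) (rule refl)
    then have "(\<Phi> \<circ> h) (v i) = (\<Oplus>\<^bsub>H.AB\<^esub>j\<in>UNIV. \<Oplus>\<^bsub>H.AB\<^esub>m\<in>UNIV. aa_tens A P.AB (t i m) (aa_tens A W (t m j) (v j)))"
      by (simp add: ring_hom_finsum[OF L.ring_AB H.ring_AB \<Phi>(1) finite] bgL.bideg_carrier[OF bgL.bideg_finsum[OF c]]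
          bgL.bideg_carrier[OF c] \<Phi>(2)[OF t t v])
    also have "\<dots> = (\<Oplus>\<^bsub>H.AB\<^esub>m\<in>UNIV. \<Oplus>\<^bsub>H.AB\<^esub>j\<in>UNIV. aa_tens A P.AB (t i m) (aa_tens A W (t m j) (v j)))"
      by (rule H.G.finsum_swap[OF finite finite c'])
    also have "\<dots> = k (v i)"
      unfolding k(2) by (subst H.tens_finsum_right[OF finite tv t]) (rule refl)
    finally show "(\<Phi> \<circ> h) (v i) = k (v i)" .
  qed
  moreover have "aav_assoc A V \<Phi>"
    unfolding aav_assoc_def L_eq H_eq av_eq
    using \<Phi>(2) ring_hom_add_hom[OF \<Phi>(1)] by (simp add: hom_def L_eq H_eq W_simps(5))
  ultimately show ?thesis
    unfolding L_eq H_eq by (intro exI[of _ \<Phi>]) (simp add: h_def k_def)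
qed

lemma L_counit:
  "\<exists>\<Psi>. dv_unit V \<Psi> \<and> (\<forall>x\<in>carrier V. \<Psi> (av_map diff_alg V (frm_counit l) id (L x)) = x)"
proof -
  let ?D = "diff_alg :: ('n, 'n mero \<Rightarrow> 'n mero) halg" and ?\<epsilon> = "frm_counit l"
  have bgD: "bg_alg ?D" by (rule bg_alg_diff_alg)
  interpret DW: bg_pair ?D W by (rule bg_pairI[OF bgD bg_W])
  have avD: "av_pair ?D V" by (rule av_pair.intro[OF bgD gr_V])
  note D_eq = av_pair.av_tens_eq[OF avD, folded W_eq] av_pair.av_map_eq[OF avD, folded W_eq]
    av_pair.av_tensor_simps(1,5)[OF avD, folded W_eq]
  have mom: "lmom W (f + g) = lmom W f \<oplus>\<^bsub>W\<^esub> lmom W g" "lmom W (f * g) = lmom W f \<otimes>\<^bsub>W\<^esub> lmom W g"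
    "lmom W 1 = \<one>\<^bsub>W\<^esub>" "lmom W 0 = \<zero>\<^bsub>W\<^esub>" for f g
  proof -
    have m: "mom_hom W (lmom W)" unfolding W_eq V_eq by (rule ext_moments)
    show add: "lmom W (f + g) = lmom W f \<oplus>\<^bsub>W\<^esub> lmom W g" "lmom W (f * g) = lmom W f \<otimes>\<^bsub>W\<^esub> lmom W g" for f g
      using m by (simp_all add: mom_hom_def)
    have c: "lmom W (mero_const c) = c \<odot>\<^bsub>W\<^esub> \<one>\<^bsub>W\<^esub>" for c
      using m by (simp add: mom_hom_def)
    show "lmom W 1 = \<one>\<^bsub>W\<^esub>" using c[of 1] P.B.smult_one[of "\<one>\<^bsub>W\<^esub>"] by simp
    show "lmom W 0 = \<zero>\<^bsub>W\<^esub>" using add(1)[of 0 0] P.B.lmom_carrier[of 0] by (simp add: P.B.add.l_cancel_one')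
  qed
  \<comment> \<open>Applying the operator f T_(-\<gamma>) to the constant function 1 returns f. Thus
    d \<otimes> x goes to f x without choosing a representation of d.\<close>
  let ?f = "\<lambda>(d :: 'n mero \<Rightarrow> 'n mero) x. lmom W (d 1) \<otimes>\<^bsub>W\<^esub> x"
  note Wc = P.B.bideg_carrier and lc = P.B.lmom_carrier
  obtain \<Psi> where \<Psi>: "\<Psi> \<in> hom (add_monoid DW.AB) (add_monoid W)"
    "\<And>\<alpha> \<gamma> \<beta> d x. d \<in> bideg ?D \<alpha> \<gamma> \<Longrightarrow> x \<in> bideg W \<gamma> \<beta> \<Longrightarrow> \<Psi> (aa_tens ?D W d x) = ?f d x"
  proof (rule DW.tensor_lift[of W ?f])
    show "abelian_group W" by (rule P.B.abelian_group_axioms)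
    fix \<alpha> \<gamma> \<beta> d x assume d: "d \<in> bideg ?D \<alpha> \<gamma>" and x: "x \<in> bideg W \<gamma> \<beta>"
    show "?f d x \<in> carrier W" using Wc[OF x] lc by simp
    show "?f (d \<oplus>\<^bsub>?D\<^esub> d') x = ?f d x \<oplus>\<^bsub>W\<^esub> ?f d' x" for d'
      by (simp add: diff_alg_simps(4) mom(1) P.B.l_distr[OF lc lc Wc[OF x]])
    show "?f d (x \<oplus>\<^bsub>W\<^esub> x') = ?f d x \<oplus>\<^bsub>W\<^esub> ?f d x'" if "x' \<in> bideg W \<gamma> \<beta>" for x'
      by (rule P.B.r_distr[OF Wc[OF x] Wc[OF that] lc])
    show "?f (rmom ?D g \<otimes>\<^bsub>?D\<^esub> d) x = ?f d (lmom W g \<otimes>\<^bsub>W\<^esub> x)" for g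
      using mom(2)[of g "d 1"] mom(2)[of "d 1" g]
      by (simp add: diff_alg_simps mult.commute[of g] flip: P.B.m_assoc[OF lc lc Wc[OF x]])
  qed (use that in blast)
  have \<Psi>c: "\<Psi> s \<in> carrier W" if "s \<in> carrier DW.AB" for s
    using \<Psi>(1) that by (auto simp: hom_def)
  have \<Psi>a: "\<Psi> (s \<oplus>\<^bsub>DW.AB\<^esub> s') = \<Psi> s \<oplus>\<^bsub>W\<^esub> \<Psi> s'" if "s \<in> carrier DW.AB" "s' \<in> carrier DW.AB" for s s'
    using \<Psi>(1) that by (auto simp: hom_def)
  interpret R: ring DW.AB by (rule DW.ring_AB)
  have \<Psi>0: "\<Psi> \<zero>\<^bsub>DW.AB\<^esub> = \<zero>\<^bsub>W\<^esub>"
    using \<Psi>a[of "\<zero>\<^bsub>DW.AB\<^esub>" "\<zero>\<^bsub>DW.AB\<^esub>"] P.B.add.l_cancel_one'[of "\<Psi> \<zero>\<^bsub>DW.AB\<^esub>" "\<Psi> \<zero>\<^bsub>DW.AB\<^esub>"] \<Psi>c by simp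
  have tens_mult: "\<Psi> (aa_tens ?D W d x \<otimes>\<^bsub>DW.AB\<^esub> aa_tens ?D W d' x') = ?f d x \<otimes>\<^bsub>W\<^esub> ?f d' x'"
    if d: "d \<in> bideg ?D \<alpha> \<gamma>" and x: "x \<in> bideg W \<gamma> \<beta>"
      and d': "d' \<in> bideg ?D \<alpha>' \<gamma>'" and x': "x' \<in> bideg W \<gamma>' \<beta>'" for d x d' x' \<alpha> \<gamma> \<beta> \<alpha>' \<gamma>' \<beta>'
  proof -
    have "lmom W (d (d' 1)) \<otimes>\<^bsub>W\<^esub> (x \<otimes>\<^bsub>W\<^esub> x') = lmom W (d 1) \<otimes>\<^bsub>W\<^esub> x \<otimes>\<^bsub>W\<^esub> (lmom W (d' 1) \<otimes>\<^bsub>W\<^esub> x')"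
    proof (cases "\<alpha> = \<gamma>")
      case True
      then obtain f where f: "d = (\<lambda>g. f * shift (- \<gamma>) g)" using d by (auto simp: diff_alg_simps)
      \<comment> \<open>Here d translates \<open>d' 1\<close> by -\<gamma>; moving the result past
        x, which has degree \<gamma>, undoes this translation.\<close>
      have "lmom W (d (d' 1)) = lmom W (d 1) \<otimes>\<^bsub>W\<^esub> lmom W (shift (- \<gamma>) (d' 1))"
        by (simp add: f flip: mom(2))
      moreover have "lmom W (shift (- \<gamma>) (d' 1)) \<otimes>\<^bsub>W\<^esub> x = x \<otimes>\<^bsub>W\<^esub> lmom W (d' 1)"
        by (rule P.B.one_bideg_shift(2)[OF x, symmetric])
      ultimately show ?thesis
        using Wc[OF x] Wc[OF x'] lc by (simp add: P.B.m_assoc) (simp flip: P.B.m_assoc)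
    next
      case False
      then show ?thesis using d Wc[OF x] Wc[OF x'] lc by (simp add: diff_alg_simps mom(4))
    qed
    then show ?thesis
      unfolding DW.tens_mult[OF that] \<Psi>(2)[OF DW.A.bideg_mult[OF d d'] P.B.bideg_mult[OF x x']]
      by (simp add: diff_alg_simps(1))
  qed
  have "\<Psi> (s \<otimes>\<^bsub>DW.AB\<^esub> s') = \<Psi> s \<otimes>\<^bsub>W\<^esub> \<Psi> s'" if s: "s \<in> carrier DW.AB" and s': "s' \<in> carrier DW.AB" for s s'
    using s
  proof (induction rule: DW.tens_induct)
    case zero
    show ?case using s' \<Psi>c[OF s'] by (simp add: \<Psi>0)
  next
    case (tens d x \<alpha> \<gamma> \<beta>)
    note dx = tens
    have c: "aa_tens ?D W d x \<in> carrier DW.AB" by (rule DW.tens_carrier[OF dx])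
    show ?case using s'
    proof (induction rule: DW.tens_induct)
      case zero
      show ?case using c \<Psi>c[OF c] by (simp add: \<Psi>0)
    next
      case (tens d' x')
      then show ?case using tens_mult[OF dx tens] \<Psi>(2)[OF dx] \<Psi>(2)[OF tens] by simp
    next
      case (add p r)
      then show ?case using c by (simp add: R.r_distr P.B.r_distr \<Psi>a \<Psi>c)
    qed
  next
    case (add p r)
    then show ?case using s' by (simp add: R.l_distr P.B.l_distr \<Psi>a \<Psi>c)
  qed
  moreover have "\<Psi> \<one>\<^bsub>DW.AB\<^esub> = \<one>\<^bsub>W\<^esub>"
    using \<Psi>(2)[OF DW.A.bideg_one P.B.bideg_one] by (simp add: DW.AB_simps(3) diff_alg_simps(2) mom(3))
  ultimately have \<Psi>r: "\<Psi> \<in> ring_hom DW.AB W"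
    by (intro ring_hom_memI) (simp_all add: \<Psi>c \<Psi>a)
  have hE: "h_algebra_hom A ?D ?\<epsilon>" unfolding A_eq by (rule frm_counit_hom(1))
  have hW: "h_algebra_hom W W id" by (rule h_algebra_hom_id[OF bg_W])
  note h = L_map[OF bgD bg_W hE hW]
  have e: "?\<epsilon> (t i j) \<in> bideg ?D (wt i) (wt j)" for i j by (rule h_algebra_hom_bideg[OF hE t])
  have e1: "lmom W (?\<epsilon> (t i j) 1) = (if i = j then \<one>\<^bsub>W\<^esub> else \<zero>\<^bsub>W\<^esub>)" for i j :: 'n
    by (simp add: frm_counit_hom(2) mom(3,4))
  have "(\<Psi> \<circ> (aa_map ?D W ?\<epsilon> id \<circ> L)) x = id x" if "x \<in> carrier V" for x
  proof (rule W_hom_eq[OF P.B.ring_axioms _ _ _ _ that])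
    show "\<Psi> \<circ> (aa_map ?D W ?\<epsilon> id \<circ> L) \<in> ring_hom W W"
      by (rule ring_hom_trans[OF h_algebra_hom_ring_hom[OF h(1)] \<Psi>r])
    show "id \<in> ring_hom W W" by (rule h_algebra_hom_ring_hom[OF hW])
    show "(\<Psi> \<circ> (aa_map ?D W ?\<epsilon> id \<circ> L)) (lmom W f) = id (lmom W f)" for f
      using \<Psi>(2)[OF DW.A.lmom_bideg P.B.bideg_one, of f] lc[of f] P.B.r_one[OF lc[of f]]
      using h_algebra_hom_mom(1)[OF h(1), of f] by (simp add: DW.AB_simps(4) diff_alg_simps)
    fix i
    have "(\<Psi> \<circ> (aa_map ?D W ?\<epsilon> id \<circ> L)) (v i) = (\<Oplus>\<^bsub>W\<^esub>j\<in>UNIV. lmom W (?\<epsilon> (t i j) 1) \<otimes>\<^bsub>W\<^esub> v j)"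
      using h(2)[of i] by (simp add: ring_hom_finsum[OF DW.ring_AB P.B.ring_axioms \<Psi>r finite] DW.tens_carrier[OF e v] \<Psi>(2)[OF e v])
    also have "\<dots> = (\<Oplus>\<^bsub>W\<^esub>j\<in>UNIV. if i = j then v j else \<zero>\<^bsub>W\<^esub>)"
      using Wc[OF v] unfolding e1 by (intro P.B.finsum_cong') auto
    also have "\<dots> = v i" by (rule P.B.finsum_delta[OF Wc[OF v]])
    finally show "(\<Psi> \<circ> (aa_map ?D W ?\<epsilon> id \<circ> L)) (v i) = id (v i)" by simp
  qed
  moreover have "dv_unit V \<Psi>"
    unfolding dv_unit_def
  proof (intro conjI allI ballI)
    show "\<Psi> \<in> hom (add_monoid (av_tensor ?D V)) (add_monoid V)"
      using \<Psi>(1) by (simp add: hom_def D_eq W_simps W_carrier)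
    fix \<alpha> f x assume "x \<in> deg V \<alpha>"
    then have x: "x \<in> bideg W \<alpha> 0" by (simp add: W_simps)
    have d: "(\<lambda>g. f * shift (- \<alpha>) g) \<in> bideg ?D \<alpha> \<alpha>" by (auto simp: diff_alg_simps)
    show "\<Psi> (av_tens ?D V (\<lambda>g. f * shift (- \<alpha>) g) x) = f \<odot>\<^bsub>V\<^esub> x"
      unfolding D_eq \<Psi>(2)[OF d x] using Wc[OF x] by (simp add: W_simps(6) W_carrier)
  qed
  ultimately show ?thesis
    unfolding D_eq by (intro exI[of _ \<Psi>]) simp
qed

end


section \<open>The comodule algebra and the uniqueness of the coaction\<close>

context coaction
begin

lemma hom_add_L: "L \<in> hom (add_monoid V) (add_monoid (av_tensor A V))"
  using ring_hom_add_hom[OF h_algebra_hom_ring_hom[OF L(1)]] by (simp add: hom_def av_simps W_simps W_carrier)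

lemma L_lmom: "L (lmom W f) = lmom P.AB f"
  by (rule h_algebra_hom_mom(1)[OF L(1)])

lemma lmom_W: "lmom W f = f \<odot>\<^bsub>V\<^esub> \<one>\<^bsub>V\<^esub>"
  by (simp add: W_eq)

lemma left_comodule_algebra_L: "left_comodule_algebra A (frm_comult l) (frm_counit l) V L"
proof -
  have Lr: "L \<in> ring_hom W P.AB" by (rule h_algebra_hom_ring_hom[OF L(1)])
  note [simp] = W_simps(1-4)[symmetric] W_carrier[symmetric]
  have bialg: "h_bialgebroid A (frm_comult l) (frm_counit l)"
    unfolding A_eq by (rule h_bialgebroid_frm)
  have space: "h_space V" unfolding V_eq by (rule h_space_ext)
  have W_smult: "f \<odot>\<^bsub>V\<^esub> x = lmom W f \<otimes>\<^bsub>W\<^esub> x" if "x \<in> carrier W" for f x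
    using that W_simps(6) by simp
  note lc = P.B.lmom_carrier
  have corep: "left_corepresentation A (frm_comult l) (frm_counit l) V L"
  proof (intro left_corepresentation.intro left_corepresentation_axioms.intro bialg space hom_add_L L_coassoc L_counit)
    fix x f assume "x \<in> carrier V"
    then show "L (f \<odot>\<^bsub>V\<^esub> x) = f \<odot>\<^bsub>av_tensor A V\<^esub> L x"
      using ring_hom_mult[OF Lr, of "lmom W f" x] by (simp add: W_smult lc av_smult L_closed L_lmom)
  next
    fix x \<alpha> assume "x \<in> deg V \<alpha>"
    then show "L x \<in> deg (av_tensor A V) \<alpha>"
      using h_algebra_hom_bideg[OF L(1)] by (simp add: W_simps(5) av_simps(6))
  qed
  show ?thesis
  proof (intro left_comodule_algebra.intro left_comodule_algebra_axioms.intro corep)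
    fix x y f assume x: "x \<in> carrier V" and y: "y \<in> carrier V"
    show "(f \<odot>\<^bsub>V\<^esub> x) \<otimes>\<^bsub>V\<^esub> y = f \<odot>\<^bsub>V\<^esub> (x \<otimes>\<^bsub>V\<^esub> y)"
      using x y by (simp add: W_smult P.B.m_assoc lc)
    show "L (x \<otimes>\<^bsub>V\<^esub> y) = L x \<otimes>\<^bsub>av_tensor A V\<^esub> L y"
      using x y ring_hom_mult[OF Lr, of x y] by (simp add: av_simps(2))
  next
    fix x y f \<alpha> assume x: "x \<in> deg V \<alpha>" and y: "y \<in> carrier V"
    then have "x \<in> bideg W \<alpha> 0" by (simp add: W_simps(5))
    then show "f \<odot>\<^bsub>V\<^esub> (x \<otimes>\<^bsub>V\<^esub> y) = x \<otimes>\<^bsub>V\<^esub> (shift \<alpha> f \<odot>\<^bsub>V\<^esub> y)"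
      using y P.B.bideg_carrier[of x \<alpha> 0] P.B.lmom_comm[of x \<alpha> 0 f]
      by (simp add: W_smult lc flip: P.B.m_assoc)
  next
    fix x y \<alpha> \<beta> assume "x \<in> deg V \<alpha>" "y \<in> deg V \<beta>"
    then show "x \<otimes>\<^bsub>V\<^esub> y \<in> deg V (\<alpha> + \<beta>)"
      using P.B.bideg_mult[of x \<alpha> 0 y \<beta> 0] by (simp add: W_simps(5))
  next
    fix e assume e: "e \<in> carrier V" "\<And>x. x \<in> carrier V \<Longrightarrow> e \<otimes>\<^bsub>V\<^esub> x = x \<and> x \<otimes>\<^bsub>V\<^esub> e = x"
    \<comment> \<open>Units are unique, so e is the unit given by the presentation, where L is
      already known.\<close>
    have "e = \<one>\<^bsub>W\<^esub>" using e(1) e(2)[of "\<one>\<^bsub>W\<^esub>"] by simp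
    then show "L e = av_tens A V \<one>\<^bsub>A\<^esub> e"
      using ring_hom_one[OF Lr] by (simp add: av_eq P.AB_simps(3))
  qed (simp_all add: P.B.m_assoc P.B.l_distr P.B.r_distr)
qed

text \<open>A finite sum depends only on the carrier, zero and addition, which the two readings of
  the tensor product share.\<close>

lemma D_av: "D i = (\<Oplus>\<^bsub>av_tensor A V\<^esub>j\<in>UNIV. av_tens A V (t i j) (v j))"
  by (simp add: finsum_def finprod_def av_simps av_eq)

lemma L_properties:
  "L \<in> carrier V \<rightarrow>\<^sub>E carrier (av_tensor A V)" "L \<one>\<^bsub>V\<^esub> = av_tens A V \<one>\<^bsub>A\<^esub> \<one>\<^bsub>V\<^esub>"
  using L_closed ring_hom_one[OF h_algebra_hom_ring_hom[OF L(1)]]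
  by (auto simp: L_def av_simps(1) W_simps(2) P.AB_simps(3) av_eq)

lemma L_unique:
  assumes "K \<in> carrier V \<rightarrow>\<^sub>E carrier (av_tensor A V)" "K \<one>\<^bsub>V\<^esub> = av_tens A V \<one>\<^bsub>A\<^esub> \<one>\<^bsub>V\<^esub>"
    and "\<And>i. K (v i) = D i" and "left_comodule_algebra A (frm_comult l) (frm_counit l) V K"
  shows "K = L"
proof (rule PiE_ext[OF assms(1) L_properties(1)])
  interpret K: left_comodule_algebra A "frm_comult l" "frm_counit l" V K by fact
  have one: "K \<one>\<^bsub>W\<^esub> = \<one>\<^bsub>P.AB\<^esub>" by (simp add: W_simps(2) assms(2) av_eq P.AB_simps(3))
  have ring: "K \<in> ring_hom W P.AB"
  proof (rule ring_hom_memI)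
    fix x y assume "x \<in> carrier W" "y \<in> carrier W"
    then have x: "x \<in> carrier V" and y: "y \<in> carrier V" by (simp_all add: W_carrier)
    show "K x \<in> carrier P.AB" using PiE_mem[OF assms(1) x] by (simp add: av_simps(1))
    show "K (x \<otimes>\<^bsub>W\<^esub> y) = K x \<otimes>\<^bsub>P.AB\<^esub> K y" using K.L_mult[OF x y] by (simp add: W_simps(1) av_simps(2))
    show "K (x \<oplus>\<^bsub>W\<^esub> y) = K x \<oplus>\<^bsub>P.AB\<^esub> K y"
      using hom_mult[OF K.corep_add, of x y] x y by (simp add: W_simps(4) av_simps(5))
  qed (rule one)
  fix x assume x: "x \<in> carrier V"
  show "K x = L x"
  proof (rule W_hom_eq[OF P.ring_AB ring h_algebra_hom_ring_hom[OF L(1)] _ _ x])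
    show "K (v i) = L (v i)" for i by (simp add: assms(3) L(2))
    \<comment> \<open>A corepresentation is linear over functions and f is f times 1, so the values
      on functions are forced by the value at 1.\<close>
    have "\<one>\<^bsub>V\<^esub> \<in> carrier V" using P.B.one_closed by (simp add: W_simps(2) W_carrier)
    moreover have "K \<one>\<^bsub>V\<^esub> = \<one>\<^bsub>P.AB\<^esub>" using one by (simp add: W_simps(2))
    ultimately show "K (lmom W f) = L (lmom W f)" for f
      by (simp add: lmom_W K.corep_smult av_smult B.lmom_carrier L_lmom[unfolded lmom_W])
  qed
qed

end

theorem proposition3p11:
  fixes q l :: complex
  assumes q_nonzero: "q \<noteq> 0"
    and log_q: "exp l = q"
    and not_root_of_unity: "\<forall>k::nat. k > 0 \<longrightarrow> q ^ k \<noteq> 1"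
  shows "\<exists>!L. L \<in> carrier (ext l) \<rightarrow>\<^sub>E carrier (av_tensor (frm l) (ext l)) \<and>
    L \<one>\<^bsub>ext l\<^esub> = av_tens (frm l) (ext l) \<one>\<^bsub>frm l\<^esub> \<one>\<^bsub>ext l\<^esub> \<and>
    (\<forall>i::'n::{finite,linorder}. L (ext_v l i) =
       (\<Oplus>\<^bsub>av_tensor (frm l) (ext l)\<^esub>j\<in>UNIV. av_tens (frm l) (ext l) (frm_t l i j) (ext_v l j))) \<and>
    left_comodule_algebra (frm l) (frm_comult l) (frm_counit l) (ext l) L"
proof -
  let ?A = "frm l :: ('n, 'n frm_free set) halg" and ?V = "ext l :: ('n, 'n ext_free set) hspace"
  \<comment> \<open>If q^(-2) were 1, then q^2 = 1, contrary to the hypothesis on q for the exponent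
    2.\<close>
  have "qpow l (-2) * q ^ 2 = 1"
    by (simp add: qpow_def flip: log_q exp_of_nat_mult exp_add)
  then have "qpow l (-2) \<noteq> 1" using not_root_of_unity by auto
  then interpret coaction l ?A ?V "as_halg ?V" by unfold_locales simp_all
  show ?thesis
  proof (intro ex1I[of _ L] conjI allI L_properties left_comodule_algebra_L)
    show "L (ext_v l i) = (\<Oplus>\<^bsub>av_tensor ?A ?V\<^esub>j\<in>UNIV. av_tens ?A ?V (frm_t l i j) (ext_v l j))" for i
      by (simp only: L(2) D_av)
  qed (elim conjE, rule L_unique, simp_all only: D_av)
qed

end
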